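(* Let $r\ge 1$, $d\ge 2$ be integers and let $G_{d,r}\subset\mathbb{P}(\mathrm{Sym}^d(V))\times\mathbb{P}(\mathrm{Sym}^{(d-2)(r+1)}(V))$ be the closure of the graph $\{(f,h_{d,r}(f)) : h_{d,r}\text{ is defined at } f\}$. Assume that there exist a nondegenerate quadratic form $q$ and a $q$-isotropic linear form $\ell$ such that one of the following three conditions holds: (a) $d=2k$ is even, $(\ell^d,\,q^{(r+1)(k-1)})\notin G_{2k,r}$, and for every integer $m$ with $1\le m\le k$ one has $2m^2+m(r-1)-k(r+1)\ne 0$; (b) $d=2k+1$ is odd, $(\ell^d,\,q^{(r+1)(k-1)}\ell^{r+1})\notin G_{2k+1,r}$, and for every integer $m$ with $0\le m\le k$ one has $m^2(2k+1)+m(rk+r-k)-k(k+1)(r+1)\ne 0$; (c) $d=2k$ is even with $k\ge 2$, $(\ell^d,\,q^{(r+1)(k-2)}\ell^{2(r+1)})\notin G_{2k,r}$, and for every integer $m$ with $0\le m\le k$ one has $2km^2+m(rk+r-5k+1)-k\bigl(k(r+1)+r-3\bigr)\ne 0$. Then the Hessian map $h_{d,r}$ is birational onto its image.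
   Context: $V=\mathbb{C}^{r+1}$, and $\mathrm{Sym}^d(V)$ is the space of forms of degree $d$ in $x_0,\dots,x_r$ with complex coefficients. $\mathrm{Hess}(f)=\det\left(\frac{\partial^2 f}{\partial x_i\partial x_j}\right)_{0\le i,j\le r}$. The Hessian map $h_{d,r}\colon \mathbb{P}(\mathrm{Sym}^d(V))\dashrightarrow\mathbb{P}(\mathrm{Sym}^{(d-2)(r+1)}(V))$ is the rational map $[f]\mapsto[\mathrm{Hess}(f)]$, defined where $\mathrm{Hess}(f)\neq 0$. Points of projective spaces are written as nonzero forms, up to scalar. For a nondegenerate quadratic form $q$, a nonzero linear form $\ell$ is $q$-isotropic if the hyperplane $\ell=0$ is tangent to the quadric $\{q=0\}$, equivalently if the dual quadratic form $q^*$ vanishes on $\ell$. *)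

theory Defs
  imports
    "HOL-Library.Poly_Mapping"
    "HOL-Analysis.Function_Topology"
    "Jordan_Normal_Form.Determinant"
begin

section \<open>Polynomials and forms\<close>

text \<open>A polynomial with complex coefficients in variables indexed by \<open>'v\<close> is a finitely
  supported map from exponent vectors to coefficients; its ring operations are those of
  \<open>Poly_Mapping\<close> (the product is the convolution).\<close>

type_synonym 'v cpoly = "('v \<Rightarrow>\<^sub>0 nat) \<Rightarrow>\<^sub>0 complex"

abbreviation "keys \<equiv> Poly_Mapping.keys"
abbreviation "lookup \<equiv> Poly_Mapping.lookup"

definition mdeg :: "('v \<Rightarrow>\<^sub>0 nat) \<Rightarrow> nat" where
  "mdeg m = (\<Sum>i\<in>keys m. lookup m i)"

definition peval :: "('v \<Rightarrow> complex) \<Rightarrow> 'v cpoly \<Rightarrow> complex" where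
  "peval x p = (\<Sum>m\<in>keys p. lookup p m * (\<Prod>i\<in>keys m. x i ^ lookup m i))"

definition pdiff :: "'v \<Rightarrow> 'v cpoly \<Rightarrow> 'v cpoly" where
  "pdiff i p =
     (\<Sum>m\<in>keys p. Poly_Mapping.single (m - Poly_Mapping.single i 1)
                      (of_nat (lookup m i) * lookup p m))"

definition homogeneous :: "nat \<Rightarrow> 'v cpoly \<Rightarrow> bool" where
  "homogeneous e p \<longleftrightarrow> (\<forall>m\<in>keys p. mdeg m = e)"

definition bihomogeneous :: "nat \<Rightarrow> nat \<Rightarrow> ('a + 'b) cpoly \<Rightarrow> bool" where
  "bihomogeneous a b p \<longleftrightarrow>
     (\<forall>m\<in>keys p. (\<Sum>x | Inl x \<in> keys m. lookup m (Inl x)) = a \<and>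
                  (\<Sum>y | Inr y \<in> keys m. lookup m (Inr y)) = b)"

text \<open>\<open>vecs I\<close> is the coordinate space with coordinates indexed by \<open>I\<close>.  In particular
  \<open>forms r d\<close> is \<open>Sym\<^sup>d(V)\<close>, \<open>V = \<complex>\<^bsup>r+1\<^esup>\<close>, a form being the vector of its coefficients.
  (The zero polynomial belongs to every \<open>forms r d\<close>.)\<close>

definition vecs :: "'a set \<Rightarrow> ('a \<Rightarrow>\<^sub>0 complex) set" where
  "vecs I = {v. keys v \<subseteq> I}"

definition monomials :: "nat \<Rightarrow> nat \<Rightarrow> (nat \<Rightarrow>\<^sub>0 nat) set" where
  "monomials r d = {m. keys m \<subseteq> {..r} \<and> mdeg m = d}"

abbreviation forms :: "nat \<Rightarrow> nat \<Rightarrow> nat cpoly set" where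
  "forms r d \<equiv> vecs (monomials r d)"

definition Hess :: "nat \<Rightarrow> nat cpoly \<Rightarrow> nat cpoly" where
  "Hess r f = Determinant.det (mat (r + 1) (r + 1) (\<lambda>(i, j). pdiff i (pdiff j f)))"


section \<open>Projective spaces and their Zariski topologies\<close>

definition proj_pt :: "('a \<Rightarrow>\<^sub>0 complex) \<Rightarrow> ('a \<Rightarrow>\<^sub>0 complex) set" where
  "proj_pt v = {w. \<exists>c. c \<noteq> 0 \<and> (\<forall>i. lookup w i = c * lookup v i)}"

definition proj_space :: "'a set \<Rightarrow> ('a \<Rightarrow>\<^sub>0 complex) set set" where
  "proj_space I = proj_pt ` (vecs I - {0})"

text \<open>The topologies are generated by the principal open sets, i.e. the complements of the zero
  sets of homogeneous (bihomogeneous, for a product of two projective spaces) polynomials in the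
  coordinates.  Such a polynomial may mention a coordinate outside of the index set; on the space in
  question that coordinate is \<open>0\<close>, so this produces no further open sets.\<close>

definition zariski :: "'a set \<Rightarrow> ('a \<Rightarrow>\<^sub>0 complex) set topology" where
  "zariski I = topology_generated_by
     {{proj_pt v | v. v \<in> vecs I - {0} \<and> peval (lookup v) F \<noteq> 0} | F.
        \<exists>e. homogeneous e F}"

definition zariski2 ::
  "'a set \<Rightarrow> 'b set \<Rightarrow> (('a \<Rightarrow>\<^sub>0 complex) set \<times> ('b \<Rightarrow>\<^sub>0 complex) set) topology" where
  "zariski2 I J = topology_generated_by
     {{(proj_pt v, proj_pt w) | v w. v \<in> vecs I - {0} \<and> w \<in> vecs J - {0} \<and>
          peval (case_sum (lookup v) (lookup w)) F \<noteq> 0} | F.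
        \<exists>a b. bihomogeneous a b F}"


section \<open>Rational maps\<close>

text \<open>A rational map from an irreducible closed \<open>X \<subseteq> \<P>(I)\<close> to \<open>\<P>(J)\<close> is given by a representative
  on a nonempty open subset of \<open>X\<close>, which is in turn encoded by its graph \<open>\<Gamma>\<close>; so the domain of
  definition is \<open>Domain \<Gamma>\<close>.  Locally the map has the shape
  \<open>[v] \<mapsto> [(F\<^sub>j(v))\<^sub>j]\<close> with homogeneous \<open>F\<^sub>j\<close> of one and the same degree \<open>e\<close>.\<close>

definition rational_map ::
  "'a set \<Rightarrow> ('a \<Rightarrow>\<^sub>0 complex) set set \<Rightarrow> 'b set \<Rightarrow>
   (('a \<Rightarrow>\<^sub>0 complex) set \<times> ('b \<Rightarrow>\<^sub>0 complex) set) set \<Rightarrow> bool" where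
  "rational_map I X J \<Gamma> \<longleftrightarrow>
     \<Gamma> \<subseteq> X \<times> proj_space J \<and> single_valued \<Gamma> \<and>
     Domain \<Gamma> \<noteq> {} \<and> openin (subtopology (zariski I) X) (Domain \<Gamma>) \<and>
     (\<forall>P\<in>Domain \<Gamma>. \<exists>N e F.
        openin (subtopology (zariski I) X) N \<and> P \<in> N \<and> (\<forall>j\<in>J. homogeneous e (F j)) \<and>
        (\<forall>v \<in> vecs I - {0}. proj_pt v \<in> N \<longrightarrow>
           (\<exists>w \<in> vecs J - {0}. (\<forall>j\<in>J. lookup w j = peval (lookup v) (F j)) \<and>
                               (proj_pt v, proj_pt w) \<in> \<Gamma>)))"

text \<open>A rational map on \<open>\<P>(I)\<close> is birational onto its image if, as a map to the closure of its
  image, it has a rational inverse \<open>\<Delta>\<close>: both compositions are the identity wherever they are defined.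
  Their domains are nonempty, as \<open>Domain \<Delta>\<close> is a nonempty open subset of the closure of
  \<open>Range \<Gamma>\<close>.\<close>

definition birational_onto_image ::
  "'a set \<Rightarrow> 'b set \<Rightarrow> (('a \<Rightarrow>\<^sub>0 complex) set \<times> ('b \<Rightarrow>\<^sub>0 complex) set) set \<Rightarrow> bool" where
  "birational_onto_image I J \<Gamma> \<longleftrightarrow>
     rational_map I (proj_space I) J \<Gamma> \<and>
     (\<exists>\<Delta>. rational_map J (zariski J closure_of Range \<Gamma>) I \<Delta> \<and>
          \<Gamma> O \<Delta> \<subseteq> Id \<and> \<Delta> O \<Gamma> \<subseteq> Id)"


section \<open>The Hessian map\<close>

text \<open>The Hessian map \<open>h\<^sub>d\<^sub>,\<^sub>r\<close>, given by its graph.\<close>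

definition hessian_map :: "nat \<Rightarrow> nat \<Rightarrow> (nat cpoly set \<times> nat cpoly set) set" where
  "hessian_map d r =
     {(proj_pt f, proj_pt (Hess r f)) | f. f \<in> forms r d \<and> Hess r f \<noteq> 0}"

definition hessian_graph_closure :: "nat \<Rightarrow> nat \<Rightarrow> (nat cpoly set \<times> nat cpoly set) set" where
  "hessian_graph_closure d r =
     zariski2 (monomials r d) (monomials r ((d - 2) * (r + 1))) closure_of hessian_map d r"


section \<open>Quadratic forms\<close>

text \<open>Vectors of \<open>\<complex>\<^bsup>r+1\<^esup>\<close> are functions \<open>nat \<Rightarrow> complex\<close> of which only the values at
  \<open>0, \<dots>, r\<close> matter.  Nondegeneracy: the polar bilinear form has trivial radical.\<close>

definition nondegenerate_quadratic_form :: "nat \<Rightarrow> nat cpoly \<Rightarrow> bool" where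
  "nondegenerate_quadratic_form r q \<longleftrightarrow> q \<in> forms r 2 \<and>
     (\<forall>v. (\<forall>w. peval (\<lambda>i. v i + w i) q - peval v q - peval w q = 0) \<longrightarrow> (\<forall>i\<le>r. v i = 0))"

text \<open>The hyperplane \<open>\<ell> = 0\<close> is the tangent hyperplane of the quadric \<open>q = 0\<close> at one of its points
  \<open>[v]\<close>.\<close>

definition isotropic :: "nat \<Rightarrow> nat cpoly \<Rightarrow> nat cpoly \<Rightarrow> bool" where
  "isotropic r q l \<longleftrightarrow> l \<in> forms r 1 \<and> l \<noteq> 0 \<and>
     (\<exists>v. (\<exists>i\<le>r. v i \<noteq> 0) \<and> peval v q = 0 \<and>
          {w. (\<Sum>i\<le>r. peval v (pdiff i q) * w i) = 0} = {w. peval w l = 0})"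

end

theory Submission
  imports Defs "HOL-Computational_Algebra.Fundamental_Theorem_Algebra"
begin

text \<open>The pair of \<open>q\<close> and \<open>l\<close> can be moved by a linear substitution to
  \<open>q0 = 2 x0 x1 + x2^2 + ... + xr^2\<close> and a multiple of \<open>x0\<close> (\<open>isotropic_normal_form\<close>). For \<open>a \<le> A\<close> let
  \<open>special r A a = q0^a x0^(A - a)\<close>, a form of degree \<open>A + a\<close>. Its Hessian is a nonzero multiple of
  \<open>q0^((r+1)(a-1)) x0^((r+1)(A-a))\<close> (\<open>Hess_special\<close>). With \<open>(A, a)\<close> equal to \<open>(k, k)\<close>, \<open>(k+1, k)\<close> and
  \<open>(k+1, k-1)\<close> these are the forms that conditions (a), (b) and (c) pair with \<open>l^d\<close>. So the assumption
  on the closure of the graph says that \<open>[x0^d]\<close> is not in the fibre of that closure over \<open>[Hess p]\<close>, where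
  \<open>p = special r A a\<close>.

  Birationality is established near \<open>p\<close> and follows from two facts: the derivative of the Hessian map at \<open>p\<close> is
  injective, and the fibre of the closure of the graph over \<open>[Hess p]\<close> is the single point \<open>[p]\<close>. The fibre is
  cut out by the bihomogeneous equations of the graph, specialised at \<open>y0 = Hess p\<close>. Injectivity of the derivative
  controls these equations near \<open>p\<close> and the Nullstellensatz controls them away from \<open>p\<close>, so in some degree they
  comprise all forms that vanish at \<open>p\<close>. Lifted back to equations of the graph, they form a system of linear
  equations for the monomials in \<open>x\<close> whose coefficients are polynomials in \<open>y\<close> and which is uniquely solvable at
  \<open>y0\<close>. Cramer's rule solves it near \<open>y0\<close> and yields a formula for the inverse map (\<open>exists_inverse_formula\<close>,
  \<open>birational_from_formula\<close>).

  Both facts come from a fixed point argument. The isometries of \<open>q0\<close> that preserve the line spanned by \<open>x0\<close>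
  include Eichler transvections and a torus, and all of these fix \<open>p\<close> up to scalars. A nonempty cone of nonzero
  forms that is stable under these isometries and under limits contains some \<open>special r (d - j) j\<close>
  (\<open>limit_cone_contains_special_form\<close>). This applies to the kernel of the derivative, where the special forms are
  excluded because \<open>special_deriv\<close>, which is the polynomial in \<open>m = k - j\<close> of the hypothesis up to a nonzero
  factor, does not vanish. It also applies to the fibre without \<open>[p]\<close>, which is still stable under limits because
  \<open>p\<close> is isolated in its fibre. There the special forms with both exponents positive are excluded because their
  Hessians are pairwise not proportional, and \<open>x0^d\<close> is excluded by assumption.

  For \<open>r = 1\<close> only the torus is left. Then all monomials \<open>x0^(d-j) x1^j\<close> are special forms and two more things
  have to be checked: the integer conditions also hold for negative \<open>m\<close>, by divisibility arguments, and \<open>[x1^d]\<close>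
  is not in the fibre. The latter holds by symmetry in case (a) and otherwise by an explicit relation between the
  coefficients of the Hessian of a binary form (\<open>off_fibre_binary\<close>).\<close>

section \<open>Polynomials and their values\<close>

definition cX :: "'v \<Rightarrow> 'v cpoly" where
  "cX i = Poly_Mapping.single (Poly_Mapping.single i 1) 1"

abbreviation cC :: "complex \<Rightarrow> 'v cpoly" where
  "cC c \<equiv> Poly_Mapping.single 0 c"

definition mono_val :: "('v \<Rightarrow> complex) \<Rightarrow> ('v \<Rightarrow>\<^sub>0 nat) \<Rightarrow> complex" where
  "mono_val x m = (\<Prod>i\<in>keys m. x i ^ lookup m i)"

definition mons :: "'v set \<Rightarrow> nat \<Rightarrow> ('v \<Rightarrow>\<^sub>0 nat) set" where
  "mons I n = {m. keys m \<subseteq> I \<and> mdeg m = n}"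

lemma monomials_eq_mons: "monomials r d = mons {..r} d"
  by (simp add: monomials_def mons_def)

lemma mono_val_superset:
  "finite V \<Longrightarrow> keys m \<subseteq> V \<Longrightarrow> mono_val x m = (\<Prod>i\<in>V. x i ^ lookup m i)"
  unfolding mono_val_def
  by (rule prod.mono_neutral_left) (auto simp: in_keys_iff)

lemma mono_val_add: "mono_val x (m + n) = mono_val x m * mono_val x n"
proof -
  let ?V = "keys m \<union> keys n"
  have "keys (m + n) \<subseteq> ?V" by (rule Poly_Mapping.keys_add)
  then show ?thesis
    by (simp add: mono_val_superset[of ?V] lookup_add power_add prod.distrib)
qed

lemma mono_val_0 [simp]: "mono_val x 0 = 1"
  by (simp add: mono_val_def)

lemma mono_val_single [simp]: "mono_val x (Poly_Mapping.single i k) = x i ^ k"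
  by (cases "k = 0") (simp_all add: mono_val_def)

lemma mdeg_superset:
  "finite V \<Longrightarrow> keys m \<subseteq> V \<Longrightarrow> mdeg m = (\<Sum>i\<in>V. lookup m i)"
  unfolding mdeg_def by (rule sum.mono_neutral_left) (auto simp: in_keys_iff)

lemma mdeg_add [simp]: "mdeg (m + n) = mdeg m + mdeg n"
proof -
  let ?V = "keys m \<union> keys n"
  have "keys (m + n) \<subseteq> ?V" by (rule Poly_Mapping.keys_add)
  then show ?thesis
    by (simp add: mdeg_superset[of ?V] lookup_add sum.distrib)
qed

lemma mdeg_0 [simp]: "mdeg 0 = 0"
  by (simp add: mdeg_def)

lemma mdeg_single [simp]: "mdeg (Poly_Mapping.single i k) = k"
  by (cases "k = 0") (simp_all add: mdeg_def)

lemma keys_add_nat: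
  fixes m n :: "'v \<Rightarrow>\<^sub>0 nat"
  shows "keys (m + n) = keys m \<union> keys n"
  by (auto simp: in_keys_iff lookup_add)

lemma monomial_split:
  fixes m :: "'v \<Rightarrow>\<^sub>0 nat"
  assumes "i \<in> keys m"
  shows "m = (m - Poly_Mapping.single i 1) + Poly_Mapping.single i 1"
  using assms
  by (intro poly_mapping_eqI) (auto simp: lookup_add lookup_minus lookup_single when_def in_keys_iff)

lemma monomial_induct [case_names zero add]:
  fixes m :: "'v \<Rightarrow>\<^sub>0 nat"
  assumes "P 0" and step: "\<And>m i. P m \<Longrightarrow> P (m + Poly_Mapping.single i 1)"
  shows "P m"
proof (induction "mdeg m" arbitrary: m)
  case 0
  then have "keys m = {}"
    by (auto simp: mdeg_def in_keys_iff simp del: keys_eq_empty)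
  then have "m = 0" by (intro poly_mapping_eqI) (auto simp: in_keys_iff)
  then show ?case using assms(1) by simp
next
  case (Suc n)
  then have "keys m \<noteq> {}" by (auto simp: mdeg_def)
  then obtain i where i: "i \<in> keys m" by blast
  note eq = monomial_split[OF i]
  have "mdeg m = mdeg (m - Poly_Mapping.single i 1) + 1"
    by (subst eq) simp
  with Suc have "P (m - Poly_Mapping.single i 1)" by simp
  from step[OF this] show ?case using eq by metis
qed

lemma finite_sub_monomials:
  fixes b :: "'v \<Rightarrow> nat"
  assumes "finite V"
  shows "finite {m :: 'v \<Rightarrow>\<^sub>0 nat. keys m \<subseteq> V \<and> (\<forall>i. lookup m i \<le> b i)}"
proof -
  let ?S = "{m :: 'v \<Rightarrow>\<^sub>0 nat. keys m \<subseteq> V \<and> (\<forall>i. lookup m i \<le> b i)}"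
  have "inj_on (\<lambda>m. restrict (lookup m) V) ?S"
  proof (rule inj_onI)
    fix m n assume mn: "m \<in> ?S" "n \<in> ?S" "restrict (lookup m) V = restrict (lookup n) V"
    show "m = n"
    proof (rule poly_mapping_eqI)
      fix i show "lookup m i = lookup n i"
      proof (cases "i \<in> V")
        case True
        then show ?thesis using fun_cong[OF mn(3), of i] by simp
      next
        case False
        then have "i \<notin> keys m" "i \<notin> keys n" using mn by auto
        then show ?thesis by (simp add: in_keys_iff)
      qed
    qed
  qed
  moreover have "(\<lambda>m. restrict (lookup m) V) ` ?S \<subseteq> (\<Pi>\<^sub>E i\<in>V. {..b i})"
    by auto
  moreover have "finite (\<Pi>\<^sub>E i\<in>V. {..b i})"
    using assms by (intro finite_PiE) auto
  ultimately show ?thesis using finite_subset inj_on_finite by blast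
qed

lemma lookup_le_mdeg: "lookup m i \<le> mdeg m"
proof (cases "i \<in> keys m")
  case True
  then show ?thesis unfolding mdeg_def by (intro member_le_sum) auto
next
  case False
  then show ?thesis by (simp add: in_keys_iff)
qed

lemma finite_mons: "finite I \<Longrightarrow> finite (mons I n)"
  by (rule finite_subset[OF _ finite_sub_monomials[of I "\<lambda>_. n"]])
     (auto simp: mons_def intro: order_trans[OF lookup_le_mdeg])

definition splits :: "('v \<Rightarrow>\<^sub>0 nat) \<Rightarrow> (('v \<Rightarrow>\<^sub>0 nat) \<times> ('v \<Rightarrow>\<^sub>0 nat)) set" where
  "splits m = {(a, b). a + b = m}"

lemma finite_splits: "finite (splits m)"
proof -
  let ?S = "{a :: 'a \<Rightarrow>\<^sub>0 nat. keys a \<subseteq> keys m \<and> (\<forall>i. lookup a i \<le> lookup m i)}"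
  have "finite ?S" by (rule finite_sub_monomials) simp
  moreover have "splits m \<subseteq> ?S \<times> ?S"
    by (auto simp: splits_def keys_add_nat lookup_add in_keys_iff)
  ultimately show ?thesis by (meson finite_SigmaI finite_subset)
qed

lemma cpoly_sum_singles: "(\<Sum>m\<in>keys p. Poly_Mapping.single m (lookup p m)) = (p :: 'v cpoly)"
  by (rule poly_mapping_eqI)
     (auto simp: lookup_sum lookup_single when_def in_keys_iff sum.delta' if_distrib cong: if_cong)

lemma cpoly_add_induct:
  fixes p :: "'v cpoly"
  assumes "\<And>m c. m \<in> keys p \<Longrightarrow> P (Poly_Mapping.single m c)" and "P 0"
    and "\<And>p q. P p \<Longrightarrow> P q \<Longrightarrow> P (p + q)"
  shows "P p"
proof -
  have "P (\<Sum>m\<in>K. Poly_Mapping.single m (lookup p m))" if "finite K" "K \<subseteq> keys p" for K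
    using that by (induction K) (auto simp: assms)
  from this[of "keys p"] show ?thesis by (simp add: cpoly_sum_singles)
qed

text \<open>Unlike the sum over the supports of the two factors, the sum over all decompositions of \<open>m\<close> has an index set that
  does not depend on the factors. This is what makes the coefficients of a product polynomial in a parameter when
  those of the factors are.\<close>

lemma lookup_mult_splits:
  fixes p q :: "'v cpoly"
  shows "lookup (p * q) m = (\<Sum>(a, b)\<in>splits m. lookup p a * lookup q b)"
proof (rule cpoly_add_induct[of p])
  fix k c
  show "lookup (Poly_Mapping.single k c * q) m =
    (\<Sum>(a, b)\<in>splits m. lookup (Poly_Mapping.single k c) a * lookup q b)"
  proof (rule cpoly_add_induct[of q])
    fix l c'
    have "(\<Sum>(a, b)\<in>splits m. lookup (Poly_Mapping.single k c) a * lookup (Poly_Mapping.single l c') b)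
       = (\<Sum>ab\<in>splits m. if ab = (k, l) then c * c' else 0)"
      by (rule sum.cong) (auto simp: lookup_single when_def split: if_splits)
    also have "\<dots> = lookup (Poly_Mapping.single k c * Poly_Mapping.single l c') m"
      by (subst sum.delta[OF finite_splits]) (simp add: mult_single lookup_single when_def splits_def)
    finally show "lookup (Poly_Mapping.single k c * Poly_Mapping.single l c') m =
      (\<Sum>(a, b)\<in>splits m. lookup (Poly_Mapping.single k c) a * lookup (Poly_Mapping.single l c') b)" ..
  next
    show "\<And>p q. lookup (Poly_Mapping.single k c * p) m =
        (\<Sum>(a, b)\<in>splits m. lookup (Poly_Mapping.single k c) a * lookup p b) \<Longrightarrow>
        lookup (Poly_Mapping.single k c * q) m =
        (\<Sum>(a, b)\<in>splits m. lookup (Poly_Mapping.single k c) a * lookup q b) \<Longrightarrow>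
        lookup (Poly_Mapping.single k c * (p + q)) m =
        (\<Sum>(a, b)\<in>splits m. lookup (Poly_Mapping.single k c) a * lookup (p + q) b)"
      by (simp add: distrib_left lookup_add split_def sum.distrib)
  qed simp
next
  show "\<And>p qa. lookup (p * q) m = (\<Sum>(a, b)\<in>splits m. lookup p a * lookup q b) \<Longrightarrow>
        lookup (qa * q) m = (\<Sum>(a, b)\<in>splits m. lookup qa a * lookup q b) \<Longrightarrow>
        lookup ((p + qa) * q) m = (\<Sum>(a, b)\<in>splits m. lookup (p + qa) a * lookup q b)"
    by (simp add: distrib_right lookup_add split_def sum.distrib)
qed simp

lemma peval_superset:
  assumes "finite S" "keys p \<subseteq> S"
  shows "peval x p = (\<Sum>m\<in>S. lookup p m * mono_val x m)"
  unfolding peval_def mono_val_def[symmetric]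
  using assms by (intro sum.mono_neutral_left) (auto simp: in_keys_iff)

lemma peval_0 [simp]: "peval x 0 = 0"
  by (simp add: peval_def)

lemma peval_add [simp]: "peval x (p + q) = peval x p + peval x q"
proof -
  let ?S = "keys p \<union> keys q"
  have "keys (p + q) \<subseteq> ?S" by (rule Poly_Mapping.keys_add)
  then show ?thesis
    by (simp add: peval_superset[of ?S] lookup_add distrib_right sum.distrib)
qed

lemma peval_single [simp]: "peval x (Poly_Mapping.single m c) = c * mono_val x m"
  by (simp add: peval_superset[of "{m}"])

lemma peval_cX [simp]: "peval x (cX i) = x i"
  by (simp add: cX_def)

lemma peval_1 [simp]: "peval x 1 = 1"
  by (metis mono_val_0 mult_1 peval_single single_one)

lemma peval_uminus [simp]: "peval x (- p) = - peval x p"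
  by (metis add.right_inverse add_eq_0_iff peval_0 peval_add)

lemma peval_diff [simp]: "peval x (p - q) = peval x p - peval x q"
  by (metis diff_conv_add_uminus peval_add peval_uminus)

lemma peval_sum [simp]: "peval x (sum f A) = (\<Sum>a\<in>A. peval x (f a))"
  by (induction A rule: infinite_finite_induct) auto

lemma peval_mult [simp]: "peval x (p * q) = peval x p * peval x q"
proof (rule cpoly_add_induct[of p])
  fix m c
  show "peval x (Poly_Mapping.single m c * q) = peval x (Poly_Mapping.single m c) * peval x q"
    by (rule cpoly_add_induct[of q]) (auto simp: mult_single mono_val_add distrib_left)
qed (auto simp: distrib_right)

lemma peval_power [simp]: "peval x (p ^ n) = peval x p ^ n"
  by (induction n) auto

lemma peval_prod [simp]: "peval x (prod f A) = (\<Prod>a\<in>A. peval x (f a))"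
  by (induction A rule: infinite_finite_induct) auto

lemma lookup_cC_mult [simp]: "lookup (cC c * p) m = c * lookup p m"
proof (rule cpoly_add_induct[of p])
  show "\<And>k d. lookup (cC c * Poly_Mapping.single k d) m = c * lookup (Poly_Mapping.single k d) m"
    by (simp add: mult_single lookup_single when_def)
qed (auto simp: distrib_left lookup_add)

lemma lookup_pdiff:
  "lookup (pdiff i p) n = of_nat (lookup n i + 1) * lookup p (n + Poly_Mapping.single i 1)"
proof -
  let ?e = "Poly_Mapping.single i (1::nat)"
  have "lookup (pdiff i p) n
      = (\<Sum>m\<in>keys p. (of_nat (lookup m i) * lookup p m when m - ?e = n))"
    by (simp add: pdiff_def lookup_sum lookup_single)
  also have "\<dots> = (\<Sum>m\<in>keys p. if m = n + ?e then of_nat (lookup m i) * lookup p m else 0)"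
  proof (rule sum.cong, rule refl)
    fix m
    show "(of_nat (lookup m i) * lookup p m when m - ?e = n)
       = (if m = n + ?e then of_nat (lookup m i) * lookup p m else 0)"
    proof (cases "m = n + ?e")
      case False
      then have "lookup m i = 0" if "m - ?e = n"
        using that monomial_split[of i m] by (auto simp: in_keys_iff)
      then show ?thesis using False by (auto simp: when_def)
    qed simp
  qed
  also have "\<dots> = of_nat (lookup n i + 1) * lookup p (n + ?e)"
    by (simp add: sum.delta' in_keys_iff lookup_add)
  finally show ?thesis .
qed

lemma pdiff_add [simp]: "pdiff i (p + q) = pdiff i p + pdiff i q"
  by (rule poly_mapping_eqI) (simp only: lookup_pdiff lookup_add distrib_left)

lemma pdiff_0 [simp]: "pdiff i 0 = 0"
  by (simp add: pdiff_def)

lemma pdiff_cC_mult [simp]: "pdiff i (cC c * p) = cC c * pdiff i p"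
  by (rule poly_mapping_eqI) (simp add: lookup_pdiff)

lemma pdiff_sum: "pdiff i (sum f A) = (\<Sum>a\<in>A. pdiff i (f a))"
  by (induction A rule: infinite_finite_induct) auto

lemma pdiff_single:
  "pdiff i (Poly_Mapping.single m c) =
     Poly_Mapping.single (m - Poly_Mapping.single i 1) (of_nat (lookup m i) * c)"
  by (cases "c = 0") (simp_all add: pdiff_def)

lemma pdiff_commute: "pdiff i (pdiff j p) = pdiff j (pdiff i p)"
  by (rule poly_mapping_eqI) (auto simp: lookup_pdiff lookup_add lookup_single when_def ac_simps)

lemma has_deriv_mono_val:
  "((\<lambda>t. mono_val (x(i := t)) m) has_field_derivative
     of_nat (lookup m i) * mono_val (x(i := s)) (m - Poly_Mapping.single i 1)) (at s)"
proof -
  let ?V = "insert i (keys m)" and ?e = "Poly_Mapping.single i (1::nat)"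
  define C where "C = (\<Prod>j\<in>keys m - {i}. x j ^ lookup m j)"
  have V: "finite ?V" "?V - {i} = keys m - {i}" by auto
  have 1: "mono_val (x(i := t)) m = t ^ lookup m i * C" for t
  proof -
    have "(\<Prod>j\<in>keys m - {i}. (x(i := t)) j ^ lookup m j) = C"
      unfolding C_def by (rule prod.cong) auto
    then show ?thesis
      by (subst mono_val_superset[of ?V]) (auto simp: prod.insert_remove)
  qed
  have km: "keys (m - ?e) \<subseteq> ?V"
    by (auto simp: in_keys_iff lookup_minus)
  have 2: "mono_val (x(i := t)) (m - ?e) = t ^ (lookup m i - 1) * C" for t
  proof -
    have "(\<Prod>j\<in>keys m - {i}. (x(i := t)) j ^ lookup (m - ?e) j) = C"
      unfolding C_def by (rule prod.cong) (auto simp: lookup_minus lookup_single when_def)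
    then show ?thesis
      by (subst mono_val_superset[OF V(1) km]) (auto simp: prod.insert_remove lookup_minus)
  qed
  show ?thesis unfolding 1 2
    by (auto intro!: derivative_eq_intros)
qed

lemma peval_deriv:
  "((\<lambda>t. peval (x(i := t)) p) has_field_derivative peval (x(i := s)) (pdiff i p)) (at s)"
proof (rule cpoly_add_induct[of p])
  fix m c
  have "((\<lambda>t. c * mono_val (x(i := t)) m) has_field_derivative
     c * (of_nat (lookup m i) * mono_val (x(i := s)) (m - Poly_Mapping.single i 1))) (at s)"
    by (rule DERIV_cmult[OF has_deriv_mono_val])
  then show "((\<lambda>t. peval (x(i := t)) (Poly_Mapping.single m c)) has_field_derivative
     peval (x(i := s)) (pdiff i (Poly_Mapping.single m c))) (at s)"
    by (simp add: pdiff_single mult_ac)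
qed (auto intro!: DERIV_add)

text \<open>A polynomial function determines its coefficients: the coefficient of a monomial is read off,
  up to a factorial, from an iterated partial derivative at the origin.\<close>

lemma peval_zero_imp_zero:
  assumes "\<And>x. peval x p = 0"
  shows "p = 0"
proof (rule poly_mapping_eqI)
  fix m
  have "lookup p m = 0" using assms
  proof (induction m arbitrary: p rule: monomial_induct)
    case zero
    have *: "mono_val (\<lambda>_. 0) m = (if m = 0 then 1 else 0)" for m :: "'a \<Rightarrow>\<^sub>0 nat"
    proof (cases "m = 0")
      case False
      then obtain i where "i \<in> keys m" by (metis keys_eq_empty ex_in_conv)
      moreover from this have "(0::complex) ^ lookup m i = 0" by (simp add: in_keys_iff)
      ultimately show ?thesis using False by (auto simp: mono_val_def intro!: prod_zero bexI[of _ i])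
    qed simp
    then have "peval (\<lambda>_. 0) p = lookup p 0"
      by (subst peval_superset[of "insert 0 (keys p)"]) (simp_all add: * if_distrib sum.delta subset_insertI cong: if_cong del: sum.insert)
    then show ?case using zero[of "\<lambda>_. 0"] by simp
  next
    case (add m i)
    have "peval x (pdiff i p) = 0" for x
      using DERIV_unique[OF peval_deriv[of x i p "x i"], of 0] add(2) by simp
    from add(1)[OF this] have "lookup (pdiff i p) m = 0" .
    then have "of_nat (lookup m i + 1) * lookup p (m + Poly_Mapping.single i 1) = 0"
      by (simp add: lookup_pdiff)
    then show ?case by (metis Suc_eq_plus1 mult_eq_0_iff of_nat_neq_0)
  qed
  then show "lookup p m = lookup 0 m" by simp
qed

lemma peval_inject: "(\<And>x. peval x p = peval x q) \<Longrightarrow> p = q"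
  using peval_zero_imp_zero[of "p - q"] by simp

lemma pdiff_mult: "pdiff i (p * q) = pdiff i p * q + p * pdiff i q"
proof (rule peval_inject)
  fix x
  have "((\<lambda>t. peval (x(i := t)) p * peval (x(i := t)) q) has_field_derivative
     peval (x(i := x i)) (pdiff i p) * peval (x(i := x i)) q +
     peval (x(i := x i)) (pdiff i q) * peval (x(i := x i)) p) (at (x i))"
    by (rule DERIV_mult[OF peval_deriv peval_deriv])
  moreover have "((\<lambda>t. peval (x(i := t)) p * peval (x(i := t)) q) has_field_derivative
     peval (x(i := x i)) (pdiff i (p * q))) (at (x i))"
    using peval_deriv[of x i "p * q" "x i"] by simp
  ultimately show "peval x (pdiff i (p * q)) = peval x (pdiff i p * q + p * pdiff i q)"
    by (auto dest: DERIV_unique)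
qed

lemma pdiff_power: "pdiff i (p ^ n) = of_nat n * p ^ (n - 1) * pdiff i p"
proof (induction n)
  case 0
  show ?case using pdiff_single[of i 0 1] by simp
next
  case (Suc n)
  then show ?case
    by (cases n) (simp_all add: pdiff_mult algebra_simps)
qed

lemma pdiff_cX: "pdiff i (cX j) = (if i = j then 1 else 0)"
  by (simp add: cX_def pdiff_single lookup_single)

lemma pdiff_cC [simp]: "pdiff i (cC c) = 0"
  by (simp add: pdiff_single)

lemma single_eq_prod_cX:
  "Poly_Mapping.single m c = cC c * (\<Prod>i\<in>keys m. cX i ^ lookup m i)"
  by (rule peval_inject) (simp add: mono_val_def)

lemma cpoly_ring_induct:
  fixes p :: "'v cpoly"
  assumes vars: "\<And>m. m \<in> keys p \<Longrightarrow> keys m \<subseteq> V"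
    and c: "\<And>c. P (cC c)" and X: "\<And>i. i \<in> V \<Longrightarrow> P (cX i)"
    and add: "\<And>p q. P p \<Longrightarrow> P q \<Longrightarrow> P (p + q)"
    and mult: "\<And>p q. P p \<Longrightarrow> P q \<Longrightarrow> P (p * q)"
  shows "P p"
proof (rule cpoly_add_induct)
  fix m c' assume m: "m \<in> keys p"
  have 1: "P 1" using c[of 1] by simp
  have pow: "P (cX i ^ n)" if "i \<in> V" for i n
    using that by (induction n) (auto simp: 1 intro!: mult X)
  have "P (\<Prod>i\<in>K. cX i ^ lookup m i)" if "finite K" "K \<subseteq> V" for K
    using that by (induction K) (auto simp: 1 intro!: mult pow)
  then show "P (Poly_Mapping.single m c')"
    using vars[OF m] by (subst single_eq_prod_cX) (auto intro!: mult c)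
next
  show "P 0" using c[of 0] by simp
qed (rule add)

lemma peval_line_deriv:
  assumes "finite V" and vars: "\<And>m. m \<in> keys p \<Longrightarrow> keys m \<subseteq> V"
  shows "((\<lambda>t. peval (\<lambda>j. x j + t * w j) p) has_field_derivative
           (\<Sum>i\<in>V. w i * peval x (pdiff i p))) (at 0)"
  using vars
proof (rule cpoly_ring_induct)
  fix i assume i: "i \<in> V"
  have "(\<Sum>k\<in>V. w k * peval x (pdiff k (cX i))) = w i"
    using i assms(1) by (simp add: pdiff_cX if_distrib sum.delta cong: if_cong)
  then show "((\<lambda>t. peval (\<lambda>j. x j + t * w j) (cX i)) has_field_derivative
           (\<Sum>k\<in>V. w k * peval x (pdiff k (cX i)))) (at 0)"
    by (auto intro!: derivative_eq_intros)
next
  fix p q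
  assume "((\<lambda>t. peval (\<lambda>j. x j + t * w j) p) has_field_derivative
           (\<Sum>i\<in>V. w i * peval x (pdiff i p))) (at 0)"
    "((\<lambda>t. peval (\<lambda>j. x j + t * w j) q) has_field_derivative
           (\<Sum>i\<in>V. w i * peval x (pdiff i q))) (at 0)"
  from DERIV_mult[OF this]
  show "((\<lambda>t. peval (\<lambda>j. x j + t * w j) (p * q)) has_field_derivative
           (\<Sum>i\<in>V. w i * peval x (pdiff i (p * q)))) (at 0)"
    by (simp add: pdiff_mult sum_distrib_left sum_distrib_right sum.distrib algebra_simps)
next
  fix p q
  assume "((\<lambda>t. peval (\<lambda>j. x j + t * w j) p) has_field_derivative
           (\<Sum>i\<in>V. w i * peval x (pdiff i p))) (at 0)"
    "((\<lambda>t. peval (\<lambda>j. x j + t * w j) q) has_field_derivative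
           (\<Sum>i\<in>V. w i * peval x (pdiff i q))) (at 0)"
  from DERIV_add[OF this]
  show "((\<lambda>t. peval (\<lambda>j. x j + t * w j) (p + q)) has_field_derivative
           (\<Sum>i\<in>V. w i * peval x (pdiff i (p + q)))) (at 0)"
    by (simp add: sum.distrib algebra_simps)
qed (auto simp: vars)


section \<open>Forms\<close>

lemma vecs_0 [simp]: "0 \<in> vecs I"
  by (simp add: vecs_def)

lemma vecs_add: "p \<in> vecs I \<Longrightarrow> q \<in> vecs I \<Longrightarrow> p + q \<in> vecs I"
  using order_trans[OF Poly_Mapping.keys_add[of p q], of I] by (simp add: vecs_def)

lemma vecs_diff: "p \<in> vecs I \<Longrightarrow> q \<in> vecs I \<Longrightarrow> p - q \<in> vecs I"
proof -
  assume "p \<in> vecs I" "q \<in> vecs I"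
  then have 0: "lookup p m = 0" "lookup q m = 0" if "m \<notin> I" for m
    using that by (auto simp: vecs_def in_keys_iff)
  have "m \<in> I" if "m \<in> keys (p - q)" for m
    using that 0[of m] by (cases "m \<in> I") (simp_all add: in_keys_iff lookup_minus)
  then show "p - q \<in> vecs I" by (auto simp: vecs_def)
qed

lemma vecs_sum: "(\<And>a. a \<in> A \<Longrightarrow> f a \<in> vecs I) \<Longrightarrow> sum f A \<in> vecs I"
  by (induction A rule: infinite_finite_induct) (auto intro: vecs_add)

lemma vecs_cC_mult: "p \<in> vecs I \<Longrightarrow> cC c * p \<in> vecs I"
  by (auto simp: vecs_def in_keys_iff)

lemma vecs_mult: "p \<in> vecs (mons I a) \<Longrightarrow> q \<in> vecs (mons I b) \<Longrightarrow> p * q \<in> vecs (mons I (a + b))"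
  using keys_mult[of p q] by (fastforce simp: vecs_def mons_def keys_add_nat)

lemma vecs_1: "1 \<in> vecs (mons I 0)"
  by (simp add: vecs_def mons_def)

lemma vecs_cC: "cC c \<in> vecs (mons I 0)"
  by (simp add: vecs_def mons_def)

lemma vecs_cX: "i \<in> I \<Longrightarrow> cX i \<in> vecs (mons I 1)"
  by (simp add: vecs_def mons_def cX_def)

lemma vecs_power: "p \<in> vecs (mons I a) \<Longrightarrow> p ^ n \<in> vecs (mons I (n * a))"
  by (induction n) (auto simp: vecs_1 intro: vecs_mult)

lemma vecs_prod:
  "finite A \<Longrightarrow> (\<And>a. a \<in> A \<Longrightarrow> f a \<in> vecs (mons I (n a))) \<Longrightarrow> prod f A \<in> vecs (mons I (sum n A))"
  by (induction A rule: finite_induct) (auto simp: vecs_1 intro: vecs_mult)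

lemma vecs_pdiff: "p \<in> vecs (mons I n) \<Longrightarrow> pdiff i p \<in> vecs (mons I (n - 1))"
proof -
  assume p: "p \<in> vecs (mons I n)"
  have "m \<in> mons I (n - 1)" if "m \<in> keys (pdiff i p)" for m
  proof -
    have "m + Poly_Mapping.single i 1 \<in> keys p"
      using that by (auto simp: in_keys_iff lookup_pdiff)
    then show ?thesis using p by (force simp: vecs_def mons_def keys_add_nat)
  qed
  then show ?thesis by (auto simp: vecs_def)
qed

lemma peval_vecs:
  assumes "finite I" "p \<in> vecs (mons I n)"
  shows "peval x p = (\<Sum>m\<in>mons I n. lookup p m * mono_val x m)"
  using assms by (intro peval_superset finite_mons) (auto simp: vecs_def)

lemma peval_cong_vars:
  assumes "p \<in> vecs (mons I n)" "\<And>i. i \<in> I \<Longrightarrow> x i = y i"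
  shows "peval x p = peval y p"
proof -
  have "mono_val x m = mono_val y m" if "m \<in> keys p" for m
    unfolding mono_val_def
  proof (rule prod.cong, rule refl)
    fix i assume "i \<in> keys m"
    then have "i \<in> I" using that assms(1) by (auto simp: vecs_def mons_def)
    then show "x i ^ lookup m i = y i ^ lookup m i" using assms(2) by simp
  qed
  then show ?thesis by (simp add: peval_superset[of "keys p"])
qed

lemma mono_val_scale: "mono_val (\<lambda>i. c * x i) m = c ^ mdeg m * mono_val x m"
  by (simp add: mono_val_def mdeg_def power_mult_distrib prod.distrib power_sum)

lemma peval_scale:
  assumes "p \<in> vecs (mons I n)"
  shows "peval (\<lambda>i. c * x i) p = c ^ n * peval x p"
proof -
  have "mdeg m = n" if "m \<in> keys p" for m
    using that assms by (auto simp: vecs_def mons_def)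
  then show ?thesis
    by (simp add: peval_superset[of "keys p"] mono_val_scale sum_distrib_left mult_ac)
qed

section \<open>Polynomial functions\<close>

text \<open>With functions instead of polynomials, substitution is composition. The degree has to be an index, since the zero
  function has every degree.\<close>

definition hom_fun :: "'v set \<Rightarrow> nat \<Rightarrow> (('v \<Rightarrow> complex) \<Rightarrow> complex) set" where
  "hom_fun I n = {\<phi>. \<exists>F\<in>vecs (mons I n). \<phi> = (\<lambda>x. peval x F)}"

lemma hom_fun_peval: "F \<in> vecs (mons I n) \<Longrightarrow> (\<lambda>x. peval x F) \<in> hom_fun I n"
  by (auto simp: hom_fun_def)

lemma hom_fun_0 [simp]: "(\<lambda>x. 0) \<in> hom_fun I n"
  using hom_fun_peval[of 0 I n] by simp

lemma hom_fun_add: "\<phi> \<in> hom_fun I n \<Longrightarrow> \<psi> \<in> hom_fun I n \<Longrightarrow> (\<lambda>x. \<phi> x + \<psi> x) \<in> hom_fun I n"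
  by (auto simp: hom_fun_def vecs_add intro!: bexI[of _ "_ + _"])

lemma hom_fun_mult: "\<phi> \<in> hom_fun I n \<Longrightarrow> \<psi> \<in> hom_fun I k \<Longrightarrow> (\<lambda>x. \<phi> x * \<psi> x) \<in> hom_fun I (n + k)"
  by (auto simp: hom_fun_def vecs_mult intro!: bexI[of _ "_ * _"])

lemma hom_fun_const: "(\<lambda>x. c) \<in> hom_fun I 0"
  using hom_fun_peval[OF vecs_cC, of c I] by simp

lemma hom_fun_coord: "i \<in> I \<Longrightarrow> (\<lambda>x. x i) \<in> hom_fun I 1"
  using hom_fun_peval[OF vecs_cX, of i I] by simp

lemma hom_fun_cmult: "\<phi> \<in> hom_fun I n \<Longrightarrow> (\<lambda>x. c * \<phi> x) \<in> hom_fun I n"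
  using hom_fun_mult[OF hom_fun_const] by fastforce

lemma hom_fun_diff: "\<phi> \<in> hom_fun I n \<Longrightarrow> \<psi> \<in> hom_fun I n \<Longrightarrow> (\<lambda>x. \<phi> x - \<psi> x) \<in> hom_fun I n"
  using hom_fun_add[of \<phi> I n, OF _ hom_fun_cmult[of \<psi> I n "-1"]] by simp

lemma hom_fun_sum: "(\<And>a. a \<in> A \<Longrightarrow> \<phi> a \<in> hom_fun I n) \<Longrightarrow> (\<lambda>x. \<Sum>a\<in>A. \<phi> a x) \<in> hom_fun I n"
  by (induction A rule: infinite_finite_induct) (auto intro: hom_fun_add)

lemma hom_fun_prod:
  "finite A \<Longrightarrow> (\<And>a. a \<in> A \<Longrightarrow> \<phi> a \<in> hom_fun I (n a)) \<Longrightarrow> (\<lambda>x. \<Prod>a\<in>A. \<phi> a x) \<in> hom_fun I (sum n A)"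
  by (induction A rule: finite_induct) (auto intro: hom_fun_mult hom_fun_const)

lemma hom_fun_power: "\<phi> \<in> hom_fun I n \<Longrightarrow> (\<lambda>x. \<phi> x ^ k) \<in> hom_fun I (k * n)"
  by (induction k) (auto intro: hom_fun_mult hom_fun_const)

lemma hom_fun_scale: "\<phi> \<in> hom_fun I n \<Longrightarrow> \<phi> (\<lambda>i. c * x i) = c ^ n * \<phi> x"
  by (auto simp: hom_fun_def peval_scale)

lemma hom_fun_cong: "\<phi> \<in> hom_fun I n \<Longrightarrow> (\<And>i. i \<in> I \<Longrightarrow> x i = y i) \<Longrightarrow> \<phi> x = \<phi> y"
  by (auto simp: hom_fun_def intro: peval_cong_vars)

lemma hom_fun_mono_val: "m \<in> mons I n \<Longrightarrow> (\<lambda>x. mono_val x m) \<in> hom_fun I n"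
  using hom_fun_peval[of "Poly_Mapping.single m 1" I n] by (simp add: vecs_def)

lemma hom_fun_basis:
  assumes "finite I" "\<phi> \<in> hom_fun I n"
  obtains c where "\<And>x. \<phi> x = (\<Sum>m\<in>mons I n. c m * mono_val x m)"
  using assms by (auto simp: hom_fun_def peval_vecs)

lemma hom_fun_compose:
  assumes "finite I" "\<phi> \<in> hom_fun I n" and \<theta>: "\<And>i. i \<in> I \<Longrightarrow> \<theta> i \<in> hom_fun K k"
  shows "(\<lambda>x. \<phi> (\<lambda>i. \<theta> i x)) \<in> hom_fun K (n * k)"
proof -
  obtain c where c: "\<And>x. \<phi> x = (\<Sum>m\<in>mons I n. c m * mono_val x m)"
    using hom_fun_basis[OF assms(1,2)] by blast
  have "(\<lambda>x. mono_val (\<lambda>i. \<theta> i x) m) \<in> hom_fun K (n * k)" if m: "m \<in> mons I n" for m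
  proof -
    have "(\<lambda>x. \<Prod>i\<in>keys m. \<theta> i x ^ lookup m i) \<in> hom_fun K (\<Sum>i\<in>keys m. lookup m i * k)"
      using m by (intro hom_fun_prod hom_fun_power \<theta>) (auto simp: mons_def)
    moreover have "(\<Sum>i\<in>keys m. lookup m i * k) = n * k"
      using m by (simp add: mons_def mdeg_def flip: sum_distrib_right)
    ultimately show ?thesis by (simp add: mono_val_def)
  qed
  then show ?thesis unfolding c by (intro hom_fun_sum hom_fun_cmult)
qed

lemma hom_fun_det:
  assumes "\<And>a b. a < s \<Longrightarrow> b < s \<Longrightarrow> (\<lambda>x. M a b x) \<in> hom_fun I n"
  shows "(\<lambda>x. Determinant.det (mat s s (\<lambda>(a, b). M a b x))) \<in> hom_fun I (n * s)"
proof -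
  have "(\<lambda>x. signof \<pi> * (\<Prod>i = 0..<s. mat s s (\<lambda>(a, b). M a b x) $$ (i, \<pi> i))) \<in> hom_fun I (n * s)"
    if "\<pi> permutes {0..<s}" for \<pi>
  proof -
    have \<pi>: "\<pi> i < s" if "i < s" for i
      using permutes_in_image[OF \<open>\<pi> permutes _\<close>, of i] that by simp
    have "(\<lambda>x. \<Prod>i = 0..<s. M i (\<pi> i) x) \<in> hom_fun I (\<Sum>i = 0..<s. n)"
      by (intro hom_fun_prod assms) (auto simp: \<pi>)
    then have "(\<lambda>x. signof \<pi> * (\<Prod>i = 0..<s. M i (\<pi> i) x)) \<in> hom_fun I (n * s)"
      by (intro hom_fun_cmult) (simp add: mult.commute)
    then show ?thesis by (simp add: \<pi>)
  qed
  then show ?thesis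
    by (subst det_def'[of _ s]) (auto intro!: hom_fun_sum)
qed

text \<open>Cramer's rule over a ring of polynomial functions: \<open>D\<close> is the determinant and \<open>A\<close> the adjugate. The matrix is
  normalised to be the identity at \<open>p\<close>, so that \<open>D\<close> is certainly not zero there.\<close>

lemma cramer_hom_fun:
  fixes M :: "'i \<Rightarrow> 'i \<Rightarrow> ('v \<Rightarrow> complex) \<Rightarrow> complex"
  assumes S: "finite S" and M: "\<And>i k. i \<in> S \<Longrightarrow> k \<in> S \<Longrightarrow> M i k \<in> hom_fun I n"
    and Mp: "\<And>i k. i \<in> S \<Longrightarrow> k \<in> S \<Longrightarrow> M i k p = (if i = k then 1 else 0)"
  obtains D A where "D \<in> hom_fun I (n * card S)" "D p = 1"
    "\<And>i k. i \<in> S \<Longrightarrow> k \<in> S \<Longrightarrow> A k i \<in> hom_fun I (n * (card S - 1))"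
    "\<And>x k l. k \<in> S \<Longrightarrow> l \<in> S \<Longrightarrow> (\<Sum>i\<in>S. A k i x * M i l x) = (if k = l then D x else 0)"
proof -
  define s where "s = card S"
  obtain f where f: "bij_betw f {0..<s} S"
    using ex_bij_betw_nat_finite[OF S] s_def by blast
  define g where "g = inv_into {0..<s} f"
  have g: "g k < s" "f (g k) = k" if "k \<in> S" for k
    using that bij_betwE[OF bij_betw_inv_into[OF f], of] bij_betw_inv_into_right[OF f that]
    by (auto simp: g_def)
  have gf: "g (f a) = a" "f a \<in> S" if "a < s" for a
    using that f by (auto simp: g_def bij_betw_inv_into_left bij_betwE)
  define Q where "Q x = mat s s (\<lambda>(a, b). M (f a) (f b) x)" for x
  have Q: "Q x \<in> carrier_mat s s" for x by (simp add: Q_def)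
  define D where "D x = Determinant.det (Q x)" for x
  define A where "A k i x = adj_mat (Q x) $$ (g k, g i)" for k i x
  show thesis
  proof (rule that[of D A])
    show "D \<in> hom_fun I (n * card S)"
      unfolding D_def Q_def s_def[symmetric] by (rule hom_fun_det) (auto intro: M gf)
    have "Q p = 1\<^sub>m s"
      by (rule eq_matI) (auto simp: Q_def Mp gf bij_betw_def dest: inj_onD[OF bij_betw_imp_inj_on[OF f]])
    then show "D p = 1" by (simp add: D_def)
    fix k l x assume kl: "k \<in> S" "l \<in> S"
    have "(\<Sum>i\<in>S. A k i x * M i l x) = (\<Sum>a=0..<s. A k (f a) x * M (f a) l x)"
      by (rule sum.reindex_bij_betw[OF f, symmetric])
    also have "\<dots> = (adj_mat (Q x) * Q x) $$ (g k, g l)"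
      using kl g carrier_matD[OF adj_mat(1)[OF Q]]
      by (auto simp: scalar_prod_def A_def gf Q_def intro!: sum.cong)
    also have "\<dots> = (if k = l then D x else 0)"
      using kl g adj_mat(3)[OF Q] by (metis (no_types, lifting) D_def index_one_mat(1) index_smult_mat(1)
          index_one_mat(2,3) mult.right_neutral mult_zero_right)
    finally show "(\<Sum>i\<in>S. A k i x * M i l x) = (if k = l then D x else 0)" .
  next
    fix i k assume ik: "i \<in> S" "k \<in> S"
    define u where "u j = (if j < g i then j else Suc j)" for j
    define v where "v j = (if j < g k then j else Suc j)" for j
    have uv: "u a < s" "v a < s" if "a < s - 1" for a
      using that by (auto simp: u_def v_def)
    have "A k i x = (-1) ^ (g i + g k) * Determinant.det (mat (s - 1) (s - 1) (\<lambda>(a, b). M (f (u a)) (f (v b)) x))" for x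
    proof -
      have "mat_delete (Q x) (g i) (g k) = mat (s - 1) (s - 1) (\<lambda>(a, b). M (f (u a)) (f (v b)) x)"
        using uv by (intro eq_matI) (auto simp: mat_delete_def Q_def u_def v_def)
      then show ?thesis
        using g ik Q[of x] by (simp add: A_def adj_mat_def cofactor_def)
    qed
    then have "A k i = (\<lambda>x. (-1) ^ (g i + g k) * Determinant.det (mat (s - 1) (s - 1) (\<lambda>(a, b). M (f (u a)) (f (v b)) x)))"
      by blast
    also have "\<dots> \<in> hom_fun I (n * (s - 1))"
      by (intro hom_fun_cmult hom_fun_det M gf uv)
    finally show "A k i \<in> hom_fun I (n * (card S - 1))" by (simp add: s_def)
  qed
qed

section \<open>Polynomial curves\<close>

definition polyfn :: "(complex \<Rightarrow> complex) \<Rightarrow> bool" where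
  "polyfn f \<longleftrightarrow> (\<exists>P. \<forall>t. f t = poly P t)"

lemma polyfn_const [simp]: "polyfn (\<lambda>t. c)"
  unfolding polyfn_def by (rule exI[of _ "[:c:]"]) simp

lemma polyfn_id [simp]: "polyfn (\<lambda>t. t)"
  unfolding polyfn_def by (rule exI[of _ "[:0, 1:]"]) simp

lemma polyfn_add: "polyfn f \<Longrightarrow> polyfn g \<Longrightarrow> polyfn (\<lambda>t. f t + g t)"
  unfolding polyfn_def by (metis poly_add)

lemma polyfn_mult: "polyfn f \<Longrightarrow> polyfn g \<Longrightarrow> polyfn (\<lambda>t. f t * g t)"
  unfolding polyfn_def by (metis poly_mult)

lemma polyfn_diff: "polyfn f \<Longrightarrow> polyfn g \<Longrightarrow> polyfn (\<lambda>t. f t - g t)"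
  unfolding polyfn_def by (metis poly_diff)

lemma polyfn_power: "polyfn f \<Longrightarrow> polyfn (\<lambda>t. f t ^ n)"
  by (induction n) (auto intro: polyfn_mult)

lemma polyfn_sum: "(\<And>a. a \<in> A \<Longrightarrow> polyfn (f a)) \<Longrightarrow> polyfn (\<lambda>t. \<Sum>a\<in>A. f a t)"
  by (induction A rule: infinite_finite_induct) (auto intro: polyfn_add)

lemma polyfn_prod: "(\<And>a. a \<in> A \<Longrightarrow> polyfn (f a)) \<Longrightarrow> polyfn (\<lambda>t. \<Prod>a\<in>A. f a t)"
  by (induction A rule: infinite_finite_induct) (auto intro: polyfn_mult)

lemma polyfn_peval:
  assumes "\<And>i. polyfn (\<lambda>t. x t i)"
  shows "polyfn (\<lambda>t. peval (x t) F)"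
  unfolding peval_def by (intro polyfn_sum polyfn_mult polyfn_const polyfn_prod polyfn_power assms)

lemma polyfn_hom_fun: "\<phi> \<in> hom_fun I n \<Longrightarrow> (\<And>i. polyfn (\<lambda>t. x t i)) \<Longrightarrow> polyfn (\<lambda>t. \<phi> (x t))"
  by (auto simp: hom_fun_def intro: polyfn_peval)

text \<open>Polynomials over an infinite field are determined by their values, so the polynomial functions of one variable
  form an integral domain.\<close>

lemma polyfn_mult_zero:
  assumes "polyfn f" "polyfn g" "\<And>t. f t * g t = 0" "g t0 \<noteq> 0"
  shows "f t = 0"
proof -
  obtain P Q where PQ: "\<And>t. f t = poly P t" "\<And>t. g t = poly Q t"
    using assms(1,2) by (auto simp: polyfn_def)
  have "poly (P * Q) t = 0" for t using assms(3)[of t] PQ by simp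
  then have "P * Q = 0" using poly_all_0_iff_0[of "P * Q"] by simp
  moreover have "Q \<noteq> 0" using assms(4) PQ by auto
  ultimately show ?thesis using PQ by simp
qed

lemma polyfn_zero_ext:
  assumes "polyfn f" "\<And>t. t \<noteq> 0 \<Longrightarrow> f t = 0"
  shows "f t = 0"
proof (rule polyfn_mult_zero[of f "\<lambda>t. t" 1])
  fix t show "f t * t = 0" using assms(2)[of t] by (cases "t = 0") auto
qed (use assms in auto)

section \<open>Bihomogeneous functions\<close>

text \<open>The asymmetric form of the definition presents a bihomogeneous equation as a linear equation for the monomials in
  the first group of variables with coefficients that are polynomials in the second group.\<close>

definition bihom_fun :: "'a set \<Rightarrow> 'b set \<Rightarrow> nat \<Rightarrow> nat \<Rightarrow> (('a \<Rightarrow> complex) \<Rightarrow> ('b \<Rightarrow> complex) \<Rightarrow> complex) set" where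
  "bihom_fun I J n k = {\<Phi>. \<exists>a. (\<forall>m\<in>mons I n. a m \<in> hom_fun J k) \<and>
                     \<Phi> = (\<lambda>x y. \<Sum>m\<in>mons I n. a m y * mono_val x m)}"

lemma bihom_fun_add: "\<Phi> \<in> bihom_fun I J n k \<Longrightarrow> \<Psi> \<in> bihom_fun I J n k \<Longrightarrow> (\<lambda>x y. \<Phi> x y + \<Psi> x y) \<in> bihom_fun I J n k"
proof -
  assume "\<Phi> \<in> bihom_fun I J n k" "\<Psi> \<in> bihom_fun I J n k"
  then obtain a b where "\<forall>m\<in>mons I n. a m \<in> hom_fun J k" "\<Phi> = (\<lambda>x y. \<Sum>m\<in>mons I n. a m y * mono_val x m)"
    "\<forall>m\<in>mons I n. b m \<in> hom_fun J k" "\<Psi> = (\<lambda>x y. \<Sum>m\<in>mons I n. b m y * mono_val x m)"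
    by (auto simp: bihom_fun_def)
  then show ?thesis unfolding bihom_fun_def
    by (auto intro!: exI[of _ "\<lambda>m y. a m y + b m y"] hom_fun_add simp: distrib_right sum.distrib)
qed

lemma bihom_fun_0: "(\<lambda>x y. 0) \<in> bihom_fun I J n k"
  unfolding bihom_fun_def by (auto intro!: exI[of _ "\<lambda>m y. 0"])

lemma bihom_fun_sum: "(\<And>a. a \<in> A \<Longrightarrow> \<Phi> a \<in> bihom_fun I J n k) \<Longrightarrow> (\<lambda>x y. \<Sum>a\<in>A. \<Phi> a x y) \<in> bihom_fun I J n k"
  by (induction A rule: infinite_finite_induct) (auto intro: bihom_fun_add bihom_fun_0)

lemma bihom_fun_hom_fun:
  assumes "finite I" "\<phi> \<in> hom_fun I n" "\<psi> \<in> hom_fun J k"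
  shows "(\<lambda>x y. \<phi> x * \<psi> y) \<in> bihom_fun I J n k"
proof -
  obtain c where c: "\<And>x. \<phi> x = (\<Sum>m\<in>mons I n. c m * mono_val x m)"
    using hom_fun_basis[OF assms(1,2)] by blast
  show ?thesis unfolding bihom_fun_def c
    by (auto intro!: exI[of _ "\<lambda>m y. c m * \<psi> y"] hom_fun_cmult assms simp: sum_distrib_left mult_ac)
qed

lemma bihom_fun_induct [consumes 2]:
  assumes "\<Phi> \<in> bihom_fun I J n k" "finite I"
    and "\<And>\<phi> \<psi>. \<phi> \<in> hom_fun I n \<Longrightarrow> \<psi> \<in> hom_fun J k \<Longrightarrow> P (\<lambda>x y. \<phi> x * \<psi> y)"
    and "P (\<lambda>x y. 0)"
    and "\<And>\<Phi> \<Psi>. P \<Phi> \<Longrightarrow> P \<Psi> \<Longrightarrow> P (\<lambda>x y. \<Phi> x y + \<Psi> x y)"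
  shows "P \<Phi>"
proof -
  obtain a where a: "\<forall>m\<in>mons I n. a m \<in> hom_fun J k" "\<Phi> = (\<lambda>x y. \<Sum>m\<in>mons I n. a m y * mono_val x m)"
    using assms(1) by (auto simp: bihom_fun_def)
  have "P (\<lambda>x y. \<Sum>m\<in>K. a m y * mono_val x m)" if "finite K" "K \<subseteq> mons I n" for K
    using that
  proof (induction K)
    case (insert m K)
    have "P (\<lambda>x y. mono_val x m * a m y)"
      using insert a(1) by (intro assms(3) hom_fun_mono_val) auto
    then have "P (\<lambda>x y. mono_val x m * a m y + (\<Sum>m\<in>K. a m y * mono_val x m))"
      using insert by (intro assms(5)) auto
    then show ?case using insert by (simp add: mult_ac)
  qed (use assms(4) in simp)
  from this[of "mons I n"] show ?thesis using a assms(2) by (simp add: finite_mons)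
qed

lemma bihom_fun_mult:
  assumes "finite I" "\<Phi> \<in> bihom_fun I J n k" "\<Psi> \<in> bihom_fun I J n' k'"
  shows "(\<lambda>x y. \<Phi> x y * \<Psi> x y) \<in> bihom_fun I J (n + n') (k + k')"
  using assms(2,1)
proof (induction rule: bihom_fun_induct)
  case (1 \<phi> \<psi>)
  show ?case using assms(3,1)
  proof (induction rule: bihom_fun_induct)
    case (1 \<phi>' \<psi>')
    have "(\<lambda>x y. (\<phi> x * \<phi>' x) * (\<psi> y * \<psi>' y)) \<in> bihom_fun I J (n + n') (k + k')"
      using 1 \<open>\<phi> \<in> _\<close> \<open>\<psi> \<in> _\<close> assms(1) by (intro bihom_fun_hom_fun hom_fun_mult)
    then show ?case by (simp add: mult_ac)
  qed (auto simp: distrib_left intro: bihom_fun_add bihom_fun_0)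
qed (auto simp: distrib_right intro: bihom_fun_add bihom_fun_0)

lemma bihom_fun_compose:
  assumes "finite I" "finite J" "finite I'" "\<Phi> \<in> bihom_fun I J n k"
    and "\<And>i. i \<in> I \<Longrightarrow> \<theta> i \<in> hom_fun I' 1" "\<And>j. j \<in> J \<Longrightarrow> \<tau> j \<in> hom_fun J' 1"
  shows "(\<lambda>x y. \<Phi> (\<lambda>i. \<theta> i x) (\<lambda>j. \<tau> j y)) \<in> bihom_fun I' J' n k"
  using assms(4,1)
proof (induction rule: bihom_fun_induct)
  case (1 \<phi> \<psi>)
  show ?case
    using hom_fun_compose[OF assms(1) 1(1), of \<theta> I' 1] hom_fun_compose[OF assms(2) 1(2), of \<tau> J' 1] assms(3,5,6)
    by (intro bihom_fun_hom_fun) auto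
qed (auto intro: bihom_fun_add bihom_fun_0)

lemma bihom_fun_scale:
  assumes "finite I" "\<Phi> \<in> bihom_fun I J n k"
  shows "\<Phi> (\<lambda>i. c * x i) (\<lambda>j. c' * y j) = c ^ n * c' ^ k * \<Phi> x y"
  using assms(2,1) by (induction rule: bihom_fun_induct) (auto simp: hom_fun_scale algebra_simps)

lemma bihom_fun_cong:
  assumes "finite I" "\<Phi> \<in> bihom_fun I J n k" "\<And>i. i \<in> I \<Longrightarrow> x i = x' i" "\<And>j. j \<in> J \<Longrightarrow> y j = y' j"
  shows "\<Phi> x y = \<Phi> x' y'"
  using assms(2,1) by (induction rule: bihom_fun_induct) (use assms hom_fun_cong in \<open>metis, auto\<close>)

lemma bihom_fun_right:
  assumes "finite I" "\<Phi> \<in> bihom_fun I J n k"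
  shows "(\<lambda>x. \<Phi> x y) \<in> hom_fun I n"
  using assms(2,1)
proof (induction rule: bihom_fun_induct)
  case (1 \<phi> \<psi>)
  then show ?case using hom_fun_cmult[of \<phi> I n "\<psi> y"] by (simp add: mult.commute)
qed (auto intro: hom_fun_add)

section \<open>A Nullstellensatz\<close>

definition polys_in :: "'v set \<Rightarrow> 'v cpoly set" where
  "polys_in I = vecs {m. keys m \<subseteq> I}"

lemma polys_in_mult: "p \<in> polys_in I \<Longrightarrow> q \<in> polys_in I \<Longrightarrow> p * q \<in> polys_in I"
  using keys_mult[of p q] by (fastforce simp: polys_in_def vecs_def keys_add_nat)

lemma polys_in_cC [simp]: "cC c \<in> polys_in I"
  by (simp add: polys_in_def vecs_def)

lemma polys_in_1 [simp]: "1 \<in> polys_in I"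
  using polys_in_cC[of 1] by simp

lemma polys_in_cX [simp]: "i \<in> I \<Longrightarrow> cX i \<in> polys_in I"
  by (simp add: polys_in_def vecs_def cX_def)

lemma polys_in_add: "p \<in> polys_in I \<Longrightarrow> q \<in> polys_in I \<Longrightarrow> p + q \<in> polys_in I"
  unfolding polys_in_def by (rule vecs_add)

lemma polys_in_diff: "p \<in> polys_in I \<Longrightarrow> q \<in> polys_in I \<Longrightarrow> p - q \<in> polys_in I"
  unfolding polys_in_def by (rule vecs_diff)

lemma polys_in_sum: "(\<And>a. a \<in> A \<Longrightarrow> f a \<in> polys_in I) \<Longrightarrow> sum f A \<in> polys_in I"
  unfolding polys_in_def by (rule vecs_sum)

lemmas polys_in_intros = polys_in_mult polys_in_cC polys_in_1 polys_in_cX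
  polys_in_add polys_in_diff polys_in_sum

lemma polys_in_power: "p \<in> polys_in I \<Longrightarrow> p ^ n \<in> polys_in I"
  by (induction n) (auto intro: polys_in_intros)

lemma polys_in_prod: "(\<And>a. a \<in> A \<Longrightarrow> f a \<in> polys_in I) \<Longrightarrow> prod f A \<in> polys_in I"
  by (induction A rule: infinite_finite_induct) (auto intro: polys_in_intros)

definition poly_ideal :: "'v set \<Rightarrow> 'v cpoly set \<Rightarrow> bool" where
  "poly_ideal I \<aa> \<longleftrightarrow> \<aa> \<subseteq> polys_in I \<and> 0 \<in> \<aa> \<and> (\<forall>f\<in>\<aa>. \<forall>g\<in>\<aa>. f + g \<in> \<aa>) \<and>
     (\<forall>f\<in>polys_in I. \<forall>g\<in>\<aa>. f * g \<in> \<aa>)"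

lemma poly_idealD:
  assumes "poly_ideal I \<aa>"
  shows "0 \<in> \<aa>" "f \<in> \<aa> \<Longrightarrow> f \<in> polys_in I" "f \<in> \<aa> \<Longrightarrow> g \<in> \<aa> \<Longrightarrow> f + g \<in> \<aa>"
    "f \<in> polys_in I \<Longrightarrow> g \<in> \<aa> \<Longrightarrow> f * g \<in> \<aa>"
  using assms by (auto simp: poly_ideal_def)

lemma poly_ideal_sum:
  "poly_ideal I \<aa> \<Longrightarrow> (\<And>a. a \<in> A \<Longrightarrow> f a \<in> \<aa>) \<Longrightarrow> sum f A \<in> \<aa>"
  by (induction A rule: infinite_finite_induct) (auto intro: poly_idealD)

lemma linear_dependence:
  fixes \<gamma> :: "'c \<Rightarrow> 'm \<Rightarrow> 'k::field"
  assumes "finite S" "finite C" "card S < card C"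
  shows "\<exists>a. (\<exists>c\<in>C. a c \<noteq> 0) \<and> (\<forall>m\<in>S. (\<Sum>c\<in>C. a c * \<gamma> c m) = 0)"
  using assms
proof (induction S arbitrary: C \<gamma>)
  case empty
  then show ?case by (auto intro!: exI[of _ "\<lambda>_. 1"] simp: card_gt_0_iff)
next
  case (insert m S)
  show ?case
  proof (cases "\<forall>c\<in>C. \<gamma> c m = 0")
    case True
    obtain a where "\<exists>c\<in>C. a c \<noteq> 0" "\<forall>m\<in>S. (\<Sum>c\<in>C. a c * \<gamma> c m) = 0"
      using insert.IH[of C \<gamma>] insert.prems insert.hyps by auto
    with True show ?thesis by (intro exI[of _ a]) auto
  next
    case False
    then obtain c1 where c1: "c1 \<in> C" "\<gamma> c1 m \<noteq> 0" by blast
    define C' where "C' = C - {c1}"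
    define \<gamma>' where "\<gamma>' c m' = \<gamma> c m' - \<gamma> c m / \<gamma> c1 m * \<gamma> c1 m'" for c m'
    have C: "C = insert c1 C'" "c1 \<notin> C'" "finite C'" using c1 insert.prems by (auto simp: C'_def)
    have "card S < card C'" using insert.prems insert.hyps C by simp
    then obtain a where a: "\<exists>c\<in>C'. a c \<noteq> 0" "\<forall>m'\<in>S. (\<Sum>c\<in>C'. a c * \<gamma>' c m') = 0"
      using insert.IH[of C' \<gamma>'] C by auto
    define b where "b c = (if c = c1 then - (\<Sum>c\<in>C'. a c * \<gamma> c m) / \<gamma> c1 m else a c)" for c
    have sum_b: "(\<Sum>c\<in>C. b c * \<gamma> c m') = (\<Sum>c\<in>C'. a c * \<gamma>' c m')" for m'
    proof -
      have "(\<Sum>c\<in>C. b c * \<gamma> c m') = b c1 * \<gamma> c1 m' + (\<Sum>c\<in>C'. b c * \<gamma> c m')"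
        using C by simp
      also have "(\<Sum>c\<in>C'. b c * \<gamma> c m') = (\<Sum>c\<in>C'. a c * \<gamma> c m')"
        using C(2) by (intro sum.cong) (auto simp: b_def)
      also have "b c1 * \<gamma> c1 m' = - (\<Sum>c\<in>C'. a c * (\<gamma> c m / \<gamma> c1 m * \<gamma> c1 m'))"
        by (simp add: b_def sum_distrib_left sum_distrib_right sum_divide_distrib mult_ac)
      finally show ?thesis
        by (simp add: \<gamma>'_def right_diff_distrib sum_subtractf)
    qed
    have "\<gamma>' c m = 0" for c using c1 by (simp add: \<gamma>'_def)
    then have "\<forall>m'\<in>insert m S. (\<Sum>c\<in>C. b c * \<gamma> c m') = 0"
      using a(2) by (simp add: sum_b)
    moreover have "\<exists>c\<in>C. b c \<noteq> 0" using a(1) C by (auto simp: b_def)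
    ultimately show ?thesis by blast
  qed
qed

lemma uncountable_UNIV_complex: "uncountable (UNIV :: complex set)"
proof
  assume "countable (UNIV :: complex set)"
  then have "countable (range complex_of_real)" by (rule countable_subset[rotated]) simp
  then have "countable (UNIV :: real set)"
    by (rule countable_image_inj_on) (simp add: inj_on_def)
  then show False using uncountable_UNIV_real by blast
qed

lemma countable_monomials:
  assumes "finite I" shows "countable {m :: 'v \<Rightarrow>\<^sub>0 nat. keys m \<subseteq> I}"
proof -
  have "{m :: 'v \<Rightarrow>\<^sub>0 nat. keys m \<subseteq> I} = (\<Union>n. mons I n)" by (auto simp: mons_def)
  then show ?thesis using finite_mons[OF assms] by (simp add: countable_finite)
qed

text \<open>The polynomial \<open>P\<close> splits into linear factors. Each factor \<open>cX i - cC c\<close> is invertible modulo the ideal and can be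
  cancelled, until a nonzero constant is left.\<close>

lemma univariate_in_ideal:
  assumes \<aa>: "poly_ideal I \<aa>" and i: "i \<in> I"
    and inv: "\<And>c. \<exists>g\<in>polys_in I. 1 - (cX i - cC c) * g \<in> \<aa>"
    and E: "E \<in> \<aa>" "\<And>x. peval x E = poly P (x i)" and "P \<noteq> 0"
  shows "1 \<in> \<aa>"
  using E \<open>P \<noteq> 0\<close>
proof (induction "degree P" arbitrary: P E)
  case 0
  then obtain c where P: "P = [:c:]" by (metis degree_eq_zeroE)
  then have "cC (1 / c) * E = 1" using 0 by (intro peval_inject) auto
  moreover have "cC (1 / c) * E \<in> \<aa>" by (rule poly_idealD[OF \<aa>]) (use 0 in auto)
  ultimately show ?case by simp
next
  case (Suc n)
  then have "\<not> constant (poly P)" by (simp add: constant_degree)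
  then obtain c where "poly P c = 0" using fundamental_theorem_of_algebra by blast
  then obtain P1 where P: "P = [:-c, 1:] * P1" by (auto simp: poly_eq_0_iff_dvd)
  then have P1: "P1 \<noteq> 0" using Suc by auto
  then have deg: "degree P1 = n" using Suc(2) P by (subst (asm) P, subst (asm) degree_mult_eq) auto
  define E1 where "E1 = (\<Sum>k\<le>degree P1. cC (coeff P1 k) * cX i ^ k)"
  have E1: "E1 \<in> polys_in I" "peval x E1 = poly P1 (x i)" for x
    using i by (auto simp: E1_def poly_altdef intro!: polys_in_intros polys_in_power)
  have E: "E = (cX i - cC c) * E1"
    using Suc.prems P E1 by (intro peval_inject) (auto simp: algebra_simps)
  obtain g where g: "g \<in> polys_in I" "1 - (cX i - cC c) * g \<in> \<aa>" using inv by blast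
  have "E1 = E1 * (1 - (cX i - cC c) * g) + g * E" by (simp add: E algebra_simps)
  also have "\<dots> \<in> \<aa>" using g E1 Suc.prems by (intro poly_idealD(3,4)[OF \<aa>]) auto
  finally show ?case using Suc.hyps(1)[of P1 E1] deg E1 P1 by auto
qed

text \<open>Suppose that all \<open>cX i - cC c\<close> have inverses \<open>g c\<close> modulo the ideal. There are uncountably many \<open>c\<close> but only
  countably many finite sets of monomials, so infinitely many of the \<open>g c\<close> have the same support. If more of them
  are taken than the support has elements, they are linearly dependent. Clearing denominators in a linear relation
  between these inverses yields a nonzero polynomial in \<open>cX i\<close> alone that lies in the ideal.\<close>

lemma exists_noninvertible_shift:
  fixes I :: "'v set"
  assumes I: "finite I" and \<aa>: "poly_ideal I \<aa>" and 1: "1 \<notin> \<aa>" and i: "i \<in> I"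
  shows "\<exists>c. \<forall>g\<in>polys_in I. 1 - (cX i - cC c) * g \<notin> \<aa>"
proof (rule ccontr)
  assume "\<not> ?thesis"
  then have inv: "\<And>c. \<exists>g\<in>polys_in I. 1 - (cX i - cC c) * g \<in> \<aa>" by blast
  then obtain g where g: "\<And>c. g c \<in> polys_in I" "\<And>c. 1 - (cX i - cC c) * g c \<in> \<aa>" by metis
  define F where "F = {S :: ('v \<Rightarrow>\<^sub>0 nat) set. finite S \<and> S \<subseteq> {m. keys m \<subseteq> I}}"
  have "countable F"
    unfolding F_def using countable_Collect_finite_subset[OF countable_monomials[OF I]] by (simp add: conj_commute)
  moreover have "UNIV = (\<Union>S\<in>F. {c. keys (g c) = S})"
    using g(1) by (auto simp: F_def polys_in_def vecs_def)
  ultimately obtain S where S: "S \<in> F" "infinite {c. keys (g c) = S}"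
    using uncountable_UNIV_complex by (metis (no_types, lifting) countable_UN countable_finite)
  obtain C where C: "finite C" "card C = Suc (card S)" "C \<subseteq> {c. keys (g c) = S}"
    using infinite_arbitrarily_large[OF S(2)] by blast
  obtain a where a: "\<exists>c\<in>C. a c \<noteq> 0" "\<forall>m\<in>S. (\<Sum>c\<in>C. a c * lookup (g c) m) = 0"
    using linear_dependence[of S C "\<lambda>c. lookup (g c)"] S C by (auto simp: F_def)
  have ag: "(\<Sum>c\<in>C. cC (a c) * g c) = 0"
  proof (rule poly_mapping_eqI)
    fix m
    show "lookup (\<Sum>c\<in>C. cC (a c) * g c) m = lookup 0 m"
    proof (cases "m \<in> S")
      case False
      then have "lookup (g c) m = 0" if "c \<in> C" for c
        using that C by (auto simp: in_keys_iff)
      then show ?thesis by (simp add: lookup_sum)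
    qed (use a in \<open>simp add: lookup_sum\<close>)
  qed
  define Q where "Q c = (\<Prod>c'\<in>C - {c}. cX i - cC c')" for c
  define E where "E = (\<Sum>c\<in>C. cC (a c) * Q c)"
  have Q: "Q c \<in> polys_in I" for c
    using i by (auto simp: Q_def intro!: polys_in_prod polys_in_intros)
  have QQ: "Q c * (cX i - cC c) = (\<Prod>c'\<in>C. cX i - cC c')" if "c \<in> C" for c
    using that C(1) by (simp add: Q_def prod.remove mult.commute)
  have "E = (\<Sum>c\<in>C. (cC (a c) * Q c) * (1 - (cX i - cC c) * g c))
      + (\<Sum>c\<in>C. cC (a c) * (Q c * (cX i - cC c)) * g c)"
    unfolding E_def sum.distrib[symmetric] by (rule sum.cong) (simp_all add: algebra_simps)
  also have "(\<Sum>c\<in>C. cC (a c) * (Q c * (cX i - cC c)) * g c)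
      = (\<Prod>c'\<in>C. cX i - cC c') * (\<Sum>c\<in>C. cC (a c) * g c)"
    unfolding sum_distrib_left by (rule sum.cong) (simp_all add: QQ mult_ac)
  finally have "E = (\<Sum>c\<in>C. (cC (a c) * Q c) * (1 - (cX i - cC c) * g c))" by (simp add: ag)
  also have "\<dots> \<in> \<aa>"
    by (intro poly_ideal_sum[OF \<aa>] poly_idealD(4)[OF \<aa>] g polys_in_intros Q)
  finally have E: "E \<in> \<aa>" .
  define P where "P = (\<Sum>c\<in>C. smult (a c) (\<Prod>c'\<in>C - {c}. [:- c', 1:]))"
  have PE: "peval x E = poly P (x i)" for x
    by (simp add: E_def P_def Q_def poly_sum poly_prod)
  obtain c0 where c0: "c0 \<in> C" "a c0 \<noteq> 0" using a by blast
  have "poly P c0 = (\<Sum>c\<in>C. if c = c0 then a c0 * (\<Prod>c'\<in>C - {c0}. c0 - c') else 0)"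
    unfolding P_def poly_sum using C(1) c0 by (intro sum.cong) (auto simp: poly_prod)
  also have "\<dots> \<noteq> 0" using C(1) c0 by (simp add: sum.delta)
  finally have "P \<noteq> 0" by auto
  from univariate_in_ideal[OF \<aa> i inv E PE this] 1 show False by blast
qed

text \<open>One variable after the other, some \<open>cX i - cC c\<close> is adjoined to the ideal without making it improper. In the end
  every polynomial is a constant modulo the enlarged ideal, namely its value at the point \<open>x\<close> of the chosen \<open>c\<close>;
  for an element of the ideal this value must be zero.\<close>

theorem nullstellensatz:
  fixes I :: "'v set"
  assumes I: "finite I" and \<aa>: "poly_ideal I \<aa>" and 1: "1 \<notin> \<aa>"
  shows "\<exists>x. \<forall>F\<in>\<aa>. peval x F = 0"
proof -
  have "\<exists>\<bb> x. poly_ideal I \<bb> \<and> \<aa> \<subseteq> \<bb> \<and> 1 \<notin> \<bb> \<and> (\<forall>i\<in>K. cX i - cC (x i) \<in> \<bb>)"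
    if "finite K" "K \<subseteq> I" for K
    using that
  proof (induction K)
    case empty
    then show ?case using \<aa> 1 by auto
  next
    case (insert i K)
    then obtain \<bb> x where b: "poly_ideal I \<bb>" "\<aa> \<subseteq> \<bb>" "1 \<notin> \<bb>" "\<forall>i\<in>K. cX i - cC (x i) \<in> \<bb>" by auto
    obtain c where c: "\<forall>g\<in>polys_in I. 1 - (cX i - cC c) * g \<notin> \<bb>"
      using exists_noninvertible_shift[OF I b(1,3), of i] insert by auto
    define d where "d = {f + (cX i - cC c) * g |f g. f \<in> \<bb> \<and> g \<in> polys_in I}"
    have X: "cX i - cC c \<in> polys_in I" using insert by (auto intro: polys_in_intros)
    have "poly_ideal I d"
      unfolding poly_ideal_def
    proof (intro conjI ballI)
      show "d \<subseteq> polys_in I"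
        using X by (auto simp: d_def intro!: polys_in_add polys_in_mult dest: poly_idealD(2)[OF b(1)])
      show "0 \<in> d"
        unfolding d_def using poly_idealD(1)[OF b(1)] vecs_0
        by (auto simp: polys_in_def intro!: exI[of _ 0])
    next
      fix f g assume "f \<in> d" "g \<in> d"
      then obtain f1 f2 g1 g2 where "f = f1 + (cX i - cC c) * f2" "g = g1 + (cX i - cC c) * g2"
        "f1 \<in> \<bb>" "g1 \<in> \<bb>" "f2 \<in> polys_in I" "g2 \<in> polys_in I" by (auto simp: d_def)
      then have "f + g = (f1 + g1) + (cX i - cC c) * (f2 + g2) \<and> f1 + g1 \<in> \<bb> \<and> f2 + g2 \<in> polys_in I"
        by (auto intro!: poly_idealD(3)[OF b(1)] polys_in_add simp only: distrib_left add_ac)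
      then show "f + g \<in> d" unfolding d_def by blast
    next
      fix f g assume "f \<in> polys_in I" "g \<in> d"
      then obtain g1 g2 where "g = g1 + (cX i - cC c) * g2"
        "g1 \<in> \<bb>" "g2 \<in> polys_in I" by (auto simp: d_def)
      then have "f * g = f * g1 + (cX i - cC c) * (f * g2) \<and> f * g1 \<in> \<bb> \<and> f * g2 \<in> polys_in I"
        using \<open>f \<in> _\<close> by (auto intro!: poly_idealD(4)[OF b(1)] polys_in_mult simp only: distrib_left mult_ac)
      then show "f * g \<in> d" unfolding d_def by blast
    qed
    moreover have "\<bb> \<subseteq> d" unfolding d_def
      using vecs_0 by (force simp: polys_in_def intro: exI[of _ 0])
    moreover have "1 \<notin> d"
    proof
      assume "1 \<in> d"
      then obtain f g where fg: "1 = f + (cX i - cC c) * g" "f \<in> \<bb>" "g \<in> polys_in I" by (auto simp: d_def)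
      then have "1 - (cX i - cC c) * g = f" by (metis add_diff_cancel_right')
      then show False using c fg by auto
    qed
    moreover have "cX i - cC c \<in> d" unfolding d_def
      using poly_idealD(1)[OF b(1)] by (force intro: exI[of _ 0] exI[of _ 1])
    ultimately show ?case using b insert
      by (intro exI[of _ d] exI[of _ "x(i := c)"]) auto
  qed
  from this[of I] obtain \<bb> x where b: "poly_ideal I \<bb>" "\<aa> \<subseteq> \<bb>" "1 \<notin> \<bb>"
    "\<And>i. i \<in> I \<Longrightarrow> cX i - cC (x i) \<in> \<bb>" using I by auto
  have red: "F - cC (peval x F) \<in> \<bb> \<and> F \<in> polys_in I" if "F \<in> polys_in I" for F
  proof (rule cpoly_ring_induct[of F I])
    show "\<And>m. m \<in> keys F \<Longrightarrow> keys m \<subseteq> I" using that by (auto simp: polys_in_def vecs_def)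
  next
    fix p q assume p: "p - cC (peval x p) \<in> \<bb> \<and> p \<in> polys_in I" and q: "q - cC (peval x q) \<in> \<bb> \<and> q \<in> polys_in I"
    have "p * q - cC (peval x (p * q)) = q * (p - cC (peval x p)) + cC (peval x p) * (q - cC (peval x q))"
      by (simp add: algebra_simps mult_single)
    also have "\<dots> \<in> \<bb>" using p q by (intro poly_idealD(3,4)[OF b(1)]) auto
    finally show "p * q - cC (peval x (p * q)) \<in> \<bb> \<and> p * q \<in> polys_in I"
      using p q by (auto intro: polys_in_intros)
    have "p + q - cC (peval x (p + q)) = (p - cC (peval x p)) + (q - cC (peval x q))"
      by (simp add: algebra_simps single_add)
    also have "\<dots> \<in> \<bb>" using p q by (intro poly_idealD(3,4)[OF b(1)]) auto
    finally show "p + q - cC (peval x (p + q)) \<in> \<bb> \<and> p + q \<in> polys_in I"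
      using p q by (auto intro: polys_in_intros)
  qed (use b poly_idealD(1)[OF b(1)] in auto)
  have "peval x F = 0" if "F \<in> \<aa>" for F
  proof (rule ccontr)
    assume nz: "peval x F \<noteq> 0"
    have F: "F \<in> \<bb>" "F \<in> polys_in I" using that b poly_idealD(2)[OF \<aa>] by auto
    have "1 = cC (1 / peval x F) * F + cC (- 1 / peval x F) * (F - cC (peval x F))"
      using nz by (intro peval_inject) (simp add: field_simps)
    also have "\<dots> \<in> \<bb>" using F red by (intro poly_idealD(3,4)[OF b(1)]) auto
    finally show False using b by blast
  qed
  then show ?thesis by blast
qed

lemma polyfn_if: "polyfn f \<Longrightarrow> polyfn g \<Longrightarrow> polyfn (\<lambda>t. if b then f t else g t)"
  by (cases b) auto

text \<open>Where \<open>x i = 1\<close>, terms of lower degree can be multiplied by powers of \<open>x i\<close>.\<close>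

lemma homogenize_at:
  assumes F: "F \<in> polys_in I" and i: "i \<in> I"
  shows "\<exists>N. \<exists>\<phi>\<in>hom_fun I N. \<forall>x. x i = 1 \<longrightarrow> peval x F = \<phi> x"
proof (rule cpoly_ring_induct[of F I])
  show "\<And>m. m \<in> keys F \<Longrightarrow> keys m \<subseteq> I" using F by (auto simp: polys_in_def vecs_def)
  fix c show "\<exists>N. \<exists>\<phi>\<in>hom_fun I N. \<forall>x. x i = 1 \<longrightarrow> peval x (cC c) = \<phi> x"
    by (rule exI[of _ 0], rule bexI[OF _ hom_fun_const[of c]]) simp
next
  fix k assume "k \<in> I"
  then show "\<exists>N. \<exists>\<phi>\<in>hom_fun I N. \<forall>x. x i = 1 \<longrightarrow> peval x (cX k) = \<phi> x"
    by (intro exI[of _ 1], intro bexI[OF _ hom_fun_coord[of k]]) simp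
next
  fix p q
  assume "\<exists>N. \<exists>\<phi>\<in>hom_fun I N. \<forall>x. x i = 1 \<longrightarrow> peval x p = \<phi> x"
    "\<exists>N. \<exists>\<phi>\<in>hom_fun I N. \<forall>x. x i = 1 \<longrightarrow> peval x q = \<phi> x"
  then obtain M N \<phi> \<psi> where *: "\<phi> \<in> hom_fun I M" "\<psi> \<in> hom_fun I N"
    "\<forall>x. x i = 1 \<longrightarrow> peval x p = \<phi> x" "\<forall>x. x i = 1 \<longrightarrow> peval x q = \<psi> x" by blast
  from hom_fun_mult[OF *(1,2)] show "\<exists>N. \<exists>\<phi>\<in>hom_fun I N. \<forall>x. x i = 1 \<longrightarrow> peval x (p * q) = \<phi> x"
    using *(3,4) by (intro exI bexI) auto
  have "(\<lambda>x. \<phi> x * x i ^ N) \<in> hom_fun I (M + N)" "(\<lambda>x. x i ^ M * \<psi> x) \<in> hom_fun I (M + N)"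
    using hom_fun_mult[OF *(1) hom_fun_power[OF hom_fun_coord[OF i], of N]]
      hom_fun_mult[OF hom_fun_power[OF hom_fun_coord[OF i], of M] *(2)] by auto
  from hom_fun_add[OF this] show "\<exists>N. \<exists>\<phi>\<in>hom_fun I N. \<forall>x. x i = 1 \<longrightarrow> peval x (p + q) = \<phi> x"
    using *(3,4) by (intro exI bexI) auto
qed

text \<open>The restrictions of \<open>B\<close> to the affine hyperplane \<open>x i = 1\<close> form an ideal without zeros, so the function \<open>1\<close> is
  among them and some power of \<open>x i\<close> is in \<open>B\<close>. In large degree every monomial is divisible by one of these powers.\<close>

theorem graded_nullstellensatz:
  fixes B :: "nat \<Rightarrow> (('v \<Rightarrow> complex) \<Rightarrow> complex) set"
  assumes I: "finite I" and sub: "\<And>n. B n \<subseteq> hom_fun I n" and zero: "\<And>n. (\<lambda>x. 0) \<in> B n"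
    and add: "\<And>n \<phi> \<psi>. \<phi> \<in> B n \<Longrightarrow> \<psi> \<in> B n \<Longrightarrow> (\<lambda>x. \<phi> x + \<psi> x) \<in> B n"
    and mult: "\<And>m n \<phi> \<psi>. \<phi> \<in> hom_fun I m \<Longrightarrow> \<psi> \<in> B n \<Longrightarrow> (\<lambda>x. \<phi> x * \<psi> x) \<in> B (m + n)"
    and no_zero: "\<And>x i. (\<And>n \<phi>. \<phi> \<in> B n \<Longrightarrow> \<phi> x = 0) \<Longrightarrow> i \<in> I \<Longrightarrow> x i = 0"
  shows "\<exists>n. hom_fun I n \<subseteq> B n"
proof -
  have "\<exists>n. (\<lambda>x. x i ^ n) \<in> B n" if i: "i \<in> I" for i
  proof -
    define \<aa> where "\<aa> = {F \<in> polys_in I. \<exists>n. \<exists>\<psi>\<in>B n. \<forall>x. x i = 1 \<longrightarrow> peval x F = \<psi> x}"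
    have id: "poly_ideal I \<aa>"
      unfolding poly_ideal_def
    proof (intro conjI ballI)
      show "\<aa> \<subseteq> polys_in I" by (auto simp: \<aa>_def)
      show "0 \<in> \<aa>" unfolding \<aa>_def
        using zero[of 0] vecs_0 by (auto simp: polys_in_def intro!: exI[of _ 0] bexI[of _ "\<lambda>x. 0"])
    next
      fix f g assume "f \<in> \<aa>" "g \<in> \<aa>"
      then obtain M N \<phi> \<psi> where *: "\<phi> \<in> B M" "\<psi> \<in> B N" "f \<in> polys_in I" "g \<in> polys_in I"
        "\<forall>x. x i = 1 \<longrightarrow> peval x f = \<phi> x" "\<forall>x. x i = 1 \<longrightarrow> peval x g = \<psi> x"
        by (auto simp: \<aa>_def)
      have "(\<lambda>x. x i ^ N * \<phi> x) \<in> B (M + N)" "(\<lambda>x. x i ^ M * \<psi> x) \<in> B (M + N)"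
        using mult[OF hom_fun_power[OF hom_fun_coord[OF i], of N] *(1)] mult[OF hom_fun_power[OF hom_fun_coord[OF i], of M] *(2)]
        by (simp_all add: add.commute)
      from add[OF this] show "f + g \<in> \<aa>" unfolding \<aa>_def
        using * by (intro CollectI conjI polys_in_add exI[of _ "M + N"] bexI[of _ "\<lambda>x. x i ^ N * \<phi> x + x i ^ M * \<psi> x"]) auto
    next
      fix f g assume f: "f \<in> polys_in I" and "g \<in> \<aa>"
      then obtain N \<psi> where *: "\<psi> \<in> B N" "g \<in> polys_in I" "\<forall>x. x i = 1 \<longrightarrow> peval x g = \<psi> x"
        by (auto simp: \<aa>_def)
      obtain M \<phi> where \<phi>: "\<phi> \<in> hom_fun I M" "\<forall>x. x i = 1 \<longrightarrow> peval x f = \<phi> x"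
        using homogenize_at[OF f i] by blast
      from mult[OF \<phi>(1) *(1)] show "f * g \<in> \<aa>" unfolding \<aa>_def
        using * \<phi>(2) f by (intro CollectI conjI polys_in_mult exI[of _ "M + N"] bexI[of _ "\<lambda>x. \<phi> x * \<psi> x"]) auto
    qed
    have "1 \<in> \<aa>"
    proof (rule ccontr)
      assume "1 \<notin> \<aa>"
      from nullstellensatz[OF I id this] obtain x where x: "\<And>F. F \<in> \<aa> \<Longrightarrow> peval x F = 0" by blast
      have "cX i - cC 1 \<in> \<aa>" unfolding \<aa>_def
        using zero[of 0] i by (auto intro!: exI[of _ 0] bexI[of _ "\<lambda>x. 0"] polys_in_diff simp del: single_one)
      from x[OF this] have xi: "x i = 1" by simp
      have "\<phi> x = 0" if "\<phi> \<in> B n" for \<phi> n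
      proof -
        obtain F where F: "F \<in> vecs (mons I n)" "\<phi> = (\<lambda>x. peval x F)"
          using subsetD[OF sub \<open>\<phi> \<in> B n\<close>] by (auto simp: hom_fun_def)
        then have "F \<in> polys_in I" by (auto simp: polys_in_def vecs_def mons_def)
        then have "F \<in> \<aa>" using that F by (auto simp: \<aa>_def)
        from x[OF this] show ?thesis by (simp add: F)
      qed
      then have "x i = 0" using no_zero i by blast
      with xi show False by simp
    qed
    then obtain n \<psi> where \<psi>: "\<psi> \<in> B n" "\<And>x. x i = 1 \<Longrightarrow> \<psi> x = 1" by (auto simp: \<aa>_def)
    have hom_fun: "\<psi> \<in> hom_fun I n" using \<psi> sub by auto
    have nz: "\<psi> x = x i ^ n" if "x i \<noteq> 0" for x
    proof -
      have "\<psi> x = \<psi> (\<lambda>k. x i * (x k / x i))" using that by simp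
      also have "\<dots> = x i ^ n * \<psi> (\<lambda>k. x k / x i)" by (rule hom_fun_scale[OF hom_fun])
      finally show ?thesis using that \<psi>(2)[of "\<lambda>k. x k / x i"] by simp
    qed
    have "\<psi> x = x i ^ n" for x
    proof -
      have "polyfn (\<lambda>t. \<psi> (x(i := t)) - t ^ n)"
        by (intro polyfn_diff polyfn_hom_fun[OF hom_fun] polyfn_power) (auto simp: fun_upd_def intro!: polyfn_if)
      then have "\<psi> (x(i := x i)) - x i ^ n = 0"
        by (rule polyfn_zero_ext) (use nz[of "x(i := t)" for t] in simp)
      then show ?thesis by simp
    qed
    then have "\<psi> = (\<lambda>x. x i ^ n)" by blast
    with \<psi> show ?thesis by blast
  qed
  then obtain \<nu> where \<nu>: "\<And>i. i \<in> I \<Longrightarrow> (\<lambda>x. x i ^ \<nu> i) \<in> B (\<nu> i)" by metis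
  define N where "N = Suc (\<Sum>i\<in>I. \<nu> i)"
  have mono: "(\<lambda>x. mono_val x m) \<in> B N" if m: "m \<in> mons I N" for m
  proof -
    have km: "keys m \<subseteq> I" "mdeg m = N" using m by (auto simp: mons_def)
    have "\<exists>i\<in>I. \<nu> i \<le> lookup m i"
    proof (rule ccontr)
      assume "\<not> ?thesis"
      then have "(\<Sum>i\<in>I. lookup m i) \<le> (\<Sum>i\<in>I. \<nu> i)" by (intro sum_mono) (auto simp: not_le)
      then show False using km mdeg_superset[OF I km(1)] by (simp add: N_def)
    qed
    then obtain i where i: "i \<in> I" "\<nu> i \<le> lookup m i" by blast
    define m' where "m' = m - Poly_Mapping.single i (\<nu> i)"
    have mm: "m = m' + Poly_Mapping.single i (\<nu> i)"
      using i by (intro poly_mapping_eqI) (auto simp: m'_def lookup_add lookup_minus lookup_single when_def)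
    have "keys m' \<subseteq> I" using km mm keys_add_nat by (metis le_sup_iff)
    then have "m' \<in> mons I (mdeg m')" by (simp add: mons_def)
    from mult[OF hom_fun_mono_val[OF this] \<nu>[OF i(1)]]
    have "(\<lambda>x. mono_val x m' * x i ^ \<nu> i) \<in> B (mdeg m' + \<nu> i)" .
    moreover have "mdeg m' + \<nu> i = N" using km(2) mm by (metis mdeg_add mdeg_single)
    moreover have "mono_val x m = mono_val x m' * x i ^ \<nu> i" for x
      by (subst mm) (simp add: mono_val_add)
    ultimately show ?thesis by simp
  qed
  have sumB: "(\<lambda>x. \<Sum>m\<in>K. c m * mono_val x m) \<in> B N" if "finite K" "K \<subseteq> mons I N" for c K
    using that
  proof (induction K)
    case (insert m K)
    have "(\<lambda>x. c m * mono_val x m) \<in> B (0 + N)"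
      using insert by (intro mult hom_fun_const mono) auto
    then show ?case using insert add[of "\<lambda>x. c m * mono_val x m" N] by simp
  qed (simp add: zero)
  have "hom_fun I N \<subseteq> B N"
  proof
    fix \<phi> assume "\<phi> \<in> hom_fun I N"
    then obtain c where "\<And>x. \<phi> x = (\<Sum>m\<in>mons I N. c m * mono_val x m)" using hom_fun_basis[OF I] by blast
    then have "\<phi> = (\<lambda>x. \<Sum>m\<in>mons I N. c m * mono_val x m)" by blast
    with sumB[of "mons I N" c] show "\<phi> \<in> B N" by (simp add: finite_mons I)
  qed
  then show ?thesis by blast
qed

section \<open>The fibre of the closure of a graph\<close>

lemma left_inverse_exists:
  fixes c :: "'j \<Rightarrow> 'i \<Rightarrow> 'k::field"
  assumes "finite I" "finite J"
    and "\<And>w i. (\<And>j. j \<in> J \<Longrightarrow> (\<Sum>i\<in>I. c j i * w i) = 0) \<Longrightarrow> i \<in> I \<Longrightarrow> w i = 0"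
  shows "\<exists>\<beta>. \<forall>i\<in>I. \<forall>k\<in>I. (\<Sum>j\<in>J. \<beta> i j * c j k) = (if i = k then 1 else 0)"
  using assms(1,3)
proof (induction I)
  case (insert k I)
  have "w i = 0" if "\<And>j. j \<in> J \<Longrightarrow> (\<Sum>i\<in>I. c j i * w i) = 0" "i \<in> I" for w i
  proof -
    have "(\<Sum>i\<in>insert k I. c j i * (w(k := 0)) i) = (\<Sum>i\<in>I. c j i * w i)" for j
      using insert.hyps by (simp, intro sum.cong) auto
    then have "(w(k := 0)) i = 0"
      using that by (intro insert.prems[of "w(k := 0)" i]) simp_all
    moreover have "i \<noteq> k" using that insert.hyps by auto
    ultimately show ?thesis by simp
  qed
  then obtain \<beta> where \<beta>: "\<And>i l. i \<in> I \<Longrightarrow> l \<in> I \<Longrightarrow> (\<Sum>j\<in>J. \<beta> i j * c j l) = (if i = l then 1 else 0)"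
    using insert.IH by metis
  define \<kappa> where "\<kappa> i = (\<Sum>j\<in>J. \<beta> i j * c j k)" for i
  define \<rho> where "\<rho> j = c j k - (\<Sum>i\<in>I. c j i * \<kappa> i)" for j
  have "\<exists>j\<in>J. \<rho> j \<noteq> 0"
  proof (rule ccontr)
    assume *: "\<not> ?thesis"
    define w where "w i = (if i = k then 1 else - \<kappa> i)" for i
    have "(\<Sum>i\<in>insert k I. c j i * w i) = \<rho> j" for j
    proof -
      have "(\<Sum>i\<in>I. c j i * w i) = - (\<Sum>i\<in>I. c j i * \<kappa> i)"
        unfolding sum_negf[symmetric] using insert.hyps by (intro sum.cong) (auto simp: w_def)
      then show ?thesis using insert.hyps by (simp add: \<rho>_def w_def)
    qed
    then have "w k = 0" using * insert.prems[of w k] by auto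
    then show False by (simp add: w_def)
  qed
  then obtain j1 where j1: "j1 \<in> J" "\<rho> j1 \<noteq> 0" by blast
  define \<theta> where "\<theta> j = ((if j = j1 then 1 else 0) - (\<Sum>i\<in>I. c j1 i * \<beta> i j)) / \<rho> j1" for j
  have \<theta>: "(\<Sum>j\<in>J. \<theta> j * c j l) = (c j1 l - (\<Sum>i\<in>I. c j1 i * (\<Sum>j\<in>J. \<beta> i j * c j l))) / \<rho> j1" for l
  proof -
    have "(\<Sum>j\<in>J. \<theta> j * c j l) = (\<Sum>j\<in>J. (if j = j1 then c j l else 0) - (\<Sum>i\<in>I. c j1 i * (\<beta> i j * c j l))) / \<rho> j1"
      unfolding sum_divide_distrib
      by (rule sum.cong) (auto simp: \<theta>_def algebra_simps sum_distrib_left sum_distrib_right divide_simps)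
    also have "\<dots> = (c j1 l - (\<Sum>j\<in>J. \<Sum>i\<in>I. c j1 i * (\<beta> i j * c j l))) / \<rho> j1"
      using j1 assms(2) by (simp add: sum_subtractf sum.delta)
    also have "(\<Sum>j\<in>J. \<Sum>i\<in>I. c j1 i * (\<beta> i j * c j l)) = (\<Sum>i\<in>I. c j1 i * (\<Sum>j\<in>J. \<beta> i j * c j l))"
      by (subst sum.swap) (simp add: sum_distrib_left)
    finally show ?thesis .
  qed
  have \<theta>k: "(\<Sum>j\<in>J. \<theta> j * c j k) = 1"
    unfolding \<theta> using j1 by (simp add: \<rho>_def \<kappa>_def)
  have \<theta>I: "(\<Sum>j\<in>J. \<theta> j * c j l) = 0" if "l \<in> I" for l
  proof -
    have "(\<Sum>i\<in>I. c j1 i * (\<Sum>j\<in>J. \<beta> i j * c j l)) = (\<Sum>i\<in>I. if i = l then c j1 i else 0)"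
      using that \<beta> by (intro sum.cong) auto
    then show ?thesis unfolding \<theta> using that insert.hyps by (simp add: sum.delta)
  qed
  define \<Lambda> where "\<Lambda> i j = (if i = k then \<theta> j else \<beta> i j - \<kappa> i * \<theta> j)" for i j
  have L: "(\<Sum>j\<in>J. \<Lambda> i j * c j l) = (if i = k then (\<Sum>j\<in>J. \<theta> j * c j l)
      else (\<Sum>j\<in>J. \<beta> i j * c j l) - \<kappa> i * (\<Sum>j\<in>J. \<theta> j * c j l))" for i l
    by (auto simp: \<Lambda>_def algebra_simps sum_subtractf sum_distrib_left)
  have "\<forall>i\<in>insert k I. \<forall>l\<in>insert k I. (\<Sum>j\<in>J. \<Lambda> i j * c j l) = (if i = l then 1 else 0)"
    unfolding L using insert.hyps by (auto simp: \<theta>k \<theta>I \<beta> \<kappa>_def)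
  then show ?case by blast
qed simp

lemma polyfn_has_deriv:
  assumes "polyfn f"
  shows "\<exists>d. (f has_field_derivative d) (at t)"
proof -
  obtain P where "\<And>t. f t = poly P t" using assms by (auto simp: polyfn_def)
  then have "f = poly P" by blast
  then show ?thesis using poly_DERIV[of P t] by blast
qed

text \<open>The homogeneous map \<open>x \<mapsto> (\<eta> j x)\<close> between the coordinate spaces, with a point \<open>p\<close> at which it does not vanish.\<close>

locale poly_map =
  fixes I :: "'a set" and J :: "'b set" and e :: nat
    and \<eta> :: "'b \<Rightarrow> ('a \<Rightarrow> complex) \<Rightarrow> complex"
    and p :: "'a \<Rightarrow> complex" and j0 :: 'b
  assumes finI: "finite I" and finJ: "finite J" and e1: "e \<ge> 1"
    and \<eta>_hom_fun: "\<And>j. j \<in> J \<Longrightarrow> \<eta> j \<in> hom_fun I e"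
    and j0: "j0 \<in> J" "\<eta> j0 p \<noteq> 0"
begin

abbreviation y0 :: "'b \<Rightarrow> complex" where "y0 \<equiv> \<lambda>j. \<eta> j p"

definition graph_eqs :: "nat \<Rightarrow> nat \<Rightarrow> (('a \<Rightarrow> complex) \<Rightarrow> ('b \<Rightarrow> complex) \<Rightarrow> complex) set" where
  "graph_eqs n k = {\<Phi> \<in> bihom_fun I J n k. \<forall>x. \<Phi> x (\<lambda>j. \<eta> j x) = 0}"

text \<open>The equations of the graph, specialised at \<open>y0\<close>. Their degree \<open>k\<close> in \<open>y\<close> is left open: it can be raised with the
  function \<open>\<psi>\<close> below, which is \<open>1\<close> at \<open>y0\<close>, and so the specialised equations of a given degree are closed under
  addition.\<close>

definition fib_ideal :: "nat \<Rightarrow> (('a \<Rightarrow> complex) \<Rightarrow> complex) set" where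
  "fib_ideal n = {\<phi>. \<exists>k. \<exists>\<Phi>\<in>graph_eqs n k. \<phi> = (\<lambda>x. \<Phi> x y0)}"

text \<open>The cone over the fibre at \<open>[y0]\<close> of the closure of the graph.\<close>

definition fib :: "('a \<Rightarrow> complex) set" where
  "fib = {x. \<forall>n. \<forall>\<phi>\<in>fib_ideal n. \<phi> x = 0}"

abbreviation \<psi> :: "('b \<Rightarrow> complex) \<Rightarrow> complex" where "\<psi> y \<equiv> 1 / y0 j0 * y j0"

lemma \<psi>_hom_fun: "(\<lambda>y. \<psi> y ^ k) \<in> hom_fun J k"
  using hom_fun_power[OF hom_fun_cmult[OF hom_fun_coord[OF j0(1)]], of "1 / y0 j0" k] by simp

lemma \<psi>_y0: "\<psi> y0 = 1"
  using j0 by simp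

lemma graph_eqs_raise:
  assumes "\<Phi> \<in> graph_eqs n k"
  shows "(\<lambda>x y. \<Phi> x y * \<psi> y ^ l) \<in> graph_eqs n (k + l)"
proof -
  have "(\<lambda>x y. 1 * \<psi> y ^ l) \<in> bihom_fun I J 0 l"
    by (rule bihom_fun_hom_fun[OF finI hom_fun_const \<psi>_hom_fun])
  then have "(\<lambda>x y. \<Phi> x y * (1 * \<psi> y ^ l)) \<in> bihom_fun I J (n + 0) (k + l)"
    using assms finI by (intro bihom_fun_mult) (auto simp: graph_eqs_def)
  then show ?thesis using assms by (simp add: graph_eqs_def)
qed

lemma fib_idealI: "\<Phi> \<in> graph_eqs n k \<Longrightarrow> (\<And>x. \<phi> x = \<Phi> x y0) \<Longrightarrow> \<phi> \<in> fib_ideal n"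
  unfolding fib_ideal_def by blast

lemma fib_idealE:
  assumes "\<phi> \<in> fib_ideal n"
  obtains k \<Phi> where "\<Phi> \<in> graph_eqs n k" "\<And>x. \<phi> x = \<Phi> x y0"
  using assms unfolding fib_ideal_def by blast

lemma graph_eqsI: "\<Phi> \<in> bihom_fun I J n k \<Longrightarrow> (\<And>x. \<Phi> x (\<lambda>j. \<eta> j x) = 0) \<Longrightarrow> \<Phi> \<in> graph_eqs n k"
  by (simp add: graph_eqs_def)

lemma graph_eqsD:
  assumes "\<Phi> \<in> graph_eqs n k"
  shows "\<Phi> \<in> bihom_fun I J n k" "\<Phi> x (\<lambda>j. \<eta> j x) = 0"
  using assms by (simp_all add: graph_eqs_def)

lemma fib_ideal_hom_fun:
  assumes "\<phi> \<in> fib_ideal n" shows "\<phi> \<in> hom_fun I n"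
proof -
  obtain k \<Phi> where *: "\<Phi> \<in> graph_eqs n k" "\<And>x. \<phi> x = \<Phi> x y0"
    using assms by (rule fib_idealE) blast
  have "\<phi> = (\<lambda>x. \<Phi> x y0)" using *(2) by blast
  then show ?thesis using bihom_fun_right[OF finI graph_eqsD(1)[OF *(1)]] by simp
qed

lemma fib_ideal_0: "(\<lambda>x. 0) \<in> fib_ideal n"
  by (rule fib_idealI[OF graph_eqsI[OF bihom_fun_0]]) auto

lemma fib_ideal_add:
  assumes "\<phi> \<in> fib_ideal n" "\<phi>' \<in> fib_ideal n"
  shows "(\<lambda>x. \<phi> x + \<phi>' x) \<in> fib_ideal n"
proof -
  obtain k \<Phi> where 1: "\<Phi> \<in> graph_eqs n k" "\<And>x. \<phi> x = \<Phi> x y0"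
    using assms(1) by (rule fib_idealE) blast
  obtain k' \<Phi>' where 2: "\<Phi>' \<in> graph_eqs n k'" "\<And>x. \<phi>' x = \<Phi>' x y0"
    using assms(2) by (rule fib_idealE) blast
  have "(\<lambda>x y. \<Phi> x y * \<psi> y ^ k') \<in> graph_eqs n (k + k')" "(\<lambda>x y. \<Phi>' x y * \<psi> y ^ k) \<in> graph_eqs n (k + k')"
    using graph_eqs_raise[OF 1(1), of k'] graph_eqs_raise[OF 2(1), of k] by (simp_all only: add.commute)
  note * = this[THEN graph_eqsD(1)] this[THEN graph_eqsD(2)]
  have "(\<lambda>x y. \<Phi> x y * \<psi> y ^ k' + \<Phi>' x y * \<psi> y ^ k) \<in> graph_eqs n (k + k')"
    by (rule graph_eqsI[OF bihom_fun_add[OF *(1,2)]]) (simp only: *(3,4) add_0)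
  then show ?thesis
    by (rule fib_idealI) (simp only: 1(2) 2(2) \<psi>_y0 power_one mult_1_right)
qed

lemma fib_ideal_mult:
  assumes "\<phi> \<in> hom_fun I m" "\<phi>' \<in> fib_ideal n"
  shows "(\<lambda>x. \<phi> x * \<phi>' x) \<in> fib_ideal (m + n)"
proof -
  obtain k' \<Phi>' where *: "\<Phi>' \<in> graph_eqs n k'" "\<And>x. \<phi>' x = \<Phi>' x y0"
    using assms(2) by (rule fib_idealE) blast
  have "(\<lambda>x y. \<phi> x * 1) \<in> bihom_fun I J m 0" by (rule bihom_fun_hom_fun[OF finI assms(1) hom_fun_const])
  from bihom_fun_mult[OF finI this graph_eqsD(1)[OF *(1)]]
  have "(\<lambda>x y. \<phi> x * \<Phi>' x y) \<in> bihom_fun I J (m + n) k'" by simp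
  from fib_idealI[OF graph_eqsI[OF this]] show ?thesis
    using * graph_eqsD(2)[OF *(1)] by simp
qed

lemma fib_ideal_sum:
  "(\<And>a. a \<in> A \<Longrightarrow> \<phi> a \<in> fib_ideal n) \<Longrightarrow> (\<lambda>x. \<Sum>a\<in>A. \<phi> a x) \<in> fib_ideal n"
  by (induction A rule: infinite_finite_induct) (auto intro: fib_ideal_add fib_ideal_0)

text \<open>On the graph \<open>y\<close> equals \<open>(\<eta> j x)\<close>, so the two by two minors of the matrix with rows \<open>y\<close> and \<open>(\<eta> j x)\<close> vanish. Specialised
  at \<open>y0\<close> and combined with the coefficients \<open>\<mu>\<close> they give the function in question.\<close>

lemma fib_ideal_linear:
  assumes "(\<Sum>j\<in>J. \<mu> j * y0 j) = 0"
  shows "(\<lambda>x. \<Sum>j\<in>J. \<mu> j * \<eta> j x) \<in> fib_ideal e"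
proof -
  have 1: "(\<lambda>y. \<Sum>j\<in>J. \<mu> j * y j) \<in> hom_fun J 1"
    using hom_fun_coord by (intro hom_fun_sum hom_fun_cmult) auto
  have 2: "(\<lambda>x. \<Sum>j\<in>J. \<mu> j * \<eta> j x) \<in> hom_fun I e"
    by (intro hom_fun_sum hom_fun_cmult \<eta>_hom_fun)
  have "(\<lambda>x y. (\<Sum>j\<in>J. \<mu> j * \<eta> j x) * \<psi> y ^ 1 + (- 1 / y0 j0 * \<eta> j0 x) * (\<Sum>j\<in>J. \<mu> j * y j)) \<in> bihom_fun I J e 1"
    by (intro bihom_fun_add bihom_fun_hom_fun finI 1 2 \<psi>_hom_fun hom_fun_cmult \<eta>_hom_fun j0)
  from fib_idealI[OF graph_eqsI[OF this]] show ?thesis using assms j0 by simp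
qed

lemma fibD: "x \<in> fib \<Longrightarrow> \<phi> \<in> fib_ideal n \<Longrightarrow> \<phi> x = 0"
  by (simp add: fib_def)

lemma fib_proportional:
  assumes "x \<in> fib" "j \<in> J"
  shows "y0 j0 * \<eta> j x = y0 j * \<eta> j0 x"
proof -
  define \<mu> where "\<mu> k = (if k = j then y0 j0 else 0) - (if k = j0 then y0 j else 0)" for k
  have *: "(\<Sum>k\<in>J. \<mu> k * f k) = y0 j0 * f j - y0 j * f j0" for f
    using assms(2) j0(1) finJ
    by (simp add: \<mu>_def left_diff_distrib sum_subtractf if_distrib[of "\<lambda>a. a * _"] sum.delta cong: if_cong)
  have "(\<lambda>x. \<Sum>k\<in>J. \<mu> k * \<eta> k x) \<in> fib_ideal e"
    by (rule fib_ideal_linear[of \<mu>]) (subst *, simp)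
  from fibD[OF assms(1) this] have "(\<Sum>k\<in>J. \<mu> k * \<eta> k x) = 0" .
  then show ?thesis by (subst (asm) *) simp
qed

lemma fib_scale: "x \<in> fib \<Longrightarrow> (\<lambda>i. c * x i) \<in> fib"
  unfolding fib_def by (auto simp: hom_fun_scale[OF fib_ideal_hom_fun])

lemma fib_cong:
  assumes "x \<in> fib" "\<And>i. i \<in> I \<Longrightarrow> x i = x' i"
  shows "x' \<in> fib"
  unfolding fib_def
proof (intro CollectI allI ballI)
  fix n \<phi> assume \<phi>: "\<phi> \<in> fib_ideal n"
  have "\<phi> x' = \<phi> x" by (rule hom_fun_cong[OF fib_ideal_hom_fun[OF \<phi>]]) (simp add: assms(2))
  then show "\<phi> x' = 0" using fibD[OF assms(1) \<phi>] by simp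
qed

lemma fib_limit:
  assumes "\<And>i. polyfn (\<lambda>t. x t i)" "\<And>t. t \<noteq> 0 \<Longrightarrow> x t \<in> fib"
  shows "x 0 \<in> fib"
  unfolding fib_def
proof (intro CollectI allI ballI)
  fix n \<phi> assume \<phi>: "\<phi> \<in> fib_ideal n"
  show "\<phi> (x 0) = 0"
    by (rule polyfn_zero_ext[OF polyfn_hom_fun[OF fib_ideal_hom_fun[OF \<phi>] assms(1)]])
       (use assms(2) \<phi> in \<open>auto simp: fib_def\<close>)
qed

text \<open>If a linear substitution in \<open>x\<close> corresponds under the map to a linear substitution in \<open>y\<close>, then the two together
  turn equations of the graph into equations of the graph.\<close>

lemma fib_invariant:
  assumes \<theta>: "\<And>i. i \<in> I \<Longrightarrow> \<theta> i \<in> hom_fun I 1" and \<tau>: "\<And>j. j \<in> J \<Longrightarrow> \<tau> j \<in> hom_fun J 1"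
    and equiv: "\<And>x j. j \<in> J \<Longrightarrow> \<eta> j (\<lambda>i. \<theta> i x) = c * \<tau> j (\<lambda>j. \<eta> j x)" and c: "c \<noteq> 0"
    and y0: "\<And>j. j \<in> J \<Longrightarrow> \<tau> j y0 = c' * y0 j" and c': "c' \<noteq> 0"
    and x: "x \<in> fib"
  shows "(\<lambda>i. \<theta> i x) \<in> fib"
  unfolding fib_def
proof (intro CollectI allI ballI)
  fix n \<phi> assume "\<phi> \<in> fib_ideal n"
  then obtain k \<Phi> where *: "\<Phi> \<in> graph_eqs n k" "\<And>x. \<phi> x = \<Phi> x y0"
    by (rule fib_idealE) blast
  note \<Phi> = graph_eqsD[OF *(1)] *(2)
  have sc: "\<Phi> x (\<lambda>j. a * y j) = a ^ k * \<Phi> x y" for a x y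
    using bihom_fun_scale[OF finI \<Phi>(1), of 1 x a y] by simp
  let ?\<Psi> = "\<lambda>x y. \<Phi> (\<lambda>i. \<theta> i x) (\<lambda>j. \<tau> j y)"
  have "?\<Psi> \<in> bihom_fun I J n k" by (rule bihom_fun_compose[OF finI finJ finI \<Phi>(1) \<theta> \<tau>])
  moreover have "?\<Psi> x (\<lambda>j. \<eta> j x) = 0" for x
  proof -
    have "c ^ k * ?\<Psi> x (\<lambda>j. \<eta> j x) = \<Phi> (\<lambda>i. \<theta> i x) (\<lambda>j. c * \<tau> j (\<lambda>j. \<eta> j x))" by (simp add: sc)
    also have "\<dots> = \<Phi> (\<lambda>i. \<theta> i x) (\<lambda>j. \<eta> j (\<lambda>i. \<theta> i x))"
      by (rule bihom_fun_cong[OF finI \<Phi>(1)]) (auto simp: equiv)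
    finally show ?thesis using c by (simp add: \<Phi>)
  qed
  ultimately have "?\<Psi> \<in> graph_eqs n k" by (rule graph_eqsI)
  then have "(\<lambda>x. ?\<Psi> x y0) \<in> fib_ideal n" by (rule fib_idealI) simp
  from fibD[OF x this] have "?\<Psi> x y0 = 0" .
  also have "?\<Psi> x y0 = \<Phi> (\<lambda>i. \<theta> i x) (\<lambda>j. c' * y0 j)"
    by (rule bihom_fun_cong[OF finI \<Phi>(1)]) (auto simp: y0)
  also have "\<dots> = c' ^ k * \<Phi> (\<lambda>i. \<theta> i x) y0" by (simp add: sc)
  finally show "\<phi> (\<lambda>i. \<theta> i x) = 0" using c' by (simp add: \<Phi>)
qed

end

section \<open>Points where the map is unramified\<close>

text \<open>The derivative is taken between the affine spaces. By Euler's formula it sends \<open>p\<close> to a multiple of \<open>y0\<close>, so its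
  injectivity is that of the differential of the map of projective spaces.\<close>

locale unramified_point = poly_map I J e \<eta> p j0
  for I :: "'a set" and J :: "'b set" and e \<eta> p j0 +
  fixes c :: "'b \<Rightarrow> 'a \<Rightarrow> complex" and i0 :: 'a
  assumes deriv: "\<And>j w. j \<in> J \<Longrightarrow>
      ((\<lambda>t. \<eta> j (\<lambda>i. p i + t * w i)) has_field_derivative (\<Sum>i\<in>I. c j i * w i)) (at 0)"
    and inj: "\<And>w i. (\<And>j. j \<in> J \<Longrightarrow> (\<Sum>i\<in>I. c j i * w i) = 0) \<Longrightarrow> i \<in> I \<Longrightarrow> w i = 0"
    and i0: "i0 \<in> I" "p i0 \<noteq> 0"
begin

abbreviation \<psi>0 :: "('a \<Rightarrow> complex) \<Rightarrow> complex" where "\<psi>0 x \<equiv> 1 / p i0 * x i0"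

text \<open>These linear forms span the space of all linear forms that vanish at \<open>p\<close>.\<close>

abbreviation z :: "'a \<Rightarrow> ('a \<Rightarrow> complex) \<Rightarrow> complex" where "z k x \<equiv> x k - p k * \<psi>0 x"

lemma \<psi>0_hom_fun: "\<psi>0 \<in> hom_fun I 1"
  by (intro hom_fun_cmult hom_fun_coord i0)

lemma \<psi>0_power_hom_fun: "(\<lambda>x. \<psi>0 x ^ n) \<in> hom_fun I n"
  using hom_fun_power[OF \<psi>0_hom_fun, of n] by simp

lemma z_hom_fun: "k \<in> I \<Longrightarrow> z k \<in> hom_fun I 1"
  by (intro hom_fun_diff hom_fun_cmult hom_fun_coord i0)

text \<open>Modulo the linear forms \<open>z k\<close> every variable \<open>x k\<close> can be replaced by \<open>p k * \<psi>0 x\<close>.\<close>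

lemma mono_division:
  assumes "keys m \<subseteq> I" "i \<in> I"
  shows "\<exists>M. (\<forall>k\<in>I. M k \<in> hom_fun I (mdeg m)) \<and>
    (\<forall>x. mono_val x m * x i = mono_val p m * p i * \<psi>0 x ^ Suc (mdeg m) + (\<Sum>k\<in>I. M k x * z k x))"
  using assms
proof (induction m arbitrary: i rule: monomial_induct)
  case zero
  define M :: "'a \<Rightarrow> ('a \<Rightarrow> complex) \<Rightarrow> complex" where "M k x = (if k = i then 1 else 0)" for k x
  have "M k \<in> hom_fun I 0" for k unfolding M_def[abs_def] by (rule hom_fun_const)
  moreover have "(\<Sum>k\<in>I. M k x * z k x) = z i x" for x
  proof -
    have "(\<Sum>k\<in>I. M k x * z k x) = (\<Sum>k\<in>I. if k = i then z k x else 0)"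
      by (rule sum.cong) (auto simp: M_def)
    then show ?thesis using zero finI by (simp add: sum.delta)
  qed
  ultimately show ?case by (intro exI[of _ M]) (simp add: algebra_simps)
next
  case (add m j)
  then have m: "keys m \<subseteq> I" "j \<in> I" by (auto simp: keys_add_nat)
  then obtain M where M: "\<And>k. k \<in> I \<Longrightarrow> M k \<in> hom_fun I (mdeg m)"
    "\<And>x. mono_val x m * x j = mono_val p m * p j * \<psi>0 x ^ Suc (mdeg m) + (\<Sum>k\<in>I. M k x * z k x)"
    using add.IH[OF m] by blast
  define M' where "M' k x = M k x * x i + (if k = i then mono_val p m * p j else 0) * \<psi>0 x ^ Suc (mdeg m)" for k x
  have M'1: "M' k \<in> hom_fun I (Suc (mdeg m))" if "k \<in> I" for k
    unfolding M'_def[abs_def]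
    using hom_fun_mult[OF M(1)[OF that] hom_fun_coord[OF add.prems(2)]]
    by (intro hom_fun_add hom_fun_cmult \<psi>0_power_hom_fun) simp
  have M'2: "mono_val x (m + Poly_Mapping.single j 1) * x i =
      mono_val p (m + Poly_Mapping.single j 1) * p i * \<psi>0 x ^ Suc (Suc (mdeg m)) + (\<Sum>k\<in>I. M' k x * z k x)" for x
  proof -
    define C R ps zi where "C = mono_val p m * p j * \<psi>0 x ^ Suc (mdeg m)"
      and "R = (\<Sum>k\<in>I. M k x * z k x)" and "ps = \<psi>0 x" and "zi = z i x"
    have "(\<Sum>k\<in>I. M' k x * z k x) = (\<Sum>k\<in>I. M k x * z k x * x i + (if k = i then C * z k x else 0))"
    proof (rule sum.cong, rule refl)
      fix k
      show "M' k x * z k x = M k x * z k x * x i + (if k = i then C * z k x else 0)"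
      proof (cases "k = i")
        case True
        have aux: "(a * b + c) * d = a * d * b + c * d" for a b c d :: complex by (simp add: algebra_simps)
        show ?thesis unfolding M'_def C_def True by (simp only: refl if_True) (rule aux)
      next
        case False
        then show ?thesis by (simp add: M'_def mult_ac)
      qed
    qed
    also have "\<dots> = R * x i + C * zi"
      using add.prems finI by (simp only: sum.distrib sum.delta R_def sum_distrib_right zi_def if_True)
    finally have 1: "(\<Sum>k\<in>I. M' k x * z k x) = R * x i + C * zi" .
    have xi: "x i = p i * ps + zi" by (simp add: ps_def zi_def)
    have "mono_val x (m + Poly_Mapping.single j 1) * x i = (mono_val x m * x j) * x i"
      by (simp add: mono_val_add)
    also have "mono_val x m * x j = C + R" using M(2)[of x] by (simp only: C_def R_def)
    also have "(C + R) * x i = C * x i + R * x i" by (rule distrib_right)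
    also have "C * x i = C * (p i * ps + zi)" using xi by (simp only:)
    finally show ?thesis unfolding 1 unfolding C_def ps_def[symmetric]
      by (simp only: mono_val_add mono_val_single power_one_right) (simp add: algebra_simps)
  qed
  have md: "mdeg (m + Poly_Mapping.single j 1) = Suc (mdeg m)" by simp
  show ?case unfolding md by (intro exI[of _ M'] conjI ballI allI M'1 M'2)
qed

lemma hom_fun_division:
  assumes "\<phi> \<in> hom_fun I (Suc n)"
  shows "\<exists>M. (\<forall>k\<in>I. M k \<in> hom_fun I n) \<and> (\<forall>x. \<phi> x = \<phi> p * \<psi>0 x ^ Suc n + (\<Sum>k\<in>I. M k x * z k x))"
proof -
  obtain a where a: "\<And>x. \<phi> x = (\<Sum>m\<in>mons I (Suc n). a m * mono_val x m)"
    using hom_fun_basis[OF finI assms] by blast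
  have "\<forall>m\<in>mons I (Suc n). \<exists>M. (\<forall>k\<in>I. M k \<in> hom_fun I n) \<and>
    (\<forall>x. mono_val x m = mono_val p m * \<psi>0 x ^ Suc n + (\<Sum>k\<in>I. M k x * z k x))"
  proof
    fix m assume m: "m \<in> mons I (Suc n)"
    have "keys m \<noteq> {}" using m by (auto simp: mons_def mdeg_def)
    then obtain i where i: "i \<in> keys m" by blast
    define m' where "m' = m - Poly_Mapping.single i 1"
    have mm: "m = m' + Poly_Mapping.single i 1"
      unfolding m'_def by (rule monomial_split[OF i])
    have m': "keys m' \<subseteq> I" "i \<in> I" "mdeg m' = n"
      using m unfolding mm by (auto simp: mons_def keys_add_nat)
    from mono_division[OF m'(1,2)] show "\<exists>M. (\<forall>k\<in>I. M k \<in> hom_fun I n) \<and>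
    (\<forall>x. mono_val x m = mono_val p m * \<psi>0 x ^ Suc n + (\<Sum>k\<in>I. M k x * z k x))" unfolding m'(3)
      by (simp add: mm mono_val_add)
  qed
  from bchoice[OF this] obtain M where M0: "\<forall>m\<in>mons I (Suc n). (\<forall>k\<in>I. M m k \<in> hom_fun I n) \<and>
    (\<forall>x. mono_val x m = mono_val p m * \<psi>0 x ^ Suc n + (\<Sum>k\<in>I. M m k x * z k x))" ..
  then have M: "\<And>m k. m \<in> mons I (Suc n) \<Longrightarrow> k \<in> I \<Longrightarrow> M m k \<in> hom_fun I n"
    "\<And>m x. m \<in> mons I (Suc n) \<Longrightarrow> mono_val x m = mono_val p m * \<psi>0 x ^ Suc n + (\<Sum>k\<in>I. M m k x * z k x)"
    by blast+
  define M' where "M' k x = (\<Sum>m\<in>mons I (Suc n). a m * M m k x)" for k x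
  have "M' k \<in> hom_fun I n" if "k \<in> I" for k
    unfolding M'_def[abs_def] using that by (intro hom_fun_sum hom_fun_cmult M)
  moreover have "\<phi> x = \<phi> p * \<psi>0 x ^ Suc n + (\<Sum>k\<in>I. M' k x * z k x)" for x
  proof -
    have "\<phi> x = (\<Sum>m\<in>mons I (Suc n). a m * (mono_val p m * \<psi>0 x ^ Suc n + (\<Sum>k\<in>I. M m k x * z k x)))"
      unfolding a[of x] by (rule sum.cong) (simp_all only: M(2)[of _ x])
    also have "\<dots> = \<phi> p * \<psi>0 x ^ Suc n + (\<Sum>m\<in>mons I (Suc n). \<Sum>k\<in>I. a m * M m k x * z k x)"
      by (simp only: distrib_left sum.distrib a[of p] sum_distrib_right sum_distrib_left mult.assoc)
    also have "(\<Sum>m\<in>mons I (Suc n). \<Sum>k\<in>I. a m * M m k x * z k x) = (\<Sum>k\<in>I. M' k x * z k x)"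
      by (subst sum.swap) (simp only: M'_def sum_distrib_right)
    finally show ?thesis .
  qed
  ultimately show ?thesis by (intro exI[of _ M']) blast
qed

text \<open>Linear combinations \<open>K i\<close> of the \<open>\<eta> j\<close> whose coefficients annihilate \<open>y0\<close> lie in the ideal of the fibre. They vanish
  at \<open>p\<close>, so \<open>K i\<close> is a combination of the \<open>z k\<close> with coefficients \<open>M i k\<close>. As the derivative is injective, the
  combinations can be chosen such that \<open>M\<close> is the identity matrix at \<open>p\<close>; by Cramer's rule the determinant of \<open>M\<close>
  times any \<open>z k\<close> is in the ideal. Thus \<open>g\<close> is this determinant.\<close>

lemma exists_isolating_function:
  "\<exists>n. \<exists>g\<in>hom_fun I n. g p \<noteq> 0 \<and> (\<forall>k\<in>I. (\<lambda>x. g x * z k x) \<in> fib_ideal (Suc n))"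
proof -
  have "\<exists>\<beta>. \<forall>i\<in>I. \<forall>k\<in>I. (\<Sum>j\<in>J. \<beta> i j * c j k) = (if i = k then 1 else 0)"
    by (rule left_inverse_exists[OF finI finJ]) (rule inj)
  then obtain \<beta> where \<beta>: "\<And>i k. i \<in> I \<Longrightarrow> k \<in> I \<Longrightarrow> (\<Sum>j\<in>J. \<beta> i j * c j k) = (if i = k then 1 else 0)"
    by blast
  \<comment> \<open>By Euler's formula the rows of \<open>\<beta>\<close> send \<open>e * y0\<close> to \<open>p\<close>; subtracting a multiple of the row \<open>i0\<close> makes them annihilate \<open>y0\<close>.\<close>
  define \<mu> where "\<mu> i j = \<beta> i j - p i / p i0 * \<beta> i0 j" for i j
  define K where "K i x = (\<Sum>j\<in>J. \<mu> i j * \<eta> j x)" for i x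
  have euler: "(\<Sum>i\<in>I. c j i * p i) = of_nat e * y0 j" if j: "j \<in> J" for j
  proof -
    have "\<eta> j (\<lambda>i. p i + t * p i) = (1 + t) ^ e * y0 j" for t
      using hom_fun_scale[OF \<eta>_hom_fun[OF j], of "1 + t" p] by (simp add: algebra_simps)
    moreover have "((\<lambda>t. (1 + t) ^ e * y0 j) has_field_derivative of_nat e * y0 j) (at 0)"
      by (auto intro!: derivative_eq_intros)
    ultimately show ?thesis using deriv[OF j, of p] DERIV_unique by auto
  qed
  have \<mu>y: "(\<Sum>j\<in>J. \<mu> i j * y0 j) = 0" if i: "i \<in> I" for i
  proof -
    have b: "(\<Sum>j\<in>J. \<beta> k j * (of_nat e * y0 j)) = p k" if k: "k \<in> I" for k
    proof -
      have "(\<Sum>j\<in>J. \<beta> k j * (of_nat e * y0 j)) = (\<Sum>j\<in>J. \<beta> k j * (\<Sum>i\<in>I. c j i * p i))"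
        by (rule sum.cong) (auto simp: euler)
      also have "\<dots> = (\<Sum>i\<in>I. (\<Sum>j\<in>J. \<beta> k j * c j i) * p i)"
        by (simp only: sum_distrib_left sum_distrib_right mult.assoc) (rule sum.swap)
      also have "\<dots> = (\<Sum>i\<in>I. if i = k then p i else 0)"
        using k by (intro sum.cong) (auto simp: \<beta>)
      finally show ?thesis using k finI by (simp add: sum.delta)
    qed
    have "of_nat e * (\<Sum>j\<in>J. \<mu> i j * y0 j) = (\<Sum>j\<in>J. \<beta> i j * (of_nat e * y0 j)) - p i / p i0 * (\<Sum>j\<in>J. \<beta> i0 j * (of_nat e * y0 j))"
      unfolding sum_distrib_left sum_subtractf[symmetric]
      by (rule sum.cong) (auto simp: \<mu>_def algebra_simps)
    then show ?thesis using b i i0 e1 by simp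
  qed
  have K: "K i \<in> fib_ideal e" if "i \<in> I" for i
    unfolding K_def[abs_def] by (rule fib_ideal_linear[OF \<mu>y[OF that]])
  obtain e' where e': "e = Suc e'" using e1 by (cases e) auto
  have "\<forall>i\<in>I. \<exists>M. (\<forall>k\<in>I. M k \<in> hom_fun I e') \<and> (\<forall>x. K i x = (\<Sum>k\<in>I. M k x * z k x))"
  proof
    fix i assume i: "i \<in> I"
    have "K i p = 0" using \<mu>y[OF i] by (simp add: K_def)
    with hom_fun_division[OF fib_ideal_hom_fun[OF K[OF i], unfolded e']]
    show "\<exists>M. (\<forall>k\<in>I. M k \<in> hom_fun I e') \<and> (\<forall>x. K i x = (\<Sum>k\<in>I. M k x * z k x))"
      by (simp only: mult_zero_left add_0)
  qed
  from bchoice[OF this] obtain M where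
    "\<forall>i\<in>I. (\<forall>k\<in>I. M i k \<in> hom_fun I e') \<and> (\<forall>x. K i x = (\<Sum>k\<in>I. M i k x * z k x))" ..
  then have M: "\<And>i k. i \<in> I \<Longrightarrow> k \<in> I \<Longrightarrow> M i k \<in> hom_fun I e'"
    "\<And>i x. i \<in> I \<Longrightarrow> K i x = (\<Sum>k\<in>I. M i k x * z k x)" by blast+
  \<comment> \<open>The form \<open>z i0\<close> is zero, so only the other columns of \<open>M\<close> matter.\<close>
  define I' where "I' = I - {i0}"
  have I': "finite I'" "I' \<subseteq> I" "i0 \<notin> I'" "I = insert i0 I'" using finI i0 by (auto simp: I'_def)
  have zi0: "z i0 x = 0" for x using i0 by simp
  have KI': "K i x = (\<Sum>k\<in>I'. M i k x * z k x)" if "i \<in> I" for i x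
    unfolding M(2)[OF that] I'(4) using I' zi0[of x] by simp
  have Mp: "M i k p = (if i = k then 1 else 0)" if ik: "i \<in> I'" "k \<in> I'" for i k
  proof -
    define w where "w l = (if l = k then 1 else (0::complex))" for l
    have wi0: "w i0 = 0" using ik I' by (auto simp: w_def)
    have line: "K i (\<lambda>l. p l + t * w l) = t * M i k (\<lambda>l. p l + t * w l)" for t
    proof -
      have "z l (\<lambda>l. p l + t * w l) = (if l = k then t else 0)" for l
        using wi0 i0 by (simp add: w_def)
      then have "K i (\<lambda>l. p l + t * w l) = (\<Sum>l\<in>I'. M i l (\<lambda>l. p l + t * w l) * (if l = k then t else 0))"
        using ik I' by (subst KI') auto
      also have "\<dots> = (\<Sum>l\<in>I'. if l = k then M i l (\<lambda>l. p l + t * w l) * t else 0)"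
        by (rule sum.cong) auto
      finally have "K i (\<lambda>l. p l + t * w l) = (\<Sum>l\<in>I'. if l = k then M i l (\<lambda>l. p l + t * w l) * t else 0)" .
      then show ?thesis using ik I' by (simp add: sum.delta)
    qed
    have "polyfn (\<lambda>t. M i k (\<lambda>l. p l + t * w l))"
      using ik I' by (intro polyfn_hom_fun[OF M(1)] polyfn_add polyfn_mult) auto
    from polyfn_has_deriv[OF this, of 0] obtain d where
      d: "((\<lambda>t. M i k (\<lambda>l. p l + t * w l)) has_field_derivative d) (at 0)" by blast
    have "((\<lambda>t. t * M i k (\<lambda>l. p l + t * w l)) has_field_derivative M i k p) (at 0)"
      using DERIV_mult[OF DERIV_ident d] by simp
    moreover have "((\<lambda>t. K i (\<lambda>l. p l + t * w l)) has_field_derivative (\<Sum>j\<in>J. \<mu> i j * (\<Sum>l\<in>I. c j l * w l))) (at 0)"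
      unfolding K_def by (intro DERIV_sum DERIV_cmult deriv)
    ultimately have "M i k p = (\<Sum>j\<in>J. \<mu> i j * (\<Sum>l\<in>I. c j l * w l))"
      unfolding line using DERIV_unique by blast
    also have "\<dots> = (\<Sum>j\<in>J. \<mu> i j * c j k)"
    proof (rule sum.cong, rule refl)
      fix j
      have "(\<Sum>l\<in>I. c j l * w l) = (\<Sum>l\<in>I. if l = k then c j l else 0)"
        by (rule sum.cong) (auto simp: w_def)
      also have "\<dots> = c j k" using ik I' finI by (subst sum.delta) auto
      finally show "\<mu> i j * (\<Sum>l\<in>I. c j l * w l) = \<mu> i j * c j k" by simp
    qed
    also have "\<dots> = (\<Sum>j\<in>J. \<beta> i j * c j k) - p i / p i0 * (\<Sum>j\<in>J. \<beta> i0 j * c j k)"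
      unfolding sum_distrib_left sum_subtractf[symmetric]
      by (rule sum.cong) (auto simp: \<mu>_def algebra_simps)
    also have "\<dots> = (if i = k then 1 else 0)"
      using ik I' i0 by (subst (1 2) \<beta>) auto
    finally show ?thesis .
  qed
  have "\<exists>D A. D \<in> hom_fun I (e' * card I') \<and> D p = 1 \<and> (\<forall>i\<in>I'. \<forall>k\<in>I'. A k i \<in> hom_fun I (e' * (card I' - 1))) \<and>
    (\<forall>x. \<forall>k\<in>I'. \<forall>l\<in>I'. (\<Sum>i\<in>I'. A k i x * M i l x) = (if k = l then D x else 0))"
  proof (rule cramer_hom_fun[of I' M I e' p])
    show "finite I'" by (rule I')
    show "M i k \<in> hom_fun I e'" if "i \<in> I'" "k \<in> I'" for i k using M(1) I'(2) that by blast
    show "M i k p = (if i = k then 1 else 0)" if "i \<in> I'" "k \<in> I'" for i k by (rule Mp[OF that])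
  qed blast
  then obtain D A where D: "D \<in> hom_fun I (e' * card I')" "D p = 1"
    and A: "\<And>i k. i \<in> I' \<Longrightarrow> k \<in> I' \<Longrightarrow> A k i \<in> hom_fun I (e' * (card I' - 1))"
    and DA: "\<And>x k l. k \<in> I' \<Longrightarrow> l \<in> I' \<Longrightarrow> (\<Sum>i\<in>I'. A k i x * M i l x) = (if k = l then D x else 0)"
    by blast
  have "(\<lambda>x. D x * z k x) \<in> fib_ideal (Suc (e' * card I'))" if k: "k \<in> I" for k
  proof (cases "k = i0")
    case True
    then have "(\<lambda>x. D x * z k x) = (\<lambda>x. 0)" using i0 by auto
    then show ?thesis by (simp add: fib_ideal_0)
  next
    case False
    then have k': "k \<in> I'" using k by (auto simp: I'_def)
    have "(\<lambda>x. \<Sum>i\<in>I'. A k i x * K i x) \<in> fib_ideal (e' * (card I' - 1) + e)"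
      using k' I' by (intro fib_ideal_sum fib_ideal_mult A K) auto
    moreover have "e' * (card I' - 1) + e = Suc (e' * card I')"
      using k' I' by (cases "card I'") (auto simp: e')
    moreover have "(\<Sum>i\<in>I'. A k i x * K i x) = D x * z k x" for x
    proof -
      have "(\<Sum>i\<in>I'. A k i x * K i x) = (\<Sum>i\<in>I'. A k i x * (\<Sum>l\<in>I'. M i l x * z l x))"
        using I' by (intro sum.cong) (auto simp: KI')
      also have "\<dots> = (\<Sum>l\<in>I'. (\<Sum>i\<in>I'. A k i x * M i l x) * z l x)"
        by (simp only: sum_distrib_left sum_distrib_right mult.assoc) (rule sum.swap)
      also have "\<dots> = (\<Sum>l\<in>I'. if l = k then D x * z l x else 0)"
        using k' by (intro sum.cong) (auto simp: DA)
      finally show ?thesis using k' I' by (simp add: sum.delta)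
    qed
    ultimately show ?thesis by simp
  qed
  then show ?thesis using D by (intro exI bexI[of _ D]) auto
qed

text \<open>The function \<open>g\<close> of \<open>exists_isolating_function\<close> is not zero at the start of the curve, so the functions \<open>z k\<close>, whose
  products with \<open>g\<close> vanish on the fibre, vanish along the curve.\<close>

lemma fib_isolated:
  assumes x: "\<And>i. polyfn (\<lambda>t. x t i)" "\<And>t. t \<noteq> 0 \<Longrightarrow> x t \<in> fib"
    and x0: "\<And>i. i \<in> I \<Longrightarrow> x 0 i = a * p i" and a: "a \<noteq> 0"
  shows "\<exists>c. \<forall>i\<in>I. x t i = c * p i"
proof -
  obtain n g where g: "g \<in> hom_fun I n" "g p \<noteq> 0" "\<And>k. k \<in> I \<Longrightarrow> (\<lambda>x. g x * z k x) \<in> fib_ideal (Suc n)"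
    using exists_isolating_function by blast
  have "z k (x t) = 0" if k: "k \<in> I" for k
  proof (rule polyfn_mult_zero[of "\<lambda>t. z k (x t)" "\<lambda>t. g (x t)" 0])
    show "polyfn (\<lambda>t. z k (x t))" by (rule polyfn_hom_fun[OF z_hom_fun[OF k] x(1)])
    show "polyfn (\<lambda>t. g (x t))" by (rule polyfn_hom_fun[OF g(1) x(1)])
    have "x t \<in> fib" for t using fib_limit[OF x] x(2) by (cases "t = 0") auto
    then show "z k (x t) * g (x t) = 0" for t
      using fibD[OF _ g(3)[OF k], of "x t"] by (simp add: mult.commute)
    have "g (x 0) = a ^ n * g p"
      using hom_fun_cong[OF g(1), of "x 0" "\<lambda>i. a * p i"] x0 hom_fun_scale[OF g(1), of a p] by simp
    then show "g (x 0) \<noteq> 0" using g a by simp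
  qed
  then show ?thesis by (intro exI[of _ "\<psi>0 (x t)"]) (auto simp: mult.commute)
qed

text \<open>The functions that multiply all \<open>z k\<close> into the ideal of the fibre have no common zero other than \<open>0\<close>: outside of the
  line of \<open>p\<close> because the fibre is contained in this line, and on the line because of \<open>exists_isolating_function\<close>. By
  the graded Nullstellensatz the ideal of the fibre contains, in some degree \<open>N\<close>, all functions that vanish at \<open>p\<close>,
  in particular the functions \<open>mono_val x m - mono_val p m * \<psi>0 x ^ N\<close>. The corresponding equations of the graph are
  linear in the monomials of degree \<open>N\<close>, and Cramer's rule expresses these monomials by \<open>\<psi>0 x ^ N\<close> with
  coefficients depending on \<open>y\<close>.\<close>

theorem exists_inverse_formula:
  assumes fib: "\<And>x. x \<in> fib \<Longrightarrow> \<exists>c. \<forall>i\<in>I. x i = c * p i"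
  shows "\<exists>K. \<exists>D\<in>hom_fun J K. \<exists>A. (\<forall>i\<in>I. A i \<in> hom_fun J K) \<and> D y0 \<noteq> 0 \<and>
    (\<forall>x. \<forall>i\<in>I. D (\<lambda>j. \<eta> j x) * x i = A i (\<lambda>j. \<eta> j x) * \<psi>0 x)"
proof -
  obtain ng g where g: "g \<in> hom_fun I ng" "g p \<noteq> 0" "\<And>k. k \<in> I \<Longrightarrow> (\<lambda>x. g x * z k x) \<in> fib_ideal (Suc ng)"
    using exists_isolating_function by blast
  define B where "B n = {\<phi> \<in> hom_fun I n. \<forall>k\<in>I. (\<lambda>x. \<phi> x * z k x) \<in> fib_ideal (Suc n)}" for n
  have "\<exists>n. hom_fun I n \<subseteq> B n"
  proof (rule graded_nullstellensatz[OF finI])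
    show "B n \<subseteq> hom_fun I n" "(\<lambda>x. 0) \<in> B n" for n by (auto simp: B_def fib_ideal_0)
    show "(\<lambda>x. \<phi> x + \<phi>' x) \<in> B n" if "\<phi> \<in> B n" "\<phi>' \<in> B n" for n \<phi> \<phi>'
    proof -
      have "(\<lambda>x. \<phi> x * z k x + \<phi>' x * z k x) \<in> fib_ideal (Suc n)" if "k \<in> I" for k
        using that \<open>\<phi> \<in> B n\<close> \<open>\<phi>' \<in> B n\<close> by (intro fib_ideal_add) (auto simp: B_def)
      then show ?thesis using that by (auto simp: B_def distrib_right intro: hom_fun_add)
    qed
    show "(\<lambda>x. \<phi> x * \<phi>' x) \<in> B (m + n)" if "\<phi> \<in> hom_fun I m" "\<phi>' \<in> B n" for m n \<phi> \<phi>'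
    proof -
      have "(\<lambda>x. \<phi> x * (\<phi>' x * z k x)) \<in> fib_ideal (m + Suc n)" if "k \<in> I" for k
        using that \<open>\<phi> \<in> hom_fun I m\<close> \<open>\<phi>' \<in> B n\<close> by (intro fib_ideal_mult) (auto simp: B_def)
      then show ?thesis using that by (auto simp: B_def mult.assoc intro: hom_fun_mult)
    qed
    show "x i = 0" if x: "\<And>n \<phi>. \<phi> \<in> B n \<Longrightarrow> \<phi> x = 0" and i: "i \<in> I" for x i
    proof -
      have "\<phi> \<in> B n" if "\<phi> \<in> fib_ideal n" for \<phi> n
      proof -
        have "(\<lambda>x. z k x * \<phi> x) \<in> fib_ideal (1 + n)" if "k \<in> I" for k
          by (intro fib_ideal_mult z_hom_fun that \<open>\<phi> \<in> _\<close>)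
        then show ?thesis using fib_ideal_hom_fun[OF that] by (simp add: B_def mult.commute)
      qed
      then have "x \<in> fib" using x by (auto simp: fib_def)
      then obtain a where a: "\<And>i. i \<in> I \<Longrightarrow> x i = a * p i" using fib by blast
      have "g \<in> B ng" using g by (simp add: B_def)
      then have "g x = 0" by (rule x)
      moreover have "g x = a ^ ng * g p"
        using hom_fun_cong[OF g(1), of x "\<lambda>i. a * p i"] a hom_fun_scale[OF g(1), of a p] by simp
      ultimately have "a = 0" using g(2) by simp
      then show ?thesis using a i by simp
    qed
  qed
  then obtain n where n: "hom_fun I n \<subseteq> B n" by blast
  define N where "N = Suc n"
  have van: "(\<lambda>x. \<phi> x - \<phi> p * \<psi>0 x ^ N) \<in> fib_ideal N" if "\<phi> \<in> hom_fun I N" for \<phi>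
  proof -
    obtain M where M: "\<And>k. k \<in> I \<Longrightarrow> M k \<in> hom_fun I n"
      "\<And>x. \<phi> x = \<phi> p * \<psi>0 x ^ Suc n + (\<Sum>k\<in>I. M k x * z k x)"
      using hom_fun_division[OF \<open>\<phi> \<in> hom_fun I N\<close>[unfolded N_def]] by blast
    have *: "(\<lambda>x. \<Sum>k\<in>I. M k x * z k x) \<in> fib_ideal N"
      unfolding N_def using M(1) n by (intro fib_ideal_sum) (auto simp: B_def)
    have "(\<lambda>x. \<phi> x - \<phi> p * \<psi>0 x ^ N) = (\<lambda>x. \<Sum>k\<in>I. M k x * z k x)"
    proof
      fix x show "\<phi> x - \<phi> p * \<psi>0 x ^ N = (\<Sum>k\<in>I. M k x * z k x)"
        by (simp only: N_def M(2)[of x] add_diff_cancel_left')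
    qed
    then show ?thesis using * by (simp only:)
  qed
  define S where "S = mons I N"
  have S: "finite S" unfolding S_def by (rule finite_mons[OF finI])
  have "\<forall>m\<in>S. \<exists>k\<Phi>. snd k\<Phi> \<in> graph_eqs N (fst k\<Phi>) \<and> (\<forall>x. snd k\<Phi> x y0 = mono_val x m - mono_val p m * \<psi>0 x ^ N)"
  proof
    fix m assume "m \<in> S"
    from van[OF hom_fun_mono_val[OF this[unfolded S_def]]] obtain k \<Phi> where
      "\<Phi> \<in> graph_eqs N k" "\<And>x. mono_val x m - mono_val p m * \<psi>0 x ^ N = \<Phi> x y0"
      by (rule fib_idealE) blast
    then show "\<exists>k\<Phi>. snd k\<Phi> \<in> graph_eqs N (fst k\<Phi>) \<and> (\<forall>x. snd k\<Phi> x y0 = mono_val x m - mono_val p m * \<psi>0 x ^ N)"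
      by (intro exI[of _ "(k, \<Phi>)"]) simp
  qed
  from bchoice[OF this] obtain k\<Phi> where
    k\<Phi>: "\<forall>m\<in>S. snd (k\<Phi> m) \<in> graph_eqs N (fst (k\<Phi> m)) \<and> (\<forall>x. snd (k\<Phi> m) x y0 = mono_val x m - mono_val p m * \<psi>0 x ^ N)" ..
  define k where "k m = fst (k\<Phi> m)" for m
  define \<Phi> where "\<Phi> m = snd (k\<Phi> m)" for m
  have \<Phi>: "\<And>m. m \<in> S \<Longrightarrow> \<Phi> m \<in> graph_eqs N (k m)"
    "\<And>m x. m \<in> S \<Longrightarrow> \<Phi> m x y0 = mono_val x m - mono_val p m * \<psi>0 x ^ N"
    using k\<Phi> unfolding k_def \<Phi>_def by blast+
  define K where "K = sum k S"
  have "\<forall>m\<in>S. \<exists>a. (\<forall>m'\<in>S. a m' \<in> hom_fun J K) \<and> (\<forall>x. (\<Sum>m'\<in>S. a m' (\<lambda>j. \<eta> j x) * mono_val x m') = 0) \<and>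
     (\<forall>x. (\<Sum>m'\<in>S. a m' y0 * mono_val x m') = mono_val x m - mono_val p m * \<psi>0 x ^ N)"
  proof
    fix m assume m: "m \<in> S"
    have "k m \<le> K" unfolding K_def using m S by (intro member_le_sum) auto
    then have *: "(\<lambda>x y. \<Phi> m x y * \<psi> y ^ (K - k m)) \<in> graph_eqs N K"
      using graph_eqs_raise[OF \<Phi>(1)[OF m], of "K - k m"] by simp
    from graph_eqsD(1)[OF *]
    have "\<exists>a. (\<forall>m'\<in>S. a m' \<in> hom_fun J K) \<and>
      (\<lambda>x y. \<Phi> m x y * \<psi> y ^ (K - k m)) = (\<lambda>x y. \<Sum>m'\<in>S. a m' y * mono_val x m')"
      unfolding bihom_fun_def S_def[symmetric] mem_Collect_eq .
    then obtain a where a0: "(\<forall>m'\<in>S. a m' \<in> hom_fun J K) \<and>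
      (\<lambda>x y. \<Phi> m x y * \<psi> y ^ (K - k m)) = (\<lambda>x y. \<Sum>m'\<in>S. a m' y * mono_val x m')" ..
    note a = conjunct1[OF a0]
    have a': "\<Phi> m x y * \<psi> y ^ (K - k m) = (\<Sum>m'\<in>S. a m' y * mono_val x m')" for x y
      using fun_cong[OF fun_cong[OF conjunct2[OF a0], of x], of y] .
    have "(\<Sum>m'\<in>S. a m' (\<lambda>j. \<eta> j x) * mono_val x m') = 0" for x
      unfolding a'[symmetric] using graph_eqsD(2)[OF *, of x] .
    moreover have "(\<Sum>m'\<in>S. a m' y0 * mono_val x m') = mono_val x m - mono_val p m * \<psi>0 x ^ N" for x
      unfolding a'[symmetric] \<Phi>(2)[OF m] \<psi>_y0 by simp
    ultimately show "\<exists>a. (\<forall>m'\<in>S. a m' \<in> hom_fun J K) \<and> (\<forall>x. (\<Sum>m'\<in>S. a m' (\<lambda>j. \<eta> j x) * mono_val x m') = 0) \<and>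
     (\<forall>x. (\<Sum>m'\<in>S. a m' y0 * mono_val x m') = mono_val x m - mono_val p m * \<psi>0 x ^ N)"
      using a by (intro exI[of _ a] conjI allI)
  qed
  from bchoice[OF this] obtain a where
    "\<forall>m\<in>S. (\<forall>m'\<in>S. a m m' \<in> hom_fun J K) \<and> (\<forall>x. (\<Sum>m'\<in>S. a m m' (\<lambda>j. \<eta> j x) * mono_val x m') = 0) \<and>
     (\<forall>x. (\<Sum>m'\<in>S. a m m' y0 * mono_val x m') = mono_val x m - mono_val p m * \<psi>0 x ^ N)" ..
  then have a: "\<And>m m'. m \<in> S \<Longrightarrow> m' \<in> S \<Longrightarrow> a m m' \<in> hom_fun J K"
    "\<And>m x. m \<in> S \<Longrightarrow> (\<Sum>m'\<in>S. a m m' (\<lambda>j. \<eta> j x) * mono_val x m') = 0"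
    "\<And>m x. m \<in> S \<Longrightarrow> (\<Sum>m'\<in>S. a m m' y0 * mono_val x m') = mono_val x m - mono_val p m * \<psi>0 x ^ N"
    by blast+
  define m0 where "m0 = Poly_Mapping.single i0 N"
  have m0: "m0 \<in> S" using i0 by (auto simp: S_def mons_def m0_def)
  define b where "b m' = (if m' = m0 then 1 / p i0 ^ N else 0)" for m'
  have b: "(\<Sum>m'\<in>S. b m' * mono_val x m') = \<psi>0 x ^ N" for x
  proof -
    have "(\<Sum>m'\<in>S. b m' * mono_val x m') = (\<Sum>m'\<in>S. if m' = m0 then mono_val x m' / p i0 ^ N else 0)"
      by (rule sum.cong) (auto simp: b_def)
    also have "\<dots> = mono_val x m0 / p i0 ^ N" using m0 S by (simp add: sum.delta)
    finally show ?thesis by (simp add: m0_def power_divide)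
  qed
  define u where "u m m' = (if m = m' then 1 else 0) - mono_val p m * b m'" for m m'
  have u: "(\<Sum>m'\<in>S. u m m' * mono_val x m') = mono_val x m - mono_val p m * \<psi>0 x ^ N" if "m \<in> S" for m x
  proof -
    have "(\<Sum>m'\<in>S. u m m' * mono_val x m') = (\<Sum>m'\<in>S. if m' = m then mono_val x m' else 0) - mono_val p m * (\<Sum>m'\<in>S. b m' * mono_val x m')"
      unfolding sum_distrib_left sum_subtractf[symmetric]
      by (rule sum.cong) (auto simp: u_def algebra_simps)
    then show ?thesis unfolding b using that S by (simp add: sum.delta)
  qed
  \<comment> \<open>The multiple of \<open>\<psi> y ^ K\<close> makes the new matrix the identity matrix at \<open>y0\<close>. Summed against the monomials, \<open>u - a\<close> at \<open>y0\<close> contributes nothing and \<open>b\<close> provides the right-hand side of the system.\<close>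
  define B' where "B' m m' y = a m m' y + (u m m' - a m m' y0 + mono_val p m * b m') * \<psi> y ^ K" for m m' y
  have B'_hom_fun: "B' m m' \<in> hom_fun J K" if "m \<in> S" "m' \<in> S" for m m'
    unfolding B'_def[abs_def] by (intro hom_fun_add a that hom_fun_cmult \<psi>_hom_fun)
  have B'_y0: "B' m m' y0 = (if m = m' then 1 else 0)" for m m'
    using j0 by (simp add: B'_def u_def)
  have B'_sum: "(\<Sum>m'\<in>S. B' m m' (\<lambda>j. \<eta> j x) * mono_val x m') = mono_val p m * \<psi> (\<lambda>j. \<eta> j x) ^ K * \<psi>0 x ^ N"
    if "m \<in> S" for m x
  proof -
    have "(\<Sum>m'\<in>S. B' m m' (\<lambda>j. \<eta> j x) * mono_val x m') = (\<Sum>m'\<in>S. a m m' (\<lambda>j. \<eta> j x) * mono_val x m')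
       + \<psi> (\<lambda>j. \<eta> j x) ^ K * ((\<Sum>m'\<in>S. u m m' * mono_val x m') - (\<Sum>m'\<in>S. a m m' y0 * mono_val x m')
           + mono_val p m * (\<Sum>m'\<in>S. b m' * mono_val x m'))"
      unfolding sum_distrib_left sum_subtractf[symmetric] sum.distrib[symmetric]
      by (rule sum.cong) (auto simp: B'_def algebra_simps)
    then show ?thesis unfolding b u[OF that] a(2)[OF that] a(3)[OF that] by (simp add: mult_ac)
  qed
  have "\<exists>D A. D \<in> hom_fun J (K * card S) \<and> D y0 = 1 \<and> (\<forall>i\<in>S. \<forall>k\<in>S. A k i \<in> hom_fun J (K * (card S - 1))) \<and>
    (\<forall>x. \<forall>k\<in>S. \<forall>l\<in>S. (\<Sum>i\<in>S. A k i x * B' i l x) = (if k = l then D x else 0))"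
  proof (rule cramer_hom_fun[of S B' J K y0])
    show "finite S" by (rule S)
    show "B' i k \<in> hom_fun J K" if "i \<in> S" "k \<in> S" for i k by (rule B'_hom_fun[OF that])
    show "B' i k y0 = (if i = k then 1 else 0)" for i k by (rule B'_y0)
  qed blast
  then obtain D A where D: "D \<in> hom_fun J (K * card S)" "D y0 = 1"
    and A: "\<And>i k. i \<in> S \<Longrightarrow> k \<in> S \<Longrightarrow> A k i \<in> hom_fun J (K * (card S - 1))"
    and DA: "\<And>x k l. k \<in> S \<Longrightarrow> l \<in> S \<Longrightarrow> (\<Sum>i\<in>S. A k i x * B' i l x) = (if k = l then D x else 0)"
    by blast
  define E where "E m y = (\<Sum>i\<in>S. A m i y * (mono_val p i * \<psi> y ^ K))" for m y
  have E_hom_fun: "E m \<in> hom_fun J (K * card S)" if "m \<in> S" for m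
  proof -
    have "E m \<in> hom_fun J (K * (card S - 1) + K)"
      unfolding E_def[abs_def] by (intro hom_fun_sum hom_fun_mult hom_fun_cmult \<psi>_hom_fun A that)
    moreover have "K * (card S - 1) + K = K * card S"
      using that S by (cases "card S") auto
    ultimately show ?thesis by simp
  qed
  have DE: "D (\<lambda>j. \<eta> j x) * mono_val x m = E m (\<lambda>j. \<eta> j x) * \<psi>0 x ^ N" if m: "m \<in> S" for m x
  proof -
    let ?y = "\<lambda>j. \<eta> j x"
    have "D ?y * mono_val x m = (\<Sum>l\<in>S. if l = m then D ?y * mono_val x l else 0)"
      using m S by (simp add: sum.delta)
    also have "\<dots> = (\<Sum>l\<in>S. (\<Sum>i\<in>S. A m i ?y * B' i l ?y) * mono_val x l)"
      using m by (intro sum.cong) (auto simp: DA)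
    also have "\<dots> = (\<Sum>i\<in>S. A m i ?y * (\<Sum>l\<in>S. B' i l ?y * mono_val x l))"
      by (simp only: sum_distrib_left sum_distrib_right mult.assoc) (rule sum.swap)
    also have "\<dots> = (\<Sum>i\<in>S. A m i ?y * (mono_val p i * \<psi> ?y ^ K)) * \<psi>0 x ^ N"
      unfolding sum_distrib_right by (rule sum.cong) (auto simp only: B'_sum mult.assoc)
    finally show ?thesis by (simp only: E_def)
  qed
  define mi where "mi i = Poly_Mapping.single i0 n + Poly_Mapping.single i (1::nat)" for i
  have mi: "mi i \<in> S" if "i \<in> I" for i
    using that i0 by (auto simp: S_def mons_def mi_def N_def keys_add_nat)
  define A' where "A' i y = 1 / p i0 ^ n * E (mi i) y" for i y
  have "D (\<lambda>j. \<eta> j x) * x i = A' i (\<lambda>j. \<eta> j x) * \<psi>0 x" if i: "i \<in> I" for i x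
  proof -
    let ?y = "\<lambda>x j. \<eta> j x"
    \<comment> \<open>The identity for the monomial \<open>x i0 ^ n * x i\<close> contains the superfluous factor \<open>x i0 ^ n\<close>, which is cancelled along lines in direction \<open>p\<close>.\<close>
    define f where "f x = D (?y x) * x i - A' i (?y x) * \<psi>0 x" for x
    have f0: "f x * x i0 ^ n = 0" for x
    proof -
      have "D (?y x) * (x i0 ^ n * x i) = E (mi i) (?y x) * \<psi>0 x ^ N"
        using DE[OF mi[OF i], of x] by (simp add: mi_def mono_val_add)
      also have "\<dots> = A' i (?y x) * \<psi>0 x * x i0 ^ n"
        using i0 by (simp add: A'_def N_def power_divide mult_ac)
      finally show ?thesis by (simp add: f_def algebra_simps)
    qed
    have pl: "polyfn (\<lambda>t. x l + t * p l)" for l by (intro polyfn_add polyfn_mult) auto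
    define F where "F = (\<lambda>x. D (?y x) * x i - A' i (?y x) * \<psi>0 x)"
    have DPF: "(\<lambda>x. D (?y x)) \<in> hom_fun I (K * card S * e)"
      by (rule hom_fun_compose[OF finJ D(1) \<eta>_hom_fun])
    have APF: "(\<lambda>x. A' i (?y x)) \<in> hom_fun I (K * card S * e)"
      unfolding A'_def by (intro hom_fun_cmult hom_fun_compose[OF finJ E_hom_fun[OF mi[OF i]] \<eta>_hom_fun])
    have fPF: "f \<in> hom_fun I (K * card S * e + 1)"
      unfolding f_def[abs_def] by (intro hom_fun_diff hom_fun_mult DPF APF hom_fun_coord i \<psi>0_hom_fun)
    have "f (\<lambda>l. x l + 0 * p l) = 0"
    proof (rule polyfn_mult_zero[of "\<lambda>t. f (\<lambda>l. x l + t * p l)" "\<lambda>t. (x i0 + t * p i0) ^ n" "(1 - x i0) / p i0"])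
      show "polyfn (\<lambda>t. f (\<lambda>l. x l + t * p l))" by (rule polyfn_hom_fun[OF fPF pl])
      show "polyfn (\<lambda>t. (x i0 + t * p i0) ^ n)" by (intro polyfn_power pl)
      show "f (\<lambda>l. x l + t * p l) * (x i0 + t * p i0) ^ n = 0" for t
        using f0[of "\<lambda>l. x l + t * p l"] .
      show "(x i0 + (1 - x i0) / p i0 * p i0) ^ n \<noteq> 0" using i0 by simp
    qed
    then show ?thesis by (simp add: f_def)
  qed
  moreover have "A' i \<in> hom_fun J (K * card S)" if "i \<in> I" for i
    unfolding A'_def[abs_def] by (intro hom_fun_cmult E_hom_fun mi that)
  ultimately show ?thesis using D
    by (intro exI[of _ "K * card S"] bexI[of _ D] exI[of _ A']) auto
qed

end

section \<open>Projective spaces\<close>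

definition vec_of :: "'a set \<Rightarrow> ('a \<Rightarrow> complex) \<Rightarrow> ('a \<Rightarrow>\<^sub>0 complex)" where
  "vec_of I f = (\<Sum>i\<in>I. Poly_Mapping.single i (f i))"

lemma lookup_vec_of: "finite I \<Longrightarrow> lookup (vec_of I f) i = (if i \<in> I then f i else 0)"
  by (simp add: vec_of_def lookup_sum lookup_single when_def sum.delta)

lemma vec_of_vecs: "finite I \<Longrightarrow> vec_of I f \<in> vecs I"
  by (auto simp: vecs_def in_keys_iff lookup_vec_of split: if_splits)

lemma lookup_outside: "v \<in> vecs I \<Longrightarrow> i \<notin> I \<Longrightarrow> lookup v i = 0"
  by (auto simp: vecs_def in_keys_iff)

lemma vec_eq_0_iff: "v \<in> vecs I \<Longrightarrow> v = 0 \<longleftrightarrow> (\<forall>i\<in>I. lookup v i = 0)"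
  using lookup_outside by (metis lookup_zero poly_mapping_eqI)

lemma vec_of_lookup: "finite I \<Longrightarrow> v \<in> vecs I \<Longrightarrow> vec_of I (lookup v) = v"
  by (rule poly_mapping_eqI) (auto simp: lookup_vec_of lookup_outside)

lemma proj_pt_eqI:
  assumes "\<And>i. lookup w i = c * lookup v i" "c \<noteq> 0"
  shows "proj_pt v = proj_pt w"
proof -
  have "(\<exists>b. b \<noteq> 0 \<and> (\<forall>i. lookup u i = b * lookup v i)) \<longleftrightarrow> (\<exists>b. b \<noteq> 0 \<and> (\<forall>i. lookup u i = b * lookup w i))" for u
    using assms by (auto intro: exI[of _ "_ / c"] exI[of _ "_ * c"])
  then show ?thesis by (simp add: proj_pt_def)
qed

lemma proj_pt_eqE:
  assumes "proj_pt v = proj_pt w"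
  obtains c where "c \<noteq> 0" "\<And>i. lookup w i = c * lookup v i"
proof -
  have "w \<in> proj_pt w" unfolding proj_pt_def by (auto intro: exI[of _ 1])
  then have "w \<in> proj_pt v" using assms by simp
  then show ?thesis using that by (auto simp: proj_pt_def)
qed

definition principal_open :: "'a set \<Rightarrow> (('a \<Rightarrow> complex) \<Rightarrow> complex) \<Rightarrow> ('a \<Rightarrow>\<^sub>0 complex) set set" where
  "principal_open I \<phi> = {proj_pt v | v. v \<in> vecs I - {0} \<and> \<phi> (lookup v) \<noteq> 0}"

lemma hom_fun_scaled:
  assumes "\<phi> \<in> hom_fun I n" "\<And>i. i \<in> I \<Longrightarrow> x i = c * y i"
  shows "\<phi> x = c ^ n * \<phi> y"
  using hom_fun_cong[OF assms(1), of x "\<lambda>i. c * y i"] assms hom_fun_scale[OF assms(1), of c y] by simp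

lemma principal_open_iff:
  assumes "\<phi> \<in> hom_fun I n" "v \<in> vecs I - {0}"
  shows "proj_pt v \<in> principal_open I \<phi> \<longleftrightarrow> \<phi> (lookup v) \<noteq> 0"
proof
  assume "proj_pt v \<in> principal_open I \<phi>"
  then obtain w where w: "proj_pt v = proj_pt w" "\<phi> (lookup w) \<noteq> 0" by (auto simp: principal_open_def)
  obtain c where "c \<noteq> 0" "\<And>i. lookup w i = c * lookup v i" using w(1) by (rule proj_pt_eqE) blast
  then show "\<phi> (lookup v) \<noteq> 0" using hom_fun_scaled[OF assms(1), of "lookup w" c "lookup v"] w(2) by simp
qed (use assms in \<open>auto simp: principal_open_def\<close>)

lemma hom_fun_homogeneous:
  assumes "\<phi> \<in> hom_fun I n"
  obtains F where "homogeneous n F" "\<And>x. peval x F = \<phi> x"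
proof -
  obtain F where "F \<in> vecs (mons I n)" "\<phi> = (\<lambda>x. peval x F)" using assms by (auto simp: hom_fun_def)
  then show ?thesis using that[of F] by (auto simp: homogeneous_def vecs_def mons_def)
qed

lemma openin_principal:
  assumes "\<phi> \<in> hom_fun I n" shows "openin (zariski I) (principal_open I \<phi>)"
proof -
  obtain F where F: "homogeneous n F" "\<And>x. peval x F = \<phi> x" using hom_fun_homogeneous[OF assms] by blast
  show ?thesis unfolding zariski_def principal_open_def F(2)[symmetric]
    by (rule topology_generated_by_Basis) (use F(1) in blast)
qed

lemma topspace_zariski: "topspace (zariski I) = proj_space I"
proof -
  have "homogeneous 0 (1 :: 'a cpoly)" by (simp add: homogeneous_def)
  then have "{proj_pt v | v. v \<in> vecs I - {0} \<and> peval (lookup v) 1 \<noteq> 0} \<in>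
      {{proj_pt v | v. v \<in> vecs I - {0} \<and> peval (lookup v) F \<noteq> 0} | F. \<exists>e. homogeneous e F}"
    by blast
  from Union_upper[OF this] have "{proj_pt v | v. v \<in> vecs I - {0} \<and> peval (lookup v) 1 \<noteq> 0} \<subseteq> topspace (zariski I)"
    unfolding zariski_def topology_generated_by_topspace .
  moreover have "{proj_pt v | v. v \<in> vecs I - {0} \<and> peval (lookup v) 1 \<noteq> 0} = proj_space I"
    by (auto simp: proj_space_def)
  ultimately have "proj_space I \<subseteq> topspace (zariski I)" by simp
  moreover have "topspace (zariski I) \<subseteq> proj_space I"
    unfolding zariski_def topology_generated_by_topspace proj_space_def by auto
  ultimately show ?thesis by blast
qed

lemma rational_map_given_by:
  assumes I: "finite I" and J: "finite J" and X: "X \<subseteq> proj_space I"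
    and g: "\<And>j. j \<in> J \<Longrightarrow> g j \<in> hom_fun I n"
    and \<Gamma>: "\<Gamma> = {(proj_pt v, proj_pt (vec_of J (\<lambda>j. g j (lookup v)))) |v.
       v \<in> vecs I - {0} \<and> proj_pt v \<in> X \<and> (\<exists>j\<in>J. g j (lookup v) \<noteq> 0)}"
    and ne: "\<Gamma> \<noteq> {}"
  shows "rational_map I X J \<Gamma>"
proof -
  let ?w = "\<lambda>v. vec_of J (\<lambda>j. g j (lookup v))"
  have w: "?w v \<in> vecs J - {0}" if "\<exists>j\<in>J. g j (lookup v) \<noteq> 0" for v
    using that J by (auto simp: vec_of_vecs vec_eq_0_iff[OF vec_of_vecs[OF J]] lookup_vec_of)
  have dom: "Domain \<Gamma> = (\<Union>j\<in>J. principal_open I (g j)) \<inter> X"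
    unfolding \<Gamma> principal_open_def by auto
  have sv: "single_valued \<Gamma>"
    unfolding single_valued_def
  proof (intro allI impI)
    fix x y z assume "(x, y) \<in> \<Gamma>" "(x, z) \<in> \<Gamma>"
    then obtain v v' where v: "x = proj_pt v" "y = proj_pt (?w v)" "x = proj_pt v'" "z = proj_pt (?w v')"
      by (auto simp: \<Gamma>)
    then have "proj_pt v = proj_pt v'" by simp
    then obtain c where c: "c \<noteq> 0" "\<And>i. lookup v' i = c * lookup v i" by (rule proj_pt_eqE) blast
    have "lookup (?w v') j = c ^ n * lookup (?w v) j" for j
      using hom_fun_scaled[OF g, of j "lookup v'" c "lookup v"] c J by (auto simp: lookup_vec_of)
    then show "y = z" unfolding v(2,4) using c(1) by (intro proj_pt_eqI[of _ "c ^ n"]) auto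
  qed
  have "openin (zariski I) (\<Union>j\<in>J. principal_open I (g j))"
    using openin_principal[OF g] by (intro openin_Union) auto
  then have op: "openin (subtopology (zariski I) X) (Domain \<Gamma>)"
    unfolding dom openin_subtopology by (intro exI conjI) (assumption, rule refl)
  have "\<forall>j\<in>J. \<exists>F. homogeneous n F \<and> (\<forall>x. peval x F = g j x)"
  proof
    fix j assume "j \<in> J"
    from hom_fun_homogeneous[OF g[OF this]] show "\<exists>F. homogeneous n F \<and> (\<forall>x. peval x F = g j x)" by blast
  qed
  from bchoice[OF this] obtain F where F: "\<forall>j\<in>J. homogeneous n (F j) \<and> (\<forall>x. peval x (F j) = g j x)" ..
  have loc: "\<exists>w\<in>vecs J - {0}. (\<forall>j\<in>J. lookup w j = peval (lookup v) (F j)) \<and> (proj_pt v, proj_pt w) \<in> \<Gamma>"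
    if v: "v \<in> vecs I - {0}" "proj_pt v \<in> Domain \<Gamma>" for v
  proof -
    obtain j where j: "j \<in> J" "proj_pt v \<in> principal_open I (g j)" "proj_pt v \<in> X" using v dom by auto
    then have "g j (lookup v) \<noteq> 0" using principal_open_iff[OF g v(1)] by blast
    then have ex: "\<exists>j\<in>J. g j (lookup v) \<noteq> 0" using j by blast
    have "(proj_pt v, proj_pt (?w v)) \<in> \<Gamma>" unfolding \<Gamma> using ex v(1) j(3) by blast
    then show ?thesis using w[OF ex] F J by (intro bexI[of _ "?w v"]) (auto simp: lookup_vec_of)
  qed
  show ?thesis
    unfolding rational_map_def
  proof (intro conjI ballI)
    show "\<Gamma> \<subseteq> X \<times> proj_space J" unfolding \<Gamma> proj_space_def using w by blast
    show "Domain \<Gamma> \<noteq> {}" using ne by auto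
  next
    fix P assume "P \<in> Domain \<Gamma>"
    then show "\<exists>N e F. openin (subtopology (zariski I) X) N \<and> P \<in> N \<and> (\<forall>j\<in>J. homogeneous e (F j)) \<and>
        (\<forall>v \<in> vecs I - {0}. proj_pt v \<in> N \<longrightarrow>
           (\<exists>w \<in> vecs J - {0}. (\<forall>j\<in>J. lookup w j = peval (lookup v) (F j)) \<and>
                               (proj_pt v, proj_pt w) \<in> \<Gamma>))"
      using op loc F by (intro exI[of _ "Domain \<Gamma>"] exI[of _ n] exI[of _ F]) blast
  qed (use sv op in auto)
qed

definition map_graph ::
  "'a set \<Rightarrow> (('a \<Rightarrow>\<^sub>0 complex) \<Rightarrow> ('b \<Rightarrow>\<^sub>0 complex)) \<Rightarrow> (('a \<Rightarrow>\<^sub>0 complex) set \<times> ('b \<Rightarrow>\<^sub>0 complex) set) set" where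
  "map_graph I h = {(proj_pt v, proj_pt (h v)) | v. v \<in> vecs I \<and> h v \<noteq> 0}"

text \<open>The inverse is \<open>y \<mapsto> D y * A y\<close>; the factor \<open>D\<close> removes the points at which the formula says nothing. On the image
  it recovers the preimage by \<open>DA\<close>. For a point \<open>w\<close> in the closure of the image, \<open>h\<close> maps the
  recovered point back to \<open>w\<close> because the two by two minors that express this proportionality vanish on the image and hence on its
  closure.\<close>

theorem birational_from_formula:
  assumes I: "finite I" and J: "finite J" and e: "e \<ge> 1" and \<eta>: "\<And>j. j \<in> J \<Longrightarrow> \<eta> j \<in> hom_fun I e"
    and h: "\<And>v. v \<in> vecs I \<Longrightarrow> h v \<in> vecs J"
      "\<And>v j. v \<in> vecs I \<Longrightarrow> j \<in> J \<Longrightarrow> lookup (h v) j = \<eta> j (lookup v)"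
    and p: "p \<in> vecs I" "h p \<noteq> 0" and i0: "i0 \<in> I" "lookup p i0 \<noteq> 0"
    and D: "D \<in> hom_fun J K" "D (\<lambda>j. \<eta> j (lookup p)) \<noteq> 0" and A: "\<And>i. i \<in> I \<Longrightarrow> A i \<in> hom_fun J K"
    and DA: "\<And>x i. i \<in> I \<Longrightarrow> D (\<lambda>j. \<eta> j x) * x i = A i (\<lambda>j. \<eta> j x) * (1 / lookup p i0 * x i0)"
  shows "birational_onto_image I J (map_graph I h)"
proof -
  define \<Gamma> where "\<Gamma> = map_graph I h"
  have \<eta>0: "\<eta> j x = 0" if "j \<in> J" "\<And>i. i \<in> I \<Longrightarrow> x i = 0" for j x
    using hom_fun_scaled[OF \<eta>[OF that(1)], of x 0 x] that e by (simp add: power_0_left split: if_splits)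
  have h_eq: "h v = vec_of J (\<lambda>j. \<eta> j (lookup v))" if "v \<in> vecs I" for v
    using that h J by (intro poly_mapping_eqI) (auto simp: lookup_vec_of lookup_outside[OF h(1)[OF that]])
  have h_ne: "h v \<noteq> 0 \<longleftrightarrow> (\<exists>j\<in>J. \<eta> j (lookup v) \<noteq> 0)" if "v \<in> vecs I" for v
    using vec_eq_0_iff[OF h(1)[OF that]] h(2)[OF that] by auto
  have h_0: "v \<noteq> 0" if "v \<in> vecs I" "h v \<noteq> 0" for v
    using that h_ne[OF that(1)] \<eta>0[of _ "lookup v"] by auto
  have \<Gamma>: "\<Gamma> = {(proj_pt v, proj_pt (vec_of J (\<lambda>j. \<eta> j (lookup v)))) |v.
       v \<in> vecs I - {0} \<and> proj_pt v \<in> proj_space I \<and> (\<exists>j\<in>J. \<eta> j (lookup v) \<noteq> 0)}"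
    unfolding \<Gamma>_def map_graph_def
  proof (intro Collect_cong ex_cong1)
    fix u v
    have ps: "proj_pt v \<in> proj_space I" if "v \<in> vecs I" "v \<noteq> 0"
      using that unfolding proj_space_def by blast
    show "(u = (proj_pt v, proj_pt (h v)) \<and> v \<in> vecs I \<and> h v \<noteq> 0) =
      (u = (proj_pt v, proj_pt (vec_of J (\<lambda>j. \<eta> j (lookup v)))) \<and>
       v \<in> vecs I - {0} \<and> proj_pt v \<in> proj_space I \<and> (\<exists>j\<in>J. \<eta> j (lookup v) \<noteq> 0))"
    proof (cases "v \<in> vecs I \<and> h v \<noteq> 0")
      case True
      then have v: "v \<in> vecs I" "h v \<noteq> 0" by auto
      show ?thesis using h_0[OF v] h_ne[OF v(1)] ps v unfolding h_eq[OF v(1), symmetric] by simp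
    next
      case False
      then show ?thesis using h_ne[of v] by auto
    qed
  qed
  have p\<Gamma>: "(proj_pt p, proj_pt (h p)) \<in> \<Gamma>" using p by (auto simp: \<Gamma>_def map_graph_def)
  have rat1: "rational_map I (proj_space I) J \<Gamma>"
    by (rule rational_map_given_by[OF I J _ \<eta> \<Gamma>]) (use p\<Gamma> in auto)
  define Y where "Y = Abstract_Topology.closure_of (zariski J) (Range \<Gamma>)"
  have Rsub: "Range \<Gamma> \<subseteq> topspace (zariski J)"
    unfolding topspace_zariski \<Gamma>_def map_graph_def proj_space_def using h(1) by auto
  have YX: "Y \<subseteq> proj_space J" unfolding Y_def topspace_zariski[symmetric] by (rule closure_of_subset_topspace)
  have vanish: "\<phi> (lookup w) = 0"
    if \<phi>: "\<phi> \<in> hom_fun J n" "\<And>v. v \<in> vecs I \<Longrightarrow> h v \<noteq> 0 \<Longrightarrow> \<phi> (lookup (h v)) = 0"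
      and w: "w \<in> vecs J - {0}" "proj_pt w \<in> Y" for \<phi> n w
  proof (rule ccontr)
    assume "\<phi> (lookup w) \<noteq> 0"
    then have "proj_pt w \<in> principal_open J \<phi>" using principal_open_iff[OF \<phi>(1) w(1)] by blast
    then obtain y where y: "y \<in> Range \<Gamma>" "y \<in> principal_open J \<phi>"
      using w(2) openin_principal[OF \<phi>(1)] unfolding Y_def in_closure_of by blast
    then obtain v where v: "v \<in> vecs I" "h v \<noteq> 0" "y = proj_pt (h v)" by (auto simp: \<Gamma>_def map_graph_def)
    then have "\<phi> (lookup (h v)) \<noteq> 0"
      using y(2) principal_open_iff[OF \<phi>(1), of "h v"] h(1) by auto
    then show False using \<phi>(2) v by blast
  qed
  define B where "B i y = D y * A i y" for i y
  have B: "B i \<in> hom_fun J (K + K)" if "i \<in> I" for i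
    unfolding B_def[abs_def] by (intro hom_fun_mult D A that)
  define u where "u w = vec_of I (\<lambda>i. B i (lookup w))" for w
  have u_ne: "u w \<noteq> 0 \<longleftrightarrow> (\<exists>i\<in>I. B i (lookup w) \<noteq> 0)" for w
    using vec_eq_0_iff[OF vec_of_vecs[OF I]] I by (auto simp: u_def lookup_vec_of)
  have uh: "\<exists>c. c \<noteq> 0 \<and> (\<forall>i\<in>I. B i (lookup (h v)) = c * lookup v i)"
    if v: "v \<in> vecs I" "h v \<noteq> 0" "u (h v) \<noteq> 0" for v
  proof -
    have eq: "B i (lookup (h v)) = B i (\<lambda>j. \<eta> j (lookup v))" if "i \<in> I" for i
      by (rule hom_fun_cong[OF B[OF that]]) (simp add: h v)
    obtain i where i: "i \<in> I" "B i (\<lambda>j. \<eta> j (lookup v)) \<noteq> 0" using v(3) u_ne eq by auto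
    define d where "d = D (\<lambda>j. \<eta> j (lookup v))"
    have d: "d \<noteq> 0" using i by (auto simp: B_def d_def)
    define s where "s = 1 / lookup p i0 * lookup v i0"
    have dv: "d * lookup v i = A i (\<lambda>j. \<eta> j (lookup v)) * s" if "i \<in> I" for i
      unfolding d_def s_def by (rule DA[OF that])
    have s: "s \<noteq> 0"
    proof
      assume "s = 0"
      then have "\<forall>i\<in>I. lookup v i = 0" using dv d by auto
      then show False using h_0[OF v(1,2)] vec_eq_0_iff[OF v(1)] by blast
    qed
    have "B i (lookup (h v)) = (d * d / s) * lookup v i" if "i \<in> I" for i
      unfolding eq[OF that] using dv[OF that] s by (simp add: B_def d_def[symmetric] field_simps)
    then show ?thesis using d s by (intro exI[of _ "d * d / s"]) auto
  qed
  have u_pt: "proj_pt (u (h v)) = proj_pt v" if v: "v \<in> vecs I" "h v \<noteq> 0" "u (h v) \<noteq> 0" for v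
  proof -
    obtain c where c: "c \<noteq> 0" "\<forall>i\<in>I. B i (lookup (h v)) = c * lookup v i" using uh[OF v] by blast
    have "lookup (u (h v)) i = c * lookup v i" for i
      using c(2) v(1) I by (auto simp: u_def lookup_vec_of lookup_outside)
    then show ?thesis using c(1) proj_pt_eqI by metis
  qed
  have u_scale: "lookup (u w') i = c ^ (K + K) * lookup (u w) i"
    if "\<And>j. lookup w' j = c * lookup w j" for w w' c i
    using hom_fun_scaled[OF B, of i "lookup w'" c "lookup w"] that I by (auto simp: u_def lookup_vec_of)
  define \<Delta> where "\<Delta> = {(proj_pt w, proj_pt (vec_of I (\<lambda>i. B i (lookup w)))) |w.
       w \<in> vecs J - {0} \<and> proj_pt w \<in> Y \<and> (\<exists>i\<in>I. B i (lookup w) \<noteq> 0)}"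
  have hpY: "proj_pt (h p) \<in> Y"
    unfolding Y_def using closure_of_subset[OF Rsub] p\<Gamma> by blast
  have "B i0 (lookup (h p)) = B i0 (\<lambda>j. \<eta> j (lookup p))"
    by (rule hom_fun_cong[OF B[OF i0(1)]]) (simp add: h p)
  moreover have "A i0 (\<lambda>j. \<eta> j (lookup p)) \<noteq> 0" using DA[OF i0(1), of "lookup p"] D(2) i0(2) by auto
  ultimately have "B i0 (lookup (h p)) \<noteq> 0" using D(2) by (simp add: B_def)
  then have ne: "\<Delta> \<noteq> {}" unfolding \<Delta>_def using hpY i0(1) p h(1) by blast
  have rat2: "rational_map J Y I \<Delta>"
    by (rule rational_map_given_by[OF J I YX B \<Delta>_def ne])
  have "\<Gamma> O \<Delta> \<subseteq> Id"
  proof (rule subrelI)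
    fix x z assume "(x, z) \<in> \<Gamma> O \<Delta>"
    then obtain y where "(x, y) \<in> \<Gamma>" "(y, z) \<in> \<Delta>" by blast
    then obtain v w where v: "x = proj_pt v" "y = proj_pt (h v)" "v \<in> vecs I" "h v \<noteq> 0"
      and w: "y = proj_pt w" "z = proj_pt (u w)" "u w \<noteq> 0"
      unfolding \<Gamma>_def map_graph_def \<Delta>_def u_ne unfolding u_def by blast
    have "proj_pt w = proj_pt (h v)" using v w by simp
    then obtain c where c: "c \<noteq> 0" "\<And>j. lookup (h v) j = c * lookup w j" by (rule proj_pt_eqE) blast
    note us = u_scale[of "h v" c w, OF c(2)]
    have "proj_pt (u w) = proj_pt (u (h v))" by (rule proj_pt_eqI[OF us]) (use c in simp)
    moreover have "u (h v) \<noteq> 0"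
    proof
      assume "u (h v) = 0"
      then have "lookup (u w) i = 0" for i using us[of i] c(1) by simp
      then show False using w(3) by (metis lookup_zero poly_mapping_eqI)
    qed
    ultimately show "(x, z) \<in> Id" using u_pt[OF v(3,4)] v w by simp
  qed
  moreover have "\<Delta> O \<Gamma> \<subseteq> Id"
  proof (rule subrelI)
    fix x z assume "(x, z) \<in> \<Delta> O \<Gamma>"
    then obtain y where "(x, y) \<in> \<Delta>" "(y, z) \<in> \<Gamma>" by blast
    then obtain v w where v: "y = proj_pt v" "z = proj_pt (h v)" "v \<in> vecs I" "h v \<noteq> 0"
      and w: "x = proj_pt w" "y = proj_pt (u w)" "w \<in> vecs J - {0}" "proj_pt w \<in> Y"
      unfolding \<Gamma>_def map_graph_def \<Delta>_def u_ne unfolding u_def by blast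
    have "proj_pt (u w) = proj_pt v" using v w by simp
    then obtain c where c: "c \<noteq> 0" "\<And>i. lookup v i = c * lookup (u w) i" by (rule proj_pt_eqE) blast
    have hv: "lookup (h v) j = c ^ e * \<eta> j (\<lambda>i. B i (lookup w))" if j: "j \<in> J" for j
    proof -
      have "\<eta> j (lookup v) = c ^ e * \<eta> j (\<lambda>i. B i (lookup w))"
        by (rule hom_fun_scaled[OF \<eta>[OF j]]) (simp add: c(2) u_def lookup_vec_of I)
      then show ?thesis using h(2)[OF v(3) j] by simp
    qed
    have minors: "lookup (h v) j * lookup w k = lookup (h v) k * lookup w j" if jk: "j \<in> J" "k \<in> J" for j k
    proof -
      define \<phi> where "\<phi> y = \<eta> j (\<lambda>i. B i y) * y k - \<eta> k (\<lambda>i. B i y) * y j" for y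
      have "\<phi> \<in> hom_fun J (e * (K + K) + 1)"
        unfolding \<phi>_def[abs_def] by (intro hom_fun_diff hom_fun_mult hom_fun_compose[OF I \<eta> B] hom_fun_coord jk)
      moreover have "\<phi> (lookup (h v')) = 0" if v': "v' \<in> vecs I" "h v' \<noteq> 0" for v'
      proof (cases "u (h v') = 0")
        case True
        then have "\<eta> l (\<lambda>i. B i (lookup (h v'))) = 0" if "l \<in> J" for l
          using that u_ne by (intro \<eta>0) auto
        then show ?thesis using jk by (simp add: \<phi>_def)
      next
        case False
        then obtain a where "\<forall>i\<in>I. B i (lookup (h v')) = a * lookup v' i" using uh v' by blast
        then have "\<eta> l (\<lambda>i. B i (lookup (h v'))) = a ^ e * lookup (h v') l" if "l \<in> J" for l
          using that h(2)[OF v'(1) that] hom_fun_scaled[OF \<eta>[OF that], of "\<lambda>i. B i (lookup (h v'))" a "lookup v'"] by simp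
        then show ?thesis using jk by (simp add: \<phi>_def)
      qed
      ultimately have "\<phi> (lookup w) = 0" by (rule vanish[OF _ _ w(3,4)])
      then show ?thesis using hv[OF jk(1)] hv[OF jk(2)] by (simp add: \<phi>_def)
    qed
    obtain j where j: "j \<in> J" "lookup (h v) j \<noteq> 0" using vec_eq_0_iff[OF h(1)[OF v(3)]] v(4) by blast
    define a where "a = lookup w j / lookup (h v) j"
    have wa: "lookup w k = a * lookup (h v) k" for k
    proof (cases "k \<in> J")
      case True
      then show ?thesis using minors[OF j(1) True] j(2) by (simp add: a_def field_simps)
    next
      case False
      then show ?thesis using w(3) h(1)[OF v(3)] by (auto simp: lookup_outside)
    qed
    have "a \<noteq> 0"
    proof
      assume "a = 0"
      then have "w = 0" using wa by (intro poly_mapping_eqI) simp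
      then show False using w(3) by simp
    qed
    then have "proj_pt (h v) = proj_pt w" by (rule proj_pt_eqI[OF wa])
    then show "(x, z) \<in> Id" using v w by simp
  qed
  ultimately show ?thesis
    unfolding birational_onto_image_def \<Gamma>_def[symmetric]
    using rat1 rat2 unfolding Y_def by blast
qed

section \<open>The product of two projective spaces\<close>

lemma bihomogeneous_bihom_fun:
  fixes F :: "('a + 'b) cpoly"
  assumes I: "finite I" and "bihomogeneous a b F"
  shows "\<exists>\<Phi>\<in>bihom_fun I J a b. \<forall>v\<in>vecs I. \<forall>w\<in>vecs J.
           \<Phi> (lookup v) (lookup w) = peval (case_sum (lookup v) (lookup w)) F"
proof -
  have "\<forall>m\<in>keys F. \<exists>\<Phi>. \<Phi> \<in> bihom_fun I J a b \<and> (\<forall>v\<in>vecs I. \<forall>w\<in>vecs J.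
           \<Phi> (lookup v) (lookup w) = lookup F m * mono_val (case_sum (lookup v) (lookup w)) m)"
  proof
    fix m assume m: "m \<in> keys F"
    define K1 where "K1 = {x. Inl x \<in> keys m}"
    define K2 where "K2 = {y. Inr y \<in> keys m}"
    have ab: "(\<Sum>x\<in>K1. lookup m (Inl x)) = a" "(\<Sum>y\<in>K2. lookup m (Inr y)) = b"
      using assms(2) m by (auto simp: bihomogeneous_def K1_def K2_def)
    have K: "keys m = Inl ` K1 \<union> Inr ` K2"
    proof (rule Set.set_eqI)
      fix k show "k \<in> keys m \<longleftrightarrow> k \<in> Inl ` K1 \<union> Inr ` K2"
        by (cases k) (auto simp: K1_def K2_def)
    qed
    have fin: "finite K1" "finite K2"
      unfolding K1_def K2_def by (rule finite_vimageI[of "keys m" Inl, unfolded vimage_def], simp, simp)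
        (rule finite_vimageI[of "keys m" Inr, unfolded vimage_def], simp, simp)
    have mv: "mono_val (case_sum x y) m = (\<Prod>i\<in>K1. x i ^ lookup m (Inl i)) * (\<Prod>j\<in>K2. y j ^ lookup m (Inr j))" for x y
      unfolding mono_val_def K using fin
      by (subst prod.union_disjoint) (auto simp: prod.reindex inj_on_def)
    show "\<exists>\<Phi>. \<Phi> \<in> bihom_fun I J a b \<and> (\<forall>v\<in>vecs I. \<forall>w\<in>vecs J.
           \<Phi> (lookup v) (lookup w) = lookup F m * mono_val (case_sum (lookup v) (lookup w)) m)"
    proof (cases "K1 \<subseteq> I \<and> K2 \<subseteq> J")
      case True
      have 1: "(\<lambda>x. \<Prod>i\<in>K1. x i ^ lookup m (Inl i)) \<in> hom_fun I (\<Sum>i\<in>K1. lookup m (Inl i) * 1)"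
        using True by (intro hom_fun_prod fin hom_fun_power hom_fun_coord) auto
      have 2: "(\<lambda>x. \<Prod>i\<in>K2. x i ^ lookup m (Inr i)) \<in> hom_fun J (\<Sum>i\<in>K2. lookup m (Inr i) * 1)"
        using True by (intro hom_fun_prod fin hom_fun_power hom_fun_coord) auto
      have "(\<lambda>x y. (lookup F m * (\<Prod>i\<in>K1. x i ^ lookup m (Inl i))) * (\<Prod>j\<in>K2. y j ^ lookup m (Inr j))) \<in> bihom_fun I J a b"
        using 1 2 ab by (intro bihom_fun_hom_fun I hom_fun_cmult) auto
      then show ?thesis by (intro exI conjI) (auto simp: mv mult.assoc)
    next
      case False
      have "mono_val (case_sum (lookup v) (lookup w)) m = 0" if vw: "v \<in> vecs I" "w \<in> vecs J" for v w
      proof -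
        consider i where "i \<in> K1" "i \<notin> I" | j where "j \<in> K2" "j \<notin> J" using False by blast
        then show ?thesis
        proof cases
          case 1
          then have "lookup v i ^ lookup m (Inl i) = 0"
            using lookup_outside[OF vw(1)] by (simp add: K1_def in_keys_iff)
          then have "(\<Prod>i\<in>K1. lookup v i ^ lookup m (Inl i)) = 0" using 1 fin by (intro prod_zero) auto
          then show ?thesis by (simp add: mv)
        next
          case 2
          then have "lookup w j ^ lookup m (Inr j) = 0"
            using lookup_outside[OF vw(2)] by (simp add: K2_def in_keys_iff)
          then have "(\<Prod>i\<in>K2. lookup w i ^ lookup m (Inr i)) = 0" using 2 fin by (intro prod_zero) auto
          then show ?thesis by (simp add: mv)
        qed
      qed
      then show ?thesis using bihom_fun_0 by (intro exI[of _ "\<lambda>x y. 0"]) auto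
    qed
  qed
  from bchoice[OF this] obtain \<Phi> where \<Phi>: "\<forall>m\<in>keys F. \<Phi> m \<in> bihom_fun I J a b \<and> (\<forall>v\<in>vecs I. \<forall>w\<in>vecs J.
           \<Phi> m (lookup v) (lookup w) = lookup F m * mono_val (case_sum (lookup v) (lookup w)) m)" ..
  have "(\<lambda>x y. \<Sum>m\<in>keys F. \<Phi> m x y) \<in> bihom_fun I J a b"
    using \<Phi> by (intro bihom_fun_sum) auto
  moreover have "(\<Sum>m\<in>keys F. \<Phi> m (lookup v) (lookup w)) = peval (case_sum (lookup v) (lookup w)) F"
    if "v \<in> vecs I" "w \<in> vecs J" for v w
    unfolding peval_superset[OF finite_keys subset_refl] using \<Phi> that by (intro sum.cong) auto
  ultimately show ?thesis by (intro bexI[of _ "\<lambda>x y. \<Sum>m\<in>keys F. \<Phi> m x y"]) auto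
qed

lemma bihom_fun_scaled:
  assumes "finite I" "\<Phi> \<in> bihom_fun I J n k" "\<And>i. x' i = c * x i" "\<And>j. y' j = c' * y j"
  shows "\<Phi> x' y' = c ^ n * c' ^ k * \<Phi> x y"
proof -
  have "x' = (\<lambda>i. c * x i)" "y' = (\<lambda>j. c' * y j)" using assms by auto
  then show ?thesis using bihom_fun_scale[OF assms(1,2)] by simp
qed

text \<open>The product of two bihomogeneous functions is bihomogeneous, so the sets that generate the topology are even a basis.\<close>

lemma zariski2_nbhd:
  assumes I: "finite I" and U: "openin (zariski2 I J) U" "(proj_pt v, proj_pt w) \<in> U"
    and vw: "v \<in> vecs I - {0}" "w \<in> vecs J - {0}"
  shows "\<exists>n k. \<exists>\<Phi>\<in>bihom_fun I J n k. \<Phi> (lookup v) (lookup w) \<noteq> 0 \<and>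
    (\<forall>v'\<in>vecs I - {0}. \<forall>w'\<in>vecs J - {0}. \<Phi> (lookup v') (lookup w') \<noteq> 0 \<longrightarrow> (proj_pt v', proj_pt w') \<in> U)"
  using U unfolding zariski2_def openin_topology_generated_by_iff
proof (induction rule: generate_topology_on.induct)
  case Empty then show ?case by simp
next
  case (Int S T)
  then obtain n k \<Phi> n' k' \<Phi>' where *: "\<Phi> \<in> bihom_fun I J n k" "\<Phi>' \<in> bihom_fun I J n' k'"
    "\<Phi> (lookup v) (lookup w) \<noteq> 0" "\<Phi>' (lookup v) (lookup w) \<noteq> 0"
    "\<forall>v'\<in>vecs I - {0}. \<forall>w'\<in>vecs J - {0}. \<Phi> (lookup v') (lookup w') \<noteq> 0 \<longrightarrow> (proj_pt v', proj_pt w') \<in> S"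
    "\<forall>v'\<in>vecs I - {0}. \<forall>w'\<in>vecs J - {0}. \<Phi>' (lookup v') (lookup w') \<noteq> 0 \<longrightarrow> (proj_pt v', proj_pt w') \<in> T"
    by auto
  show ?case
    by (rule exI, rule exI, rule bexI[OF _ bihom_fun_mult[OF I *(1,2)]]) (use *(3-6) in auto)
next
  case (UN K)
  then obtain k where "k \<in> K" "(proj_pt v, proj_pt w) \<in> k" by blast
  with UN.IH[OF this] show ?case by (meson UnionI)
next
  case (Basis S)
  then obtain F a b where F: "bihomogeneous a b F" "S = {(proj_pt v, proj_pt w) | v w. v \<in> vecs I - {0} \<and> w \<in> vecs J - {0} \<and>
          peval (case_sum (lookup v) (lookup w)) F \<noteq> 0}" by blast
  obtain \<Phi> where \<Phi>: "\<Phi> \<in> bihom_fun I J a b" "\<forall>v\<in>vecs I. \<forall>w\<in>vecs J.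
           \<Phi> (lookup v) (lookup w) = peval (case_sum (lookup v) (lookup w)) F"
    using bihomogeneous_bihom_fun[OF I F(1)] by blast
  have S: "S = {(proj_pt v, proj_pt w) | v w. v \<in> vecs I - {0} \<and> w \<in> vecs J - {0} \<and> \<Phi> (lookup v) (lookup w) \<noteq> 0}"
    unfolding F(2) using \<Phi>(2) by (metis (no_types, lifting) DiffD1)
  obtain v1 w1 where 1: "proj_pt v = proj_pt v1" "proj_pt w = proj_pt w1" "\<Phi> (lookup v1) (lookup w1) \<noteq> 0"
    using Basis(2) unfolding S by blast
  obtain c where c: "\<And>i. lookup v1 i = c * lookup v i" using 1(1) by (rule proj_pt_eqE) blast
  obtain c' where c': "\<And>i. lookup w1 i = c' * lookup w i" using 1(2) by (rule proj_pt_eqE) blast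
  have "\<Phi> (lookup v) (lookup w) \<noteq> 0"
    using 1(3) bihom_fun_scaled[OF I \<Phi>(1), of "lookup v1" c "lookup v" "lookup w1" c' "lookup w"] c c' by auto
  then show ?case using \<Phi>(1) unfolding S by (intro exI[of _ a] exI[of _ b] bexI[of _ \<Phi>]) blast+
qed

lemma topspace_zariski2: "proj_space I \<times> proj_space J \<subseteq> topspace (zariski2 I J)"
proof -
  have "bihomogeneous 0 0 (1 :: ('a + 'b) cpoly)" by (simp add: bihomogeneous_def)
  then have "{(proj_pt v, proj_pt w) | v w. v \<in> vecs I - {0} \<and> w \<in> vecs J - {0} \<and> peval (case_sum (lookup v) (lookup w)) 1 \<noteq> 0} \<in>
      {{(proj_pt v, proj_pt w) | v w. v \<in> vecs I - {0} \<and> w \<in> vecs J - {0} \<and>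
          peval (case_sum (lookup v) (lookup w)) F \<noteq> 0} | F. \<exists>a b. bihomogeneous a b F}"
    by blast
  from Union_upper[OF this] have "{(proj_pt v, proj_pt w) | v w. v \<in> vecs I - {0} \<and> w \<in> vecs J - {0} \<and>
      peval (case_sum (lookup v) (lookup w)) 1 \<noteq> 0} \<subseteq> topspace (zariski2 I J)"
    unfolding zariski2_def topology_generated_by_topspace .
  moreover have "proj_space I \<times> proj_space J \<subseteq> {(proj_pt v, proj_pt w) | v w. v \<in> vecs I - {0} \<and> w \<in> vecs J - {0} \<and>
      peval (case_sum (lookup v) (lookup w)) 1 \<noteq> 0}"
    by (auto simp: proj_space_def)
  ultimately show ?thesis by (rule subset_trans[rotated])
qed

lemma not_in_closure_equation:
  assumes I: "finite I" and vw: "v \<in> vecs I - {0}" "w \<in> vecs J - {0}"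
    and not: "(proj_pt v, proj_pt w) \<notin> Abstract_Topology.closure_of (zariski2 I J) (map_graph I h)"
    and h: "\<And>v. v \<in> vecs I \<Longrightarrow> h v \<in> vecs J" "h 0 = 0"
  shows "\<exists>n k. \<exists>\<Phi>\<in>bihom_fun I J n k. \<Phi> (lookup v) (lookup w) \<noteq> 0 \<and>
    (\<forall>x\<in>vecs I. h x \<noteq> 0 \<longrightarrow> \<Phi> (lookup x) (lookup (h x)) = 0)"
proof -
  have "(proj_pt v, proj_pt w) \<in> topspace (zariski2 I J)"
    using topspace_zariski2 vw by (fastforce simp: proj_space_def)
  then obtain U where U: "openin (zariski2 I J) U" "(proj_pt v, proj_pt w) \<in> U"
    "\<And>P. P \<in> map_graph I h \<Longrightarrow> P \<notin> U"
    using not unfolding in_closure_of by blast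
  from zariski2_nbhd[OF I U(1,2) vw] obtain n k \<Phi> where \<Phi>: "\<Phi> \<in> bihom_fun I J n k" "\<Phi> (lookup v) (lookup w) \<noteq> 0"
    "\<forall>v'\<in>vecs I - {0}. \<forall>w'\<in>vecs J - {0}. \<Phi> (lookup v') (lookup w') \<noteq> 0 \<longrightarrow> (proj_pt v', proj_pt w') \<in> U"
    by blast
  have "\<Phi> (lookup x) (lookup (h x)) = 0" if x: "x \<in> vecs I" "h x \<noteq> 0" for x
  proof (rule ccontr)
    assume "\<not> ?thesis"
    moreover have "x \<noteq> 0" using x h(2) by auto
    ultimately have "(proj_pt x, proj_pt (h x)) \<in> U" using \<Phi>(3) x h(1) by blast
    then show False using U(3) x by (auto simp: map_graph_def)
  qed
  then show ?thesis using \<Phi> by blast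
qed

section \<open>Values and coefficients of the Hessian\<close>

lemma sign_eq: "sign \<pi> = 1 \<or> sign \<pi> = - 1"
  by (simp add: sign_def)

lemma peval_of_sign [simp]: "peval x (of_int (sign \<pi>)) = of_int (sign \<pi>)"
  using sign_eq[of \<pi>] by auto

lemma peval_signof: "peval x (signof \<pi> * q) = signof \<pi> * peval x q"
  using sign_eq[of \<pi>] by auto

lemma peval_det:
  "peval x (Determinant.det (mat n n (\<lambda>(i, j). M i j))) = Determinant.det (mat n n (\<lambda>(i, j). peval x (M i j)))"
proof -
  have "(\<Prod>i = 0..<n. mat n n (\<lambda>(i, j). peval x (M i j)) $$ (i, \<pi> i)) =
        peval x (\<Prod>i = 0..<n. mat n n (\<lambda>(i, j). M i j) $$ (i, \<pi> i))" if "\<pi> permutes {0..<n}" for \<pi>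
  proof -
    have \<pi>: "\<pi> i < n" if "i < n" for i
      using permutes_in_image[OF \<open>\<pi> permutes _\<close>, of i] that by simp
    show ?thesis unfolding peval_prod by (rule prod.cong) (auto simp: \<pi>)
  qed
  then show ?thesis
    by (simp add: det_def'[of _ n] peval_signof)
qed

lemma peval_Hess:
  "peval x (Hess r f) = Determinant.det (mat (r + 1) (r + 1) (\<lambda>(i, j). peval x (pdiff i (pdiff j f))))"
  unfolding Hess_def by (rule peval_det)

lemma vecs_signof: "q \<in> vecs I \<Longrightarrow> signof \<pi> * (q :: 'v cpoly) \<in> vecs I"
  using sign_eq[of \<pi>] vecs_diff[of 0 I q] by auto

lemma Hess_forms:
  assumes "f \<in> vecs (mons {..r} d)"
  shows "Hess r f \<in> vecs (mons {..r} ((d - 2) * (r + 1)))"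
proof -
  let ?M = "mat (r + 1) (r + 1) (\<lambda>(i, j). pdiff i (pdiff j f))"
  have M: "?M $$ (i, \<pi> i) \<in> vecs (mons {..r} (d - 2))" if "\<pi> permutes {0..<r + 1}" "i < r + 1" for i \<pi>
  proof -
    have "\<pi> i < r + 1" using permutes_in_image[OF that(1), of i] that(2) by simp
    moreover have "d - 2 = d - 1 - 1" by simp
    ultimately show ?thesis using that(2) vecs_pdiff[OF vecs_pdiff[OF assms]] by simp
  qed
  have prod: "(\<Prod>i = 0..<r + 1. ?M $$ (i, \<pi> i)) \<in> vecs (mons {..r} (\<Sum>i = 0..<r + 1. d - 2))"
    if "\<pi> permutes {0..<r + 1}" for \<pi>
    using M[OF that] by (intro vecs_prod) auto
  have deg: "(\<Sum>i = 0..<r + 1. d - 2) = (d - 2) * (r + 1)" by simp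
  have eq: "Hess r f = (\<Sum>\<pi> | \<pi> permutes {0..<r + 1}. signof \<pi> * (\<Prod>i = 0..<r + 1. ?M $$ (i, \<pi> i)))"
    unfolding Hess_def by (rule det_def') simp
  show ?thesis
    unfolding eq using prod unfolding deg by (intro vecs_sum vecs_signof) blast
qed

definition hom_coeffs :: "'i set \<Rightarrow> nat \<Rightarrow> (('i \<Rightarrow> complex) \<Rightarrow> 'v cpoly) \<Rightarrow> bool" where
  "hom_coeffs I n A \<longleftrightarrow> (\<forall>m. (\<lambda>x. lookup (A x) m) \<in> hom_fun I n)"

lemma hom_coeffs_mult: "hom_coeffs I n A \<Longrightarrow> hom_coeffs I k B \<Longrightarrow> hom_coeffs I (n + k) (\<lambda>x. A x * B x)"
  unfolding hom_coeffs_def lookup_mult_splits split_def by (intro allI hom_fun_sum hom_fun_mult) auto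

lemma hom_coeffs_1: "hom_coeffs I 0 (\<lambda>x. 1)"
  unfolding hom_coeffs_def by (simp add: hom_fun_const)

lemma hom_coeffs_prod:
  "finite K \<Longrightarrow> (\<And>k. k \<in> K \<Longrightarrow> hom_coeffs I n (A k)) \<Longrightarrow> hom_coeffs I (card K * n) (\<lambda>x. \<Prod>k\<in>K. A k x)"
  by (induction K rule: finite_induct) (auto intro: hom_coeffs_mult hom_coeffs_1)

lemma hom_coeffs_sum:
  "(\<And>k. k \<in> K \<Longrightarrow> hom_coeffs I n (A k)) \<Longrightarrow> hom_coeffs I n (\<lambda>x. \<Sum>k\<in>K. A k x)"
  unfolding hom_coeffs_def lookup_sum by (intro allI hom_fun_sum) auto

lemma hom_coeffs_signof: "hom_coeffs I n A \<Longrightarrow> hom_coeffs I n (\<lambda>x. signof \<pi> * A x)"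
  using sign_eq[of \<pi>] hom_fun_cmult[of _ I n "-1"] unfolding hom_coeffs_def by auto

lemma hom_coeffs_pdiff: "hom_coeffs I n A \<Longrightarrow> hom_coeffs I n (\<lambda>x. pdiff i (A x))"
  unfolding hom_coeffs_def lookup_pdiff by (intro allI hom_fun_cmult) auto

lemma hom_coeffs_vec_of: "finite I \<Longrightarrow> hom_coeffs I 1 (vec_of I)"
  unfolding hom_coeffs_def
proof
  fix m assume I: "finite I"
  show "(\<lambda>x. lookup (vec_of I x) m) \<in> hom_fun I 1"
    using hom_fun_coord[of m I] hom_fun_0[of I 1] by (cases "m \<in> I") (simp_all add: lookup_vec_of I)
qed

lemma hom_coeffs_Hess:
  assumes "finite I" shows "hom_coeffs I (r + 1) (\<lambda>x. Hess r (vec_of I x))"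
proof -
  let ?M = "\<lambda>x. mat (r + 1) (r + 1) (\<lambda>(i, j). pdiff i (pdiff j (vec_of I x)))"
  have M: "hom_coeffs I 1 (\<lambda>x. ?M x $$ (i, \<pi> i))" if "\<pi> permutes {0..<r + 1}" "i < r + 1" for i \<pi>
  proof -
    have "\<pi> i < r + 1" using permutes_in_image[OF that(1), of i] that(2) by simp
    then show ?thesis using that(2) hom_coeffs_pdiff[OF hom_coeffs_pdiff[OF hom_coeffs_vec_of[OF assms]]] by simp
  qed
  have "hom_coeffs I (card {0..<r + 1} * 1) (\<lambda>x. \<Prod>i = 0..<r + 1. ?M x $$ (i, \<pi> i))"
    if "\<pi> permutes {0..<r + 1}" for \<pi>
    using M[OF that] by (intro hom_coeffs_prod) auto
  then have "hom_coeffs I (r + 1) (\<lambda>x. \<Sum>\<pi> | \<pi> permutes {0..<r + 1}. signof \<pi> * (\<Prod>i = 0..<r + 1. ?M x $$ (i, \<pi> i)))"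
    by (intro hom_coeffs_sum hom_coeffs_signof) auto
  then show ?thesis unfolding Hess_def by (subst det_def'[of _ "r + 1"]) auto
qed

lemma Hess_0: "Hess r 0 = 0"
proof (rule peval_inject)
  fix x
  have "mat (r + 1) (r + 1) (\<lambda>(i, j). peval x (pdiff i (pdiff j 0))) = 0 \<cdot>\<^sub>m mat (r + 1) (r + 1) (\<lambda>_. 0)"
    by (rule eq_matI) auto
  then show "peval x (Hess r 0) = peval x 0" unfolding peval_Hess by simp
qed

section \<open>Linear substitutions\<close>

definition lin_map :: "nat \<Rightarrow> (nat \<Rightarrow> nat \<Rightarrow> complex) \<Rightarrow> (nat \<Rightarrow> complex) \<Rightarrow> nat \<Rightarrow> complex" where
  "lin_map r \<delta> x i = (\<Sum>k\<le>r. \<delta> i k * x k)"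

text \<open>The substitution of the linear forms given by the rows of \<open>\<delta>\<close> for the variables.\<close>

definition act :: "nat \<Rightarrow> (nat \<Rightarrow> nat \<Rightarrow> complex) \<Rightarrow> nat cpoly \<Rightarrow> nat cpoly" where
  "act r \<delta> f = (\<Sum>m\<in>keys f. cC (lookup f m) * (\<Prod>i\<in>keys m. (\<Sum>k\<le>r. cC (\<delta> i k) * cX k) ^ lookup m i))"

lemma peval_act [simp]: "peval x (act r \<delta> f) = peval (lin_map r \<delta> x) f"
  by (simp add: act_def peval_def[of "lin_map r \<delta> x"] lin_map_def)

lemma act_forms: 
  assumes "f \<in> vecs (mons {..r} n)"
  shows "act r \<delta> f \<in> vecs (mons {..r} n)"
proof -
  have L: "(\<Sum>k\<le>r. cC (\<delta> i k) * cX k) \<in> vecs (mons {..r} 1)" for i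
    by (intro vecs_sum vecs_cC_mult vecs_cX) auto
  have "(\<Prod>i\<in>keys m. (\<Sum>k\<le>r. cC (\<delta> i k) * cX k) ^ lookup m i) \<in> vecs (mons {..r} (\<Sum>i\<in>keys m. lookup m i * 1))" for m
    by (intro vecs_prod vecs_power L) auto
  then show ?thesis unfolding act_def
    using assms by (intro vecs_sum vecs_cC_mult) (auto simp: vecs_def mons_def mdeg_def)
qed

lemma hom_coeffs_act: "finite I \<Longrightarrow> hom_coeffs I 1 (\<lambda>x. act r \<delta> (vec_of I x))"
proof -
  assume I: "finite I"
  let ?L = "\<lambda>m. \<Prod>i\<in>keys m. (\<Sum>k\<le>r. cC (\<delta> i k) * cX k) ^ lookup m i"
  have "act r \<delta> (vec_of I x) = (\<Sum>m\<in>I. cC (x m) * ?L m)" for x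
  proof (rule peval_inject)
    fix y
    have "keys (vec_of I x) \<subseteq> I" using vec_of_vecs[OF I] by (auto simp: vecs_def)
    then have "peval y (act r \<delta> (vec_of I x)) = (\<Sum>m\<in>I. lookup (vec_of I x) m * mono_val (lin_map r \<delta> y) m)"
      unfolding peval_act by (rule peval_superset[OF I])
    also have "\<dots> = peval y (\<Sum>m\<in>I. cC (x m) * ?L m)"
      by (simp add: lookup_vec_of I mono_val_def lin_map_def)
    finally show "peval y (act r \<delta> (vec_of I x)) = peval y (\<Sum>m\<in>I. cC (x m) * ?L m)" .
  qed
  moreover have "(\<lambda>x. \<Sum>m\<in>I. lookup (?L m) k * x m) \<in> hom_fun I 1" for k
    by (intro hom_fun_sum hom_fun_cmult hom_fun_coord)
  ultimately show ?thesis
    unfolding hom_coeffs_def by (simp add: lookup_sum mult.commute)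
qed

lemma act_add: "act r \<delta> (f + g) = act r \<delta> f + act r \<delta> g"
  by (rule peval_inject) simp

lemma act_cC_mult: "act r \<delta> (cC c * f) = cC c * act r \<delta> f"
  by (rule peval_inject) simp

lemma act_0 [simp]: "act r \<delta> 0 = 0"
  by (simp add: act_def)

lemma pdiff_act:
  assumes f: "f \<in> vecs (mons {..r} n)" and j: "j \<le> r"
  shows "pdiff j (act r \<delta> f) = (\<Sum>l\<le>r. cC (\<delta> l j) * act r \<delta> (pdiff l f))"
proof (rule peval_inject)
  fix x
  define u where "u k = (if k = j then 1 else (0::complex))" for k
  have vars: "keys m \<subseteq> {..r}" if "m \<in> keys g" "g \<in> vecs (mons {..r} n)" for m g
    using that by (auto simp: vecs_def mons_def)
  have "((\<lambda>t. peval (\<lambda>k. x k + t * u k) (act r \<delta> f)) has_field_derivative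
      (\<Sum>i\<le>r. u i * peval x (pdiff i (act r \<delta> f)))) (at 0)"
    by (rule peval_line_deriv) (use vars act_forms[OF f] in auto)
  moreover have "(\<Sum>i\<le>r. u i * peval x (pdiff i (act r \<delta> f))) = peval x (pdiff j (act r \<delta> f))"
    using j by (simp add: u_def if_distrib[of "\<lambda>a. a * _"] sum.delta cong: if_cong)
  moreover have "lin_map r \<delta> (\<lambda>k. x k + t * u k) = (\<lambda>k. lin_map r \<delta> x k + t * \<delta> k j)" for t
  proof
    fix k
    have "(\<Sum>l\<le>r. \<delta> k l * (t * u l)) = (\<Sum>l\<le>r. if l = j then t * \<delta> k l else 0)"
      by (rule sum.cong) (auto simp: u_def)
    then show "lin_map r \<delta> (\<lambda>k. x k + t * u k) k = lin_map r \<delta> x k + t * \<delta> k j"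
      using j by (simp add: lin_map_def distrib_left sum.distrib sum.delta)
  qed
  ultimately have "((\<lambda>t. peval (\<lambda>k. lin_map r \<delta> x k + t * \<delta> k j) f) has_field_derivative
      peval x (pdiff j (act r \<delta> f))) (at 0)" by simp
  moreover have "((\<lambda>t. peval (\<lambda>k. lin_map r \<delta> x k + t * \<delta> k j) f) has_field_derivative
      (\<Sum>l\<le>r. \<delta> l j * peval (lin_map r \<delta> x) (pdiff l f))) (at 0)"
    by (rule peval_line_deriv) (use vars f in auto)
  ultimately show "peval x (pdiff j (act r \<delta> f)) = peval x (\<Sum>l\<le>r. cC (\<delta> l j) * act r \<delta> (pdiff l f))"
    by (simp add: DERIV_unique)
qed

lemma pdiff_pdiff_act:
  assumes f: "f \<in> vecs (mons {..r} n)" and ij: "i \<le> r" "j \<le> r"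
  shows "peval x (pdiff i (pdiff j (act r \<delta> f))) =
    (\<Sum>l\<le>r. (\<Sum>k\<le>r. \<delta> k i * peval (lin_map r \<delta> x) (pdiff k (pdiff l f))) * \<delta> l j)"
  unfolding pdiff_act[OF f ij(2)] pdiff_sum pdiff_cC_mult
  by (simp add: pdiff_act[OF vecs_pdiff[OF f] ij(1)] mult.commute)

definition lin_mat :: "nat \<Rightarrow> (nat \<Rightarrow> nat \<Rightarrow> complex) \<Rightarrow> complex mat" where
  "lin_mat r \<delta> = mat (r + 1) (r + 1) (\<lambda>(i, j). \<delta> i j)"

text \<open>By the chain rule the matrix of second derivatives is multiplied by \<open>\<delta>\<close> from the right and by its transpose from
  the left.\<close>

lemma peval_Hess_act:
  assumes f: "f \<in> vecs (mons {..r} n)"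
  shows "peval x (Hess r (act r \<delta> f)) =
    (Determinant.det (lin_mat r \<delta>))\<^sup>2 * peval (lin_map r \<delta> x) (Hess r f)"
proof -
  let ?P = "lin_mat r \<delta>"
  let ?H = "mat (r + 1) (r + 1) (\<lambda>(i, j). peval (lin_map r \<delta> x) (pdiff i (pdiff j f)))"
  have P: "?P \<in> carrier_mat (r + 1) (r + 1)" and H: "?H \<in> carrier_mat (r + 1) (r + 1)"
    by (auto simp: lin_mat_def)
  have set: "{0..<Suc r} = {..r}" by auto
  have "mat (r + 1) (r + 1) (\<lambda>(i, j). peval x (pdiff i (pdiff j (act r \<delta> f)))) = transpose_mat ?P * ?H * ?P"
    by (rule eq_matI) (auto simp: lin_mat_def scalar_prod_def pdiff_pdiff_act[OF f] set)
  then have "peval x (Hess r (act r \<delta> f)) = Determinant.det (transpose_mat ?P * ?H * ?P)"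
    by (simp only: peval_Hess)
  also have "\<dots> = Determinant.det ?P * Determinant.det ?H * Determinant.det ?P"
    using P H by (simp add: det_mult[of _ "r + 1"] det_transpose[OF P])
  finally show ?thesis by (simp add: peval_Hess power2_eq_square)
qed

lemma Hess_act:
  assumes f: "f \<in> vecs (mons {..r} n)"
  shows "Hess r (act r \<delta> f) = cC ((Determinant.det (lin_mat r \<delta>))\<^sup>2) * act r \<delta> (Hess r f)"
  by (rule peval_inject) (simp add: peval_Hess_act[OF f])

section \<open>The Hessian on a plane\<close>

lemma det_2x2:
  "Determinant.det (mat 2 2 (\<lambda>(i, j). M i j)) = M 0 0 * M 1 1 - M 0 1 * (M 1 0 :: 'a :: comm_ring_1)"
proof -
  have "Determinant.det (mat 2 2 (\<lambda>(i, j). M i j)) =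
    (\<Sum>i<2. mat 2 2 (\<lambda>(i, j). M i j) $$ (i, 0) * cofactor (mat 2 2 (\<lambda>(i, j). M i j)) i 0)"
    by (rule laplace_expansion_column) auto
  moreover have "Determinant.det (mat_delete (mat 2 2 (\<lambda>(i, j). M i j)) i 0) = M (1 - i) 1" if "i < 2" for i
    using that by (subst det_single) (auto simp: mat_delete_def)
  ultimately show ?thesis by (simp add: cofactor_def numeral_2_eq_2 algebra_simps)
qed

lemma det_block:
  fixes M :: "nat \<Rightarrow> nat \<Rightarrow> 'a :: idom"
  assumes off: "\<And>i j. i \<noteq> j \<Longrightarrow> i \<ge> 2 \<or> j \<ge> 2 \<Longrightarrow> i < n + 2 \<Longrightarrow> j < n + 2 \<Longrightarrow> M i j = 0"
    and diag: "\<And>i. i \<ge> 2 \<Longrightarrow> i < n + 2 \<Longrightarrow> M i i = c"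
  shows "Determinant.det (mat (n + 2) (n + 2) (\<lambda>(i, j). M i j)) = c ^ n * (M 0 0 * M 1 1 - M 0 1 * M 1 0)"
proof -
  have "mat (n + 2) (n + 2) (\<lambda>(i, j). M i j) =
    four_block_mat (mat 2 2 (\<lambda>(i, j). M i j)) (0\<^sub>m 2 n) (0\<^sub>m n 2) (c \<cdot>\<^sub>m 1\<^sub>m n)"
  proof (rule eq_matI)
    fix i j assume "i < dim_row (four_block_mat (mat 2 2 (\<lambda>(i, j). M i j)) (0\<^sub>m 2 n) (0\<^sub>m n 2) (c \<cdot>\<^sub>m 1\<^sub>m n))"
      "j < dim_col (four_block_mat (mat 2 2 (\<lambda>(i, j). M i j)) (0\<^sub>m 2 n) (0\<^sub>m n 2) (c \<cdot>\<^sub>m 1\<^sub>m n))"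
    then show "mat (n + 2) (n + 2) (\<lambda>(i, j). M i j) $$ (i, j) =
      four_block_mat (mat 2 2 (\<lambda>(i, j). M i j)) (0\<^sub>m 2 n) (0\<^sub>m n 2) (c \<cdot>\<^sub>m 1\<^sub>m n) $$ (i, j)"
      using off[of i j] diag[of i] by (cases "i = j") auto
  qed auto
  also have "Determinant.det \<dots> = Determinant.det (mat 2 2 (\<lambda>(i, j). M i j)) * Determinant.det (c \<cdot>\<^sub>m 1\<^sub>m n)"
    by (rule det_four_block_mat_lower_left_zero) auto
  finally show ?thesis by (simp add: det_2x2 mult.commute)
qed

text \<open>On the plane \<open>x2 = ... = xr = 0\<close> the matrix of second derivatives consists of a two by two block and of the diagonal
  entries \<open>R\<close>.\<close>

lemma Hess_plane:
  assumes r: "r \<ge> 1" and f: "\<And>i. 2 \<le> i \<Longrightarrow> i \<le> r \<Longrightarrow> pdiff i f = cX i * R"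
    and x: "\<And>i. 2 \<le> i \<Longrightarrow> i \<le> r \<Longrightarrow> x i = 0"
  shows "peval x (Hess r f) = peval x R ^ (r - 1) *
    (peval x (pdiff 0 (pdiff 0 f)) * peval x (pdiff 1 (pdiff 1 f)) - (peval x (pdiff 0 (pdiff 1 f)))\<^sup>2)"
proof -
  let ?M = "\<lambda>i j. peval x (pdiff i (pdiff j f))"
  have M: "?M i j = (if i = j then peval x R else 0)" if "2 \<le> j" "j \<le> r" for i j
    using x[OF that] by (simp add: f[OF that] pdiff_mult pdiff_cX)
  have "r + 1 = (r - 1) + 2" using r by simp
  then have "peval x (Hess r f) = Determinant.det (mat ((r - 1) + 2) ((r - 1) + 2) (\<lambda>(i, j). ?M i j))"
    unfolding peval_Hess by (simp only:)
  also have "\<dots> = peval x R ^ (r - 1) * (?M 0 0 * ?M 1 1 - ?M 0 1 * ?M 1 0)"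
  proof (rule det_block)
    fix i j :: nat assume ij: "i \<noteq> j" "i \<ge> 2 \<or> j \<ge> 2" "i < r - 1 + 2" "j < r - 1 + 2"
    show "?M i j = 0"
    proof (cases "j \<ge> 2")
      case True then show ?thesis using M[of j i] ij r by simp
    next
      case False
      then have "?M j i = 0" using M[of i j] ij r by simp
      then show ?thesis by (simp add: pdiff_commute)
    qed
  next
    fix i :: nat assume "i \<ge> 2" "i < r - 1 + 2"
    then show "?M i i = peval x R" using M[of i i] r by simp
  qed
  finally show ?thesis by (simp add: power2_eq_square pdiff_commute[of "Suc 0" 0])
qed

section \<open>A quadric and one of its isotropic forms\<close>

lemma peval_numeral [simp]: "peval x (numeral n) = numeral n"
  by (metis mono_val_0 mult.right_neutral peval_single single_numeral)

lemma peval_of_nat [simp]: "peval x (of_nat n) = of_nat n"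
  by (metis mono_val_0 mult.right_neutral peval_single single_of_nat)

lemma pdiff_numeral [simp]: "pdiff i (numeral n) = 0"
  by (metis pdiff_cC single_numeral)

definition q0 :: "nat \<Rightarrow> nat cpoly" where
  "q0 r = cC 2 * cX 0 * cX 1 + (\<Sum>i = 2..r. cX i ^ 2)"

lemma peval_q0: "peval x (q0 r) = 2 * x 0 * x 1 + (\<Sum>i = 2..r. x i ^ 2)"
  by (simp add: q0_def)

lemma q0_forms: "r \<ge> 1 \<Longrightarrow> q0 r \<in> vecs (mons {..r} 2)"
proof -
  assume r: "r \<ge> 1"
  have "cC 2 * cX 0 * cX 1 \<in> vecs (mons {..r} (0 + 1 + 1))"
    using r by (intro vecs_mult vecs_cC vecs_cX) auto
  moreover have "cX i ^ 2 \<in> vecs (mons {..r} (2 * 1))" if "i \<in> {2..r}" for i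
    using that by (intro vecs_power vecs_cX) auto
  ultimately show ?thesis unfolding q0_def by (intro vecs_add vecs_sum) (auto simp: numeral_2_eq_2)
qed

text \<open>The points of the plane \<open>x2 = ... = xr = 0\<close>.\<close>

definition pl :: "complex \<Rightarrow> complex \<Rightarrow> nat \<Rightarrow> complex" where
  "pl \<alpha> \<beta> i = (if i = 0 then \<alpha> else if i = 1 then \<beta> else 0)"

lemma pl_simps [simp]: "pl \<alpha> \<beta> 0 = \<alpha>" "pl \<alpha> \<beta> (Suc 0) = \<beta>" "2 \<le> i \<Longrightarrow> pl \<alpha> \<beta> i = 0"
  by (auto simp: pl_def)

lemma pl_upd: "(pl \<alpha> \<beta>)(0 := t) = pl t \<beta>" "(pl \<alpha> \<beta>)(1 := t) = pl \<alpha> t"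
  by (auto simp: pl_def fun_eq_iff)

lemma peval_pl_q0: "peval (pl \<alpha> \<beta>) (q0 r) = 2 * \<alpha> * \<beta>"
  by (simp add: peval_q0)

text \<open>The parameters \<open>A\<close> and \<open>a\<close> are the exponents of \<open>x0\<close> and \<open>x1\<close> after restriction to the plane \<open>x2 = ... = xr = 0\<close>,
  where \<open>q0\<close> is \<open>2 x0 x1\<close>. The second branch is meant for \<open>r = 1\<close>, where the plane is the whole space and every monomial
  is of this kind; there it continues the first branch.\<close>

definition special :: "nat \<Rightarrow> nat \<Rightarrow> nat \<Rightarrow> nat cpoly" where
  "special r A a = (if a \<le> A then q0 r ^ a * cX 0 ^ (A - a) else cC (2 ^ a) * cX 0 ^ A * cX 1 ^ a)"

lemma special_forms: "r \<ge> 1 \<Longrightarrow> special r A a \<in> vecs (mons {..r} (A + a))"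
proof (cases "a \<le> A")
  case True
  assume r: "r \<ge> 1"
  have "q0 r ^ a * cX 0 ^ (A - a) \<in> vecs (mons {..r} (a * 2 + (A - a) * 1))"
    by (intro vecs_mult vecs_power q0_forms r vecs_cX) auto
  moreover have "a * 2 + (A - a) * 1 = A + a" using True by simp
  ultimately show ?thesis using True by (simp only: special_def if_True)
next
  case False
  assume r: "r \<ge> 1"
  have "cC (2 ^ a) * cX 0 ^ A * cX 1 ^ a \<in> vecs (mons {..r} (0 + A * 1 + a * 1))"
    using r by (intro vecs_mult vecs_power vecs_cC vecs_cX) auto
  then show ?thesis using False by (simp add: special_def)
qed

lemma special_plane: "peval (pl \<alpha> \<beta>) (special r A a) = 2 ^ a * \<alpha> ^ A * \<beta> ^ a"
proof (cases "a \<le> A")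
  case True
  then have "\<alpha> ^ A = \<alpha> ^ a * \<alpha> ^ (A - a)" by (simp flip: power_add)
  then show ?thesis using True by (simp add: special_def peval_pl_q0 power_mult_distrib)
qed (simp add: special_def)

text \<open>The quotient of the derivative of \<open>special r A a\<close> in direction \<open>i \<ge> 2\<close> by the variable \<open>cX i\<close>.\<close>

definition special_normal :: "nat \<Rightarrow> nat \<Rightarrow> nat \<Rightarrow> nat cpoly" where
  "special_normal r A a = cC (2 * of_nat a) * q0 r ^ (a - 1) * cX 0 ^ (A - a)"

lemma pdiff_q0: "2 \<le> i \<Longrightarrow> i \<le> r \<Longrightarrow> pdiff i (q0 r) = cC 2 * cX i"
proof -
  assume i: "2 \<le> i" "i \<le> r"
  have "pdiff i (cX j ^ 2 :: nat cpoly) = (if j = i then cC 2 * cX i else 0)" for j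
    by (rule peval_inject) (simp add: pdiff_power pdiff_cX)
  then show ?thesis
    using i by (simp add: q0_def pdiff_mult pdiff_cX pdiff_sum sum.delta)
qed

lemma pdiff_special:
  assumes "a \<le> A \<or> r = 1" "2 \<le> i" "i \<le> r"
  shows "pdiff i (special r A a) = cX i * special_normal r A a"
proof -
  have "a \<le> A" using assms by auto
  then show ?thesis
    using assms by (intro peval_inject) (simp add: special_def special_normal_def pdiff_mult pdiff_power pdiff_q0 pdiff_cX)
qed

lemma plane_pdiff:
  assumes "\<And>\<alpha> \<beta>. peval (pl \<alpha> \<beta>) f = s * \<alpha> ^ A * \<beta> ^ a"
  shows "peval (pl \<alpha> \<beta>) (pdiff 0 f) = s * of_nat A * \<alpha> ^ (A - 1) * \<beta> ^ a"
    and "peval (pl \<alpha> \<beta>) (pdiff 1 f) = s * of_nat a * \<alpha> ^ A * \<beta> ^ (a - 1)"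
proof -
  have "((\<lambda>t. s * t ^ A * \<beta> ^ a) has_field_derivative s * of_nat A * \<alpha> ^ (A - 1) * \<beta> ^ a) (at \<alpha>)"
    by (auto intro!: derivative_eq_intros)
  moreover have "((\<lambda>t. s * t ^ A * \<beta> ^ a) has_field_derivative peval (pl \<alpha> \<beta>) (pdiff 0 f)) (at \<alpha>)"
    using peval_deriv[of "pl \<alpha> \<beta>" 0 f \<alpha>] by (simp add: pl_upd assms)
  ultimately show "peval (pl \<alpha> \<beta>) (pdiff 0 f) = s * of_nat A * \<alpha> ^ (A - 1) * \<beta> ^ a"
    by (rule DERIV_unique[rotated])
  have "((\<lambda>t. s * \<alpha> ^ A * t ^ a) has_field_derivative s * of_nat a * \<alpha> ^ A * \<beta> ^ (a - 1)) (at \<beta>)"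
    by (auto intro!: derivative_eq_intros)
  moreover have "((\<lambda>t. s * \<alpha> ^ A * t ^ a) has_field_derivative peval (pl \<alpha> \<beta>) (pdiff 1 f)) (at \<beta>)"
    using peval_deriv[of "pl \<alpha> \<beta>" 1 f \<beta>] by (simp only: pl_upd assms)
  ultimately show "peval (pl \<alpha> \<beta>) (pdiff 1 f) = s * of_nat a * \<alpha> ^ A * \<beta> ^ (a - 1)"
    by (rule DERIV_unique[rotated])
qed

lemma plane_pdiff2:
  assumes f: "\<And>\<alpha> \<beta>. peval (pl \<alpha> \<beta>) f = s * \<alpha> ^ A * \<beta> ^ a"
  shows "peval (pl \<alpha> \<beta>) (pdiff 0 (pdiff 0 f)) = s * of_nat A * of_nat (A - 1) * \<alpha> ^ (A - 2) * \<beta> ^ a"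
    and "peval (pl \<alpha> \<beta>) (pdiff 0 (pdiff 1 f)) = s * of_nat A * of_nat a * \<alpha> ^ (A - 1) * \<beta> ^ (a - 1)"
    and "peval (pl \<alpha> \<beta>) (pdiff 1 (pdiff 1 f)) = s * of_nat a * of_nat (a - 1) * \<alpha> ^ A * \<beta> ^ (a - 2)"
  using plane_pdiff(1)[OF plane_pdiff(1)[OF f]] plane_pdiff(1)[OF plane_pdiff(2)[OF f]]
    plane_pdiff(2)[OF plane_pdiff(2)[OF f]]
  by (simp_all add: numeral_2_eq_2 mult_ac)

section \<open>Transvections\<close>

text \<open>The Eichler transvection of \<open>q0\<close> in the plane of \<open>x0\<close> and \<open>xi\<close>: it fixes \<open>x0\<close>, adds \<open>t x0\<close> to \<open>xi\<close> and changes
  \<open>x1\<close> such that \<open>q0\<close> is preserved.\<close>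

definition transvec :: "nat \<Rightarrow> complex \<Rightarrow> nat \<Rightarrow> nat \<Rightarrow> complex" where
  "transvec i t j k = (if j = k then 1 else 0) + (if j = 1 \<and> k = i then - t else 0)
     + (if j = 1 \<and> k = 0 then - t\<^sup>2 / 2 else 0) + (if j = i \<and> k = 0 then t else 0)"

lemma lin_map_transvec:
  assumes "2 \<le> i" "i \<le> r" "j \<le> r"
  shows "lin_map r (transvec i t) x j = (if j = 1 then x 1 - t * x i - t\<^sup>2 / 2 * x 0
     else if j = i then x i + t * x 0 else x j)"
proof -
  have "lin_map r (transvec i t) x j = (\<Sum>k\<le>r. if k = j then x j else 0) +
     (\<Sum>k\<le>r. if k = i then (if j = 1 then - t * x i else 0) else 0) +
     (\<Sum>k\<le>r. if k = 0 then (if j = 1 then - t\<^sup>2 / 2 * x 0 else 0) + (if j = i then t * x 0 else 0) else 0)"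
    unfolding lin_map_def sum.distrib[symmetric] by (rule sum.cong) (auto simp: transvec_def algebra_simps)
  also have "\<dots> = (if j = 1 then x 1 - t * x i - t\<^sup>2 / 2 * x 0
     else if j = i then x i + t * x 0 else x j)"
    using assms by (simp add: sum.delta)
  finally show ?thesis .
qed

lemma det_transvec:
  assumes "2 \<le> i" "i \<le> r"
  shows "Determinant.det (lin_mat r (transvec i t)) = 1"
proof -
  let ?n = "r + 1"
  let ?A = "addrow t i 0 (1\<^sub>m ?n)" let ?B = "addrow (- t) 1 i ?A" let ?C = "addrow (t\<^sup>2 / 2) 1 0 ?B"
  have "lin_mat r (transvec i t) = ?C"
    using assms by (intro eq_matI) (auto simp: lin_mat_def transvec_def mat_addrow_def power2_eq_square)
  moreover have "Determinant.det ?C = Determinant.det ?B" by (rule det_addrow[where n = ?n]) auto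
  moreover have "Determinant.det ?B = Determinant.det ?A" using assms by (intro det_addrow[where n = ?n]) auto
  moreover have "Determinant.det ?A = Determinant.det (1\<^sub>m ?n :: complex mat)" using assms by (intro det_addrow[where n = ?n]) auto
  ultimately show ?thesis by simp
qed

definition unip_inv :: "nat \<Rightarrow> nat cpoly \<Rightarrow> bool" where
  "unip_inv r f \<longleftrightarrow> (\<forall>i t. 2 \<le> i \<and> i \<le> r \<longrightarrow> act r (transvec i t) f = f)"

text \<open>Where \<open>x0\<close> is not zero, a transvection brings the coordinate \<open>xi\<close> to \<open>0\<close> without changing \<open>x0\<close> and \<open>q0\<close>. So the value
  of an invariant form depends on \<open>x0\<close> and \<open>q0\<close> only.\<close>

lemma unip_inv_plane:
  assumes f: "f \<in> vecs (mons {..r} n)" and U: "unip_inv r f" and r: "r \<ge> 1" and x: "x 0 \<noteq> 0"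
  shows "peval x f = peval (pl (x 0) (peval x (q0 r) / (2 * x 0))) f"
proof -
  define y where "y S j = (if j \<in> S then 0 else if j = 1 then x 1 + (\<Sum>i\<in>S. x i ^ 2) / (2 * x 0) else x j)" for S j
  have "peval x f = peval (y S) f" if "finite S" "S \<subseteq> {2..r}" for S
    using that
  proof (induction S)
    case empty
    have "y {} = x" by (auto simp: y_def fun_eq_iff)
    then show ?case by simp
  next
    case (insert i S)
    then have i: "2 \<le> i" "i \<le> r" by auto
    define t where "t = - x i / x 0"
    have n1: "1 \<notin> S" "0 \<notin> S" using insert by auto
    have yi: "y S i = x i" "y S 0 = x 0" using insert i n1 by (auto simp: y_def)
    have "peval x f = peval (y S) (act r (transvec i t) f)"
      using insert U i by (simp add: unip_inv_def)
    also have "\<dots> = peval (lin_map r (transvec i t) (y S)) f" by simp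
    also have "\<dots> = peval (y (insert i S)) f"
    proof (rule peval_cong_vars[OF f])
      fix j assume "j \<in> {..r}"
      then have L: "lin_map r (transvec i t) (y S) j = (if j = 1 then y S 1 - t * x i - t\<^sup>2 / 2 * x 0
          else if j = i then x i + t * x 0 else y S j)"
        using lin_map_transvec[OF i, of j t "y S"] yi by simp
      show "lin_map r (transvec i t) (y S) j = y (insert i S) j"
      proof (cases "j = 1")
        case True
        have "(x 1 + s) - t * x i - t\<^sup>2 / 2 * x 0 = x 1 + (x i ^ 2 / (2 * x 0) + s)" for s
          using x by (simp add: t_def power2_eq_square field_simps)
        from this[of "(\<Sum>i\<in>S. x i ^ 2) / (2 * x 0)"] show ?thesis unfolding L using True n1 insert i
          by (simp add: y_def add_divide_distrib)
      next
        case False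
        then show ?thesis unfolding L using i x by (auto simp: y_def t_def)
      qed
    qed
    finally show ?case .
  qed
  from this[of "{2..r}"] have "peval x f = peval (y {2..r}) f" by simp
  also have "\<dots> = peval (pl (x 0) (peval x (q0 r) / (2 * x 0))) f"
    by (rule peval_cong_vars[OF f]) (use x in \<open>auto simp: y_def pl_def peval_q0 field_simps\<close>)
  finally show ?thesis .
qed

lemma unip_inv_eqI:
  assumes f: "f \<in> vecs (mons {..r} n)" "unip_inv r f" and g: "g \<in> vecs (mons {..r} n)" "unip_inv r g"
    and r: "r \<ge> 1" and eq: "\<And>\<alpha> \<beta>. \<alpha> \<noteq> 0 \<Longrightarrow> peval (pl \<alpha> \<beta>) f = peval (pl \<alpha> \<beta>) g"
  shows "f = g"
proof (rule peval_inject)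
  fix x
  have "polyfn (\<lambda>t. peval (x(0 := t)) f - peval (x(0 := t)) g)"
    by (intro polyfn_diff polyfn_peval) (auto simp: fun_upd_def intro!: polyfn_if)
  then have "peval (x(0 := x 0)) f - peval (x(0 := x 0)) g = 0"
    by (rule polyfn_zero_ext)
      (use unip_inv_plane[OF f r, of "x(0 := t)" for t] unip_inv_plane[OF g r, of "x(0 := t)" for t] eq in simp)
  then show "peval x f = peval x g" by simp
qed

lemma act_mult: "act r \<delta> (f * g) = act r \<delta> f * act r \<delta> g"
  by (rule peval_inject) simp

lemma act_power: "act r \<delta> (f ^ n) = act r \<delta> f ^ n"
  by (rule peval_inject) simp

lemma act_transvec_q0: "2 \<le> i \<Longrightarrow> i \<le> r \<Longrightarrow> act r (transvec i t) (q0 r) = q0 r"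
proof (rule peval_inject)
  fix x assume i: "2 \<le> i" "i \<le> r"
  have 1: "lin_map r (transvec i t) x 1 = x 1 - t * x i - t\<^sup>2 / 2 * x 0" "lin_map r (transvec i t) x 0 = x 0"
    using i by (simp_all add: lin_map_transvec)
  have "(\<Sum>j = 2..r. lin_map r (transvec i t) x j ^ 2) = (\<Sum>j = 2..r. x j ^ 2 + (if j = i then 2 * t * x 0 * x i + t\<^sup>2 * (x 0)\<^sup>2 else 0))"
    using i by (intro sum.cong) (auto simp: lin_map_transvec power2_eq_square algebra_simps)
  also have "\<dots> = (\<Sum>j = 2..r. x j ^ 2) + (2 * t * x 0 * x i + t\<^sup>2 * (x 0)\<^sup>2)"
    using i by (simp add: sum.distrib sum.delta)
  finally show "peval x (act r (transvec i t) (q0 r)) = peval x (q0 r)"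
    by (simp add: peval_q0 1[unfolded One_nat_def] power2_eq_square algebra_simps)
qed

lemma act_transvec_X0: "2 \<le> i \<Longrightarrow> i \<le> r \<Longrightarrow> act r (transvec i t) (cX 0) = cX 0"
  by (rule peval_inject) (simp add: lin_map_transvec)

lemma unip_inv_special: "a \<le> A \<or> r = 1 \<Longrightarrow> unip_inv r (special r A a)"
  unfolding unip_inv_def
proof (intro allI impI)
  fix i t assume *: "a \<le> A \<or> r = 1" "2 \<le> i \<and> i \<le> r"
  then have "a \<le> A" by auto
  with * show "act r (transvec i t) (special r A a) = special r A a"
    by (simp add: special_def act_mult act_power act_transvec_q0 act_transvec_X0)
qed

lemma unip_inv_cC_mult: "unip_inv r f \<Longrightarrow> unip_inv r (cC c * f)"
  by (simp add: unip_inv_def act_cC_mult)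

lemma unip_inv_sum: "(\<And>j. j \<in> S \<Longrightarrow> unip_inv r (f j)) \<Longrightarrow> unip_inv r (\<Sum>j\<in>S. f j)"
  by (induction S rule: infinite_finite_induct) (auto simp: unip_inv_def act_add)

lemma unip_inv_Hess:
  assumes "f \<in> vecs (mons {..r} n)" "unip_inv r f" shows "unip_inv r (Hess r f)"
  unfolding unip_inv_def
proof (intro allI impI)
  fix i t assume i: "2 \<le> i \<and> i \<le> r"
  have "Hess r f = Hess r (act r (transvec i t) f)" using assms(2) i by (simp add: unip_inv_def)
  also have "\<dots> = act r (transvec i t) (Hess r f)"
    using i by (simp add: Hess_act[OF assms(1)] det_transvec)
  finally show "act r (transvec i t) (Hess r f) = Hess r f" by simp
qed

section \<open>The Hessian of the special forms\<close>

lemma special_normal_plane: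
  assumes "a \<ge> 1" "a \<le> A"
  shows "peval (pl \<alpha> \<beta>) (special_normal r A a) = 2 ^ a * of_nat a * \<alpha> ^ (A - 1) * \<beta> ^ (a - 1)"
proof -
  have "A - 1 = (a - 1) + (A - a)" using assms by simp
  then have "\<alpha> ^ (A - 1) = \<alpha> ^ (a - 1) * \<alpha> ^ (A - a)" by (simp only: power_add)
  moreover have "(2::complex) ^ a = 2 * 2 ^ (a - 1)" using assms by (cases a) auto
  ultimately show ?thesis by (simp add: special_normal_def peval_pl_q0 power_mult_distrib)
qed

definition special_const :: "nat \<Rightarrow> nat \<Rightarrow> nat \<Rightarrow> complex" where
  "special_const r A a = (2 ^ a * of_nat a) ^ (r - 1) * (4 ^ a * of_nat A * of_nat a * (1 - of_nat (A + a))) / 2 ^ ((r + 1) * (a - 1))"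

lemma special_const_nz: "A \<ge> 1 \<Longrightarrow> a \<ge> 1 \<Longrightarrow> special_const r A a \<noteq> 0"
proof -
  assume *: "A \<ge> 1" "a \<ge> 1"
  have "(of_nat (A + a) :: complex) \<noteq> of_nat 1" using * by (subst of_nat_eq_iff) auto
  then show ?thesis using * by (simp add: special_const_def)
qed

text \<open>Both sides are invariant under the transvections, so they can be compared on the plane \<open>x2 = ... = xr = 0\<close>, where
  \<open>Hess_plane\<close> applies.\<close>

lemma Hess_special:
  assumes r: "r \<ge> 1" and ok: "a \<le> A \<or> r = 1" and a: "a \<ge> 1" "A \<ge> 1"
  shows "Hess r (special r A a) = cC (special_const r A a) * special r ((r + 1) * (A - 1)) ((r + 1) * (a - 1))"
proof (rule unip_inv_eqI[OF _ _ _ _ r])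
  have deg: "(A + a - 2) * (r + 1) = (r + 1) * (A - 1) + (r + 1) * (a - 1)"
    using a by (cases A; cases a) (auto simp: algebra_simps)
  show "Hess r (special r A a) \<in> vecs (mons {..r} ((A + a - 2) * (r + 1)))"
    by (rule Hess_forms[OF special_forms[OF r]])
  show "cC (special_const r A a) * special r ((r + 1) * (A - 1)) ((r + 1) * (a - 1)) \<in> vecs (mons {..r} ((A + a - 2) * (r + 1)))"
    unfolding deg by (intro vecs_cC_mult special_forms r)
  show "unip_inv r (Hess r (special r A a))" by (rule unip_inv_Hess[OF special_forms[OF r] unip_inv_special[OF ok]])
  have "(r + 1) * (a - 1) \<le> (r + 1) * (A - 1)" if "a \<le> A" using that by (intro mult_le_mono2) simp
  then have "(r + 1) * (a - 1) \<le> (r + 1) * (A - 1) \<or> r = 1" using ok by blast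
  then show "unip_inv r (cC (special_const r A a) * special r ((r + 1) * (A - 1)) ((r + 1) * (a - 1)))"
    by (intro unip_inv_cC_mult unip_inv_special)
next
  fix \<alpha> \<beta> :: complex
  let ?x = "pl \<alpha> \<beta>"
  have R: "peval ?x (special_normal r A a) ^ (r - 1) = (2 ^ a * of_nat a * \<alpha> ^ (A - 1) * \<beta> ^ (a - 1)) ^ (r - 1)"
    using ok special_normal_plane[OF a(1)] by (cases "r = 1") auto
  note p2 = plane_pdiff2[OF special_plane[of _ _ r A a]]
  have H: "peval ?x (pdiff 0 (pdiff 0 (special r A a))) * peval ?x (pdiff 1 (pdiff 1 (special r A a)))
       - (peval ?x (pdiff 0 (pdiff 1 (special r A a))))\<^sup>2
     = 4 ^ a * of_nat A * of_nat a * (1 - of_nat (A + a)) * \<alpha> ^ (2 * (A - 1)) * \<beta> ^ (2 * (a - 1))"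
  proof -
    have 4: "(2::complex) ^ a * 2 ^ a = 4 ^ a" by (simp flip: power_mult_distrib)
    have *: "of_nat A * of_nat (A - 1) * (of_nat a * of_nat (a - 1)) * (\<alpha> ^ (A - 2) * \<alpha> ^ A * (\<beta> ^ a * \<beta> ^ (a - 2)))
      = (of_nat A * of_nat (A - 1) * (of_nat a * of_nat (a - 1))) * (\<alpha> ^ (2 * (A - 1)) * \<beta> ^ (2 * (a - 1)))"
    proof (cases "A = 1 \<or> a = 1")
      case False
      then have "A - 2 + A = 2 * (A - 1)" "a + (a - 2) = 2 * (a - 1)" using a by auto
      then show ?thesis by (simp flip: power_add)
    qed auto
    have "peval ?x (pdiff 0 (pdiff 0 (special r A a))) * peval ?x (pdiff 1 (pdiff 1 (special r A a)))
       = (2 ^ a * 2 ^ a) * (of_nat A * of_nat (A - 1) * (of_nat a * of_nat (a - 1)) * (\<alpha> ^ (A - 2) * \<alpha> ^ A * (\<beta> ^ a * \<beta> ^ (a - 2))))"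
      unfolding p2 by (simp only: mult_ac)
    also have "\<dots> = 4 ^ a * ((of_nat A * of_nat (A - 1) * (of_nat a * of_nat (a - 1))) * (\<alpha> ^ (2 * (A - 1)) * \<beta> ^ (2 * (a - 1))))"
      by (simp only: * 4)
    finally have 1: "peval ?x (pdiff 0 (pdiff 0 (special r A a))) * peval ?x (pdiff 1 (pdiff 1 (special r A a))) = \<dots>" .
    have 2: "(peval ?x (pdiff 0 (pdiff 1 (special r A a))))\<^sup>2 = 4 ^ a * ((of_nat A * of_nat a * (of_nat A * of_nat a)) * (\<alpha> ^ (2 * (A - 1)) * \<beta> ^ (2 * (a - 1))))"
      unfolding p2 by (simp add: power_mult_distrib power_mult power2_eq_square mult_ac flip: 4)
    have 3: "(of_nat (A - 1) :: complex) = of_nat A - 1" "(of_nat (a - 1) :: complex) = of_nat a - 1"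
      using a by (auto simp: of_nat_diff)
    show ?thesis unfolding 1 2 3 by (simp add: algebra_simps)
  qed
  have pw: "(\<alpha> ^ (A - 1)) ^ (r - 1) * \<alpha> ^ (2 * (A - 1)) = \<alpha> ^ ((r + 1) * (A - 1))" for A and \<alpha> :: complex
  proof -
    have "n * (r - 1) + 2 * n = (r + 1) * n" for n using r by (cases r) (auto simp: algebra_simps)
    from this[of "A - 1"] show ?thesis by (simp only: power_mult[symmetric] power_add[symmetric])
  qed
  have "peval ?x (Hess r (special r A a)) = (2 ^ a * of_nat a) ^ (r - 1) * (4 ^ a * of_nat A * of_nat a * (1 - of_nat (A + a)))
     * ((\<alpha> ^ (A - 1)) ^ (r - 1) * \<alpha> ^ (2 * (A - 1))) * ((\<beta> ^ (a - 1)) ^ (r - 1) * \<beta> ^ (2 * (a - 1)))"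
  proof -
    have "peval ?x (Hess r (special r A a)) = peval ?x (special_normal r A a) ^ (r - 1) *
      (peval ?x (pdiff 0 (pdiff 0 (special r A a))) * peval ?x (pdiff 1 (pdiff 1 (special r A a)))
       - (peval ?x (pdiff 0 (pdiff 1 (special r A a))))\<^sup>2)"
      by (rule Hess_plane[OF r pdiff_special[OF ok]]) simp_all
    then show ?thesis unfolding R H by (simp only: power_mult_distrib mult_ac)
  qed
  then show "peval ?x (Hess r (special r A a)) = peval ?x (cC (special_const r A a) * special r ((r + 1) * (A - 1)) ((r + 1) * (a - 1)))"
    unfolding pw by (simp add: special_plane special_const_def)
qed

text \<open>Up to a nonzero constant, the derivative of the Hessian at \<open>special r A a\<close> in the direction \<open>special r A' a'\<close>, evaluated
  at a point of the plane with \<open>x0 = q0 = 1\<close>.\<close>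

definition special_deriv :: "nat \<Rightarrow> nat \<Rightarrow> nat \<Rightarrow> nat \<Rightarrow> nat \<Rightarrow> int" where
  "special_deriv r A a A' a' = (int r - 1) * int a' * int A * int a * (1 - int (A + a)) +
     int a * (int A * (int A - 1) * int a' * (int a' - 1) + int a * (int a - 1) * int A' * (int A' - 1)
       - 2 * int A * int a * int A' * int a')"

lemma Hess_special_deriv_nz:
  assumes r: "r \<ge> 1" and ok: "a \<le> A \<or> r = 1" "a' \<le> A' \<or> r = 1" and a: "a \<ge> 1" "A \<ge> 1"
    and nz: "special_deriv r A a A' a' \<noteq> 0"
  shows "\<exists>x D. D \<noteq> 0 \<and> ((\<lambda>t. peval x (Hess r (special r A a + cC t * special r A' a'))) has_field_derivative D) (at 0)"
proof -
  \<comment> \<open>At this point \<open>x0\<close> and \<open>q0\<close> are \<open>1\<close>, and so are the values of all special forms.\<close>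
  let ?x = "pl 1 (1/2)"
  let ?f = "special r A a" and ?g = "special r A' a'"
  define Rf where "Rf = 2 * of_nat a * (1::complex)"
  define Rg where "Rg = 2 * of_nat a' * (1::complex)"
  have R: "peval ?x (special_normal r A a) = 2 * of_nat a" for A a
    by (simp add: special_normal_def peval_pl_q0)
  define f00 f01 f11 g00 g01 g11 :: complex where "f00 = of_nat A * (of_nat A - 1)" and "f01 = 2 * of_nat A * of_nat a"
    and "f11 = 4 * of_nat a * (of_nat a - 1)" and "g00 = of_nat A' * (of_nat A' - 1)"
    and "g01 = 2 * of_nat A' * of_nat a'" and "g11 = 4 * of_nat a' * (of_nat a' - 1)"
  have of1: "of_nat n * of_nat (n - 1) = of_nat n * (of_nat n - (1::complex))" for n by (cases n) auto
  have two: "(2::complex) ^ b * ((1/2) ^ b) = 1" for b by (simp flip: power_mult_distrib)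
  have p2: "peval ?x (pdiff 0 (pdiff 0 (special r A a))) = of_nat A * (of_nat A - 1)"
    "peval ?x (pdiff 0 (pdiff 1 (special r A a))) = 2 * of_nat A * of_nat a"
    "peval ?x (pdiff 1 (pdiff 1 (special r A a))) = 4 * of_nat a * (of_nat a - 1)" for A a
  proof -
    show "peval ?x (pdiff 0 (pdiff 0 (special r A a))) = of_nat A * (of_nat A - 1)"
      unfolding plane_pdiff2[OF special_plane] using of1[of A] two[of a] by (simp add: mult_ac)
    show "peval ?x (pdiff 0 (pdiff 1 (special r A a))) = 2 * of_nat A * of_nat a"
    proof (cases a)
      case (Suc b)
      then show ?thesis unfolding plane_pdiff2[OF special_plane] using two[of b] by (simp add: mult_ac)
    next
      case 0
      then show ?thesis unfolding plane_pdiff2[OF special_plane] by simp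
    qed
    show "peval ?x (pdiff 1 (pdiff 1 (special r A a))) = 4 * of_nat a * (of_nat a - 1)"
    proof (cases "a < 2")
      case True
      then have "a = 0 \<or> a = 1" by auto
      then show ?thesis unfolding plane_pdiff2[OF special_plane] by auto
    next
      case False
      then obtain b where b: "a = Suc (Suc b)" by (metis add_2_eq_Suc le_iff_add not_less)
      show ?thesis unfolding plane_pdiff2[OF special_plane] by (simp add: b power_one_over field_simps)
    qed
  qed
  have pd: "pdiff i (?f + cC t * ?g) = cX i * (special_normal r A a + cC t * special_normal r A' a')" if "2 \<le> i" "i \<le> r" for i t
    using pdiff_special[OF ok(1) that] pdiff_special[OF ok(2) that] by (simp add: algebra_simps)
  have eq: "peval ?x (Hess r (?f + cC t * ?g)) = (Rf + t * Rg) ^ (r - 1) * ((f00 + t * g00) * (f11 + t * g11) - (f01 + t * g01)\<^sup>2)" for t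
  proof -
    let ?F = "?f + cC t * ?g" and ?R = "special_normal r A a + cC t * special_normal r A' a'"
    have "peval ?x (Hess r ?F) = peval ?x ?R ^ (r - 1) *
      (peval ?x (pdiff 0 (pdiff 0 ?F)) * peval ?x (pdiff 1 (pdiff 1 ?F)) - (peval ?x (pdiff 0 (pdiff 1 ?F)))\<^sup>2)"
    proof (rule Hess_plane[OF r])
      fix i assume "2 \<le> i" "i \<le> r"
      then show "pdiff i ?F = cX i * ?R" by (rule pd)
      show "?x i = 0" using \<open>2 \<le> i\<close> by simp
    qed
    then show ?thesis
      by (simp only: Rf_def Rg_def f00_def f01_def f11_def g00_def g01_def g11_def
          pdiff_add pdiff_cC_mult peval_add peval_mult peval_single mono_val_0 mult_1_right p2 R)
  qed
  define D where "D = of_nat (r - 1) * Rf ^ (r - 2) * Rg * (f00 * f11 - f01\<^sup>2) + Rf ^ (r - 1) * (f00 * g11 + g00 * f11 - 2 * f01 * g01)"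
  have "((\<lambda>t. (Rf + t * Rg) ^ (r - 1) * ((f00 + t * g00) * (f11 + t * g11) - (f01 + t * g01)\<^sup>2)) has_field_derivative D) (at 0)"
    unfolding D_def by (auto intro!: derivative_eq_intros simp: numeral_2_eq_2 algebra_simps)
  then have der: "((\<lambda>t. peval ?x (Hess r (?f + cC t * ?g))) has_field_derivative D) (at 0)"
    unfolding eq .
  define E where "E = (of_int (special_deriv r A a A' a') :: complex)"
  have E: "E \<noteq> 0" using nz by (simp add: E_def)
  define P where "P = of_nat A * (of_nat A - 1) * of_nat a' * (of_nat a' - 1) + of_nat a * (of_nat a - 1) * of_nat A' * (of_nat A' - 1)
       - 2 * of_nat A * of_nat a * of_nat A' * (of_nat a' :: complex)"
  have EP: "E = (of_nat r - 1) * of_nat a' * of_nat A * of_nat a * (1 - of_nat (A + a)) + of_nat a * P"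
    by (simp add: E_def special_deriv_def P_def)
  have 1: "f00 * f11 - f01\<^sup>2 = 4 * of_nat A * of_nat a * (1 - of_nat (A + a))"
    by (simp add: f00_def f11_def f01_def power2_eq_square algebra_simps)
  have 2: "f00 * g11 + g00 * f11 - 2 * f01 * g01 = 4 * P"
    by (simp add: f00_def f11_def f01_def g00_def g11_def g01_def P_def algebra_simps)
  have "D \<noteq> 0"
  proof (cases "r = 1")
    case True
    then have "D = 4 * P" "E = of_nat a * P" using 2 EP by (auto simp: D_def)
    then show ?thesis using E by auto
  next
    case False
    define s where "s = r - 2"
    have s: "r = Suc (Suc s)" using r False by (simp add: s_def)
    define W where "W = Rf ^ s"
    have "D = W * (of_nat (Suc s) * Rg * (4 * of_nat A * of_nat a * (1 - of_nat (A + a))) + Rf * (4 * P))"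
      unfolding D_def 1 2 W_def s by (simp add: algebra_simps)
    also have "\<dots> = W * (8 * E)"
      unfolding EP s by (simp add: Rf_def Rg_def algebra_simps)
    finally show ?thesis using E a by (simp add: Rf_def W_def)
  qed
  then show ?thesis using der by blast
qed

section \<open>Limits of orbits\<close>

definition coeffs_poly :: "(complex \<Rightarrow> 'v cpoly) \<Rightarrow> bool" where
  "coeffs_poly A \<longleftrightarrow> (\<forall>m. polyfn (\<lambda>t. lookup (A t) m))"

lemma coeffs_poly_const: "coeffs_poly (\<lambda>t. f)"
  by (simp add: coeffs_poly_def)

lemma coeffs_poly_cC: "polyfn f \<Longrightarrow> coeffs_poly (\<lambda>t. cC (f t))"
  unfolding coeffs_poly_def by (auto simp: lookup_single when_def intro!: polyfn_if)

lemma coeffs_poly_mult: "coeffs_poly A \<Longrightarrow> coeffs_poly B \<Longrightarrow> coeffs_poly (\<lambda>t. A t * B t)"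
  unfolding coeffs_poly_def lookup_mult_splits split_def by (intro allI polyfn_sum polyfn_mult) auto

lemma coeffs_poly_sum: "(\<And>k. k \<in> K \<Longrightarrow> coeffs_poly (A k)) \<Longrightarrow> coeffs_poly (\<lambda>t. \<Sum>k\<in>K. A k t)"
  unfolding coeffs_poly_def lookup_sum by (intro allI polyfn_sum) auto

lemma coeffs_poly_power: "coeffs_poly A \<Longrightarrow> coeffs_poly (\<lambda>t. A t ^ n)"
  by (induction n) (auto intro: coeffs_poly_mult coeffs_poly_const)

lemma coeffs_poly_prod:
  "(\<And>k. k \<in> K \<Longrightarrow> coeffs_poly (A k)) \<Longrightarrow> coeffs_poly (\<lambda>t. \<Prod>k\<in>K. A k t)"
  by (induction K rule: infinite_finite_induct) (auto intro: coeffs_poly_mult coeffs_poly_const)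

lemma coeffs_poly_act:
  assumes "\<And>j k. polyfn (\<lambda>t. \<delta> t j k)" shows "coeffs_poly (\<lambda>t. act r (\<delta> t) f)"
  unfolding act_def
  by (intro coeffs_poly_sum coeffs_poly_mult coeffs_poly_prod coeffs_poly_power coeffs_poly_cC coeffs_poly_const assms)

lemma coeffs_poly_act_curve:
  assumes "finite I" "coeffs_poly c" "\<And>t. c t \<in> vecs I"
  shows "coeffs_poly (\<lambda>t. act r \<delta> (c t))"
  unfolding coeffs_poly_def
proof
  fix m
  have "(\<lambda>x. lookup (act r \<delta> (vec_of I x)) m) \<in> hom_fun I 1"
    using hom_coeffs_act[OF assms(1)] by (simp add: hom_coeffs_def)
  from polyfn_hom_fun[OF this, of "\<lambda>t. lookup (c t)"]
  have "polyfn (\<lambda>t. lookup (act r \<delta> (vec_of I (lookup (c t)))) m)"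
    using assms(2) by (simp add: coeffs_poly_def)
  then show "polyfn (\<lambda>t. lookup (act r \<delta> (c t)) m)"
    using assms by (simp add: vec_of_lookup)
qed

text \<open>The isometries of \<open>q0\<close> that are diagonal in the hyperbolic plane of \<open>x0\<close> and \<open>x1\<close>.\<close>

definition torus :: "complex \<Rightarrow> nat \<Rightarrow> nat \<Rightarrow> complex" where
  "torus s j k = (if j = k then (if j = 0 then s else if j = 1 then 1 / s else 1) else 0)"

lemma lin_map_torus: "j \<le> r \<Longrightarrow> lin_map r (torus s) x j = (if j = 0 then s else if j = 1 then 1 / s else 1) * x j"
proof -
  assume j: "j \<le> r"
  have "lin_map r (torus s) x j = (\<Sum>k\<le>r. if k = j then (if j = 0 then s else if j = 1 then 1 / s else 1) * x j else 0)"
    unfolding lin_map_def by (rule sum.cong) (auto simp: torus_def)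
  then show ?thesis using j by (simp add: sum.delta)
qed

lemma act_torus_special:
  assumes r: "r \<ge> 1" and s: "s \<noteq> 0"
  shows "act r (torus s) (special r A a) = cC (s ^ A * (1 / s) ^ a) * special r A a"
proof (rule peval_inject)
  fix x
  have 0: "lin_map r (torus s) x 0 = s * x 0" "lin_map r (torus s) x (Suc 0) = x (Suc 0) / s"
    using r by (simp_all add: lin_map_torus)
  have q: "peval (lin_map r (torus s) x) (q0 r) = peval x (q0 r)"
    using s by (simp add: peval_q0 0 lin_map_torus)
  show "peval x (act r (torus s) (special r A a)) = peval x (cC (s ^ A * (1 / s) ^ a) * special r A a)"
  proof (cases "a \<le> A")
    case True
    then have "s ^ A = s ^ a * s ^ (A - a)" by (simp flip: power_add)
    then have "s ^ A * (1 / s) ^ a = s ^ (A - a)" using s by (simp add: power_divide)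
    then show ?thesis using True by (simp add: special_def q 0 power_mult_distrib)
  next
    case False
    then show ?thesis by (simp add: special_def 0 power_mult_distrib power_divide)
  qed
qed

lemma act_transvec_transvec:
  assumes f: "f \<in> vecs (mons {..r} n)" and i: "2 \<le> i" "i \<le> r"
  shows "act r (transvec i u) (act r (transvec i t) f) = act r (transvec i (t + u)) f"
proof (rule peval_inject)
  fix x
  show "peval x (act r (transvec i u) (act r (transvec i t) f)) = peval x (act r (transvec i (t + u)) f)"
    unfolding peval_act
    by (rule peval_cong_vars[OF f]) (use i in \<open>auto simp: lin_map_transvec power2_eq_square algebra_simps add_divide_distrib\<close>)
qed

lemma act_transvec_commute:
  assumes f: "f \<in> vecs (mons {..r} n)" and i: "2 \<le> i" "i \<le> r" and j: "2 \<le> j" "j \<le> r" and ij: "i \<noteq> j"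
  shows "act r (transvec j u) (act r (transvec i t) f) = act r (transvec i t) (act r (transvec j u) f)"
proof (rule peval_inject)
  fix x
  show "peval x (act r (transvec j u) (act r (transvec i t) f)) = peval x (act r (transvec i t) (act r (transvec j u) f))"
    unfolding peval_act
    by (rule peval_cong_vars[OF f]) (use i j ij in \<open>auto simp: lin_map_transvec algebra_simps\<close>)
qed

lemma act_transvec_0:
  assumes f: "f \<in> vecs (mons {..r} n)" and i: "2 \<le> i" "i \<le> r"
  shows "act r (transvec i 0) f = f"
proof (rule peval_inject)
  fix x
  show "peval x (act r (transvec i 0) f) = peval x f"
    unfolding peval_act by (rule peval_cong_vars[OF f]) (use i in \<open>auto simp: lin_map_transvec\<close>)
qed

lemma polyfn_transvec: "polyfn (\<lambda>t. transvec i t j k)"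
  unfolding transvec_def power2_eq_square divide_inverse
  by (intro polyfn_add polyfn_if polyfn_const polyfn_id polyfn_mult polyfn_diff[of "\<lambda>t. 0", simplified])

text \<open>Closedness is only required along curves with polynomial coefficients: the limits needed below are all of this kind,
  and these limits are compatible with vanishing of polynomial functions.\<close>

definition limit_cone :: "nat \<Rightarrow> nat \<Rightarrow> nat cpoly set \<Rightarrow> bool" where
  "limit_cone r d Z \<longleftrightarrow> Z \<subseteq> vecs (mons {..r} d) - {0} \<and>
     (\<forall>c f. c \<noteq> 0 \<longrightarrow> f \<in> Z \<longrightarrow> cC c * f \<in> Z) \<and>
     (\<forall>c. coeffs_poly c \<longrightarrow> (\<forall>t. c t \<in> vecs (mons {..r} d)) \<longrightarrow> (\<forall>t. t \<noteq> 0 \<longrightarrow> c t \<in> Z) \<longrightarrow> c 0 \<noteq> 0 \<longrightarrow> c 0 \<in> Z) \<and>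
     (\<forall>i t f. 2 \<le> i \<longrightarrow> i \<le> r \<longrightarrow> f \<in> Z \<longrightarrow> act r (transvec i t) f \<in> Z) \<and>
     (\<forall>s f. s \<noteq> 0 \<longrightarrow> f \<in> Z \<longrightarrow> act r (torus s) f \<in> Z)"

lemma limit_coneD:
  assumes "limit_cone r d Z"
  shows "f \<in> Z \<Longrightarrow> f \<in> vecs (mons {..r} d)" "f \<in> Z \<Longrightarrow> f \<noteq> 0" "c \<noteq> 0 \<Longrightarrow> f \<in> Z \<Longrightarrow> cC c * f \<in> Z"
    "coeffs_poly C \<Longrightarrow> (\<And>t. C t \<in> vecs (mons {..r} d)) \<Longrightarrow> (\<And>t. t \<noteq> 0 \<Longrightarrow> C t \<in> Z) \<Longrightarrow> C 0 \<noteq> 0 \<Longrightarrow> C 0 \<in> Z"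
    "2 \<le> i \<Longrightarrow> i \<le> r \<Longrightarrow> f \<in> Z \<Longrightarrow> act r (transvec i t) f \<in> Z"
    "s \<noteq> 0 \<Longrightarrow> f \<in> Z \<Longrightarrow> act r (torus s) f \<in> Z"
  using assms by (auto simp: limit_cone_def)

lemma poly_homogenized:
  fixes P :: "complex poly"
  assumes "degree P \<le> K" "a \<noteq> 0"
  shows "a ^ K * poly P (b / a) = (\<Sum>k\<le>K. coeff P k * b ^ k * a ^ (K - k))"
proof -
  have eq: "poly P (b / a) = (\<Sum>k\<le>K. coeff P k * (b / a) ^ k)"
    unfolding poly_altdef using assms(1) by (intro sum.mono_neutral_left) (auto simp: coeff_eq_0 not_le)
  have "a ^ K * (coeff P k * (b / a) ^ k) = coeff P k * b ^ k * a ^ (K - k)" if "k \<le> K" for k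
  proof -
    have "a ^ K = a ^ k * a ^ (K - k)" using that by (simp flip: power_add)
    then show ?thesis using assms(2) by (simp add: power_divide)
  qed
  then show ?thesis unfolding eq sum_distrib_left by (intro sum.cong) auto
qed

lemma sum_zero_power: "(\<Sum>k\<le>K. f k * 0 ^ (K - k)) = (f K :: complex)"
proof -
  have "(\<Sum>k\<le>K. f k * 0 ^ (K - k)) = (\<Sum>k\<le>K. if k = K then f k else 0)"
  proof (rule sum.cong, rule refl)
    fix k assume "k \<in> {..K}"
    then show "f k * 0 ^ (K - k) = (if k = K then f k else 0)"
      by (cases "k = K") (auto simp: power_0_left)
  qed
  then show ?thesis by (simp add: sum.delta)
qed

text \<open>The coefficients of \<open>act r (transvec i t) f\<close> are polynomials in \<open>t\<close>. The coefficient of the highest power of \<open>t\<close> is the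
  limit of the suitably scaled curve for \<open>t\<close> tending to infinity; it is fixed by the transvections in direction \<open>i\<close>, since these
  translate \<open>t\<close>. The limit inherits invariance under the other transvections because they commute.\<close>

lemma unipotent_limit:
  assumes Z: "limit_cone r d Z" and f: "f \<in> Z" and i: "2 \<le> i" "i \<le> r"
  shows "\<exists>g\<in>Z. (\<forall>u. act r (transvec i u) g = g) \<and>
    (\<forall>j. 2 \<le> j \<and> j \<le> r \<and> j \<noteq> i \<and> (\<forall>u. act r (transvec j u) f = f) \<longrightarrow> (\<forall>u. act r (transvec j u) g = g))"
proof -
  let ?M = "mons {..r} d"
  have M: "finite ?M" by (rule finite_mons) simp
  have fF: "f \<in> vecs ?M" using limit_coneD(1)[OF Z f] .
  let ?f = "\<lambda>t. act r (transvec i t) f"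
  have fF': "?f t \<in> vecs ?M" for t by (rule act_forms[OF fF])
  have "\<forall>m. \<exists>P. \<forall>t. lookup (?f t) m = poly P t"
    using coeffs_poly_act[of "transvec i" r f, OF polyfn_transvec] unfolding coeffs_poly_def polyfn_def .
  from choice[OF this] obtain P where P: "\<forall>m. \<forall>t. lookup (?f t) m = poly (P m) t" ..
  define M' where "M' = {m \<in> ?M. P m \<noteq> 0}"
  have "M' \<noteq> {}"
  proof
    assume "M' = {}"
    then have "lookup f m = 0" if "m \<in> ?M" for m
      using that P[rule_format, of 0 m] act_transvec_0[OF fF i] by (auto simp: M'_def)
    then show False using limit_coneD(2)[OF Z f] vec_eq_0_iff[OF fF] by blast
  qed
  have finM': "finite M'" using M by (simp add: M'_def)
  define K where "K = Max ((\<lambda>m. degree (P m)) ` M')"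
  have K: "degree (P m) \<le> K" if "m \<in> ?M" for m
    using that finM' by (cases "P m = 0") (auto simp: K_def M'_def)
  have "K \<in> (\<lambda>m. degree (P m)) ` M'" unfolding K_def using finM' \<open>M' \<noteq> {}\<close> by (intro Max_in) auto
  then obtain m1 where m1: "m1 \<in> ?M" "coeff (P m1) K \<noteq> 0" by (auto simp: M'_def)
  define c where "c s = vec_of ?M (\<lambda>m. \<Sum>k\<le>K. coeff (P m) k * 1 ^ k * s ^ (K - k))" for s
  have cF: "c s \<in> vecs ?M" for s unfolding c_def by (rule vec_of_vecs[OF M])
  have "polyfn (\<lambda>s. lookup (c s) m) " for m
    unfolding c_def lookup_vec_of[OF M] by (intro polyfn_if polyfn_sum polyfn_mult polyfn_power polyfn_const polyfn_id)
  then have cP: "coeffs_poly c" unfolding coeffs_poly_def by blast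
  have c_eq: "c s = cC (s ^ K) * ?f (1 / s)" if "s \<noteq> 0" for s
  proof (rule poly_mapping_eqI)
    fix m show "lookup (c s) m = lookup (cC (s ^ K) * ?f (1 / s)) m"
    proof (cases "m \<in> ?M")
      case True
      then show ?thesis using poly_homogenized[OF K[OF True] that, of 1] P by (simp add: c_def lookup_vec_of[OF M])
    next
      case False
      then show ?thesis using lookup_outside[OF fF' False] by (simp add: c_def lookup_vec_of[OF M])
    qed
  qed
  have c0: "lookup (c 0) m = coeff (P m) K" if "m \<in> ?M" for m
    using that sum_zero_power[of "\<lambda>k. coeff (P m) k"] by (simp add: c_def lookup_vec_of[OF M])
  have "c 0 \<noteq> 0" using c0[OF m1(1)] m1(2) by auto
  moreover have "c s \<in> Z" if "s \<noteq> 0" for s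
    unfolding c_eq[OF that] using that by (intro limit_coneD(3)[OF Z] limit_coneD(5)[OF Z i] f) simp
  ultimately have c0Z: "c 0 \<in> Z" using limit_coneD(4)[OF Z cP cF] by blast
  have "act r (transvec i u) (c 0) = c 0" for u
  proof (rule poly_mapping_eqI)
    fix m show "lookup (act r (transvec i u) (c 0)) m = lookup (c 0) m"
    proof (cases "m \<in> ?M")
      case True
      let ?R = "\<lambda>s. \<Sum>k\<le>K. coeff (P m) k * (1 + u * s) ^ k * s ^ (K - k)"
      have "polyfn (\<lambda>s. lookup (act r (transvec i u) (c s)) m - ?R s)"
        using coeffs_poly_act_curve[OF M cP cF] unfolding coeffs_poly_def
        by (intro polyfn_diff polyfn_sum polyfn_mult polyfn_power polyfn_add polyfn_const polyfn_id) auto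
      then have "lookup (act r (transvec i u) (c 0)) m - ?R 0 = 0"
      proof (rule polyfn_zero_ext)
        fix s :: complex assume s: "s \<noteq> 0"
        have "act r (transvec i u) (c s) = cC (s ^ K) * ?f (1 / s + u)"
          by (simp add: c_eq[OF s] act_cC_mult act_transvec_transvec[OF fF i])
        also have "1 / s + u = (1 + u * s) / s" using s by (simp add: field_simps)
        finally show "lookup (act r (transvec i u) (c s)) m - ?R s = 0"
          using poly_homogenized[OF K[OF True] s] P by simp
      qed
      moreover have "?R 0 = coeff (P m) K"
        using sum_zero_power[of "\<lambda>k. coeff (P m) k"] by simp
      ultimately show ?thesis by (simp only: c0[OF True]) simp
    next
      case False
      then show ?thesis using lookup_outside[OF act_forms[OF cF] False] lookup_outside[OF cF False] by simp
    qed
  qed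
  moreover have "act r (transvec j u) (c 0) = c 0"
    if j: "2 \<le> j" "j \<le> r" "j \<noteq> i" "\<forall>u. act r (transvec j u) f = f" for j u
  proof (rule poly_mapping_eqI)
    fix m
    have "polyfn (\<lambda>s. lookup (act r (transvec j u) (c s)) m - lookup (c s) m)"
      using coeffs_poly_act_curve[OF M cP cF] cP unfolding coeffs_poly_def by (intro polyfn_diff) auto
    then have "lookup (act r (transvec j u) (c 0)) m - lookup (c 0) m = 0"
    proof (rule polyfn_zero_ext)
      fix s :: complex assume s: "s \<noteq> 0"
      have "act r (transvec j u) (?f (1 / s)) = ?f (1 / s)"
        using act_transvec_commute[OF fF i j(1,2), of u "1 / s"] j(3,4) by simp
      then show "lookup (act r (transvec j u) (c s)) m - lookup (c s) m = 0"
        by (simp add: c_eq[OF s] act_cC_mult)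
    qed
    then show "lookup (act r (transvec j u) (c 0)) m = lookup (c 0) m" by simp
  qed
  ultimately show ?thesis using c0Z by (intro bexI[of _ "c 0"]) auto
qed

lemma exists_unip_inv:
  assumes Z: "limit_cone r d Z" and f: "f \<in> Z"
  shows "\<exists>g\<in>Z. unip_inv r g"
proof -
  have "\<exists>g\<in>Z. \<forall>i\<in>S. \<forall>u. act r (transvec i u) g = g" if "finite S" "S \<subseteq> {2..r}" for S
    using that
  proof (induction S)
    case (insert i S)
    then obtain g where g: "g \<in> Z" "\<forall>i\<in>S. \<forall>u. act r (transvec i u) g = g" by auto
    have i: "2 \<le> i" "i \<le> r" using insert by auto
    obtain h where h: "h \<in> Z" "\<forall>u. act r (transvec i u) h = h"
      "\<forall>j. 2 \<le> j \<and> j \<le> r \<and> j \<noteq> i \<and> (\<forall>u. act r (transvec j u) g = g) \<longrightarrow> (\<forall>u. act r (transvec j u) h = h)"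
      using unipotent_limit[OF Z g(1) i] by blast
    have "\<forall>u. act r (transvec j u) h = h" if "j \<in> S" for j
      using that insert g(2) h(3) by (auto simp: subset_iff)
    with h show ?case by (intro bexI[of _ h]) auto
  qed (use f in auto)
  from this[of "{2..r}"] obtain g where "g \<in> Z" "\<forall>i\<in>{2..r}. \<forall>u. act r (transvec i u) g = g" by auto
  then show ?thesis by (intro bexI[of _ g]) (auto simp: unip_inv_def)
qed

lemma plane_expansion:
  assumes r: "r \<ge> 1" and g: "g \<in> vecs (mons {..r} d)"
  shows "\<exists>b. \<forall>\<alpha> \<beta>. peval (pl \<alpha> \<beta>) g = (\<Sum>j\<le>d. b j * \<alpha> ^ (d - j) * \<beta> ^ j)"
proof -
  let ?M = "mons {..r} d"
  define supp where "supp m \<longleftrightarrow> (\<forall>i\<in>{2..r}. lookup m i = 0)" for m :: "nat \<Rightarrow>\<^sub>0 nat"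
  have mv: "mono_val (pl \<alpha> \<beta>) m = (if supp m then \<alpha> ^ (d - lookup m 1) * \<beta> ^ lookup m 1 else 0)"
    if m: "m \<in> ?M" for m \<alpha> \<beta>
  proof -
    have split: "{..r} = {0, 1} \<union> {2..r}" using r by auto
    have "mono_val (pl \<alpha> \<beta>) m = (\<Prod>i\<in>{0, 1} \<union> {2..r}. pl \<alpha> \<beta> i ^ lookup m i)"
      unfolding split[symmetric] using m by (intro mono_val_superset) (auto simp: mons_def)
    also have "\<dots> = \<alpha> ^ lookup m 0 * \<beta> ^ lookup m 1 * (\<Prod>i\<in>{2..r}. pl \<alpha> \<beta> i ^ lookup m i)"
      by (subst prod.union_disjoint) auto
    finally have 1: "mono_val (pl \<alpha> \<beta>) m = \<dots>" .
    have "mdeg m = (\<Sum>i\<in>{0, 1} \<union> {2..r}. lookup m i)"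
      unfolding split[symmetric] using m by (intro mdeg_superset) (auto simp: mons_def)
    also have "\<dots> = lookup m 0 + lookup m 1 + (\<Sum>i\<in>{2..r}. lookup m i)"
      by (subst sum.union_disjoint) auto
    finally have 2: "d = \<dots>" using m by (simp add: mons_def)
    show ?thesis
    proof (cases "supp m")
      case True
      then have "(\<Prod>i\<in>{2..r}. pl \<alpha> \<beta> i ^ lookup m i) = 1" "(\<Sum>i\<in>{2..r}. lookup m i) = 0"
        by (auto simp: supp_def)
      then show ?thesis using 1 2 True by simp
    next
      case False
      then have "(\<Prod>i\<in>{2..r}. pl \<alpha> \<beta> i ^ lookup m i) = 0" by (auto simp: supp_def)
      then show ?thesis using 1 False by simp
    qed
  qed
  define b where "b j = (\<Sum>m\<in>{m \<in> ?M. lookup m 1 = j}. if supp m then lookup g m else 0)" for j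
  have "peval (pl \<alpha> \<beta>) g = (\<Sum>j\<le>d. b j * \<alpha> ^ (d - j) * \<beta> ^ j)" for \<alpha> \<beta>
  proof -
    have "lookup m 1 \<le> d" if "m \<in> ?M" for m
      using that lookup_le_mdeg[of m 1] by (simp add: mons_def)
    then have im: "(\<lambda>m. lookup m 1) ` ?M \<subseteq> {..d}" by auto
    have "peval (pl \<alpha> \<beta>) g = (\<Sum>m\<in>?M. lookup g m * mono_val (pl \<alpha> \<beta>) m)"
      by (rule peval_vecs[OF _ g]) simp
    also have "\<dots> = (\<Sum>m\<in>?M. (if supp m then lookup g m else 0) * \<alpha> ^ (d - lookup m 1) * \<beta> ^ lookup m 1)"
      by (rule sum.cong) (auto simp: mv)
    also have "\<dots> = (\<Sum>j\<le>d. \<Sum>m\<in>{m \<in> ?M. lookup m 1 = j}. (if supp m then lookup g m else 0) * \<alpha> ^ (d - lookup m 1) * \<beta> ^ lookup m 1)"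
      by (rule sum.group[symmetric, OF finite_mons _ im]) auto
    also have "\<dots> = (\<Sum>j\<le>d. b j * \<alpha> ^ (d - j) * \<beta> ^ j)"
      unfolding b_def sum_distrib_right by (intro sum.cong) auto
    finally show ?thesis .
  qed
  then show ?thesis by blast
qed

text \<open>Restricted to the plane, \<open>g\<close> is a combination of the monomials \<open>x0^(d-j) x1^j\<close>, and \<open>x1\<close> stands for \<open>q0 / (2 x0)\<close> by
  \<open>unip_inv_plane\<close>. If \<open>r \<ge> 2\<close>, then \<open>x0\<close> can tend to \<open>0\<close> while \<open>q0 = 1\<close>, and a term with \<open>j > d - j\<close> would have a pole.\<close>

lemma unip_inv_decomposition:
  assumes r: "r \<ge> 1" and g: "g \<in> vecs (mons {..r} d)" "unip_inv r g"
  shows "\<exists>c. g = (\<Sum>j\<in>{j. j \<le> d \<and> (j \<le> d - j \<or> r = 1)}. cC (c j) * special r (d - j) j)"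
proof -
  obtain b where b: "\<And>\<alpha> \<beta>. peval (pl \<alpha> \<beta>) g = (\<Sum>j\<le>d. b j * \<alpha> ^ (d - j) * \<beta> ^ j)"
    using plane_expansion[OF r g(1)] by blast
  let ?J = "{j. j \<le> d \<and> (j \<le> d - j \<or> r = 1)}"
  have b0: "b j = 0" if j: "j \<le> d" "\<not> j \<le> d - j" "r \<noteq> 1" for j
  proof -
    have r2: "2 \<le> r" using r j by auto
    define x where "x e i = (if i = 0 then e else if i = 2 then 1 else (0::complex))" for e :: complex and i :: nat
    have "polyfn (\<lambda>e. peval (x e) g)"
      by (rule polyfn_peval) (auto simp: x_def intro!: polyfn_if)
    then obtain P where P: "\<And>e. peval (x e) g = poly P e" by (auto simp: polyfn_def)
    have q: "peval (x e) (q0 r) = 1" for e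
    proof -
      have "(\<Sum>i = 2..r. x e i ^ 2) = (\<Sum>i = 2..r. if i = 2 then 1 else 0)"
        by (rule sum.cong) (auto simp: x_def)
      then show ?thesis using r2 by (simp add: peval_q0 sum.delta) (simp add: x_def)
    qed
    define Q where "Q = (\<Sum>k\<le>d. monom (b k / 2 ^ k) (2 * (d - k)))"
    have Z0: "poly (monom 1 d * P - Q) e * e = 0" for e
    proof (cases "e = 0")
      case False
      then have "poly P e = (\<Sum>k\<le>d. b k * e ^ (d - k) * (1 / (2 * e)) ^ k)"
        using unip_inv_plane[OF g r, of "x e"] by (simp add: q P[symmetric] b) (simp add: x_def)
      then have "e ^ d * poly P e = (\<Sum>k\<le>d. e ^ d * (b k * e ^ (d - k) * (1 / (2 * e)) ^ k))"
        by (simp add: sum_distrib_left)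
      also have "\<dots> = (\<Sum>k\<le>d. b k / 2 ^ k * e ^ (2 * (d - k)))"
      proof (rule sum.cong, rule refl)
        fix k assume "k \<in> {..d}"
        define u v where "u = e ^ (d - k)" and "v = e ^ k"
        have "e ^ d = u * v" using \<open>k \<in> {..d}\<close> by (simp add: u_def v_def flip: power_add)
        moreover have "(1 / (2 * e)) ^ k = 1 / (2 ^ k * v)" by (simp add: v_def power_divide power_mult_distrib)
        moreover have "e ^ (2 * (d - k)) = u * u" by (simp add: u_def mult_2 power_add)
        moreover have "v \<noteq> 0" using False by (simp add: v_def)
        ultimately show "e ^ d * (b k * e ^ (d - k) * (1 / (2 * e)) ^ k) = b k / 2 ^ k * e ^ (2 * (d - k))"
          unfolding u_def[symmetric] by simp
      qed
      finally show ?thesis by (simp add: Q_def poly_sum poly_monom)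
    qed simp
    have A: "poly (X * [:0, 1:]) e = poly X e * e" for X :: "complex poly" and e
      by (simp add: mult.commute)
    have "poly ((monom 1 d * P - Q) * [:0, 1:]) e = 0" for e unfolding A by (rule Z0)
    then have "(monom 1 d * P - Q) * [:0, 1:] = 0" using poly_all_0_iff_0 by blast
    then have eq: "monom 1 d * P = Q" by simp
    have "2 * (d - j) < d" using j by linarith
    then have "coeff (monom 1 d * P) (2 * (d - j)) = 0" by (simp add: coeff_monom_mult)
    moreover have "coeff Q (2 * (d - j)) = (\<Sum>k\<le>d. if k = j then b k / 2 ^ k else 0)"
      unfolding Q_def coeff_sum using j by (intro sum.cong) (auto simp: coeff_monom)
    ultimately show "b j = 0" using eq j by (simp add: sum.delta)
  qed
  define c where "c j = b j / 2 ^ j" for j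
  have "g = (\<Sum>j\<in>?J. cC (c j) * special r (d - j) j)"
  proof (rule unip_inv_eqI[OF g _ _ r])
    have "special r (d - j) j \<in> vecs (mons {..r} d)" if "j \<in> ?J" for j
      using special_forms[OF r, of "d - j" j] that by simp
    then show "(\<Sum>j\<in>?J. cC (c j) * special r (d - j) j) \<in> vecs (mons {..r} d)"
      by (intro vecs_sum vecs_cC_mult)
    show "unip_inv r (\<Sum>j\<in>?J. cC (c j) * special r (d - j) j)"
      by (intro unip_inv_sum unip_inv_cC_mult unip_inv_special) auto
    fix \<alpha> \<beta> :: complex
    have "peval (pl \<alpha> \<beta>) g = (\<Sum>j\<in>?J. b j * \<alpha> ^ (d - j) * \<beta> ^ j)"
      unfolding b by (rule sum.mono_neutral_right) (use b0 in auto)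
    also have "\<dots> = peval (pl \<alpha> \<beta>) (\<Sum>j\<in>?J. cC (c j) * special r (d - j) j)"
      by (simp add: special_plane c_def mult.assoc)
    finally show "peval (pl \<alpha> \<beta>) g = peval (pl \<alpha> \<beta>) (\<Sum>j\<in>?J. cC (c j) * special r (d - j) j)" .
  qed
  then show ?thesis by blast
qed

text \<open>A form that is invariant under the transvections is a combination of special forms, and these have pairwise different
  weights under the torus. The limit under the torus is the term with the smallest \<open>j\<close>.\<close>

theorem limit_cone_contains_special_form:
  assumes r: "r \<ge> 1" and Z: "limit_cone r d Z" and f: "f \<in> Z"
  shows "\<exists>j. j \<le> d \<and> (j \<le> d - j \<or> r = 1) \<and> special r (d - j) j \<in> Z"
proof -
  let ?J = "{j. j \<le> d \<and> (j \<le> d - j \<or> r = 1)}"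
  obtain g where g: "g \<in> Z" "unip_inv r g" using exists_unip_inv[OF Z f] by blast
  note gF = limit_coneD(1)[OF Z g(1)]
  obtain c where c: "g = (\<Sum>j\<in>?J. cC (c j) * special r (d - j) j)" using unip_inv_decomposition[OF r gF g(2)] by blast
  have "\<exists>j\<in>?J. c j \<noteq> 0"
  proof (rule ccontr)
    assume "\<not> ?thesis"
    then have "g = 0" unfolding c by (intro sum.neutral) auto
    then show False using limit_coneD(2)[OF Z g(1)] by simp
  qed
  then obtain j0 where j0: "j0 \<in> ?J" "c j0 \<noteq> 0" "\<And>j. j \<in> ?J \<Longrightarrow> c j \<noteq> 0 \<Longrightarrow> j0 \<le> j"
    using exists_least_iff[of "\<lambda>j. j \<in> ?J \<and> c j \<noteq> 0"] by (metis (no_types, lifting) not_le)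
  define h where "h s = (\<Sum>j\<in>?J. cC (c j * s ^ (j - j0)) * special r (d - j) j)" for s
  have spF: "special r (d - j) j \<in> vecs (mons {..r} d)" if "j \<in> ?J" for j
    using special_forms[OF r, of "d - j" j] that by simp
  have hF: "h s \<in> vecs (mons {..r} d)" for s
    unfolding h_def by (intro vecs_sum vecs_cC_mult spF)
  have hP: "coeffs_poly h"
    unfolding h_def by (intro coeffs_poly_sum coeffs_poly_mult coeffs_poly_cC coeffs_poly_const polyfn_mult polyfn_power) auto
  have h0: "h 0 = cC (c j0) * special r (d - j0) j0"
  proof -
    have "h 0 = (\<Sum>j\<in>?J. if j = j0 then cC (c j0) * special r (d - j0) j0 else 0)"
      unfolding h_def
    proof (rule sum.cong, rule refl)
      fix j assume j: "j \<in> ?J"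
      show "cC (c j * 0 ^ (j - j0)) * special r (d - j) j = (if j = j0 then cC (c j0) * special r (d - j0) j0 else 0)"
      proof (cases "j = j0 \<or> c j = 0")
        case False
        then have "0 < j - j0" using j0(3)[OF j] by simp
        then show ?thesis using False by (simp add: power_0_left)
      qed (use j0(2) in auto)
    qed
    then show ?thesis using j0(1) by (simp add: sum.delta)
  qed
  have h0nz: "h 0 \<noteq> 0"
  proof
    assume "h 0 = 0"
    then have "peval (pl 1 1) (h 0) = 0" by simp
    then show False using j0(2) unfolding h0 by (simp add: special_plane)
  qed
  have "h s \<in> Z" if s: "s \<noteq> 0" for s
  proof -
    \<comment> \<open>The torus acts on \<open>special r (d - j) j\<close> with weight \<open>d - 2 j\<close>; the square root turns the exponents \<open>2 j\<close> into \<open>j\<close>.\<close>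
    define w where "w = csqrt s"
    have w: "w \<noteq> 0" "w ^ 2 = s" using s by (auto simp: w_def)
    have "cC (w ^ d * (1 / s) ^ j0) * act r (torus (1 / w)) g = h s"
    proof -
      have act_sum: "act r \<delta> (\<Sum>j\<in>S. F j) = (\<Sum>j\<in>S. act r \<delta> (F j))" for \<delta> and F :: "nat \<Rightarrow> nat cpoly" and S
        by (rule peval_inject) simp
      have T: "act r (torus (1 / w)) (special r A a) = cC ((1 / w) ^ A * w ^ a) * special r A a" for A a
        using act_torus_special[OF r, of "1 / w" A a] w(1) by simp
      have "cC (w ^ d * (1 / s) ^ j0) * act r (torus (1 / w)) g =
         (\<Sum>j\<in>?J. cC (w ^ d * (1 / s) ^ j0) * (cC (c j) * (cC ((1 / w) ^ (d - j) * w ^ j) * special r (d - j) j)))"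
        unfolding c act_sum sum_distrib_left
        by (intro sum.cong refl) (simp only: act_cC_mult T)
      also have "\<dots> = h s"
        unfolding h_def
      proof (rule sum.cong, rule refl)
        fix j assume j: "j \<in> ?J"
        show "cC (w ^ d * (1 / s) ^ j0) * (cC (c j) * (cC ((1 / w) ^ (d - j) * w ^ j) * special r (d - j) j)) =
          cC (c j * s ^ (j - j0)) * special r (d - j) j"
        proof (cases "c j = 0")
          case False
          then have jj: "j0 \<le> j" using j0(3)[OF j] by simp
          have "w ^ d = w ^ (d - j) * w ^ j" using j by (simp flip: power_add)
          then have 1: "w ^ d * ((1 / w) ^ (d - j) * w ^ j) = w ^ j * w ^ j" using w(1) by (simp add: power_divide)
          have 2: "w ^ j * w ^ j = s ^ j" by (simp add: w(2)[symmetric] power2_eq_square power_mult_distrib)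
          have 3: "s ^ j = s ^ j0 * s ^ (j - j0)" using jj by (simp flip: power_add)
          have "w ^ d * (1 / s) ^ j0 * (c j * ((1 / w) ^ (d - j) * w ^ j)) = c j * ((1 / s) ^ j0 * s ^ j)"
            using 1 2 by (metis (no_types, lifting) mult.assoc mult.commute)
          also have "\<dots> = c j * s ^ (j - j0)" unfolding 3 using s by (simp add: power_divide)
          finally have 4: "w ^ d * (1 / s) ^ j0 * (c j * ((1 / w) ^ (d - j) * w ^ j)) = c j * s ^ (j - j0)" .
          have "cC a1 * (cC a2 * (cC a3 * F)) = cC (a1 * (a2 * a3)) * F" for a1 a2 a3 and F :: "nat cpoly"
            by (rule peval_inject) simp
          then show ?thesis unfolding 4[symmetric] by simp
        qed simp
      qed
      finally show ?thesis .
    qed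
    moreover have "cC (w ^ d * (1 / s) ^ j0) * act r (torus (1 / w)) g \<in> Z"
      using w(1) s by (intro limit_coneD(3)[OF Z] limit_coneD(6)[OF Z] g) auto
    ultimately show ?thesis by simp
  qed
  then have "h 0 \<in> Z" using limit_coneD(4)[OF Z hP hF _ h0nz] by blast
  then have "cC (1 / c j0) * h 0 \<in> Z" using j0(2) by (intro limit_coneD(3)[OF Z]) auto
  moreover have "cC (1 / c j0) * h 0 = special r (d - j0) j0"
    unfolding h0 using j0(2) by (intro peval_inject) simp
  ultimately show ?thesis using j0(1) by (intro exI[of _ j0]) auto
qed

section \<open>Birationality at a special form\<close>

lemma peval_Hess_scale: "peval x (Hess r (cC c * f)) = c ^ (r + 1) * peval x (Hess r f)"
proof -
  have "mat (r + 1) (r + 1) (\<lambda>(i, j). peval x (pdiff i (pdiff j (cC c * f)))) =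
    c \<cdot>\<^sub>m mat (r + 1) (r + 1) (\<lambda>(i, j). peval x (pdiff i (pdiff j f)))"
    by (rule eq_matI) auto
  then show ?thesis unfolding peval_Hess by simp
qed

lemma hom_fun_line_deriv:
  assumes "finite I" "\<phi> \<in> hom_fun I n"
  shows "\<exists>c. \<forall>w. ((\<lambda>t. \<phi> (\<lambda>i. p i + t * w i)) has_field_derivative (\<Sum>i\<in>I. c i * w i)) (at 0)"
proof -
  obtain F where F: "F \<in> vecs (mons I n)" "\<phi> = (\<lambda>x. peval x F)" using assms(2) by (auto simp: hom_fun_def)
  have "((\<lambda>t. peval (\<lambda>i. p i + t * w i) F) has_field_derivative (\<Sum>i\<in>I. w i * peval p (pdiff i F))) (at 0)" for w
    by (rule peval_line_deriv[OF assms(1)]) (use F in \<open>auto simp: vecs_def mons_def\<close>)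
  then show ?thesis unfolding F(2) by (intro exI[of _ "\<lambda>i. peval p (pdiff i F)"]) (simp add: mult.commute)
qed

lemma act_transvec_inverse:
  assumes f: "f \<in> vecs (mons {..r} n)" and i: "2 \<le> i" "i \<le> r"
  shows "act r (transvec i (- t)) (act r (transvec i t) f) = f"
  using act_transvec_transvec[OF f i, of "- t" t] act_transvec_0[OF f i] by simp

lemma act_torus_inverse:
  assumes f: "f \<in> vecs (mons {..r} n)" and s: "s \<noteq> 0"
  shows "act r (torus (1 / s)) (act r (torus s) f) = f"
proof (rule peval_inject)
  fix x show "peval x (act r (torus (1 / s)) (act r (torus s) f)) = peval x f"
    unfolding peval_act by (rule peval_cong_vars[OF f]) (use s in \<open>auto simp: lin_map_torus\<close>)
qed

lemma power_ratio_eq: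
  fixes c1 c2 :: complex
  assumes "c1 \<noteq> 0" "\<And>\<beta>. c1 * 2 ^ n * \<beta> ^ n = c2 * 2 ^ m * \<beta> ^ m"
  shows "n = m"
proof -
  have 1: "c1 * 2 ^ n = c2 * 2 ^ m" using assms(2)[of 1] by simp
  have "c1 * 2 ^ n * 2 ^ n = c1 * 2 ^ n * 2 ^ m" using assms(2)[of 2] 1 by simp
  then have "(2::complex) ^ n = 2 ^ m" using assms(1) by simp
  then have "(of_nat (2 ^ n) :: complex) = of_nat (2 ^ m)" by simp
  then have "(2::nat) ^ n = 2 ^ m" by (simp only: of_nat_eq_iff)
  then show ?thesis by simp
qed

definition hess_coeff :: "nat \<Rightarrow> nat \<Rightarrow> (nat \<Rightarrow>\<^sub>0 nat) \<Rightarrow> ((nat \<Rightarrow>\<^sub>0 nat) \<Rightarrow> complex) \<Rightarrow> complex" where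
  "hess_coeff r d j x = lookup (Hess r (vec_of (mons {..r} d) x)) j"

text \<open>The point \<open>([f], [y])\<close> violates an equation of the graph of the Hessian map.\<close>

definition off_fibre :: "nat \<Rightarrow> nat \<Rightarrow> nat cpoly \<Rightarrow> nat cpoly \<Rightarrow> bool" where
  "off_fibre r d f y \<longleftrightarrow> (\<exists>n k. \<exists>\<Phi>\<in>bihom_fun (mons {..r} d) (mons {..r} ((d - 2) * (r + 1))) n k.
     (\<forall>x. \<Phi> x (\<lambda>j. hess_coeff r d j x) = 0) \<and> \<Phi> (lookup f) (lookup y) \<noteq> 0)"

text \<open>The kernel of the derivative at \<open>p = special r A a\<close>, without \<open>0\<close>, and the cone over the fibre at \<open>[Hess r p]\<close>, without the
  multiples of \<open>p\<close>, are limit cones. If one of them were nonempty, it would contain a special form. The kernel contains none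
  by \<open>nz\<close>. In the fibre the Hessian has to be proportional to that of \<open>p\<close>, which leaves only the two powers of variables,
  excluded by \<open>off\<close> and \<open>off'\<close>.\<close>

theorem birational_at_special_form:
  assumes r: "r \<ge> 1" and a: "a \<ge> 1" "a \<le> A" and d: "d = A + a"
    and nz: "\<And>j. j \<le> d \<Longrightarrow> j \<le> d - j \<or> r = 1 \<Longrightarrow> special_deriv r A a (d - j) j \<noteq> 0"
    and off: "off_fibre r d (special r d 0) (Hess r (special r A a))"
    and off': "r = 1 \<Longrightarrow> off_fibre r d (special r 0 d) (Hess r (special r A a))"
  shows "birational_onto_image (mons {..r} d) (mons {..r} ((d - 2) * (r + 1)))
           (map_graph (mons {..r} d) (Hess r))"
proof -
  define I where "I = mons {..r} d"
  define J where "J = mons {..r} ((d - 2) * (r + 1))"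
  define \<eta> where "\<eta> = hess_coeff r d"
  define p where "p = special r A a"
  have I: "finite I" and J: "finite J" by (simp_all add: I_def J_def finite_mons)
  have A1: "A \<ge> 1" using a by simp
  have pI: "p \<in> vecs I" unfolding p_def I_def d by (rule special_forms[OF r])
  have HJ: "Hess r f \<in> vecs J" if "f \<in> vecs I" for f
    using Hess_forms[of f r d] that by (simp add: I_def J_def)
  have \<eta>: "\<eta> j \<in> hom_fun I (r + 1)" for j
    using hom_coeffs_Hess[OF I, of r] unfolding \<eta>_def hess_coeff_def[abs_def] I_def[symmetric] hom_coeffs_def by blast
  have \<eta>l: "\<eta> j (lookup f) = lookup (Hess r f) j" if "f \<in> vecs I" for f j
    using vec_of_lookup[OF I that] by (simp add: \<eta>_def hess_coeff_def I_def)
  have ok: "a \<le> A \<or> r = 1" using a by simp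
  note Hp = Hess_special[OF r ok a(1) A1, folded p_def]
  let ?A' = "(r + 1) * (A - 1)" and ?a' = "(r + 1) * (a - 1)"
  have Hp_ne: "Hess r p \<noteq> 0"
  proof
    assume "Hess r p = 0"
    then have "peval (pl 1 1) (Hess r p) = 0" by simp
    then show False using special_const_nz[OF A1 a(1)] unfolding Hp by (simp add: special_plane)
  qed
  have p_ne: "p \<noteq> 0" using Hp_ne Hess_0 by auto
  obtain j0 where j0: "j0 \<in> J" "lookup (Hess r p) j0 \<noteq> 0" using Hp_ne vec_eq_0_iff[OF HJ[OF pI]] by blast
  note Hpj0 = j0(2)
  obtain i0 where i0: "i0 \<in> I" "lookup p i0 \<noteq> 0" using p_ne vec_eq_0_iff[OF pI] by blast
  interpret poly_map I J "r + 1" \<eta> "lookup p" j0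
    by standard (use I J \<eta> j0 \<eta>l[OF pI] in auto)
  have y0: "y0 = lookup (Hess r p)" using \<eta>l[OF pI] by auto
  have "\<forall>j. \<exists>c. \<forall>w. ((\<lambda>t. \<eta> j (\<lambda>i. lookup p i + t * w i)) has_field_derivative (\<Sum>i\<in>I. c i * w i)) (at 0)"
    using hom_fun_line_deriv[OF I \<eta>] by blast
  from choice[OF this] obtain c where
    c: "\<forall>j. \<forall>w. ((\<lambda>t. \<eta> j (\<lambda>i. lookup p i + t * w i)) has_field_derivative (\<Sum>i\<in>I. c j i * w i)) (at 0)" ..
  define dH where "dH f = vec_of J (\<lambda>j. \<Sum>i\<in>I. c j i * lookup f i)" for f
  have dH: "((\<lambda>t. peval x (Hess r (p + cC t * f))) has_field_derivative peval x (dH f)) (at 0)"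
    if f: "f \<in> vecs I" for f x
  proof -
    have pf: "p + cC t * f \<in> vecs I" for t using pI f by (intro vecs_add vecs_cC_mult)
    have ex: "peval x g = (\<Sum>j\<in>J. lookup g j * mono_val x j)" if "g \<in> vecs J" for g
      using that by (intro peval_superset J) (auto simp: vecs_def)
    have l: "lookup (Hess r (p + cC t * f)) j = \<eta> j (\<lambda>i. lookup p i + t * lookup f i)" for t j
    proof -
      have "lookup (p + cC t * f) = (\<lambda>i. lookup p i + t * lookup f i)"
        by (rule ext) (simp add: lookup_add)
      then show ?thesis using \<eta>l[OF pf, of j t] by simp
    qed
    have "((\<lambda>t. \<Sum>j\<in>J. \<eta> j (\<lambda>i. lookup p i + t * lookup f i) * mono_val x j) has_field_derivative
      (\<Sum>j\<in>J. (\<Sum>i\<in>I. c j i * lookup f i) * mono_val x j)) (at 0)"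
      using c by (intro DERIV_sum DERIV_cmult_right) blast
    then show ?thesis
      unfolding ex[OF HJ[OF pf]] ex[of "dH f", unfolded dH_def, OF vec_of_vecs[OF J]] dH_def l
      by (simp add: lookup_vec_of J)
  qed
  have dH_add_scale: "dH (cC b * f) = cC b * dH f" for b f
    by (rule poly_mapping_eqI) (simp add: dH_def lookup_vec_of J sum_distrib_left mult.left_commute)
  \<comment> \<open>The derivative at \<open>p\<close> is equivariant under the substitutions that multiply \<open>p\<close> by a scalar.\<close>
  have dH_act: "dH (act r \<delta> f) = 0"
    if f: "f \<in> vecs I" "dH f = 0" and \<delta>: "act r \<delta> p = cC \<kappa> * p" "\<kappa> \<noteq> 0" for f \<delta> \<kappa>
  proof (rule peval_inject)
    fix x
    have fI: "p + cC t * f \<in> vecs (mons {..r} d)" for t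
      using pI f by (auto simp: I_def intro!: vecs_add vecs_cC_mult)
    define F where "F t = peval (lin_map r \<delta> x) (Hess r (p + cC t * f))" for t
    have "(F has_field_derivative 0) (at (\<kappa> * 0))"
      using dH[OF f(1), of "lin_map r \<delta> x"] f(2) by (simp add: F_def[abs_def])
    moreover have "((\<lambda>t. \<kappa> * t) has_field_derivative \<kappa>) (at 0)"
      by (auto intro!: derivative_eq_intros)
    ultimately have "((\<lambda>t. F (\<kappa> * t)) has_field_derivative 0 * \<kappa>) (at 0)"
      by (rule DERIV_chain2)
    then have "((\<lambda>t. (Determinant.det (lin_mat r \<delta>))\<^sup>2 / \<kappa> ^ (r + 1) * F (\<kappa> * t)) has_field_derivative
       (Determinant.det (lin_mat r \<delta>))\<^sup>2 / \<kappa> ^ (r + 1) * (0 * \<kappa>)) (at 0)"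
      by (rule DERIV_cmult)
    moreover have "peval x (Hess r (p + cC t * act r \<delta> f)) = (Determinant.det (lin_mat r \<delta>))\<^sup>2 / \<kappa> ^ (r + 1) * F (\<kappa> * t)" for t
    proof -
      have "cC \<kappa> * (p + cC t * act r \<delta> f) = act r \<delta> (p + cC (\<kappa> * t) * f)"
        unfolding act_add act_cC_mult \<delta>(1) by (rule peval_inject) (simp add: algebra_simps)
      then have "\<kappa> ^ (r + 1) * peval x (Hess r (p + cC t * act r \<delta> f)) =
          (Determinant.det (lin_mat r \<delta>))\<^sup>2 * F (\<kappa> * t)"
        using peval_Hess_scale[of x r \<kappa> "p + cC t * act r \<delta> f"] peval_Hess_act[OF fI, of x \<delta> "\<kappa> * t"]
        by (simp add: F_def)
      then show ?thesis using \<delta>(2) by (simp add: field_simps)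
    qed
    moreover have "((\<lambda>t. peval x (Hess r (p + cC t * act r \<delta> f))) has_field_derivative peval x (dH (act r \<delta> f))) (at 0)"
      using act_forms[of f r d \<delta>] f(1) by (intro dH) (simp add: I_def)
    ultimately show "peval x (dH (act r \<delta> f)) = peval x 0"
      by (simp add: DERIV_unique)
  qed
  have transvec_p: "act r (transvec i t) p = cC 1 * p" if "2 \<le> i" "i \<le> r" for i t
    using unip_inv_special[OF ok] that by (simp add: unip_inv_def p_def)
  have torus_p: "act r (torus s) p = cC (s ^ A * (1 / s) ^ a) * p" if "s \<noteq> 0" for s
    unfolding p_def by (rule act_torus_special[OF r that])
  have torus_nz: "s ^ A * (1 / s) ^ a \<noteq> 0" if "s \<noteq> 0" for s :: complex using that by simp
  have inj: "lookup f i = 0" if f: "f \<in> vecs I" "dH f = 0" for f i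
  proof (rule ccontr)
    assume ne: "lookup f i \<noteq> 0"
    define N where "N = {f \<in> vecs I - {0}. dH f = 0}"
    have "limit_cone r d N"
      unfolding limit_cone_def
    proof (intro conjI allI impI)
      show "N \<subseteq> vecs (mons {..r} d) - {0}" by (auto simp: N_def I_def)
    next
      fix b f assume b: "b \<noteq> (0::complex)" and "f \<in> N"
      then show "cC b * f \<in> N"
        using arg_cong[of "cC b * f" 0 "\<lambda>g. cC (1 / b) * g"]
        by (auto simp: N_def dH_add_scale intro: vecs_cC_mult)
          (metis (no_types, lifting) b lookup_cC_mult lookup_zero mult_eq_0_iff poly_mapping_eqI)
    next
      fix C assume C: "coeffs_poly C" "\<forall>t. C t \<in> vecs (mons {..r} d)" "\<forall>t. t \<noteq> 0 \<longrightarrow> C t \<in> N" "C 0 \<noteq> 0"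
      have "dH (C 0) = 0"
      proof (rule poly_mapping_eqI)
        fix j
        have "polyfn (\<lambda>t. lookup (dH (C t)) j)"
          unfolding dH_def lookup_vec_of[OF J] using C(1) unfolding coeffs_poly_def
          by (intro polyfn_if polyfn_sum polyfn_mult polyfn_const) auto
        then show "lookup (dH (C 0)) j = lookup 0 j"
          using polyfn_zero_ext[of "\<lambda>t. lookup (dH (C t)) j" 0] C(3) by (simp add: N_def)
      qed
      then show "C 0 \<in> N" using C by (simp add: N_def I_def)
    next
      fix i t f assume i: "2 \<le> i" "i \<le> r" and f: "f \<in> N"
      have fI: "f \<in> vecs (mons {..r} d)" using f by (simp add: N_def I_def)
      have "act r (transvec i t) f \<noteq> 0"
        using act_transvec_inverse[OF fI i, of t] f by (auto simp: N_def)
      then show "act r (transvec i t) f \<in> N"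
        using f act_forms[OF fI] dH_act[OF _ _ transvec_p[OF i]] by (auto simp: N_def I_def)
    next
      fix s f assume s: "s \<noteq> (0::complex)" and f: "f \<in> N"
      have fI: "f \<in> vecs (mons {..r} d)" using f by (simp add: N_def I_def)
      have "act r (torus s) f \<noteq> 0"
        using act_torus_inverse[OF fI s] f by (auto simp: N_def)
      then show "act r (torus s) f \<in> N"
        using f act_forms[OF fI] dH_act[OF _ _ torus_p[OF s] torus_nz[OF s]] by (auto simp: N_def I_def)
    qed
    moreover have "f \<in> N" using f ne by (auto simp: N_def)
    ultimately obtain j where j: "j \<le> d" "j \<le> d - j \<or> r = 1" "special r (d - j) j \<in> N"
      using limit_cone_contains_special_form[OF r] by blast
    obtain x D where "D \<noteq> 0" "((\<lambda>t. peval x (Hess r (p + cC t * special r (d - j) j))) has_field_derivative D) (at 0)"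
      using Hess_special_deriv_nz[OF r ok j(2) a(1) A1 nz[OF j(1,2)]] unfolding p_def by blast
    moreover have "((\<lambda>t. peval x (Hess r (p + cC t * special r (d - j) j))) has_field_derivative 0) (at 0)"
      using dH[of "special r (d - j) j" x] j(3) by (simp add: N_def)
    ultimately show False using DERIV_unique by blast
  qed
  interpret unramified_point I J "r + 1" \<eta> "lookup p" j0 c i0
  proof
    fix j w assume "j \<in> J"
    show "((\<lambda>t. \<eta> j (\<lambda>i. lookup p i + t * w i)) has_field_derivative (\<Sum>i\<in>I. c j i * w i)) (at 0)"
      using c by blast
  next
    fix w i assume w: "\<And>j. j \<in> J \<Longrightarrow> (\<Sum>i\<in>I. c j i * w i) = 0" and i: "i \<in> I"
    have "dH (vec_of I w) = 0"
      using w I by (intro poly_mapping_eqI) (auto simp: dH_def lookup_vec_of J cong: sum.cong)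
    from inj[OF vec_of_vecs[OF I] this, of i] show "w i = 0" using i by (simp add: lookup_vec_of I)
  qed (use i0 in auto)
  have off_fib: "lookup f \<notin> fib" if off_f: "off_fibre r d f (Hess r p)" for f
  proof
    assume fib: "lookup f \<in> fib"
    obtain n k \<Phi> where \<Phi>: "\<Phi> \<in> bihom_fun I J n k" "\<forall>x. \<Phi> x (\<lambda>j. \<eta> j x) = 0" "\<Phi> (lookup f) (lookup (Hess r p)) \<noteq> 0"
      using off_f unfolding off_fibre_def I_def[symmetric] J_def[symmetric] \<eta>_def[symmetric] by blast
    have "\<Phi> \<in> graph_eqs n k" using \<Phi> by (intro graph_eqsI) auto
    then have "(\<lambda>x. \<Phi> x y0) \<in> fib_ideal n" by (rule fib_idealI) simp
    from fibD[OF fib this] \<Phi>(3) show False unfolding y0 by simp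
  qed
  have fib_act: "lookup (act r \<delta> f) \<in> fib"
    if f: "f \<in> vecs I" "lookup f \<in> fib" and det: "Determinant.det (lin_mat r \<delta>) \<noteq> 0"
      and y: "act r \<delta> (Hess r p) = cC b * Hess r p" "b \<noteq> 0" for f \<delta> b
  proof -
    have "(\<lambda>i. lookup (act r \<delta> (vec_of I (lookup f))) i) \<in> fib"
    proof (rule fib_invariant[of "\<lambda>i x. lookup (act r \<delta> (vec_of I x)) i" "\<lambda>j y. lookup (act r \<delta> (vec_of J y)) j"
        "(Determinant.det (lin_mat r \<delta>))\<^sup>2" b "lookup f"])
      show "(\<lambda>x. lookup (act r \<delta> (vec_of I x)) i) \<in> hom_fun I 1" for i
        using hom_coeffs_act[OF I] by (simp add: hom_coeffs_def)
      show "(\<lambda>x. lookup (act r \<delta> (vec_of J x)) j) \<in> hom_fun J 1" for j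
        using hom_coeffs_act[OF J] by (simp add: hom_coeffs_def)
      show "\<eta> j (\<lambda>i. lookup (act r \<delta> (vec_of I x)) i) =
        (Determinant.det (lin_mat r \<delta>))\<^sup>2 * lookup (act r \<delta> (vec_of J (\<lambda>j. \<eta> j x))) j" if "j \<in> J" for x j
      proof -
        define g where "g = vec_of I x"
        have g: "g \<in> vecs I" unfolding g_def by (rule vec_of_vecs[OF I])
        have "vec_of J (\<lambda>j. \<eta> j x) = vec_of J (lookup (Hess r g))"
          by (simp add: \<eta>_def hess_coeff_def[abs_def] g_def I_def)
        also have "\<dots> = Hess r g" by (rule vec_of_lookup[OF J HJ[OF g]])
        finally have 1: "vec_of J (\<lambda>j. \<eta> j x) = Hess r g" .
        have "act r \<delta> g \<in> vecs I" using g act_forms[of g r d] by (simp add: I_def)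
        then have "\<eta> j (lookup (act r \<delta> g)) = lookup (Hess r (act r \<delta> g)) j" by (rule \<eta>l)
        also have "\<dots> = (Determinant.det (lin_mat r \<delta>))\<^sup>2 * lookup (act r \<delta> (Hess r g)) j"
          using Hess_act[of g r d \<delta>] g by (simp add: I_def)
        finally show ?thesis unfolding 1 g_def[symmetric] by simp
      qed
      show "(Determinant.det (lin_mat r \<delta>))\<^sup>2 \<noteq> 0" using det by simp
      show "lookup (act r \<delta> (vec_of J y0)) j = b * y0 j" if "j \<in> J" for j
        unfolding y0 vec_of_lookup[OF J HJ[OF pI]] y(1) using fun_cong[OF y0, of j] by simp
    qed (use y f in auto)
    then show ?thesis using vec_of_lookup[OF I f(1)] by simp
  qed
  have det_torus: "Determinant.det (lin_mat r (torus s)) \<noteq> 0" if "s \<noteq> 0" for s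
  proof -
    have "upper_triangular (lin_mat r (torus s))" by (auto simp: lin_mat_def torus_def)
    then have "Determinant.det (lin_mat r (torus s)) = prod_list (diag_mat (lin_mat r (torus s)))"
      by (rule det_upper_triangular) (auto simp: lin_mat_def)
    also have "\<dots> \<noteq> 0" using that by (auto simp: prod_list_zero_iff diag_mat_def lin_mat_def torus_def)
    finally show ?thesis .
  qed
  have fib_p: "\<exists>b. \<forall>i\<in>I. x i = b * lookup p i" if x: "x \<in> fib" for x
  proof (rule ccontr)
    assume no: "\<not> ?thesis"
    define Z where "Z = {f \<in> vecs I. lookup f \<in> fib \<and> \<not> (\<exists>b. f = cC b * p)}"
    have Z0: "f \<noteq> 0" if "f \<in> Z" for f
      using that by (auto simp: Z_def dest: spec[of _ 0])
    have inv_Z: "act r \<delta> f \<in> Z"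
      if f: "f \<in> Z" and det: "Determinant.det (lin_mat r \<delta>) \<noteq> 0"
        and y: "act r \<delta> (Hess r p) = cC b * Hess r p" "b \<noteq> 0"
        and inv: "act r \<delta>' (act r \<delta> f) = f" "act r \<delta>' p = cC b' * p" for f \<delta> b \<delta>' b'
    proof -
      have "act r \<delta> f \<in> vecs I" using f act_forms[of f r d] by (simp add: Z_def I_def)
      moreover have "lookup (act r \<delta> f) \<in> fib" using f by (intro fib_act[OF _ _ det y]) (auto simp: Z_def)
      moreover have "act r \<delta> f \<noteq> cC u * p" for u
      proof
        assume "act r \<delta> f = cC u * p"
        then have "f = cC u * (cC b' * p)" using inv by (simp add: act_cC_mult)
        also have "\<dots> = cC (u * b') * p" by (rule peval_inject) simp
        finally show False using f by (auto simp: Z_def)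
      qed
      ultimately show ?thesis by (auto simp: Z_def)
    qed
    have "limit_cone r d Z"
      unfolding limit_cone_def
    proof (intro conjI allI impI)
      show "Z \<subseteq> vecs (mons {..r} d) - {0}" using Z0 by (auto simp: Z_def I_def)
    next
      fix b f assume b: "b \<noteq> (0::complex)" and f: "f \<in> Z"
      have "lookup (cC b * f) \<in> fib"
      proof (rule fib_cong)
        show "(\<lambda>i. b * lookup f i) \<in> fib" using f by (intro fib_scale) (simp add: Z_def)
      qed simp
      moreover have "cC b * f \<noteq> cC u * p" for u
      proof
        assume "cC b * f = cC u * p"
        then have "cC (1 / b) * (cC b * f) = cC (1 / b) * (cC u * p)" by simp
        moreover have "cC (1 / b) * (cC b * f) = f" using b by (intro peval_inject) simp
        moreover have "cC (1 / b) * (cC u * p) = cC (u / b) * p" by (rule peval_inject) simp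
        ultimately show False using f by (auto simp: Z_def)
      qed
      ultimately show "cC b * f \<in> Z" using f by (auto simp: Z_def intro: vecs_cC_mult)
    next
      fix C assume C: "coeffs_poly C" "\<forall>t. C t \<in> vecs (mons {..r} d)" "\<forall>t. t \<noteq> 0 \<longrightarrow> C t \<in> Z" "C 0 \<noteq> 0"
      have CP: "polyfn (\<lambda>t. lookup (C t) i)" for i using C(1) by (simp add: coeffs_poly_def)
      have Cf: "lookup (C t) \<in> fib" if "t \<noteq> 0" for t using C(3) that by (simp add: Z_def)
      have "C 0 \<noteq> cC u * p" for u
      proof
        assume u: "C 0 = cC u * p"
        then have "u \<noteq> 0" using C(4) by auto
        then obtain b where b: "\<forall>i\<in>I. lookup (C 1) i = b * lookup p i"
          using fib_isolated[of "\<lambda>t. lookup (C t)" u 1, OF CP Cf] u by auto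
        have "C 1 = cC b * p"
        proof (rule poly_mapping_eqI)
          fix i show "lookup (C 1) i = lookup (cC b * p) i"
            using b lookup_outside[OF pI, of i] lookup_outside[of "C 1" I i] C(2) by (cases "i \<in> I") (auto simp: I_def)
        qed
        then show False using C(3) by (auto simp: Z_def)
      qed
      moreover have "lookup (C 0) \<in> fib" by (rule fib_limit[OF CP Cf])
      ultimately show "C 0 \<in> Z" using C(2) by (auto simp: Z_def I_def)
    next
      fix i t f assume i: "2 \<le> i" "i \<le> r" and f: "f \<in> Z"
      have fI: "f \<in> vecs (mons {..r} d)" using f by (simp add: Z_def I_def)
      have y: "act r (transvec i t) (Hess r p) = cC 1 * Hess r p"
        using unip_inv_Hess[of p r d] pI unip_inv_special[OF ok] i by (simp add: unip_inv_def p_def I_def)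
      show "act r (transvec i t) f \<in> Z"
        by (rule inv_Z[OF f _ y _ act_transvec_inverse[OF fI i, of t] transvec_p[OF i]]) (simp_all add: det_transvec[OF i])
    next
      fix s f assume s: "s \<noteq> (0::complex)" and f: "f \<in> Z"
      have fI: "f \<in> vecs (mons {..r} d)" using f by (simp add: Z_def I_def)
      have y: "act r (torus s) (Hess r p) = cC (s ^ ?A' * (1 / s) ^ ?a') * Hess r p"
        unfolding Hp act_cC_mult act_torus_special[OF r s] by (rule peval_inject) simp
      have s': "1 / s \<noteq> 0" using s by simp
      show "act r (torus s) f \<in> Z"
        by (rule inv_Z[OF f det_torus[OF s] y _ act_torus_inverse[OF fI s] torus_p[OF s']]) (use s in simp)
    qed
    moreover have "vec_of I x \<in> Z"
    proof -
      have "lookup (vec_of I x) \<in> fib" by (rule fib_cong[OF x]) (simp add: lookup_vec_of I)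
      moreover have "vec_of I x \<noteq> cC u * p" for u
      proof
        assume "vec_of I x = cC u * p"
        then have "\<forall>i\<in>I. x i = u * lookup p i" using lookup_vec_of[OF I, of x] by (metis lookup_cC_mult)
        then show False using no by blast
      qed
      ultimately show ?thesis by (auto simp: Z_def vec_of_vecs I)
    qed
    ultimately obtain j where j: "j \<le> d" "j \<le> d - j \<or> r = 1" "special r (d - j) j \<in> Z"
      using limit_cone_contains_special_form[OF r] by blast
    let ?f = "special r (d - j) j"
    have f: "?f \<in> vecs I" "lookup ?f \<in> fib" using j(3) by (auto simp: Z_def)
    show False
    proof (cases "j = 0 \<or> j = d")
      case True
      then consider "j = 0" | "j = d" "r = 1" using j(2) by auto
      then show False
      proof cases
        case 1
        then show False using off_fib[of "special r d 0"] off f unfolding p_def[symmetric] by simp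
      next
        case 2
        then show False using off_fib[of "special r 0 d"] off' f unfolding p_def[symmetric] by simp
      qed
    next
      case False
      then have jj: "j \<ge> 1" "d - j \<ge> 1" using j(1) by auto
      note Hf = Hess_special[OF r j(2) jj]
      \<comment> \<open>The Hessians of \<open>?f\<close> and \<open>p\<close> are proportional; comparing exponents on the plane gives \<open>j = a\<close>.\<close>
      have "cC (lookup (Hess r p) j0) * Hess r ?f = cC (\<eta> j0 (lookup ?f)) * Hess r p"
      proof (rule poly_mapping_eqI)
        fix k show "lookup (cC (lookup (Hess r p) j0) * Hess r ?f) k = lookup (cC (\<eta> j0 (lookup ?f)) * Hess r p) k"
        proof (cases "k \<in> J")
          case True
          from fib_proportional[OF f(2) True] show ?thesis
            unfolding lookup_cC_mult \<eta>l[OF pI] \<eta>l[OF f(1)] by (simp only: mult.commute)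
        next
          case False
          then show ?thesis using lookup_outside[OF HJ[OF pI] False] lookup_outside[OF HJ[OF f(1)] False] by simp
        qed
      qed
      then have "peval (pl 1 \<beta>) (cC (lookup (Hess r p) j0) * Hess r ?f) = peval (pl 1 \<beta>) (cC (\<eta> j0 (lookup ?f)) * Hess r p)" for \<beta>
        by simp
      then have "(lookup (Hess r p) j0 * special_const r (d - j) j) * 2 ^ ((r + 1) * (j - 1)) * \<beta> ^ ((r + 1) * (j - 1)) =
          (\<eta> j0 (lookup ?f) * special_const r A a) * 2 ^ ?a' * \<beta> ^ ?a'" for \<beta>
        unfolding Hf Hp by (simp add: special_plane mult.assoc)
      from power_ratio_eq[OF _ this] have "(r + 1) * (j - 1) = ?a'"
        using Hpj0 special_const_nz[OF jj(2,1)] by simp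
      then have "j - 1 = a - 1" by (simp only: mult_cancel1) simp
      then have "j = a" using jj a by simp
      then have "?f = cC 1 * p" by (simp add: p_def d)
      moreover have "?f \<noteq> cC 1 * p" using j(3) unfolding Z_def by blast
      ultimately show False by (rule notE[rotated])
    qed
  qed
  obtain K D B where D: "D \<in> hom_fun J K" "D y0 \<noteq> 0" and B: "\<forall>i\<in>I. B i \<in> hom_fun J K"
    and DB: "\<forall>x. \<forall>i\<in>I. D (\<lambda>j. \<eta> j x) * x i = B i (\<lambda>j. \<eta> j x) * (1 / lookup p i0 * x i0)"
    using exists_inverse_formula[OF fib_p] by blast
  have "birational_onto_image I J (map_graph I (Hess r))"
    by (rule birational_from_formula[where e = "r + 1" and \<eta> = \<eta> and p = p and ?i0.0 = i0 and D = D and K = K and A = B])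
       (use I J \<eta> HJ \<eta>l pI Hp_ne i0 D B DB in auto)
  then show ?thesis by (simp add: I_def J_def)
qed

section \<open>Transport of equations of the graph\<close>

lemma off_fibre_scale:
  assumes "off_fibre r d f y" "b \<noteq> 0" "b' \<noteq> 0"
  shows "off_fibre r d (cC b * f) (cC b' * y)"
proof -
  have fin: "finite (mons {..r} d)" by (simp add: finite_mons)
  obtain n k \<Phi> where \<Phi>: "\<Phi> \<in> bihom_fun (mons {..r} d) (mons {..r} ((d - 2) * (r + 1))) n k"
    "\<forall>x. \<Phi> x (\<lambda>j. hess_coeff r d j x) = 0" "\<Phi> (lookup f) (lookup y) \<noteq> 0"
    using assms(1) unfolding off_fibre_def by blast
  have "\<Phi> (lookup (cC b * f)) (lookup (cC b' * y)) = b ^ n * b' ^ k * \<Phi> (lookup f) (lookup y)"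
    by (rule bihom_fun_scaled[OF fin \<Phi>(1)]) simp_all
  then have "\<Phi> (lookup (cC b * f)) (lookup (cC b' * y)) \<noteq> 0" using assms \<Phi>(3) by simp
  then show ?thesis unfolding off_fibre_def using \<Phi>(1,2) by blast
qed

text \<open>An equation can be pulled back along \<open>\<delta>\<close>, because substitutions commute with the Hessian up to the square of the
  determinant.\<close>

lemma off_fibre_act:
  assumes off: "off_fibre r d (act r \<delta> f) (act r \<delta> y)" and det: "Determinant.det (lin_mat r \<delta>) \<noteq> 0"
    and f: "f \<in> vecs (mons {..r} d)" and y: "y \<in> vecs (mons {..r} ((d - 2) * (r + 1)))"
  shows "off_fibre r d f y"
proof -
  define I where "I = mons {..r} d"
  define J where "J = mons {..r} ((d - 2) * (r + 1))"
  have I: "finite I" and J: "finite J" by (simp_all add: I_def J_def finite_mons)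
  obtain n k \<Phi> where \<Phi>: "\<Phi> \<in> bihom_fun I J n k"
    "\<And>x. \<Phi> x (\<lambda>j. hess_coeff r d j x) = 0" "\<Phi> (lookup (act r \<delta> f)) (lookup (act r \<delta> y)) \<noteq> 0"
    using off unfolding off_fibre_def I_def J_def by blast
  define D where "D = (Determinant.det (lin_mat r \<delta>))\<^sup>2"
  have D: "D \<noteq> 0" using det by (simp add: D_def)
  define \<Psi> where "\<Psi> x y = \<Phi> (\<lambda>i. lookup (act r \<delta> (vec_of I x)) i) (\<lambda>j. lookup (act r \<delta> (vec_of J y)) j)" for x y
  have "\<Psi> \<in> bihom_fun I J n k"
    unfolding \<Psi>_def[abs_def]
    using hom_coeffs_act[OF I] hom_coeffs_act[OF J]
    by (intro bihom_fun_compose[OF I J I \<Phi>(1)]) (auto simp: hom_coeffs_def)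
  moreover have "\<Psi> x (\<lambda>j. hess_coeff r d j x) = 0" for x
  proof -
    define g where "g = vec_of I x"
    have g: "g \<in> vecs (mons {..r} d)" unfolding g_def I_def[symmetric] by (rule vec_of_vecs[OF I])
    have "vec_of J (\<lambda>j. hess_coeff r d j x) = vec_of J (lookup (Hess r g))"
      by (simp add: hess_coeff_def[abs_def] g_def I_def)
    also have "\<dots> = Hess r g" using Hess_forms[OF g] by (intro vec_of_lookup J) (simp add: J_def)
    finally have 1: "vec_of J (\<lambda>j. hess_coeff r d j x) = Hess r g" .
    have ag: "vec_of I (lookup (act r \<delta> g)) = act r \<delta> g"
      using act_forms[OF g] by (intro vec_of_lookup I) (simp add: I_def)
    have 2: "hess_coeff r d j (lookup (act r \<delta> g)) = D * lookup (act r \<delta> (Hess r g)) j" for j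
      using ag by (simp add: hess_coeff_def I_def Hess_act[OF g] D_def)
    have "0 = \<Phi> (lookup (act r \<delta> g)) (\<lambda>j. hess_coeff r d j (lookup (act r \<delta> g)))" by (simp add: \<Phi>(2))
    also have "\<dots> = 1 ^ n * D ^ k * \<Phi> (lookup (act r \<delta> g)) (\<lambda>j. lookup (act r \<delta> (Hess r g)) j)"
      by (rule bihom_fun_scaled[OF I \<Phi>(1)]) (simp_all add: 2)
    finally show ?thesis using D by (simp add: \<Psi>_def 1 g_def[symmetric])
  qed
  moreover have "\<Psi> (lookup f) (lookup y) \<noteq> 0"
    using \<Phi>(3) vec_of_lookup[OF I f[folded I_def]] vec_of_lookup[OF J y[folded J_def]] by (simp add: \<Psi>_def)
  ultimately show ?thesis unfolding off_fibre_def I_def[symmetric] J_def[symmetric] by blast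
qed

lemma hessian_map_eq: "hessian_map d r = map_graph (monomials r d) (Hess r)"
  by (simp add: hessian_map_def map_graph_def)

text \<open>The equation provided by the topology holds where the Hessian is not zero. Multiplied with a coordinate of \<open>y\<close>, it
  holds everywhere.\<close>

lemma off_fibre_if_not_in_closure:
  assumes not: "(proj_pt f, proj_pt y) \<notin> hessian_graph_closure d r"
    and f: "f \<in> vecs (mons {..r} d) - {0}" and y: "y \<in> vecs (mons {..r} ((d - 2) * (r + 1))) - {0}"
  shows "off_fibre r d f y"
proof -
  define I where "I = mons {..r} d"
  define J where "J = mons {..r} ((d - 2) * (r + 1))"
  have I: "finite I" and J: "finite J" by (simp_all add: I_def J_def finite_mons)
  have "\<exists>n k. \<exists>\<Phi>\<in>bihom_fun I J n k. \<Phi> (lookup f) (lookup y) \<noteq> 0 \<and>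
    (\<forall>x\<in>vecs I. Hess r x \<noteq> 0 \<longrightarrow> \<Phi> (lookup x) (lookup (Hess r x)) = 0)"
  proof (rule not_in_closure_equation[OF I])
    show "(proj_pt f, proj_pt y) \<notin> Abstract_Topology.closure_of (zariski2 I J) (map_graph I (Hess r))"
      using not unfolding hessian_graph_closure_def hessian_map_eq monomials_eq_mons I_def J_def .
  qed (use f y Hess_forms[of _ r d] Hess_0 in \<open>auto simp: I_def J_def\<close>)
  then obtain n k \<Phi> where \<Phi>: "\<Phi> \<in> bihom_fun I J n k" "\<Phi> (lookup f) (lookup y) \<noteq> 0"
    "\<And>x. x \<in> vecs I \<Longrightarrow> Hess r x \<noteq> 0 \<Longrightarrow> \<Phi> (lookup x) (lookup (Hess r x)) = 0" by blast
  obtain j0 where j0: "j0 \<in> J" "lookup y j0 \<noteq> 0" using y vec_eq_0_iff[of y J] by (auto simp: J_def)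
  define \<Psi> where "\<Psi> x y = \<Phi> x y * (1 * y j0)" for x y
  have "(\<lambda>x y. 1 * y j0) \<in> bihom_fun I J 0 1"
    by (rule bihom_fun_hom_fun[OF I hom_fun_const hom_fun_coord[OF j0(1)]])
  then have "\<Psi> \<in> bihom_fun I J (n + 0) (k + 1)" unfolding \<Psi>_def[abs_def] by (rule bihom_fun_mult[OF I \<Phi>(1)])
  moreover have "\<Psi> x (\<lambda>j. hess_coeff r d j x) = 0" for x
  proof -
    define g where "g = vec_of I x"
    have g: "g \<in> vecs I" unfolding g_def by (rule vec_of_vecs[OF I])
    have h: "hess_coeff r d j x = lookup (Hess r g) j" for j by (simp add: hess_coeff_def g_def I_def)
    have "\<Phi> x (\<lambda>j. hess_coeff r d j x) = \<Phi> (lookup g) (lookup (Hess r g))"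
      by (rule bihom_fun_cong[OF I \<Phi>(1)]) (simp_all add: g_def lookup_vec_of I h)
    then show ?thesis using \<Phi>(3)[OF g] by (cases "Hess r g = 0") (auto simp: \<Psi>_def h)
  qed
  moreover have "\<Psi> (lookup f) (lookup y) \<noteq> 0" using \<Phi>(2) j0(2) by (simp add: \<Psi>_def)
  ultimately show ?thesis unfolding off_fibre_def I_def[symmetric] J_def[symmetric] by blast
qed

section \<open>Binary forms\<close>

lemma euler_identity:
  fixes f :: "nat cpoly"
  assumes f: "f \<in> vecs (mons {..r} n)"
  shows "(\<Sum>i\<le>r. x i * peval x (pdiff i f)) = of_nat n * peval x f"
proof -
  have "((\<lambda>t. peval (\<lambda>j. x j + t * x j) f) has_field_derivative (\<Sum>i\<le>r. x i * peval x (pdiff i f))) (at 0)"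
    by (rule peval_line_deriv) (use f in \<open>auto simp: vecs_def mons_def\<close>)
  moreover have "peval (\<lambda>j. x j + t * x j) f = (1 + t) ^ n * peval x f" for t
    using peval_scale[OF f, of "1 + t" x] by (simp add: algebra_simps)
  moreover have "((\<lambda>t. (1 + t) ^ n * peval x f) has_field_derivative of_nat n * peval x f) (at 0)"
    by (auto intro!: derivative_eq_intros)
  ultimately show ?thesis by (simp add: DERIV_unique)
qed

definition bin_mon :: "nat \<Rightarrow> nat \<Rightarrow> (nat \<Rightarrow>\<^sub>0 nat)" where
  "bin_mon n i = Poly_Mapping.single 0 i + Poly_Mapping.single 1 (n - i)"

lemma bin_mons: "mons {..1::nat} n = bin_mon n ` {..n}"
proof (rule Set.set_eqI, rule iffI)
  fix m assume m: "m \<in> mons {..1::nat} n"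
  have s: "{..1} = {0, 1::nat}" by auto
  have "mdeg m = (\<Sum>i\<in>{0,1::nat}. lookup m i)"
    using m unfolding mons_def s by (intro mdeg_superset) auto
  moreover have "mdeg m = n" using m by (simp only: mons_def mem_Collect_eq)
  ultimately have n: "n = lookup m 0 + lookup m 1" by simp
  have "m = bin_mon n (lookup m 0)"
  proof (rule poly_mapping_eqI)
    fix i :: nat
    have keys: "keys m \<subseteq> {0, 1}" using m unfolding mons_def s by blast
    consider "i = 0" | "i = 1" | "i \<notin> {0, 1}" by blast
    then show "lookup m i = lookup (bin_mon n (lookup m 0)) i"
    proof cases
      case 3
      then have "i \<notin> keys m" using keys by blast
      then show ?thesis using 3 by (simp add: in_keys_iff bin_mon_def lookup_add lookup_single when_def)
    qed (simp_all add: n bin_mon_def lookup_add lookup_single when_def)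
  qed
  moreover have "lookup m 0 \<in> {..n}" using n by simp
  ultimately show "m \<in> bin_mon n ` {..n}" by (rule image_eqI)
qed (auto simp: mons_def bin_mon_def keys_add_nat split: if_splits)

lemma bin_mon_in: "i \<le> n \<Longrightarrow> bin_mon n i \<in> mons {..1} n"
  unfolding bin_mons by blast

lemma lookup_bin_mon_0: "lookup (bin_mon n i) 0 = i"
  by (simp add: bin_mon_def lookup_add lookup_single when_def)

lemma bin_mon_inj: "bin_mon n i = bin_mon n j \<longleftrightarrow> i = j"
  using lookup_bin_mon_0 by metis

lemma bin_mon_val: "mono_val (pl s 1) (bin_mon n i) = s ^ i"
  by (simp add: bin_mon_def mono_val_add)

lemma binary_peval:
  assumes "f \<in> vecs (mons {..1::nat} n)"
  shows "peval (pl s 1) f = (\<Sum>i\<le>n. lookup f (bin_mon n i) * s ^ i)"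
proof -
  have "peval (pl s 1) f = (\<Sum>m\<in>bin_mon n ` {..n}. lookup f m * mono_val (pl s 1) m)"
    unfolding bin_mons[symmetric] by (rule peval_vecs[OF _ assms]) simp
  also have "\<dots> = (\<Sum>i\<le>n. lookup f (bin_mon n i) * s ^ i)"
    by (subst sum.reindex) (auto simp: inj_on_def bin_mon_inj bin_mon_val)
  finally show ?thesis .
qed

text \<open>The coefficients of \<open>(d - 1) (d f f'' - (d - 1) f'^2)\<close>, where \<open>u\<close> is the sequence of coefficients of \<open>f\<close>. By Euler's
  formula this is the Hessian of a binary form of degree \<open>d\<close> whose dehomogenisation is \<open>f\<close>.\<close>

definition hess_seq :: "nat \<Rightarrow> nat \<Rightarrow> (nat \<Rightarrow> complex) \<Rightarrow> complex" where
  "hess_seq d j u = (of_nat d - 1) *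
    ((\<Sum>i\<le>j. of_nat d * (of_nat (j - i + 2) * of_nat (j - i + 1)) * (u i * u (j + 2 - i)))
     - (\<Sum>i\<le>j. (of_nat d - 1) * (of_nat (i + 1) * of_nat (j - i + 1)) * (u (i + 1) * u (j + 1 - i))))"

lemma coeff_hess_seq:
  fixes P :: "complex poly"
  shows "coeff (smult (of_nat d - 1) (smult (of_nat d) (P * pderiv (pderiv P)) - smult (of_nat d - 1) (pderiv P * pderiv P))) j
    = hess_seq d j (coeff P)"
proof -
  have 1: "coeff (P * pderiv (pderiv P)) j = (\<Sum>i\<le>j. of_nat (j - i + 2) * of_nat (j - i + 1) * (coeff P i * coeff P (j + 2 - i)))"
    unfolding coeff_mult
  proof (rule sum.cong, rule refl)
    fix i assume "i \<in> {..j}"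
    then have "Suc (Suc (j - i)) = j + 2 - i" by auto
    then show "coeff P i * coeff (pderiv (pderiv P)) (j - i) = of_nat (j - i + 2) * of_nat (j - i + 1) * (coeff P i * coeff P (j + 2 - i))"
      by (simp add: coeff_pderiv algebra_simps)
  qed
  have 2: "coeff (pderiv P * pderiv P) j = (\<Sum>i\<le>j. of_nat (i + 1) * of_nat (j - i + 1) * (coeff P (i + 1) * coeff P (j + 1 - i)))"
    unfolding coeff_mult
  proof (rule sum.cong, rule refl)
    fix i assume "i \<in> {..j}"
    then have "Suc (j - i) = j + 1 - i" by auto
    then show "coeff (pderiv P) i * coeff (pderiv P) (j - i) = of_nat (i + 1) * of_nat (j - i + 1) * (coeff P (i + 1) * coeff P (j + 1 - i))"
      by (simp add: coeff_pderiv algebra_simps)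
  qed
  show ?thesis
    unfolding coeff_smult coeff_diff 1 2 hess_seq_def sum_distrib_left by (simp only: mult.assoc)
qed

lemma hess_coeff_binary:
  assumes d: "d \<ge> 2" and j: "j \<le> 2 * (d - 2)"
  shows "hess_coeff 1 d (bin_mon (2 * (d - 2)) j) x = hess_seq d j (\<lambda>i. if i \<le> d then x (bin_mon d i) else 0)"
proof -
  let ?I = "mons {..1::nat} d" and ?n = "2 * (d - 2)"
  have I: "finite ?I" by (simp add: finite_mons)
  define f where "f = vec_of ?I x"
  have f: "f \<in> vecs ?I" unfolding f_def by (rule vec_of_vecs[OF I])
  define P where "P = (\<Sum>i\<le>d. monom (x (bin_mon d i)) i)"
  have cP: "coeff P = (\<lambda>i. if i \<le> d then x (bin_mon d i) else 0)"
    by (auto simp: P_def coeff_sum coeff_monom sum.delta fun_eq_iff)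
  have fP: "peval (pl s 1) f = poly P s" for s
    unfolding binary_peval[OF f] P_def poly_sum poly_monom
  proof (rule sum.cong, rule refl)
    fix i assume "i \<in> {..d}"
    then have "bin_mon d i \<in> ?I" using bin_mon_in by blast
    then show "lookup f (bin_mon d i) * s ^ i = x (bin_mon d i) * s ^ i"
      unfolding f_def lookup_vec_of[OF I] by (simp only: if_True)
  qed
  have der: "peval (pl s 1) (pdiff 0 g) = poly (pderiv Q) s" if "\<And>s. peval (pl s 1) g = poly Q s" for g Q s
  proof -
    have "((\<lambda>t. poly Q t) has_field_derivative peval (pl s 1) (pdiff 0 g)) (at s)"
      using peval_deriv[of "pl s 1" 0 g s] by (simp add: pl_upd that)
    then show ?thesis using poly_DERIV[of Q s] DERIV_unique by blast
  qed
  note f0 = der[OF fP] note f00 = der[OF f0]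
  have s1: "{..1} = {0, 1::nat}" by auto
  have f1: "peval (pl s 1) (pdiff 1 f) = of_nat d * poly P s - s * poly (pderiv P) s" for s
    using euler_identity[OF f, of "pl s 1"] unfolding s1 by (simp add: fP f0 algebra_simps)
  have d1: "(of_nat (d - 1) :: complex) = of_nat d - 1" using d by (simp add: of_nat_diff)
  have f01: "peval (pl s 1) (pdiff 0 (pdiff 1 f)) = (of_nat d - 1) * poly (pderiv P) s - s * poly (pderiv (pderiv P)) s" for s
    using euler_identity[OF vecs_pdiff[OF f, of 0], of "pl s 1"] unfolding s1 d1
    by (simp add: f0 f00 pdiff_commute[of "Suc 0" 0] algebra_simps)
  have f11: "peval (pl s 1) (pdiff 1 (pdiff 1 f)) = (of_nat d - 1) * (of_nat d * poly P s - s * poly (pderiv P) s)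
      - s * ((of_nat d - 1) * poly (pderiv P) s - s * poly (pderiv (pderiv P)) s)" for s
  proof -
    have "peval (pl s 1) (pdiff 1 (pdiff 1 f)) =
        (of_nat d - 1) * peval (pl s 1) (pdiff 1 f) - s * peval (pl s 1) (pdiff 0 (pdiff 1 f))"
      using euler_identity[OF vecs_pdiff[OF f, of 1], of "pl s 1"] unfolding s1 d1
      by (simp add: algebra_simps)
    then show ?thesis unfolding f1 f01 .
  qed
  define Q where "Q = smult (of_nat d - 1) (smult (of_nat d) (P * pderiv (pderiv P)) - smult (of_nat d - 1) (pderiv P * pderiv P))"
  have n: "(d - 2) * (1 + 1) = ?n" by simp
  have Hf: "Hess 1 f \<in> vecs (mons {..1::nat} ?n)" using Hess_forms[OF f] unfolding n .
  have HQ: "peval (pl s 1) (Hess 1 f) = poly Q s" for s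
  proof -
    have "peval (pl s 1) (Hess 1 f) = peval (pl s 1) 0 ^ (1 - 1) *
      (peval (pl s 1) (pdiff 0 (pdiff 0 f)) * peval (pl s 1) (pdiff 1 (pdiff 1 f)) - (peval (pl s 1) (pdiff 0 (pdiff 1 f)))\<^sup>2)"
      by (rule Hess_plane) auto
    then show ?thesis unfolding f00 f11 f01 Q_def by (simp add: power2_eq_square algebra_simps)
  qed
  define R where "R = (\<Sum>i\<le>?n. monom (lookup (Hess 1 f) (bin_mon ?n i)) i)"
  have "poly R s = poly Q s" for s
    using HQ[of s] binary_peval[OF Hf, of s] by (simp add: R_def poly_sum poly_monom)
  then have "R = Q" by (simp add: poly_eq_poly_eq_iff[symmetric] fun_eq_iff)
  moreover have "coeff R j = lookup (Hess 1 f) (bin_mon ?n j)"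
    using j by (simp add: R_def coeff_sum coeff_monom sum.delta)
  ultimately show ?thesis
    using coeff_hess_seq[of d P j] unfolding Q_def[symmetric] cP by (simp add: hess_coeff_def f_def)
qed

text \<open>The Hessian of a power of a linear form vanishes. The linear form is normalised such that the first two coefficients
  of its power are \<open>1\<close>.\<close>

lemma hess_seq_power:
  assumes d: "d \<ge> 2"
  shows "hess_seq d j (coeff ([:1, 1 / of_nat d:] ^ d)) = 0"
    and "coeff ([:1, 1 / of_nat d:] ^ d) 0 = (1::complex)" and "coeff ([:1, 1 / of_nat d:] ^ d) 1 = (1::complex)"
    and "i > d \<Longrightarrow> coeff ([:1, 1 / of_nat d:] ^ d) i = (0::complex)"
proof -
  let ?L = "[:1, 1 / of_nat d:] :: complex poly"
  obtain e where e: "d = Suc (Suc e)" using d by (metis add_2_eq_Suc le_iff_add)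
  have nz: "(of_nat d :: complex) \<noteq> 0" using d by auto
  have pL: "pderiv ?L = [:1 / of_nat d:]" by (simp add: pderiv_pCons)
  have p1: "pderiv (?L ^ d) = ?L ^ Suc e"
  proof -
    have "pderiv (?L ^ Suc (Suc e)) = smult (of_nat (Suc (Suc e))) (?L ^ Suc e) * pderiv ?L" by (rule pderiv_power_Suc)
    then show ?thesis using nz unfolding pL by (simp add: e del: power_Suc of_nat_Suc)
  qed
  have p2: "pderiv (pderiv (?L ^ d)) = smult ((of_nat d - 1) / of_nat d) (?L ^ e)"
  proof -
    have "pderiv (?L ^ Suc e) = smult (of_nat (Suc e)) (?L ^ e) * pderiv ?L" by (rule pderiv_power_Suc)
    then show ?thesis unfolding p1 pL by (simp add: e del: power_Suc)
  qed
  have pw: "?L ^ d * ?L ^ e = ?L ^ Suc e * ?L ^ Suc e"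
  proof -
    have "d + e = Suc e + Suc e" by (simp add: e)
    then show ?thesis by (metis power_add)
  qed
  have "smult (of_nat d) (?L ^ d * smult ((of_nat d - 1) / of_nat d) (?L ^ e)) = smult (of_nat d - 1) (?L ^ Suc e * ?L ^ Suc e)"
    unfolding mult_smult_right smult_smult pw using nz by simp
  then show "hess_seq d j (coeff (?L ^ d)) = 0"
    unfolding coeff_hess_seq[symmetric] p2 unfolding p1 by simp
  show "coeff (?L ^ d) 0 = 1" by (simp add: coeff_0_power)
  have "coeff (pderiv (?L ^ d)) 0 = coeff (?L ^ d) 1" by (simp add: coeff_pderiv)
  then show "coeff (?L ^ d) 1 = 1" unfolding p1 by (simp add: coeff_0_power)
  have "degree (?L ^ d) \<le> d" using degree_power_le[of ?L d] by (simp split: if_splits)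
  then show "i > d \<Longrightarrow> coeff (?L ^ d) i = 0" by (simp add: coeff_eq_0)
qed

text \<open>If the Hessian of \<open>f\<close> vanishes to order \<open>j\<close> and \<open>f\<close> has nonzero constant term, then up to order \<open>j + 1\<close> it agrees with the
  power of a linear form that has the same first two coefficients. The functions \<open>T i\<close> measure the deviation. The
  lemma makes the argument explicit as a statement on ideals: \<open>comb n K \<phi>\<close> says that \<open>\<phi>\<close> is a combination of the first \<open>K\<close>
  coefficients of the Hessian. As a power of a linear form has zero Hessian, \<open>u 0 ^ j * G j\<close> can be expressed by \<open>T 2\<close>, ..., \<open>T (j + 2)\<close>,
  and by induction all of these but the last are combinations of \<open>G 0\<close>, ..., \<open>G (j - 1)\<close>.\<close>

lemma hess_relation:
  fixes u :: "nat \<Rightarrow> ('v \<Rightarrow> complex) \<Rightarrow> complex" and c :: "nat \<Rightarrow> complex"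
  assumes u: "\<And>i. u i \<in> hom_fun I 1" and d: "d \<ge> 2"
    and c: "\<And>j. hess_seq d j c = 0" "c 0 = 1" "c 1 = 1"
  defines "G \<equiv> \<lambda>j x. hess_seq d j (\<lambda>i. u i x)"
    and "T \<equiv> \<lambda>i x. u 0 x ^ (i - 1) * u i x - c i * u 1 x ^ i"
    and "comb \<equiv> \<lambda>n K \<phi>. \<exists>\<alpha>. (\<forall>k. \<alpha> k \<in> hom_fun I n) \<and> (\<forall>x. \<phi> x = (\<Sum>k<K. \<alpha> k x * hess_seq d k (\<lambda>i. u i x)))"
  shows "comb j j (\<lambda>x. u 0 x ^ j * G j x - (of_nat d - 1) * (of_nat d * (of_nat (j + 2) * of_nat (j + 1))) * T (j + 2) x)"
proof -
  have comb_0: "comb n K (\<lambda>x. 0)" for n K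
    unfolding comb_def by (intro exI[of _ "\<lambda>k x. 0"]) simp
  have comb_add: "comb n K (\<lambda>x. \<phi> x + \<psi> x)" if hyp: "comb n K \<phi>" "comb n K \<psi>" for n K \<phi> \<psi>
  proof -
    obtain \<alpha> \<beta> where "\<forall>k. \<alpha> k \<in> hom_fun I n" "\<forall>x. \<phi> x = (\<Sum>k<K. \<alpha> k x * hess_seq d k (\<lambda>i. u i x))"
      "\<forall>k. \<beta> k \<in> hom_fun I n" "\<forall>x. \<psi> x = (\<Sum>k<K. \<beta> k x * hess_seq d k (\<lambda>i. u i x))"
      using hyp unfolding comb_def by blast
    then show ?thesis unfolding comb_def
      by (intro exI[of _ "\<lambda>k x. \<alpha> k x + \<beta> k x"]) (auto intro: hom_fun_add simp: distrib_right sum.distrib)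
  qed
  have comb_mult: "comb (m + n) K (\<lambda>x. \<psi> x * \<phi> x)" if hyp: "comb n K \<phi>" "\<psi> \<in> hom_fun I m" for m n K \<phi> \<psi>
  proof -
    obtain \<alpha> where "\<forall>k. \<alpha> k \<in> hom_fun I n" "\<forall>x. \<phi> x = (\<Sum>k<K. \<alpha> k x * hess_seq d k (\<lambda>i. u i x))"
      using hyp unfolding comb_def by blast
    then show ?thesis unfolding comb_def using hyp(2)
      by (intro exI[of _ "\<lambda>k x. \<psi> x * \<alpha> k x"]) (auto intro: hom_fun_mult simp: sum_distrib_left mult.assoc)
  qed
  have comb_cmult: "comb n K (\<lambda>x. b * \<phi> x)" if "comb n K \<phi>" for n K \<phi> b
    using comb_mult[OF that hom_fun_const, of b] by simp
  have comb_sum: "comb n K (\<lambda>x. \<Sum>i\<in>S. \<phi> i x)" if "\<And>i. i \<in> S \<Longrightarrow> comb n K (\<phi> i)" for n K S and \<phi> :: "nat \<Rightarrow> _"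
    using that by (induction S rule: infinite_finite_induct) (auto intro: comb_0 comb_add)
  have comb_mono: "comb n K' \<phi>" if hyp: "comb n K \<phi>" "K \<le> K'" for n K K' \<phi>
  proof -
    obtain \<alpha> where \<alpha>: "\<forall>k. \<alpha> k \<in> hom_fun I n" "\<forall>x. \<phi> x = (\<Sum>k<K. \<alpha> k x * hess_seq d k (\<lambda>i. u i x))"
      using hyp unfolding comb_def by blast
    have "(\<Sum>k<K'. (if k < K then \<alpha> k x else 0) * hess_seq d k (\<lambda>i. u i x)) = (\<Sum>k<K. \<alpha> k x * hess_seq d k (\<lambda>i. u i x))" for x
      using hyp(2) by (intro sum.mono_neutral_cong_right) auto
    moreover have "(\<lambda>x. if k < K then \<alpha> k x else 0) \<in> hom_fun I n" for k using \<alpha> by (cases "k < K") auto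
    ultimately show ?thesis unfolding comb_def using \<alpha>(2)
      by (intro exI[of _ "\<lambda>k x. if k < K then \<alpha> k x else 0"]) auto
  qed
  define a where "a i x = u 0 x ^ (i - 1) * u i x" for i x
  have a_hom_fun: "a i \<in> hom_fun I i" if "i \<ge> 1" for i
    using hom_fun_mult[OF hom_fun_power[OF u, of 0 "i - 1"] u[of i]] that by (simp add: a_def[abs_def])
  have u1_hom_fun: "(\<lambda>x. u 1 x ^ i) \<in> hom_fun I i" for i using hom_fun_power[OF u[of 1], of i] by simp
  define D where "D j i x = (if i = 0 then T (j + 2) x else a i x * a (j + 2 - i) x - c i * c (j + 2 - i) * u 1 x ^ (j + 2))" for j i x
  have B: "comb j j (\<lambda>x. u 0 x ^ j * G j x - (of_nat d - 1) * (of_nat d * (of_nat (j + 2) * of_nat (j + 1))) * T (j + 2) x)"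
    if TT: "\<And>i. 2 \<le> i \<Longrightarrow> i \<le> j + 1 \<Longrightarrow> comb (i - 2) (i - 1) (T i)" for j
  proof -
    have T1: "T 1 x = 0" for x using c(3) by (simp add: T_def)
    have Dc: "comb j j (D j i)" if i: "1 \<le> i" "i \<le> j + 1" for i
    proof -
      define i' where "i' = j + 2 - i"
      have i': "1 \<le> i'" "i' \<le> j + 1" "i + i' = j + 2" using i by (auto simp: i'_def)
      have 1: "comb j j (\<lambda>x. a i' x * T i x)"
      proof (cases "i = 1")
        case True then show ?thesis using T1 comb_0 by simp
      next
        case False
        then have h: "comb (i' + (i - 2)) (i - 1) (\<lambda>x. a i' x * T i x)"
          using i i' by (intro comb_mult TT a_hom_fun) auto
        have e: "i' + (i - 2) = j" "i - 1 \<le> j" using False i i' by auto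
        show ?thesis by (rule comb_mono[OF h[unfolded e(1)] e(2)])
      qed
      have 2: "comb j j (\<lambda>x. u 1 x ^ i * T i' x)"
      proof (cases "i' = 1")
        case True then show ?thesis using T1 comb_0 by simp
      next
        case False
        then have h: "comb (i + (i' - 2)) (i' - 1) (\<lambda>x. u 1 x ^ i * T i' x)"
          using i i' by (intro comb_mult TT u1_hom_fun) auto
        have e: "i + (i' - 2) = j" "i' - 1 \<le> j" using False i i' by auto
        show ?thesis by (rule comb_mono[OF h[unfolded e(1)] e(2)])
      qed
      have "D j i = (\<lambda>x. a i' x * T i x + c i * (u 1 x ^ i * T i' x))"
      proof
        fix x
        have p: "u 1 x ^ (j + 2) = u 1 x ^ i * u 1 x ^ i'" using i'(3) by (simp flip: power_add)
        have a: "u 0 x ^ (i' - 1) * u i' x = a i' x" "u 0 x ^ (i - 1) * u i x = a i x" by (simp_all add: a_def)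
        have "i \<noteq> 0" using i by simp
        then have Dji: "D j i x = a i x * a i' x - c i * c i' * (u 1 x ^ i * u 1 x ^ i')"
          unfolding D_def i'_def[symmetric] p by simp
        then show "D j i x = a i' x * T i x + c i * (u 1 x ^ i * T i' x)"
          unfolding Dji T_def a by (simp only: right_diff_distrib mult_ac) simp
      qed
      then show ?thesis using comb_add[OF 1 comb_cmult[OF 2, of "c i"]] by simp
    qed
    have key: "u 0 x ^ j * G j x - (of_nat d - 1) * (of_nat d * (of_nat (j + 2) * of_nat (j + 1))) * T (j + 2) x =
      (of_nat d - 1) * (\<Sum>i\<in>{1..j}. of_nat d * (of_nat (j - i + 2) * of_nat (j - i + 1)) * D j i x)
      + - (of_nat d - 1) * (\<Sum>i\<le>j. (of_nat d - 1) * (of_nat (i + 1) * of_nat (j - i + 1)) * D j (i + 1) x)" for x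
    proof -
      have s0: "{..j} = insert 0 {1..j}" by auto
      have P: "u 0 x ^ j * (u i x * u (j + 2 - i) x) - u 1 x ^ (j + 2) * (c i * c (j + 2 - i)) = D j i x" if "i \<le> j + 1" for i
      proof (cases "i = 0")
        case True
        then show ?thesis using c(2) by (simp add: D_def T_def mult_ac)
      next
        case False
        then have "j = (i - 1) + (j + 2 - i - 1)" using that by simp
        then have "u 0 x ^ j = u 0 x ^ (i - 1) * u 0 x ^ (j + 2 - i - 1)" by (metis power_add)
        then show ?thesis using False by (simp add: D_def a_def mult_ac)
      qed
      have "u 0 x ^ j * G j x = u 0 x ^ j * G j x - u 1 x ^ (j + 2) * hess_seq d j c" by (simp add: c)
      also have "\<dots> = (of_nat d - 1) *
         ((\<Sum>i\<le>j. of_nat d * (of_nat (j - i + 2) * of_nat (j - i + 1)) * (u 0 x ^ j * (u i x * u (j + 2 - i) x) - u 1 x ^ (j + 2) * (c i * c (j + 2 - i))))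
        - (\<Sum>i\<le>j. (of_nat d - 1) * (of_nat (i + 1) * of_nat (j - i + 1)) * (u 0 x ^ j * (u (i + 1) x * u (j + 1 - i) x) - u 1 x ^ (j + 2) * (c (i + 1) * c (j + 1 - i)))))"
        unfolding G_def hess_seq_def right_diff_distrib sum_subtractf sum_distrib_left
        by (simp only: mult_ac) simp
      also have "\<dots> = (of_nat d - 1) *
         ((\<Sum>i\<le>j. of_nat d * (of_nat (j - i + 2) * of_nat (j - i + 1)) * D j i x)
        - (\<Sum>i\<le>j. (of_nat d - 1) * (of_nat (i + 1) * of_nat (j - i + 1)) * D j (i + 1) x))"
      proof -
        have "(\<Sum>i\<le>j. of_nat d * (of_nat (j - i + 2) * of_nat (j - i + 1)) * (u 0 x ^ j * (u i x * u (j + 2 - i) x) - u 1 x ^ (j + 2) * (c i * c (j + 2 - i)))) =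
          (\<Sum>i\<le>j. of_nat d * (of_nat (j - i + 2) * of_nat (j - i + 1)) * D j i x)"
        proof (rule sum.cong, rule refl)
          fix i assume "i \<in> {..j}"
          then have "i \<le> j + 1" by simp
          then show "of_nat d * (of_nat (j - i + 2) * of_nat (j - i + 1)) * (u 0 x ^ j * (u i x * u (j + 2 - i) x) - u 1 x ^ (j + 2) * (c i * c (j + 2 - i))) =
            of_nat d * (of_nat (j - i + 2) * of_nat (j - i + 1)) * D j i x" by (simp only: P)
        qed
        moreover have "(\<Sum>i\<le>j. (of_nat d - 1) * (of_nat (i + 1) * of_nat (j - i + 1)) * (u 0 x ^ j * (u (i + 1) x * u (j + 1 - i) x) - u 1 x ^ (j + 2) * (c (i + 1) * c (j + 1 - i)))) =
          (\<Sum>i\<le>j. (of_nat d - 1) * (of_nat (i + 1) * of_nat (j - i + 1)) * D j (i + 1) x)"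
        proof (rule sum.cong, rule refl)
          fix i assume "i \<in> {..j}"
          then have "i + 1 \<le> j + 1" "j + 2 - (i + 1) = j + 1 - i" by auto
          with P[of "i + 1"] show "(of_nat d - 1) * (of_nat (i + 1) * of_nat (j - i + 1)) * (u 0 x ^ j * (u (i + 1) x * u (j + 1 - i) x) - u 1 x ^ (j + 2) * (c (i + 1) * c (j + 1 - i))) =
            (of_nat d - 1) * (of_nat (i + 1) * of_nat (j - i + 1)) * D j (i + 1) x" by simp
        qed
        ultimately show ?thesis by simp
      qed
      also have "(\<Sum>i\<le>j. of_nat d * (of_nat (j - i + 2) * of_nat (j - i + 1)) * D j i x) =
        of_nat d * (of_nat (j + 2) * of_nat (j + 1)) * T (j + 2) x + (\<Sum>i\<in>{1..j}. of_nat d * (of_nat (j - i + 2) * of_nat (j - i + 1)) * D j i x)"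
        unfolding s0 by (subst sum.insert) (auto simp: D_def)
      finally show ?thesis by (simp only: right_diff_distrib distrib_left mult.assoc mult_minus_left) simp
    qed
    have 1: "comb j j (\<lambda>x. (of_nat d - 1) * (\<Sum>i\<in>{1..j}. of_nat d * (of_nat (j - i + 2) * of_nat (j - i + 1)) * D j i x))"
      by (intro comb_cmult comb_sum Dc) auto
    have 2: "comb j j (\<lambda>x. - (of_nat d - 1) * (\<Sum>i\<le>j. (of_nat d - 1) * (of_nat (i + 1) * of_nat (j - i + 1)) * D j (i + 1) x))"
      by (intro comb_cmult comb_sum Dc) auto
    show ?thesis unfolding key by (rule comb_add[OF 1 2])
  qed
  have TT: "comb (i - 2) (i - 1) (T i)" if "2 \<le> i" for i
    using that
  proof (induction i rule: less_induct)
    case (less i)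
    define j where "j = i - 2"
    have i: "i = j + 2" using less.prems by (simp add: j_def)
    define \<kappa> where "\<kappa> = (of_nat d - 1) * (of_nat d * (of_nat (j + 2) * of_nat (j + 1)) :: complex)"
    have "(of_nat d :: complex) \<noteq> of_nat 1" using d by (subst of_nat_eq_iff) simp
    then have \<kappa>: "\<kappa> \<noteq> 0" using d by (simp add: \<kappa>_def del: of_nat_Suc)
    have h: "comb j j (\<lambda>x. u 0 x ^ j * G j x - \<kappa> * T (j + 2) x)"
      unfolding \<kappa>_def by (rule B) (use less.IH i in auto)
    have 1: "comb j (j + 1) (\<lambda>x. - 1 / \<kappa> * (u 0 x ^ j * G j x - \<kappa> * T (j + 2) x))"
      by (rule comb_mono[OF comb_cmult[OF h]]) simp
    have "(\<lambda>x. u 0 x ^ j) \<in> hom_fun I j" using hom_fun_power[OF u[of 0], of j] by simp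
    then have "(\<lambda>x. if k = j then u 0 x ^ j else 0) \<in> hom_fun I j" for k by (cases "k = j") auto
    then have 2: "comb j (j + 1) (\<lambda>x. u 0 x ^ j * G j x)"
      unfolding comb_def
      by (intro exI[of _ "\<lambda>k x. if k = j then u 0 x ^ j else 0"])
         (auto simp: G_def if_distrib[of "\<lambda>a. a * _"] sum.delta cong: if_cong)
    have "comb j (j + 1) (\<lambda>x. - 1 / \<kappa> * (u 0 x ^ j * G j x - \<kappa> * T (j + 2) x) + 1 / \<kappa> * (u 0 x ^ j * G j x))"
      by (rule comb_add[OF 1 comb_cmult[OF 2]])
    moreover have "(\<lambda>x. - 1 / \<kappa> * (u 0 x ^ j * G j x - \<kappa> * T (j + 2) x) + 1 / \<kappa> * (u 0 x ^ j * G j x)) = T i"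
      using \<kappa> by (auto simp: i field_simps fun_eq_iff)
    ultimately show ?case by (simp add: i)
  qed
  show ?thesis by (rule B) (use TT in auto)
qed

lemma special_binary: "special 1 A a = Poly_Mapping.single (bin_mon (A + a) A) (2 ^ a)"
proof (rule peval_inject)
  fix x
  have b: "mono_val x (bin_mon (A + a) A) = x 0 ^ A * x 1 ^ a" by (simp add: bin_mon_def mono_val_add)
  show "peval x (special 1 A a) = peval x (Poly_Mapping.single (bin_mon (A + a) A) (2 ^ a))"
  proof (cases "a \<le> A")
    case True
    then have "x 0 ^ A = x 0 ^ a * x 0 ^ (A - a)" by (simp flip: power_add)
    then show ?thesis using True by (simp add: b[unfolded One_nat_def] special_def peval_q0 power_mult_distrib)
  qed (simp add: b[unfolded One_nat_def] special_def)
qed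

text \<open>For \<open>B = 2 (A - 1)\<close> the function \<open>T (B + 2)\<close> vanishes identically because \<open>B + 2 > d\<close>. So \<open>hess_relation\<close> expresses
  \<open>u 0 ^ B\<close> times the coefficient \<open>B\<close> of the Hessian by the coefficients before it. This equation of the graph fails for \<open>x1^d\<close>
  together with the Hessian of \<open>x0^A x1^a\<close>, in which only the coefficient \<open>B\<close> is not zero.\<close>

lemma off_fibre_binary:
  assumes a: "1 \<le> a" "a < A"
  shows "off_fibre 1 (A + a) (special 1 0 (A + a)) (Hess 1 (special 1 A a))"
proof -
  define d where "d = A + a"
  have d: "d \<ge> 2" using a by (simp add: d_def)
  let ?I = "mons {..1::nat} d" and ?n = "2 * (d - 2)"
  have I: "finite ?I" by (simp add: finite_mons)
  define B where "B = 2 * (A - 1)"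
  have B: "B \<le> ?n" "d - 1 \<le> B" using a by (auto simp: B_def d_def)
  define u where "u i x = (if i \<le> d then x (bin_mon d i) else (0::complex))" for i x
  have u: "u i \<in> hom_fun ?I 1" for i
  proof (cases "i \<le> d")
    case True
    then have "bin_mon d i \<in> ?I" by (rule bin_mon_in)
    from hom_fun_coord[OF this] show ?thesis using True by (simp add: u_def[abs_def])
  qed (simp add: u_def[abs_def])
  define c where "c = coeff ([:1, 1 / of_nat d:] ^ d :: complex poly)"
  have c: "hess_seq d j c = 0" "c 0 = 1" "c 1 = 1" "d < i \<Longrightarrow> c i = 0" for i j
    unfolding c_def using hess_seq_power[OF d] by blast+
  obtain \<alpha> where \<alpha>: "\<forall>k. \<alpha> k \<in> hom_fun ?I B"
    "\<forall>x. u 0 x ^ B * hess_seq d B (\<lambda>i. u i x) - (of_nat d - 1) * (of_nat d * (of_nat (B + 2) * of_nat (B + 1))) *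
       (u 0 x ^ (B + 2 - 1) * u (B + 2) x - c (B + 2) * u 1 x ^ (B + 2))
     = (\<Sum>k<B. \<alpha> k x * hess_seq d k (\<lambda>i. u i x))"
    using hess_relation[where u = u and c = c and j = B, OF u d c(1-3)] by blast
  have top: "u (B + 2) x = 0" "c (B + 2) = 0" for x using B c(4) by (auto simp: u_def)
  have rel: "u 0 x ^ B * hess_seq d B (\<lambda>i. u i x) = (\<Sum>k<B. \<alpha> k x * hess_seq d k (\<lambda>i. u i x))" for x
    using \<alpha>(2)[rule_format, of x] top by simp
  let ?J = "mons {..1::nat} ((d - 2) * (1 + 1))"
  have J: "bin_mon ?n j \<in> ?J" if "j \<le> ?n" for j
  proof -
    have n: "(d - 2) * (1 + 1) = ?n" by simp
    show ?thesis unfolding n by (rule bin_mon_in[OF that])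
  qed
  define \<Phi> where "\<Phi> x y = u 0 x ^ B * y (bin_mon ?n B) + (\<Sum>k<B. (- 1 * \<alpha> k x) * y (bin_mon ?n k))" for x y
  have "\<Phi> \<in> bihom_fun ?I ?J B 1"
    unfolding \<Phi>_def[abs_def]
  proof (intro bihom_fun_add bihom_fun_sum bihom_fun_hom_fun I hom_fun_cmult hom_fun_coord J)
    show "(\<lambda>x. u 0 x ^ B) \<in> hom_fun ?I B" using hom_fun_power[OF u[of 0], of B] by simp
    show "\<alpha> k \<in> hom_fun ?I B" for k using \<alpha> by blast
    show "B \<le> ?n" by (rule B)
    show "k \<le> ?n" if "k \<in> {..<B}" for k using that B by auto
  qed
  moreover have "\<Phi> x (\<lambda>j. hess_coeff 1 d j x) = 0" for x
  proof -
    have h: "hess_coeff 1 d (bin_mon ?n k) x = hess_seq d k (\<lambda>i. u i x)" if "k \<le> B" for k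
      using hess_coeff_binary[OF d, of k x] that B by (simp add: u_def)
    have "(\<Sum>k<B. (- 1 * \<alpha> k x) * hess_coeff 1 d (bin_mon ?n k) x) = (\<Sum>k<B. - (\<alpha> k x * hess_seq d k (\<lambda>i. u i x)))"
    proof (rule sum.cong, rule refl)
      fix k assume "k \<in> {..<B}"
      then have k: "hess_coeff 1 d (bin_mon ?n k) x = hess_seq d k (\<lambda>i. u i x)" by (intro h) simp
      show "(- 1 * \<alpha> k x) * hess_coeff 1 d (bin_mon ?n k) x = - (\<alpha> k x * hess_seq d k (\<lambda>i. u i x))"
        unfolding k by simp
    qed
    then show ?thesis using rel[of x] h[of B] by (simp add: \<Phi>_def sum_negf)
  qed
  moreover have "\<Phi> (lookup (special 1 0 d)) (lookup (Hess 1 (special 1 A a))) \<noteq> 0"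
  proof -
    have n: "?n = 2 * (A - 1) + 2 * (a - 1)" using a by (simp add: d_def)
    define H where "H = Hess 1 (special 1 A a)"
    have "H = cC (special_const 1 A a) * special 1 (2 * (A - 1)) (2 * (a - 1))"
      unfolding H_def using Hess_special[of 1 a A] a by (simp add: numeral_2_eq_2)
    then have y: "lookup H (bin_mon ?n k) = (if k = B then special_const 1 A a * 2 ^ (2 * (a - 1)) else 0)" for k
      unfolding special_binary n by (auto simp: lookup_single bin_mon_inj B_def when_def)
    have "(\<Sum>k<B. (- 1 * \<alpha> k (lookup (special 1 0 d))) * lookup H (bin_mon ?n k)) = 0"
      by (rule sum.neutral) (simp add: y)
    then have "\<Phi> (lookup (special 1 0 d)) (lookup H) = u 0 (lookup (special 1 0 d)) ^ B * (special_const 1 A a * 2 ^ (2 * (a - 1)))"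
      unfolding \<Phi>_def y by simp
    moreover have "u 0 (lookup (special 1 0 d)) = 2 ^ d"
      unfolding special_binary by (simp add: u_def)
    ultimately show ?thesis using special_const_nz[of A a 1] a by (simp add: H_def)
  qed
  ultimately show ?thesis unfolding off_fibre_def d_def by blast
qed

definition swap01 :: "nat \<Rightarrow> nat \<Rightarrow> complex" where
  "swap01 i j = (if i + j = 1 then 1 else 0)"

lemma act_swap01: "act 1 swap01 (special 1 A a) = cC (2 ^ a / 2 ^ A) * special 1 a A"
proof (rule peval_inject)
  fix x
  have l: "lin_map 1 swap01 x 0 = x 1" "lin_map 1 swap01 x 1 = x 0"
    by (simp_all add: lin_map_def swap01_def)
  show "peval x (act 1 swap01 (special 1 A a)) = peval x (cC (2 ^ a / 2 ^ A) * special 1 a A)"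
    unfolding special_binary using l by (simp add: bin_mon_def mono_val_add)
qed

text \<open>The exchange of \<open>x0\<close> and \<open>x1\<close> fixes \<open>x0^k x1^k\<close>.\<close>

lemma off_fibre_swap:
  assumes k: "k \<ge> 1" and off: "off_fibre 1 (k + k) (special 1 (k + k) 0) (Hess 1 (special 1 k k))"
  shows "off_fibre 1 (k + k) (special 1 0 (k + k)) (Hess 1 (special 1 k k))"
proof (rule off_fibre_act)
  let ?H = "Hess 1 (special 1 k k)"
  have spI: "special 1 A a \<in> vecs (mons {..1::nat} (A + a))" for A a by (rule special_forms) simp
  show "special 1 0 (k + k) \<in> vecs (mons {..1::nat} (k + k))" using spI[of 0 "k + k"] by simp
  show "?H \<in> vecs (mons {..1::nat} ((k + k - 2) * (1 + 1)))" by (rule Hess_forms[OF spI])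
  have "lin_mat 1 swap01 = mat 2 2 (\<lambda>(i, j). swap01 i j)" by (simp add: lin_mat_def numeral_2_eq_2)
  then show "Determinant.det (lin_mat 1 swap01) \<noteq> 0" by (simp add: det_2x2 swap01_def)
  have "act 1 swap01 ?H = cC 1 * ?H"
    unfolding Hess_special[OF order_refl disjI2[OF refl] k k] act_cC_mult act_swap01 by (rule peval_inject) simp
  moreover have "act 1 swap01 (special 1 0 (k + k)) = cC (2 ^ (k + k)) * special 1 (k + k) 0"
    unfolding act_swap01 by simp
  ultimately show "off_fibre 1 (k + k) (act 1 swap01 (special 1 0 (k + k))) (act 1 swap01 ?H)"
    using off_fibre_scale[OF off, of "2 ^ (k + k)" 1] by simp
qed

section \<open>Normal form of a quadratic form with an isotropic linear form\<close>

lemma mons_Suc: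
  assumes "m \<in> mons I (Suc n)"
  obtains i m' where "m' \<in> mons I n" "i \<in> I" "m = m' + Poly_Mapping.single i 1"
proof -
  have "m \<noteq> 0" using assms by (auto simp: mons_def)
  then obtain i where i: "i \<in> keys m" by fastforce
  define m' where "m' = m - Poly_Mapping.single i 1"
  have m: "m = m' + Poly_Mapping.single i 1" unfolding m'_def by (rule monomial_split[OF i])
  have "keys m = keys m' \<union> {i}" unfolding m by (simp add: keys_add_nat)
  moreover have "mdeg m = mdeg m' + 1" unfolding m by simp
  ultimately show thesis using that[OF _ _ m] assms by (auto simp: mons_def)
qed

lemma mons_0: "m \<in> mons I 0 \<Longrightarrow> m = 0"
proof (rule poly_mapping_eqI)
  fix i assume "m \<in> mons I 0"
  then show "lookup m i = lookup 0 i" using lookup_le_mdeg[of m i] by (simp add: mons_def)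
qed

lemma mons_1:
  assumes "m \<in> mons I 1"
  shows "\<exists>i. m = Poly_Mapping.single i 1"
proof -
  have "m \<in> mons I (Suc 0)" using assms by simp
  then obtain i m' where "m' \<in> mons I 0" "i \<in> I" "m = m' + Poly_Mapping.single i 1" by (rule mons_Suc)
  then show ?thesis using mons_0[of m' I] by auto
qed

lemma mons_2:
  assumes "m \<in> mons I 2"
  shows "\<exists>i j. m = Poly_Mapping.single i 1 + Poly_Mapping.single j 1"
proof -
  have "m \<in> mons I (Suc 1)" using assms by (simp add: numeral_2_eq_2)
  then obtain i m' where m': "m' \<in> mons I 1" "i \<in> I" "m = m' + Poly_Mapping.single i 1" by (rule mons_Suc)
  then show ?thesis using mons_1[OF m'(1)] by blast
qed

lemma linear_form_linear:
  assumes l: "l \<in> vecs (mons {..r::nat} 1)"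
  shows "peval (\<lambda>i. v i + t * w i) l = peval v l + t * peval w l"
proof -
  have "mono_val (\<lambda>i. v i + t * w i) m = mono_val v m + t * mono_val w m" if "m \<in> mons {..r} 1" for m
    using mons_1[OF that] by auto
  then have "peval (\<lambda>i. v i + t * w i) l = (\<Sum>m\<in>mons {..r} 1. lookup l m * (mono_val v m + t * mono_val w m))"
    unfolding peval_vecs[OF finite_atMost l] by (intro sum.cong) simp_all
  also have "\<dots> = peval v l + t * peval w l"
    unfolding peval_vecs[OF finite_atMost l] by (simp only: sum_distrib_left distrib_left sum.distrib mult.left_commute)
  finally show ?thesis .
qed

locale nondegenerate_form =
  fixes r :: nat and q :: "nat cpoly"
  assumes q: "q \<in> vecs (mons {..r} 2)"
    and nondegenerate: "\<And>v. (\<And>w. peval (\<lambda>i. v i + w i) q - peval v q - peval w q = 0) \<Longrightarrow> \<forall>i\<le>r. v i = 0"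
begin

definition polar :: "(nat \<Rightarrow> complex) \<Rightarrow> (nat \<Rightarrow> complex) \<Rightarrow> complex" where
  "polar v w = peval (\<lambda>i. v i + w i) q - peval v q - peval w q"

lemma q_add: "peval (\<lambda>i. v i + w i) q = peval v q + peval w q + polar v w"
  by (simp add: polar_def)

lemma polar_commute: "polar v w = polar w v"
  by (simp add: polar_def add.commute)

lemma q_scale: "peval (\<lambda>i. c * v i) q = c\<^sup>2 * peval v q"
  by (rule peval_scale[OF q])

lemma polar_self: "polar v v = 2 * peval v q"
proof -
  have "(\<lambda>i. v i + v i) = (\<lambda>i. 2 * v i)" by auto
  then show ?thesis by (simp add: polar_def q_scale)
qed

text \<open>A quadratic form is a linear combination of products of two coordinates.\<close>

lemma polar_scale: "polar v (\<lambda>i. c * w i) = c * polar v w"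
proof -
  have "\<forall>m. \<exists>p. m \<in> mons {..r} 2 \<longrightarrow> m = Poly_Mapping.single (fst p) 1 + Poly_Mapping.single (snd p) 1"
    using mons_2 by fastforce
  from choice[OF this] obtain p where
    p: "\<forall>m. m \<in> mons {..r} 2 \<longrightarrow> m = Poly_Mapping.single (fst (p m)) 1 + Poly_Mapping.single (snd (p m)) 1" ..
  have mv: "mono_val x m = x (fst (p m)) * x (snd (p m))" if "m \<in> mons {..r} 2" for x m
  proof -
    have "mono_val x m = mono_val x (Poly_Mapping.single (fst (p m)) 1 + Poly_Mapping.single (snd (p m)) 1)"
      by (rule arg_cong[of _ _ "mono_val x"]) (rule p[rule_format, OF that])
    then show ?thesis by (simp add: mono_val_add)
  qed
  have "peval x q = (\<Sum>m\<in>mons {..r} 2. lookup q m * (x (fst (p m)) * x (snd (p m))))" for x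
    unfolding peval_vecs[OF finite_atMost q] by (rule sum.cong) (simp_all add: mv)
  then have "polar v w = (\<Sum>m\<in>mons {..r} 2. lookup q m * (v (fst (p m)) * w (snd (p m)) + w (fst (p m)) * v (snd (p m))))" for w
    by (simp add: polar_def sum_subtractf[symmetric] algebra_simps)
  then show ?thesis by (simp add: sum_distrib_left algebra_simps)
qed

lemma polar_grad: "polar v w = (\<Sum>i\<le>r. peval v (pdiff i q) * w i)"
proof -
  have "((\<lambda>t. peval (\<lambda>i. v i + t * w i) q) has_field_derivative (\<Sum>i\<le>r. w i * peval v (pdiff i q))) (at 0)"
    by (rule peval_line_deriv) (use q in \<open>auto simp: vecs_def mons_def\<close>)
  moreover have "peval (\<lambda>i. v i + t * w i) q = peval v q + t\<^sup>2 * peval w q + t * polar v w" for t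
    using q_add[of v "\<lambda>i. t * w i"] by (simp add: q_scale polar_scale)
  moreover have "((\<lambda>t. peval v q + t\<^sup>2 * peval w q + t * polar v w) has_field_derivative polar v w) (at 0)"
    by (auto intro!: derivative_eq_intros)
  ultimately have "polar v w = (\<Sum>i\<le>r. w i * peval v (pdiff i q))" by (simp add: DERIV_unique)
  then show ?thesis by (simp add: mult.commute)
qed

lemma polar_add: "polar v (\<lambda>i. w i + u i) = polar v w + polar v u"
  by (simp add: polar_grad distrib_left sum.distrib)

lemma polar_diff: "polar v (\<lambda>i. w i - u i) = polar v w - polar v u"
  by (simp add: polar_grad right_diff_distrib sum_subtractf)

lemma polar_sum: "polar v (\<lambda>i. \<Sum>k\<in>S. a k * g k i) = (\<Sum>k\<in>S. a k * polar v (g k))"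
proof -
  have "polar v (\<lambda>i. \<Sum>k\<in>S. a k * g k i) = (\<Sum>i\<le>r. \<Sum>k\<in>S. a k * (peval v (pdiff i q) * g k i))"
    by (simp add: polar_grad sum_distrib_left mult.left_commute)
  also have "\<dots> = (\<Sum>k\<in>S. \<Sum>i\<le>r. a k * (peval v (pdiff i q) * g k i))" by (rule sum.swap)
  also have "\<dots> = (\<Sum>k\<in>S. a k * polar v (g k))" by (simp add: polar_grad sum_distrib_left)
  finally show ?thesis .
qed

definition swap_index :: "nat \<Rightarrow> nat" where
  "swap_index i = (if i = 0 then 1 else if i = 1 then 0 else i)"

text \<open>The polar form has the same Gram matrix on \<open>g 0, ..., g k\<close> as the polar form of \<open>q0\<close> on the standard basis.\<close>

definition adapted :: "nat \<Rightarrow> (nat \<Rightarrow> nat \<Rightarrow> complex) \<Rightarrow> bool" where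
  "adapted k g \<longleftrightarrow> (\<forall>i\<le>k. \<forall>j\<le>k. polar (g i) (g j) = (if j = swap_index i then 2 else 0))"

lemma swap_index_swap_index [simp]: "swap_index (swap_index i) = i"
  by (simp add: swap_index_def)

lemma swap_index_le: "1 \<le> k \<Longrightarrow> i \<le> k \<Longrightarrow> swap_index i \<le> k"
  by (auto simp: swap_index_def)

text \<open>A vector \<open>u\<close> orthogonal to all \<open>g i\<close> exists for dimension reasons. If it is isotropic, let \<open>w'\<close> be the projection of a vector
  not orthogonal to \<open>u\<close>; then \<open>w'\<close> or \<open>u + w'\<close> is not isotropic.\<close>

lemma exists_orthogonal_nonisotropic:
  assumes g: "adapted k g" and k: "1 \<le> k" "k < r"
  shows "\<exists>w. (\<forall>i\<le>k. polar (g i) w = 0) \<and> peval w q \<noteq> 0"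
proof -
  obtain u where u: "\<exists>c\<in>{..r}. u c \<noteq> 0" "\<forall>m\<in>{..k}. (\<Sum>c\<in>{..r}. u c * peval (g m) (pdiff c q)) = 0"
    using linear_dependence[of "{..k}" "{..r}" "\<lambda>c m. peval (g m) (pdiff c q)"] k by auto
  have gu: "polar (g i) u = 0" if "i \<le> k" for i
    using u(2) that by (simp add: polar_grad mult.commute)
  show ?thesis
  proof (cases "peval u q = 0")
    case False
    then show ?thesis using gu by blast
  next
    case True
    obtain w where w: "polar u w \<noteq> 0" using nondegenerate[of u] u(1) unfolding polar_def by auto
    define w' where "w' = (\<lambda>i. w i - (\<Sum>j\<le>k. (polar (g (swap_index j)) w / 2) * g j i))"
    have p: "polar v w' = polar v w - (\<Sum>j\<le>k. (polar (g (swap_index j)) w / 2) * polar v (g j))" for v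
      unfolding w'_def polar_diff polar_sum ..
    have orth: "polar (g i) w' = 0" if i: "i \<le> k" for i
    proof -
      have "(\<Sum>j\<le>k. (polar (g (swap_index j)) w / 2) * polar (g i) (g j)) =
          (\<Sum>j\<le>k. if j = swap_index i then polar (g (swap_index j)) w else 0)"
        using g i by (intro sum.cong) (auto simp: adapted_def)
      also have "\<dots> = polar (g i) w" using swap_index_le[OF k(1) i] by (simp add: sum.delta)
      finally show ?thesis unfolding p by simp
    qed
    have "polar u w' = polar u w"
    proof -
      have "(\<Sum>j\<le>k. (polar (g (swap_index j)) w / 2) * polar u (g j)) = 0"
        using gu by (intro sum.neutral) (simp add: polar_commute[of u])
      then show ?thesis unfolding p by simp
    qed
    then have uw: "polar u w' \<noteq> 0" using w by simp
    show ?thesis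
    proof (cases "peval w' q = 0")
      case False
      then show ?thesis using orth by blast
    next
      case w'0: True
      have "peval (\<lambda>i. u i + w' i) q \<noteq> 0" using uw True w'0 by (simp add: q_add)
      moreover have "\<forall>i\<le>k. polar (g i) (\<lambda>i. u i + w' i) = 0" using orth gu by (simp add: polar_add)
      ultimately show ?thesis by blast
    qed
  qed
qed

lemma exists_adapted_family:
  assumes e: "adapted 1 g" and k: "1 \<le> k" "k \<le> r"
  shows "\<exists>h. h 0 = g 0 \<and> h 1 = g 1 \<and> adapted k h"
  using k
proof (induction k rule: nat_induct_at_least)
  case base
  then show ?case using e by blast
next
  case (Suc k)
  then obtain h where h: "h 0 = g 0" "h 1 = g 1" "adapted k h" by auto
  obtain w where w: "\<forall>i\<le>k. polar (h i) w = 0" "peval w q \<noteq> 0"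
    using exists_orthogonal_nonisotropic[OF h(3)] Suc by auto
  define s where "s = 1 / csqrt (peval w q)"
  define w' where "w' = (\<lambda>i. s * w i)"
  have "polar w' w' = 2"
    using w(2) unfolding polar_self w'_def q_scale by (simp add: s_def power_divide)
  moreover have wi: "polar (h i) w' = 0" if "i \<le> k" for i using w(1) that by (simp add: w'_def polar_scale)
  moreover have "polar w' (h i) = 0" if "i \<le> k" for i using wi[OF that] polar_commute by simp
  moreover have "swap_index (Suc k) = Suc k" "i \<le> k \<Longrightarrow> swap_index i \<noteq> Suc k" for i using Suc.hyps by (auto simp: swap_index_def)
  ultimately have "adapted (Suc k) (h(Suc k := w'))"
    using h(3) unfolding adapted_def by (auto simp: le_Suc_eq)
  moreover have "(h(Suc k := w')) 0 = g 0" "(h(Suc k := w')) 1 = g 1" using h(1,2) Suc.hyps by auto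
  ultimately show ?case by blast
qed

text \<open>A vector \<open>f\<close> that is not orthogonal to \<open>e\<close> becomes isotropic when a multiple of \<open>e\<close> is subtracted.\<close>

lemma exists_hyperbolic_pair:
  assumes e: "peval e q = 0" "\<exists>i\<le>r. e i \<noteq> 0"
  shows "\<exists>g. g 1 = e \<and> adapted 1 g"
proof -
  obtain w where w: "polar e w \<noteq> 0" using nondegenerate[of e] e(2) unfolding polar_def by auto
  define f where "f = (\<lambda>i. 1 / polar e w * w i)"
  have ef: "polar e f = 1" using w unfolding f_def polar_scale by simp
  define f' where "f' = (\<lambda>i. 2 * (f i - peval f q * e i))"
  have ee: "polar e e = 0" using e(1) by (simp add: polar_self)
  have ef': "polar e f' = 2" by (simp add: f'_def polar_scale polar_diff ef ee)
  have "polar f f' = 2 * (2 * peval f q - peval f q)"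
    using ef by (simp add: f'_def polar_scale polar_diff polar_self polar_commute[of f e])
  moreover have "polar v f' = 2 * (polar v f - peval f q * polar v e)" for v
    unfolding f'_def polar_scale polar_diff ..
  ultimately have ff: "polar f' f' = 0" using ef' polar_commute[of f' f] polar_commute[of f' e] by simp
  have f'e: "polar f' e = 2" using ef' polar_commute[of f' e] by simp
  have "i = 0 \<or> i = 1" if "i \<le> 1" for i :: nat using that by auto
  then have "adapted 1 (\<lambda>i. if i = 0 then f' else e)"
    unfolding adapted_def using ee ef' ff f'e by (fastforce simp: swap_index_def)
  then show ?thesis by (intro exI[of _ "\<lambda>i. if i = 0 then f' else e"]) simp
qed

lemma adapted_lin_map:
  assumes g: "adapted r g" and r: "r \<ge> 1"
  defines "\<gamma> \<equiv> \<lambda>i k. g k i"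
  shows "j \<le> r \<Longrightarrow> polar (g j) (lin_map r \<gamma> x) = 2 * x (swap_index j)"
    and "peval (lin_map r \<gamma> x) q = peval x (q0 r)"
    and "Determinant.det (lin_mat r \<gamma>) \<noteq> 0"
proof -
  have lm: "lin_map r \<gamma> x = (\<lambda>i. \<Sum>k\<in>{..r}. x k * g k i)" for x
    by (rule ext) (simp add: lin_map_def \<gamma>_def mult.commute)
  have 1: "polar (g j) (lin_map r \<gamma> x) = 2 * x (swap_index j)" if j: "j \<le> r" for j x
  proof -
    have "polar (g j) (lin_map r \<gamma> x) = (\<Sum>k\<le>r. x k * polar (g j) (g k))" unfolding lm polar_sum ..
    also have "\<dots> = (\<Sum>k\<le>r. if k = swap_index j then 2 * x k else 0)"
      using g j by (intro sum.cong) (auto simp: adapted_def)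
    also have "\<dots> = 2 * x (swap_index j)" using swap_index_le[OF r j] by (simp add: sum.delta)
    finally show ?thesis .
  qed
  then show "j \<le> r \<Longrightarrow> polar (g j) (lin_map r \<gamma> x) = 2 * x (swap_index j)" .
  have "2 * peval (lin_map r \<gamma> x) q = polar (lin_map r \<gamma> x) (lin_map r \<gamma> x)" by (simp add: polar_self)
  also have "\<dots> = (\<Sum>k\<le>r. x k * polar (lin_map r \<gamma> x) (g k))"
    using polar_sum[of "lin_map r \<gamma> x" x g "{..r}"] unfolding lm[symmetric] .
  also have "\<dots> = (\<Sum>k\<le>r. 2 * (x k * x (swap_index k)))"
    by (rule sum.cong) (simp_all add: polar_commute[of "lin_map r \<gamma> x"] 1)
  also have "\<dots> = 2 * (\<Sum>k\<le>r. x k * x (swap_index k))" by (simp only: sum_distrib_left)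
  also have "(\<Sum>k\<le>r. x k * x (swap_index k)) = peval x (q0 r)"
  proof -
    have "{..r} = insert 0 (insert 1 {2..r})" using r by auto
    then have "(\<Sum>k\<le>r. x k * x (swap_index k)) = x 0 * x (swap_index 0) + (x 1 * x (swap_index 1) + (\<Sum>k\<in>{2..r}. x k * x (swap_index k)))" by simp
    moreover have "(\<Sum>k\<in>{2..r}. x k * x (swap_index k)) = (\<Sum>k\<in>{2..r}. x k ^ 2)"
      by (rule sum.cong) (auto simp: swap_index_def power2_eq_square)
    ultimately show ?thesis by (simp add: peval_q0 swap_index_def)
  qed
  finally show "peval (lin_map r \<gamma> x) q = peval x (q0 r)" by simp
  have carrier: "lin_mat r \<gamma> \<in> carrier_mat (r + 1) (r + 1)" by (simp add: lin_mat_def)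
  show "Determinant.det (lin_mat r \<gamma>) \<noteq> 0"
  proof
    assume "Determinant.det (lin_mat r \<gamma>) = 0"
    then obtain v where v: "v \<in> carrier_vec (r + 1)" "v \<noteq> 0\<^sub>v (r + 1)" "lin_mat r \<gamma> *\<^sub>v v = 0\<^sub>v (r + 1)"
      using det_0_iff_vec_prod_zero[OF carrier] by blast
    have set: "{0..<Suc r} = {..r}" by auto
    have "lin_map r \<gamma> (vec_index v) i = 0" if i: "i \<le> r" for i
    proof -
      have "(lin_mat r \<gamma> *\<^sub>v v) $ i = 0" unfolding v(3) using i by simp
      then show ?thesis using i v(1) by (simp add: lin_mat_def lin_map_def scalar_prod_def set)
    qed
    then have "polar (g j) (lin_map r \<gamma> (vec_index v)) = 0" for j by (simp add: polar_grad)
    then have z: "v $ swap_index j = 0" if "j \<le> r" for j using 1[OF that, of "vec_index v"] by simp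
    have "v = 0\<^sub>v (r + 1)"
    proof (rule eq_vecI)
      fix i assume "i < dim_vec (0\<^sub>v (r + 1) :: complex vec)"
      then have "i \<le> r" by simp
      then show "v $ i = 0\<^sub>v (r + 1) $ i" using z[OF swap_index_le[OF r]] by simp
    qed (use v in simp)
    then show False using v(2) by simp
  qed
qed

end

lemma exists_inverse_lin_map:
  assumes "Determinant.det (lin_mat r \<gamma>) \<noteq> 0"
  shows "\<exists>\<delta>. Determinant.det (lin_mat r \<delta>) \<noteq> 0 \<and> (\<forall>x. \<forall>i\<le>r. lin_map r \<gamma> (lin_map r \<delta> x) i = x i)"
proof -
  have G: "lin_mat r \<gamma> \<in> carrier_mat (r + 1) (r + 1)" by (simp add: lin_mat_def)
  obtain D where D: "D \<in> carrier_mat (r + 1) (r + 1)" "lin_mat r \<gamma> * D = 1\<^sub>m (r + 1)"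
    using det_non_zero_imp_unit[OF G assms, of "()"] unfolding Units_def by (auto simp: ring_mat_simps)
  define \<delta> where "\<delta> i j = D $$ (i, j)" for i j
  have D\<delta>: "lin_mat r \<delta> = D" using D(1) by (intro eq_matI) (auto simp: lin_mat_def \<delta>_def)
  have "Determinant.det (lin_mat r \<gamma>) * Determinant.det D = 1"
    using det_mult[OF G D(1)] D(2) by simp
  then have "Determinant.det D \<noteq> 0" by auto
  moreover have "lin_map r \<gamma> (lin_map r \<delta> x) i = x i" if i: "i \<le> r" for x i
  proof -
    have set: "{0..<Suc r} = {..r}" by auto
    have gd: "(\<Sum>k\<le>r. \<gamma> i k * \<delta> k j) = (if i = j then 1 else 0)" if j: "j \<le> r" for j
    proof -
      have "(lin_mat r \<gamma> * lin_mat r \<delta>) $$ (i, j) = (1\<^sub>m (r + 1) :: complex mat) $$ (i, j)" unfolding D\<delta> D(2) ..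
      then show ?thesis using i j by (simp add: lin_mat_def scalar_prod_def set)
    qed
    have "lin_map r \<gamma> (lin_map r \<delta> x) i = (\<Sum>k\<le>r. \<Sum>j\<le>r. \<gamma> i k * \<delta> k j * x j)"
      by (simp add: lin_map_def sum_distrib_left mult.assoc)
    also have "\<dots> = (\<Sum>j\<le>r. \<Sum>k\<le>r. \<gamma> i k * \<delta> k j * x j)" by (rule sum.swap)
    also have "\<dots> = (\<Sum>j\<le>r. (if i = j then 1 else 0) * x j)"
      by (rule sum.cong) (simp_all add: gd sum_distrib_right[symmetric])
    also have "\<dots> = (\<Sum>j\<le>r. if i = j then x j else 0)"
      by (rule sum.cong) simp_all
    also have "\<dots> = x i" using i by (simp add: sum.delta)
    finally show ?thesis .
  qed
  ultimately show ?thesis using D\<delta> by blast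
qed

text \<open>The tangent hyperplane at an isotropic vector \<open>e\<close> is the orthogonal complement of \<open>e\<close>, so \<open>l\<close> is a multiple of \<open>polar e\<close>. In the
  coordinates of an adapted family with \<open>g 1 = e\<close> this is a multiple of \<open>x0\<close>.\<close>

lemma isotropic_normal_form:
  assumes r: "r \<ge> 1" and q: "nondegenerate_quadratic_form r q" and l: "isotropic r q l"
  shows "\<exists>\<delta> c. Determinant.det (lin_mat r \<delta>) \<noteq> 0 \<and> c \<noteq> 0 \<and> act r \<delta> (q0 r) = q \<and> act r \<delta> (cX 0) = cC c * l"
proof -
  interpret nondegenerate_form r q
    using q unfolding nondegenerate_quadratic_form_def monomials_eq_mons by unfold_locales blast+
  have lf: "l \<in> vecs (mons {..r} 1)" using l unfolding isotropic_def monomials_eq_mons by blast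
  obtain e where e: "\<exists>i\<le>r. e i \<noteq> 0" "peval e q = 0" "{w. polar e w = 0} = {w. peval w l = 0}"
    using l unfolding isotropic_def polar_grad by blast
  obtain g0 where g0: "g0 1 = e" "adapted 1 g0" using exists_hyperbolic_pair[OF e(2,1)] by blast
  obtain g where g: "g 1 = e" "adapted r g" using exists_adapted_family[OF g0(2) r order_refl] g0(1) by auto
  define \<gamma> where "\<gamma> = (\<lambda>i k. g k i)"
  note \<gamma> = adapted_lin_map[OF g(2) r, folded \<gamma>_def]
  obtain \<delta> where \<delta>: "Determinant.det (lin_mat r \<delta>) \<noteq> 0" "\<forall>x. \<forall>i\<le>r. lin_map r \<gamma> (lin_map r \<delta> x) i = x i"
    using exists_inverse_lin_map[OF \<gamma>(3)] by blast
  have inv: "peval (lin_map r \<gamma> (lin_map r \<delta> x)) p = peval x p" if "p \<in> vecs (mons {..r} n)" for p n x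
    by (rule peval_cong_vars[OF that]) (use \<delta>(2) in auto)
  have e0: "polar e (lin_map r \<gamma> x) = 2 * x 0" for x
    using \<gamma>(1)[OF r, of x] by (simp add: g(1)[unfolded One_nat_def] swap_index_def)
  define f where "f = lin_map r \<gamma> (\<lambda>i. if i = 0 then 1 / 2 else 0)"
  have ef: "polar e f = 1" unfolding f_def e0 by simp
  define b where "b = peval f l"
  have "f \<notin> {w. polar e w = 0}" using ef by simp
  then have "f \<notin> {w. peval w l = 0}" unfolding e(3) .
  then have b: "b \<noteq> 0" by (simp add: b_def)
  have l_eq: "peval w l = polar e w * b" for w
  proof -
    have "polar e (\<lambda>i. w i + (- polar e w) * f i) = 0"
      unfolding polar_add polar_scale ef by simp
    then have "peval (\<lambda>i. w i + (- polar e w) * f i) l = 0" using e(3) by blast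
    then show ?thesis unfolding linear_form_linear[OF lf] b_def by simp
  qed
  have "act r \<delta> (q0 r) = q"
  proof (rule peval_inject)
    fix x show "peval x (act r \<delta> (q0 r)) = peval x q"
      unfolding peval_act \<gamma>(2)[symmetric] by (rule inv[OF q])
  qed
  moreover have "act r \<delta> (cX 0) = cC (1 / (2 * b)) * l"
  proof (rule peval_inject)
    fix x
    have "peval x l = peval (lin_map r \<gamma> (lin_map r \<delta> x)) l" by (rule inv[OF lf, symmetric])
    also have "\<dots> = 2 * lin_map r \<delta> x 0 * b" by (simp only: l_eq e0)
    finally show "peval x (act r \<delta> (cX 0)) = peval x (cC (1 / (2 * b)) * l)" using b by simp
  qed
  moreover have "1 / (2 * b) \<noteq> 0" using b by simp
  ultimately show ?thesis using \<delta>(1) by blast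
qed

section \<open>The arithmetic conditions\<close>

lemma special_deriv_even:
  "special_deriv r k k (2 * k - j) j = (int k)\<^sup>2 * (2 * int k - 1) *
     (2 * (int k - int j)\<^sup>2 + (int k - int j) * (int r - 1) - int k * (int r + 1))" if "j \<le> 2 * k"
  using that by (simp add: special_deriv_def of_nat_diff power2_eq_square algebra_simps)

lemma special_deriv_odd:
  "special_deriv r (k + 1) k (2 * k + 1 - j) j = 2 * (int k)\<^sup>2 *
     ((int k - int j)\<^sup>2 * (2 * int k + 1) + (int k - int j) * (int r * int k + int r - int k)
       - int k * (int k + 1) * (int r + 1))" if "j \<le> 2 * k + 1"
  using that by (simp add: special_deriv_def of_nat_diff power2_eq_square algebra_simps)

lemma special_deriv_even':
  "special_deriv r (k + 1) (k - 1) (2 * k - j) j = (int k - 1) * (2 * int k - 1) *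
     (2 * int k * (int k - int j)\<^sup>2 + (int k - int j) * (int r * int k + int r - 5 * int k + 1)
       - int k * (int k * (int r + 1) + int r - 3))" if "j \<le> 2 * k" "k \<ge> 1"
  using that by (simp add: special_deriv_def of_nat_diff power2_eq_square algebra_simps)

text \<open>Negative \<open>m\<close> occur for \<open>r = 1\<close> only, where the expression is even in \<open>m\<close>.\<close>

lemma cond_even:
  assumes k: "k \<ge> 1"
    and nz: "\<forall>m::int. 1 \<le> m \<and> m \<le> int k \<longrightarrow> 2 * m\<^sup>2 + m * (int r - 1) - int k * (int r + 1) \<noteq> 0"
    and m: "- int k \<le> m" "m \<le> int k" "0 \<le> m \<or> r = 1"
  shows "2 * m\<^sup>2 + m * (int r - 1) - int k * (int r + 1) \<noteq> 0"
proof -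
  consider "1 \<le> m" | "m = 0" | "m \<le> -1" by linarith
  then show ?thesis
  proof cases
    case 2
    then show ?thesis using k by simp
  next
    case 3
    then have "r = 1" using m by linarith
    moreover have "1 \<le> - m" "- m \<le> int k" using 3 m by auto
    ultimately show ?thesis using nz[rule_format, of "- m"] by simp
  qed (use nz m in blast)
qed

text \<open>Negative \<open>m = - n\<close> occur for \<open>r = 1\<close> only. A zero would imply that \<open>2 k + 1\<close> divides \<open>2 n - 1\<close>, hence \<open>n = k + 1\<close>, which
  is not a zero.\<close>

lemma cond_odd:
  assumes k: "k \<ge> 1" and nz: "\<forall>m::int. 0 \<le> m \<and> m \<le> int k \<longrightarrow>
      m\<^sup>2 * (2 * int k + 1) + m * (int r * int k + int r - int k) - int k * (int k + 1) * (int r + 1) \<noteq> 0"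
    and m: "- int k - 1 \<le> m" "m \<le> int k" "0 \<le> m \<or> r = 1"
  shows "m\<^sup>2 * (2 * int k + 1) + m * (int r * int k + int r - int k) - int k * (int k + 1) * (int r + 1) \<noteq> 0"
proof (cases "0 \<le> m")
  case False
  then have r: "r = 1" using m by simp
  define n where "n = - m"
  have n: "1 \<le> n" "n \<le> int k + 1" using False m by (auto simp: n_def)
  have m': "m = - n" by (simp add: n_def)
  show ?thesis
  proof
    assume "m\<^sup>2 * (2 * int k + 1) + m * (int r * int k + int r - int k) - int k * (int k + 1) * (int r + 1) = 0"
    then have eq: "n\<^sup>2 * (2 * int k + 1) = n + 2 * (int k * (int k + 1))" by (simp add: r m' algebra_simps)
    have "(2 * int k + 1) * (2 * n\<^sup>2 - (2 * int k + 1)) = 2 * n - 1"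
      using eq by (simp add: algebra_simps power2_eq_square)
    then have dvd: "(2 * int k + 1) dvd (2 * n - 1)" by (metis dvd_triv_left)
    moreover have "0 < 2 * n - 1" using n by simp
    ultimately have "2 * int k + 1 \<le> 2 * n - 1" by (rule zdvd_imp_le)
    then have "n = int k + 1" using n by simp
    then have "(int k + 1)\<^sup>2 * (2 * int k + 1) = (int k + 1) * (2 * int k + 1)"
      using eq by (simp add: algebra_simps)
    then have "(int k + 1) * (2 * int k + 1) * int k = 0" by (simp add: power2_eq_square algebra_simps)
    then show False using k by simp
  qed
qed (use nz m in blast)

text \<open>Negative \<open>m = - n\<close> occur for \<open>r = 1\<close> only. A zero would imply that \<open>k\<close> divides \<open>n\<close>, hence \<open>n = k\<close>, which is not a zero.\<close>

lemma cond_even':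
  assumes k: "k \<ge> 2" and nz: "\<forall>m::int. 0 \<le> m \<and> m \<le> int k \<longrightarrow>
      2 * int k * m\<^sup>2 + m * (int r * int k + int r - 5 * int k + 1) - int k * (int k * (int r + 1) + int r - 3) \<noteq> 0"
    and m: "- int k \<le> m" "m \<le> int k" "0 \<le> m \<or> r = 1"
  shows "2 * int k * m\<^sup>2 + m * (int r * int k + int r - 5 * int k + 1) - int k * (int k * (int r + 1) + int r - 3) \<noteq> 0"
proof (cases "0 \<le> m")
  case False
  then have r: "r = 1" using m by simp
  define n where "n = - m"
  have n: "1 \<le> n" "n \<le> int k" using False m by (auto simp: n_def)
  have m': "m = - n" by (simp add: n_def)
  show ?thesis
  proof
    assume "2 * int k * m\<^sup>2 + m * (int r * int k + int r - 5 * int k + 1) - int k * (int k * (int r + 1) + int r - 3) = 0"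
    then have eq: "n = int k * (n\<^sup>2 + 2 * n - int k + 1)" by (simp add: r m' algebra_simps)
    then have "int k dvd n" by (metis dvd_triv_left)
    then have "int k \<le> n" using n by (intro zdvd_imp_le) auto
    then have "n = int k" using n by simp
    then have "int k * (int k * (int k + 1)) = 0" using eq by (simp add: power2_eq_square algebra_simps)
    then show False using k by simp
  qed
qed (use nz m in blast)

text \<open>The three conditions of the theorem are treated alike, with \<open>(A, a)\<close> equal to \<open>(k, k)\<close>, \<open>(k + 1, k)\<close> and \<open>(k + 1, k - 1)\<close>.\<close>

lemma birational_from_isotropic:
  assumes r: "r \<ge> 1" and q: "nondegenerate_quadratic_form r q" and l: "isotropic r q l"
    and a: "1 \<le> a" "a \<le> A" and d: "d = A + a"
    and not: "(proj_pt (l ^ d), proj_pt (q ^ ((r + 1) * (a - 1)) * l ^ ((r + 1) * (A - a)))) \<notin> hessian_graph_closure d r"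
    and nz: "\<And>j. j \<le> d \<Longrightarrow> j \<le> d - j \<or> r = 1 \<Longrightarrow> special_deriv r A a (d - j) j \<noteq> 0"
  shows "birational_onto_image (monomials r d) (monomials r ((d - 2) * (r + 1))) (hessian_map d r)"
proof -
  obtain \<delta> c where \<delta>: "Determinant.det (lin_mat r \<delta>) \<noteq> 0" and c: "c \<noteq> 0"
    and aq: "act r \<delta> (q0 r) = q" and al: "act r \<delta> (cX 0) = cC c * l"
    using isotropic_normal_form[OF r q l] by blast
  have l0: "l \<noteq> 0" and lf: "l \<in> vecs (mons {..r} 1)" and qf: "q \<in> vecs (mons {..r} 2)"
    using l q unfolding isotropic_def nondegenerate_quadratic_form_def monomials_eq_mons by auto
  have asp: "act r \<delta> (special r A' a') = cC (c ^ (A' - a')) * (q ^ a' * l ^ (A' - a'))" if "a' \<le> A'" for A' a'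
    unfolding special_def if_P[OF that] act_mult act_power aq al
    by (rule peval_inject) (simp add: power_mult_distrib)
  let ?A' = "(r + 1) * (A - 1)" and ?a' = "(r + 1) * (a - 1)"
  have A': "?a' \<le> ?A'" "?A' - ?a' = (r + 1) * (A - a)"
    using a by (auto intro!: mult_le_mono simp: right_diff_distrib'[symmetric] simp del: mult_Suc)
  have ok: "a \<le> A \<or> r = 1" "A \<ge> 1" using a by auto
  note Hp = Hess_special[OF r ok(1) a(1) ok(2)]
  define y where "y = q ^ ?a' * l ^ ((r + 1) * (A - a))"
  define b where "b = special_const r A a * c ^ (?A' - ?a')"
  have b: "b \<noteq> 0" using c special_const_nz[OF ok(2) a(1)] by (simp add: b_def)
  have ay: "act r \<delta> (Hess r (special r A a)) = cC b * y"
    unfolding Hp act_cC_mult asp[OF A'(1)] unfolding A'(2) y_def b_def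
    by (rule peval_inject) (simp only: peval_mult peval_single mono_val_0 mult.right_neutral mult.assoc A'(2))
  have af: "act r \<delta> (special r d 0) = cC (c ^ d) * l ^ d" using asp[of 0 d] by simp
  have ne: "q0 r \<noteq> 0"
  proof
    assume "q0 r = 0"
    then have "peval (\<lambda>i. if i \<le> 1 then 1 else 0) (q0 r) = 0" by simp
    then show False by (simp add: peval_q0)
  qed
  have "q \<noteq> 0"
  proof
    assume "q = 0"
    then have "\<And>v. \<forall>i\<le>r. v i = (0::complex)" using q unfolding nondegenerate_quadratic_form_def by simp
    from this[of "\<lambda>_. 1", rule_format, of 0] show False by simp
  qed
  have no0: "f * g \<noteq> 0" if "f \<noteq> 0" "g \<noteq> 0" for f g :: "nat cpoly" using that by simp
  have lf': "l ^ d \<in> vecs (mons {..r} d) - {0}" using vecs_power[OF lf, of d] l0 by simp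
  have "(r + 1) * u * 2 + (r + 1) * w * 1 = (r + 1) * (2 * u + w)" for u w by (simp add: algebra_simps)
  then have "?a' * 2 + (r + 1) * (A - a) * 1 = (r + 1) * (2 * (a - 1) + (A - a))" .
  also have "2 * (a - 1) + (A - a) = d - 2" using a d by simp
  finally have "?a' * 2 + (r + 1) * (A - a) * 1 = (d - 2) * (r + 1)" by (simp only: mult.commute)
  then have "y \<in> vecs (mons {..r} ((d - 2) * (r + 1)))"
    using vecs_mult[OF vecs_power[OF qf, of ?a'] vecs_power[OF lf, of "(r + 1) * (A - a)"]] unfolding y_def by (simp only:)
  moreover have "y \<noteq> 0" using l0 \<open>q \<noteq> 0\<close> unfolding y_def by (intro no0 power_not_zero)
  ultimately have yf: "y \<in> vecs (mons {..r} ((d - 2) * (r + 1))) - {0}" by simp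
  have "off_fibre r d (l ^ d) y"
    by (rule off_fibre_if_not_in_closure[OF not[folded y_def] lf' yf])
  then have "off_fibre r d (act r \<delta> (special r d 0)) (act r \<delta> (Hess r (special r A a)))"
    unfolding af ay by (rule off_fibre_scale) (use b c in simp_all)
  then have off: "off_fibre r d (special r d 0) (Hess r (special r A a))"
    by (rule off_fibre_act[OF _ \<delta>]) (use special_forms[OF r, of d 0] Hess_forms[OF special_forms[OF r, of A a]] d in auto)
  have off': "off_fibre r d (special r 0 d) (Hess r (special r A a))" if r1: "r = 1"
  proof (cases "A = a")
    case True
    then show ?thesis using off off_fibre_swap[OF a(1)] unfolding r1 d True by blast
  next
    case False
    then show ?thesis using off_fibre_binary[OF a(1), of A] a(2) unfolding r1 d by simp
  qed
  show ?thesis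
    unfolding monomials_eq_mons hessian_map_eq
    by (rule birational_at_special_form[OF r a d nz off off'])
qed

theorem theorem2p23:
  fixes r d :: nat
  assumes "r \<ge> 1" and "d \<ge> 2"
    and "\<exists>q l. nondegenerate_quadratic_form r q \<and> isotropic r q l \<and>
      ((\<exists>k. d = 2 * k \<and>
          (proj_pt (l ^ d), proj_pt (q ^ ((r + 1) * (k - 1)))) \<notin> hessian_graph_closure d r \<and>
          (\<forall>m::int. 1 \<le> m \<and> m \<le> int k \<longrightarrow>
             2 * m\<^sup>2 + m * (int r - 1) - int k * (int r + 1) \<noteq> 0)) \<or>
       (\<exists>k. d = 2 * k + 1 \<and>
          (proj_pt (l ^ d), proj_pt (q ^ ((r + 1) * (k - 1)) * l ^ (r + 1)))
             \<notin> hessian_graph_closure d r \<and>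
          (\<forall>m::int. 0 \<le> m \<and> m \<le> int k \<longrightarrow>
             m\<^sup>2 * (2 * int k + 1) + m * (int r * int k + int r - int k)
               - int k * (int k + 1) * (int r + 1) \<noteq> 0)) \<or>
       (\<exists>k. d = 2 * k \<and> k \<ge> 2 \<and>
          (proj_pt (l ^ d), proj_pt (q ^ ((r + 1) * (k - 2)) * l ^ (2 * (r + 1))))
             \<notin> hessian_graph_closure d r \<and>
          (\<forall>m::int. 0 \<le> m \<and> m \<le> int k \<longrightarrow>
             2 * int k * m\<^sup>2 + m * (int r * int k + int r - 5 * int k + 1)
               - int k * (int k * (int r + 1) + int r - 3) \<noteq> 0)))"
  shows "birational_onto_image (monomials r d) (monomials r ((d - 2) * (r + 1))) (hessian_map d r)"
proof -
  note r = assms(1)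
  obtain q l where q: "nondegenerate_quadratic_form r q" and l: "isotropic r q l"
    and cases: "(\<exists>k. d = 2 * k \<and>
          (proj_pt (l ^ d), proj_pt (q ^ ((r + 1) * (k - 1)))) \<notin> hessian_graph_closure d r \<and>
          (\<forall>m::int. 1 \<le> m \<and> m \<le> int k \<longrightarrow>
             2 * m\<^sup>2 + m * (int r - 1) - int k * (int r + 1) \<noteq> 0)) \<or>
       (\<exists>k. d = 2 * k + 1 \<and>
          (proj_pt (l ^ d), proj_pt (q ^ ((r + 1) * (k - 1)) * l ^ (r + 1)))
             \<notin> hessian_graph_closure d r \<and>
          (\<forall>m::int. 0 \<le> m \<and> m \<le> int k \<longrightarrow>
             m\<^sup>2 * (2 * int k + 1) + m * (int r * int k + int r - int k)
               - int k * (int k + 1) * (int r + 1) \<noteq> 0)) \<or>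
       (\<exists>k. d = 2 * k \<and> k \<ge> 2 \<and>
          (proj_pt (l ^ d), proj_pt (q ^ ((r + 1) * (k - 2)) * l ^ (2 * (r + 1))))
             \<notin> hessian_graph_closure d r \<and>
          (\<forall>m::int. 0 \<le> m \<and> m \<le> int k \<longrightarrow>
             2 * int k * m\<^sup>2 + m * (int r * int k + int r - 5 * int k + 1)
               - int k * (int k * (int r + 1) + int r - 3) \<noteq> 0))"
    using assms(3) by (elim exE conjE)
  from cases show ?thesis
  proof (elim disjE exE conjE)
    fix k assume d: "d = 2 * k"
      and not: "(proj_pt (l ^ d), proj_pt (q ^ ((r + 1) * (k - 1)))) \<notin> hessian_graph_closure d r"
      and nz: "\<forall>m::int. 1 \<le> m \<and> m \<le> int k \<longrightarrow> 2 * m\<^sup>2 + m * (int r - 1) - int k * (int r + 1) \<noteq> 0"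
    have k: "k \<ge> 1" using assms(2) d by simp
    show ?thesis
    proof (rule birational_from_isotropic[OF r q l k order_refl])
      show "(proj_pt (l ^ d), proj_pt (q ^ ((r + 1) * (k - 1)) * l ^ ((r + 1) * (k - k)))) \<notin> hessian_graph_closure d r"
        using not by simp
      fix j assume j: "j \<le> d" "j \<le> d - j \<or> r = 1"
      have "2 * (int k - int j)\<^sup>2 + (int k - int j) * (int r - 1) - int k * (int r + 1) \<noteq> 0"
        by (rule cond_even[OF k nz]) (use j d in auto)
      then show "special_deriv r k k (d - j) j \<noteq> 0"
        using k j(1) unfolding d special_deriv_even[OF j(1)[unfolded d]] by simp
    qed (use d in simp)
  next
    fix k assume d: "d = 2 * k + 1"
      and not: "(proj_pt (l ^ d), proj_pt (q ^ ((r + 1) * (k - 1)) * l ^ (r + 1))) \<notin> hessian_graph_closure d r"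
      and nz: "\<forall>m::int. 0 \<le> m \<and> m \<le> int k \<longrightarrow>
             m\<^sup>2 * (2 * int k + 1) + m * (int r * int k + int r - int k) - int k * (int k + 1) * (int r + 1) \<noteq> 0"
    have k: "k \<ge> 1" using assms(2) d by simp
    show ?thesis
    proof (rule birational_from_isotropic[OF r q l k, of "k + 1"])
      show "(proj_pt (l ^ d), proj_pt (q ^ ((r + 1) * (k - 1)) * l ^ ((r + 1) * (k + 1 - k)))) \<notin> hessian_graph_closure d r"
        using not by simp
      fix j assume j: "j \<le> d" "j \<le> d - j \<or> r = 1"
      have "(int k - int j)\<^sup>2 * (2 * int k + 1) + (int k - int j) * (int r * int k + int r - int k)
          - int k * (int k + 1) * (int r + 1) \<noteq> 0"
        by (rule cond_odd[OF k nz]) (use j d in auto)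
      then show "special_deriv r (k + 1) k (d - j) j \<noteq> 0"
        using k unfolding d special_deriv_odd[OF j(1)[unfolded d]] by simp
    qed (use d in simp_all)
  next
    fix k :: nat assume d: "d = 2 * k" and k: "k \<ge> 2"
      and not: "(proj_pt (l ^ d), proj_pt (q ^ ((r + 1) * (k - 2)) * l ^ (2 * (r + 1)))) \<notin> hessian_graph_closure d r"
      and nz: "\<forall>m::int. 0 \<le> m \<and> m \<le> int k \<longrightarrow>
             2 * int k * m\<^sup>2 + m * (int r * int k + int r - 5 * int k + 1) - int k * (int k * (int r + 1) + int r - 3) \<noteq> 0"
    have e: "k - 1 - 1 = k - 2" "k + 1 - (k - 1) = 2" "1 \<le> k - 1" "k - 1 \<le> k + 1" "1 \<le> k" using k by auto
    show ?thesis
    proof (rule birational_from_isotropic[OF r q l e(3,4)])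
      show "(proj_pt (l ^ d), proj_pt (q ^ ((r + 1) * (k - 1 - 1)) * l ^ ((r + 1) * (k + 1 - (k - 1))))) \<notin> hessian_graph_closure d r"
        using not unfolding e(1,2) mult.commute[of 2 "r + 1"] .
      fix j assume j: "j \<le> d" "j \<le> d - j \<or> r = 1"
      have "2 * int k * (int k - int j)\<^sup>2 + (int k - int j) * (int r * int k + int r - 5 * int k + 1)
          - int k * (int k * (int r + 1) + int r - 3) \<noteq> 0"
        by (rule cond_even'[OF k nz]) (use j d in auto)
      then show "special_deriv r (k + 1) (k - 1) (d - j) j \<noteq> 0"
        using k unfolding d special_deriv_even'[OF j(1)[unfolded d] e(5)] by simp
    qed (use d k in simp)
  qed
qed

end
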